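(* There is a unique eigendistribution of $T_d$ which has second moment equal to $1/4$, which we denote $\mathcal{W}_d$. Let $\mu_{\mathcal{W}_d}(k)$ denote the $k$-th moment of $\mathcal{W}_d$. Then for all $k\in\mathbb{N}$ we have $\mu_{\mathcal{W}_d}(2k+1)=0$ and $$\mu_{\mathcal{W}_d}(2k)=c_{2k}+O\left(1/d^2\right),$$ where $c_m$ is the $m$-th moment of the semi-circle distribution normalized to have second moment $1/4$. We have $\mu_{\mathcal{W}_d}(2)=1/4$, $\mu_{\mathcal{W}_d}(4)=1/8$, $\mu_{\mathcal{W}_d}(6)=5/64$ (all agreeing with the normalized semi-circular density), but $$\mu_{\mathcal{W}_d}(8)=\frac{7}{128}+\frac{1}{128(d^2+d+1)},$$ which disagrees with the eighth moment of the semi-circle, $7/128$.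
   Context: Here $d$ is the degree of regularity of the graphs considered. All graphs are simple, without self-loops or multiple edges. A weight distribution $\mathcal{W}$ is (the distribution of) a random variable on $\mathbb{R}$ with finite moments and density $p_{\mathcal{W}}$; the unweighted case corresponds to each weight being $1$. For a $d$-regular graph $G$ on $N=|G|$ vertices, attach to its edges independent identically distributed random weights drawn from $\mathcal{W}$. The weighted adjacency matrix is the $N\times N$ real symmetric matrix $A_{\mathbf{w}}=(b_{ij})$ with $b_{ij}=b_{ji}$ equal to the weight of the edge $ij$ if $i,j$ are adjacent in $G$, and $b_{ij}=0$ otherwise. The spectral distribution of the weighted graph is the uniform measure on the eigenvalues $\lambda_1\le\dots\le\lambda_N$ of $A_{\mathbf{w}}$, namely $\frac1N\sum_{n=1}^N\delta_{\lambda_n}$. Let $\nu_{d,G,\mathcal{W}}$ denote this spectral distribution, averaged over the random weights drawn from $\mathcal{W}$. It is known that for any sequence of $d$-regular graphs $\{G_i\}$ such that $|G_i|\to\infty$ and, for every $k\ge3$, the number of cycles of length $k$ in $G_i$ is $o(|G_i|)$, the limiting distribution $\nu_{d,\mathcal{W}}=\lim_{i\to\infty}\nu_{d,G_i,\mathcal{W}}$ exists and depends only on $d$ and $\mathcal{W}$. The map $T_d$ is defined by $T_d:\mathcal{W}\mapsto\nu_{d,\mathcal{W}}$. For a measure $\nu$ on $\mathbb{R}$ and a real $\lambda>0$, the rescaled measure $\nu^{(\lambda)}$ is given by $\nu^{(\lambda)}(A)=\nu(\lambda A)$ for all $A\subseteq\mathbb{R}$. A distribution $\mathcal{W}$ is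 an eigendistribution of $T_d$ with eigenvalue $\lambda$ if $T_d\mathcal{W}=\mathcal{W}^{(\lambda)}$ for some $\lambda>0$. The moments of the semi-circle distribution normalized to have second moment (variance) $1/4$ are $c_{2k+1}=0$ and $c_{2k}=\frac{1}{4^k(k+1)}\binom{2k}{k}$.
   Formalization: The degree d is taken to be at least 2: for d = 1 every symmetric weight distribution with second moment 1/4 is an eigendistribution, so uniqueness fails, and for d = 0 no eigendistribution has second moment 1/4. *)

theory Defs
  imports
    "HOL-Probability.Probability"
    "HOL-Library.Landau_Symbols"
    "Jordan_Normal_Form.Char_Poly"
begin

text \<open>
  A graph has vertex set \<^term>\<open>{..<N::nat}\<close> and edges that are two-element sets of vertices; up to
  isomorphism this covers all finite simple graphs.
\<close>

record fin_graph =
  nverts :: nat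
  edges :: "nat set set"

definition simple_graph :: "fin_graph \<Rightarrow> bool" where
  "simple_graph G \<longleftrightarrow> edges G \<subseteq> {e. e \<subseteq> {..<nverts G} \<and> card e = 2}"

definition regular_graph :: "nat \<Rightarrow> fin_graph \<Rightarrow> bool" where
  "regular_graph d G \<longleftrightarrow>
     simple_graph G \<and> (\<forall>v<nverts G. card {e \<in> edges G. v \<in> e} = d)"

text \<open>
  Cycles are counted as subgraphs: a cycle of length \<open>k \<ge> 3\<close> is identified with its edge set, so
  different starting points and orientations are not counted separately.
\<close>

definition cycles :: "fin_graph \<Rightarrow> nat \<Rightarrow> nat set set set" where
  "cycles G k = {C. C \<subseteq> edges G \<and>
     (\<exists>vs. distinct vs \<and> length vs = k \<and> C = {{vs ! i, vs ! (Suc i mod k)} | i. i < k})}"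

definition few_cycles_sequence :: "nat \<Rightarrow> (nat \<Rightarrow> fin_graph) \<Rightarrow> bool" where
  "few_cycles_sequence d G \<longleftrightarrow>
     (\<forall>i. regular_graph d (G i)) \<and>
     filterlim (\<lambda>i. nverts (G i)) at_top sequentially \<and>
     (\<forall>k\<ge>3. (\<lambda>i. real (card (cycles (G i) k))) \<in> o(\<lambda>i. real (nverts (G i))))"

text \<open>
  Point masses are included, since the unweighted case (all weights equal to 1) is a weight
  distribution; the density of a weight distribution is thus not required to be a function.
\<close>

definition weight_distribution :: "real measure \<Rightarrow> bool" where
  "weight_distribution W \<longleftrightarrow> real_distribution W \<and> (\<forall>k::nat. integrable W (\<lambda>x. x ^ k))"

definition moment :: "real measure \<Rightarrow> nat \<Rightarrow> real" where
  "moment W k = (\<integral>x. x ^ k \<partial>W)"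

definition weighted_adjacency :: "fin_graph \<Rightarrow> (nat set \<Rightarrow> real) \<Rightarrow> real mat" where
  "weighted_adjacency G w =
     Matrix.mat (nverts G) (nverts G) (\<lambda>(i, j). if {i, j} \<in> edges G then w {i, j} else 0)"

text \<open>
  The uniform distribution on the eigenvalues, counted with algebraic multiplicity. It is only used
  for real symmetric matrices, whose characteristic polynomials split over the reals.
\<close>

definition eigenvalue_distribution :: "real mat \<Rightarrow> real measure" where
  "eigenvalue_distribution A =
     distr (measure_pmf (pmf_of_multiset (proots (char_poly A)))) borel (\<lambda>x. x)"

definition spectral_distribution :: "fin_graph \<Rightarrow> real measure \<Rightarrow> real measure" where
  "spectral_distribution G W =
     PiM (edges G) (\<lambda>_. W) \<bind> (\<lambda>w. eigenvalue_distribution (weighted_adjacency G w))"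

text \<open>
  The graph of the map \<open>T\<^sub>d\<close>: \<open>T_maps d W \<nu>\<close> states \<open>T\<^sub>d W = \<nu>\<close>, i.e. that \<open>\<nu>\<close> is the weak limit of
  the averaged spectral distributions along every sequence of \<open>d\<close>-regular graphs with few cycles.
  Such sequences exist for every \<open>d\<close>, and weak limits are unique, so \<open>\<nu>\<close> is determined by \<open>d\<close> and \<open>W\<close>.
\<close>

definition T_maps :: "nat \<Rightarrow> real measure \<Rightarrow> real measure \<Rightarrow> bool" where
  "T_maps d W \<nu> \<longleftrightarrow> real_distribution \<nu> \<and>
     (\<forall>G. few_cycles_sequence d G \<longrightarrow>
        weak_conv_m (\<lambda>i. spectral_distribution (G i) W) \<nu>)"

definition rescale :: "real \<Rightarrow> real measure \<Rightarrow> real measure" where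
  "rescale l \<nu> = distr \<nu> borel (\<lambda>x. x / l)"

lemma emeasure_rescale:
  assumes "l > 0" "sets \<nu> = sets borel" "A \<in> sets borel"
  shows "emeasure (rescale l \<nu>) A = emeasure \<nu> ((\<lambda>x. l * x) ` A)"
proof -
  have "(\<lambda>x. x / l) -` A \<inter> space \<nu> = (\<lambda>x. l * x) ` A"
    using assms(1) sets_eq_imp_space_eq[OF assms(2)] by (force simp: image_iff)
  moreover have "(\<lambda>x. x / l) \<in> measurable \<nu> borel"
    using assms(2) by (subst measurable_cong_sets[OF assms(2) refl]) measurable
  ultimately show ?thesis
    using assms(3) by (simp add: rescale_def emeasure_distr)
qed

definition eigendistribution :: "nat \<Rightarrow> real measure \<Rightarrow> bool" where
  "eigendistribution d W \<longleftrightarrow>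
     weight_distribution W \<and> (\<exists>l>0. T_maps d W (rescale l W))"

definition W_eigen :: "nat \<Rightarrow> real measure" where
  "W_eigen d = (THE W. eigendistribution d W \<and> moment W 2 = 1 / 4)"

definition semicircle :: "real measure" where
  "semicircle = density lborel (\<lambda>x. ennreal (indicator {-1..1} x * (2 / pi) * sqrt (1 - x\<^sup>2)))"

definition semicircle_moment :: "nat \<Rightarrow> real" where
  "semicircle_moment m = moment semicircle m"

end

theory Submission
  imports Defs "Jordan_Normal_Form.Schur_Decomposition" "HOL-Computational_Algebra.Formal_Power_Series"
begin

text \<open>
  Most vertices are far from all short cycles and have neighbourhoods that are \<open>d\<close>-regular trees, so the
  \<open>k\<close>-th moment of \<open>T\<^sub>d W\<close> is the expected weight of the closed walks of length \<open>k\<close> at the root of the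
  weighted \<open>d\<close>-regular tree. It vanishes for odd \<open>k\<close>, and for \<open>2k\<close> it is a polynomial in the even moments
  \<open>m 1, \<dots>, m k\<close> of \<open>W\<close>, given by the recursion for the resolvent of a tree, in which \<open>m k\<close> occurs only in
  the term \<open>d * m k\<close>. For an eigendistribution the eigenvalue is \<open>1 / sqrt d\<close>, and as \<open>d ^ k \<noteq> d\<close> for
  \<open>k \<ge> 2\<close> the even moments are determined recursively.

  These moments grow at most like \<open>C ^ k * fact (2 * k)\<close>, so they determine the distribution; this
  gives uniqueness, and also turns convergence of moments into weak convergence. For existence, the
  normalised map is iterated from a two-point distribution: all moments converge, and tightness yields a
  distribution with the limit moments. Graphs with few cycles, needed for \<open>T\<^sub>d\<close> to be meaningful, are
  obtained as Cayley graphs of groups generated by \<open>d\<close> involutions.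

  For the asymptotics the recursion is expanded to order \<open>1 / d\<close> after rescaling the weights by \<open>sqrt d\<close>:
  the limit is the Catalan equation \<open>s = 1 + z s^2 / 4\<close>, and the terms of order \<open>1 / d\<close> cancel.
\<close>

section \<open>Spectral distributions and traces\<close>

text \<open>Expanding \<open>1 / (1 - Y)\<close> for a sum \<open>Y\<close> over independent
  children needs the moments of every power of each summand, so the recursion does not close on the
  mean: \<open>E[R ^ p]\<close> is carried for all \<open>p\<close> at once. For natural numbers of
  children all coefficients are polynomials in the \<open>m j\<close> with nonnegative coefficients;
  sign, continuity and locality in \<open>m\<close> all come from one induction over that shape. The
  eigenvalue is forced by second moments: \<open>tree_moment m d 1 = d * m 1\<close> with
  \<open>m 1\<close> nonzero. The delicate estimate is the factorial bound. A new moment is obtained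
  by dividing by \<open>d ^ k - d\<close>, so the induction step must reproduce precisely this
  factor; for \<open>d = 2\<close> it is \<open>2 ^ k - 2\<close>, which leaves no slack. The
  cancellation at order \<open>1 / d\<close> has three sources: two factors choosing the same child
  (\<open>Y2\<close>), the ban on further coincidences (\<open>- Y * Y\<close>), and the correction
  \<open>Y'\<close> inherited from a child. As \<open>s $ 2\<close> is twice the square of
  \<open>s $ 1\<close>, \<open>Y2 = 2 * Y * Y\<close>, and the surplus \<open>Y * Y\<close> is
  balanced by \<open>Y'\<close>, which stems from the one child missing below the root.\<close>

lemma symmetric_eigenvalue_real:
  fixes A :: "real mat"
  assumes A: "A \<in> carrier_mat n n" and sym: "\<And>i j. i < n \<Longrightarrow> j < n \<Longrightarrow> A $$ (i, j) = A $$ (j, i)"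
    and ev: "eigenvalue (map_mat complex_of_real A) a"
  shows "a \<in> \<real>"
proof -
  define B where "B = map_mat complex_of_real A"
  have B: "B \<in> carrier_mat n n" using A by (simp add: B_def)
  obtain v where v: "v \<in> carrier_vec n" "v \<noteq> 0\<^sub>v n" "B *\<^sub>v v = a \<cdot>\<^sub>v v"
    using ev B unfolding eigenvalue_def eigenvector_def B_def[symmetric] by auto
  define q where "q = (\<Sum>i<n. v $ i * cnj (v $ i))"
  define z where "z = (\<Sum>i<n. \<Sum>j<n. complex_of_real (A $$ (i, j)) * v $ j * cnj (v $ i))"
  have "q = v \<bullet>c v"
    using v by (simp add: q_def scalar_prod_def atLeast0LessThan conjugate_complex_def)
  then have q0: "q \<noteq> 0" using v by simp
  have "cnj q = q" by (simp add: q_def mult.commute)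
  then have qr: "q \<in> \<real>" by (simp add: Reals_cnj_iff)
  have "z = (\<Sum>i<n. (B *\<^sub>v v) $ i * cnj (v $ i))"
    unfolding z_def
  proof (intro sum.cong refl)
    fix i assume "i \<in> {..<n}"
    then have "(B *\<^sub>v v) $ i = (\<Sum>j<n. complex_of_real (A $$ (i, j)) * v $ j)"
      using A v(1) by (simp add: B_def scalar_prod_def atLeast0LessThan)
    then show "(\<Sum>j<n. complex_of_real (A $$ (i, j)) * v $ j * cnj (v $ i)) = (B *\<^sub>v v) $ i * cnj (v $ i)"
      by (simp add: sum_distrib_right)
  qed
  also have "\<dots> = a * q"
    using v by (simp add: q_def sum_distrib_left mult.assoc)
  finally have zq: "z = a * q" .
  have "cnj z = (\<Sum>i<n. \<Sum>j<n. complex_of_real (A $$ (i, j)) * cnj (v $ j) * v $ i)"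
    by (simp add: z_def)
  also have "\<dots> = (\<Sum>j<n. \<Sum>i<n. complex_of_real (A $$ (i, j)) * cnj (v $ j) * v $ i)"
    by (rule sum.swap)
  also have "\<dots> = z"
    unfolding z_def by (intro sum.cong refl) (simp add: sym mult_ac)
  finally have "z \<in> \<real>" by (simp add: Reals_cnj_iff)
  then show ?thesis using zq q0 qr
    by (metis Reals_divide nonzero_mult_div_cancel_right)
qed

text \<open>The factorisation exists over the complex numbers; since all roots are real, it is the
  image of a real product under \<open>of_real\<close>, and injectivity on polynomials brings it
  back.\<close>

lemma symmetric_char_poly_splits:
  fixes A :: "real mat"
  assumes A: "A \<in> carrier_mat n n" and sym: "\<And>i j. i < n \<Longrightarrow> j < n \<Longrightarrow> A $$ (i, j) = A $$ (j, i)"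
  obtains rs where "char_poly A = (\<Prod>r\<leftarrow>rs. [:- r, 1:])" "length rs = n"
proof -
  define B where "B = map_mat complex_of_real A"
  have B: "B \<in> carrier_mat n n" using A by (simp add: B_def)
  obtain as where as: "char_poly B = (\<Prod>a\<leftarrow>as. [:- a, 1:])" "length as = n"
    using char_poly_factorized[OF B] by auto
  have real: "a \<in> \<real>" if "a \<in> set as" for a
  proof -
    have "poly (char_poly B) a = 0"
      unfolding as using that by (induction as) auto
    then have "eigenvalue B a" using eigenvalue_root_char_poly[OF B] by simp
    then show ?thesis using symmetric_eigenvalue_real[OF A sym] by (simp add: B_def)
  qed
  define rs where "rs = map Re as"
  have "map complex_of_real rs = as"
    unfolding rs_def using real by (auto simp: comp_def intro!: map_idI)
  have "map_poly complex_of_real (char_poly A) = char_poly B"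
    unfolding B_def by (rule of_real_hom.char_poly_hom[OF A, symmetric])
  also have "\<dots> = (\<Prod>a\<leftarrow>map complex_of_real rs. [:- a, 1:])"
    unfolding as \<open>map complex_of_real rs = as\<close> ..
  also have "\<dots> = map_poly complex_of_real (\<Prod>r\<leftarrow>rs. [:- r, 1:])"
  proof (induction rs)
    case (Cons r rs)
    interpret h: map_poly_comm_ring_hom complex_of_real ..
    have "map_poly complex_of_real ([:- r, 1:] * q) = [:- complex_of_real r, 1:] * map_poly complex_of_real q" for q
    proof -
      have "map_poly complex_of_real [:- r, 1:] = [:- complex_of_real r, 1:]" by simp
      then show ?thesis by (simp only: h.hom_mult)
    qed
    then show ?case using Cons by (simp only: list.map prod_list.Cons)
  qed simp
  finally have "char_poly A = (\<Prod>r\<leftarrow>rs. [:- r, 1:])"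
  proof -
    assume eq: "map_poly complex_of_real (char_poly A) = map_poly complex_of_real (\<Prod>r\<leftarrow>rs. [:- r, 1:])"
    interpret h: map_poly_inj_comm_ring_hom complex_of_real ..
    show ?thesis using eq by (simp only: h.eq_iff)
  qed
  moreover have "length rs = n" using as by (simp add: rs_def)
  ultimately show thesis by (rule that)
qed

lemma sum_diag_mult_commute:
  fixes A B :: "'a :: comm_semiring_0 mat"
  assumes "A \<in> carrier_mat n n" "B \<in> carrier_mat n n"
  shows "(\<Sum>i<n. (A * B) $$ (i, i)) = (\<Sum>i<n. (B * A) $$ (i, i))"
proof -
  have "(\<Sum>i<n. (A * B) $$ (i, i)) = (\<Sum>i<n. \<Sum>j<n. A $$ (i, j) * B $$ (j, i))"
    using assms by (intro sum.cong refl) (auto simp: scalar_prod_def atLeast0LessThan)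
  also have "\<dots> = (\<Sum>j<n. \<Sum>i<n. B $$ (j, i) * A $$ (i, j))"
    by (subst sum.swap) (simp add: mult.commute)
  also have "\<dots> = (\<Sum>i<n. (B * A) $$ (i, i))"
    using assms by (intro sum.cong refl) (auto simp: scalar_prod_def atLeast0LessThan)
  finally show ?thesis .
qed

lemma upper_triangular_power:
  fixes B :: "'a :: comm_ring_1 mat"
  assumes B: "B \<in> carrier_mat n n" "upper_triangular B"
  shows "(\<forall>i<n. \<forall>j<i. (B ^\<^sub>m k) $$ (i, j) = 0) \<and> (\<forall>i<n. (B ^\<^sub>m k) $$ (i, i) = (B $$ (i, i)) ^ k)"
proof (induction k)
  case 0
  then show ?case using B by auto
next
  case (Suc k)
  have C: "B ^\<^sub>m k \<in> carrier_mat n n" using B by auto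
  have ut: "B $$ (i, j) = 0" if "j < i" "i < n" for i j using B that unfolding upper_triangular_def by auto
  have mult: "(B ^\<^sub>m Suc k) $$ (i, j) = (\<Sum>l<n. (B ^\<^sub>m k) $$ (i, l) * B $$ (l, j))" if "i < n" "j < n" for i j
    using that B C by (auto simp: scalar_prod_def atLeast0LessThan)
  have "(B ^\<^sub>m Suc k) $$ (i, j) = 0" if "i < n" "j < i" for i j
  proof -
    have "(B ^\<^sub>m k) $$ (i, l) * B $$ (l, j) = 0" if "l < n" for l
      using Suc.IH \<open>i < n\<close> \<open>j < i\<close> that by (cases "l < i") (auto simp: ut)
    then show ?thesis using mult that by simp
  qed
  moreover have "(B ^\<^sub>m Suc k) $$ (i, i) = (B $$ (i, i)) ^ Suc k" if "i < n" for i
  proof -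
    have "(B ^\<^sub>m k) $$ (i, l) * B $$ (l, i) = (if l = i then (B $$ (i, i)) ^ Suc k else 0)" if "l < n" for l
      using Suc.IH \<open>i < n\<close> that by (cases l i rule: linorder_cases) (auto simp: ut)
    then show ?thesis using that by (simp add: mult sum.delta del: pow_mat.simps power_Suc)
  qed
  ultimately show ?case by blast
qed

text \<open>Schur triangularisation puts the roots on the diagonal of \<open>B\<close>; powers of a
  triangular matrix carry the powers of its diagonal entries, and conjugation preserves the
  trace.\<close>

lemma trace_power_eq_sum_roots:
  fixes A :: "real mat"
  assumes A: "A \<in> carrier_mat n n" and cp: "char_poly A = (\<Prod>r\<leftarrow>rs. [:- r, 1:])"
  shows "(\<Sum>i<n. (A ^\<^sub>m k) $$ (i, i)) = (\<Sum>r\<leftarrow>rs. r ^ k)"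
proof -
  obtain B P Q where dec: "schur_decomposition A rs = (B, P, Q)" by (metis prod_cases3)
  have wit: "similar_mat_wit A B P Q" and ut: "upper_triangular B" and diag: "diag_mat B = rs"
    using schur_decomposition[OF A cp dec] by auto
  have car: "B \<in> carrier_mat n n" "P \<in> carrier_mat n n" "Q \<in> carrier_mat n n" and QP: "Q * P = 1\<^sub>m n"
    using similar_mat_witD2[OF A wit] by auto
  have Bk: "B ^\<^sub>m k \<in> carrier_mat n n" using car by auto
  have "A ^\<^sub>m k = P * (B ^\<^sub>m k * Q)"
    using similar_mat_wit_pow_id[OF wit, of k] car Bk by (simp add: assoc_mult_mat)
  moreover have "(\<Sum>i<n. (P * (B ^\<^sub>m k * Q)) $$ (i, i)) = (\<Sum>i<n. ((B ^\<^sub>m k * Q) * P) $$ (i, i))"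
    by (rule sum_diag_mult_commute) (use car Bk in auto)
  ultimately have "(\<Sum>i<n. (A ^\<^sub>m k) $$ (i, i)) = (\<Sum>i<n. ((B ^\<^sub>m k * Q) * P) $$ (i, i))"
    by (simp only:)
  also have "(B ^\<^sub>m k * Q) * P = B ^\<^sub>m k"
    using car Bk QP assoc_mult_mat[of "B ^\<^sub>m k" n n Q n P n] right_mult_one_mat[OF Bk] by simp
  also have "(\<Sum>i<n. (B ^\<^sub>m k) $$ (i, i)) = (\<Sum>i<n. (B $$ (i, i)) ^ k)"
    using upper_triangular_power[OF car(1) ut] by simp
  also have "\<dots> = (\<Sum>r\<leftarrow>diag_mat B. r ^ k)"
    using car(1) by (simp add: diag_mat_def comp_def interv_sum_list_conv_sum_set_nat atLeast0LessThan)
  finally show ?thesis using diag by simp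
qed

lemma proots_prod_list_linear:
  fixes rs :: "'a :: idom list"
  shows "proots (\<Prod>r\<leftarrow>rs. [:- r, 1:]) = mset rs"
proof (induction rs)
  case (Cons r rs)
  have "(\<Prod>r\<leftarrow>rs. [:- r, 1:]) \<noteq> 0" by (auto simp: prod_list_zero_iff)
  then have "proots ([:- r, 1:] * (\<Prod>r\<leftarrow>rs. [:- r, 1:])) = proots [:- r, 1:] + proots (\<Prod>r\<leftarrow>rs. [:- r, 1:])"
    by (intro proots_mult) auto
  then show ?case using Cons by simp
qed simp

lemma real_distribution_eigenvalue_distribution: "real_distribution (eigenvalue_distribution A)"
  unfolding eigenvalue_distribution_def real_distribution_def real_distribution_axioms_def
  by (auto intro!: measure_pmf.prob_space_distr)

lemma sum_count_list_mult:
  fixes f :: "'a \<Rightarrow> 'b :: comm_semiring_1"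
  assumes "finite A" "set xs \<subseteq> A"
  shows "(\<Sum>x\<in>A. of_nat (count_list xs x) * f x) = (\<Sum>x\<leftarrow>xs. f x)"
  using assms(2)
proof (induction xs)
  case (Cons a xs)
  have "(\<Sum>x\<in>A. of_nat (count_list (a # xs) x) * f x) =
      (\<Sum>x\<in>A. (if x = a then f a else 0) + of_nat (count_list xs x) * f x)"
    by (intro sum.cong) (auto simp: algebra_simps)
  then show ?case using Cons assms(1) by (simp add: sum.distrib sum.delta')
qed simp

lemma integral_eigenvalue_distribution:
  fixes f :: "real \<Rightarrow> real"
  assumes cp: "char_poly A = (\<Prod>r\<leftarrow>rs. [:- r, 1:])" and rs: "rs \<noteq> []" and f: "f \<in> borel_measurable borel"
  shows "integrable (eigenvalue_distribution A) f"
    and "(\<integral>x. f x \<partial>eigenvalue_distribution A) = (\<Sum>r\<leftarrow>rs. f r) / length rs"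
proof -
  have pr: "proots (char_poly A) = mset rs" by (simp add: cp proots_prod_list_linear)
  have ne: "mset rs \<noteq> {#}" using rs by simp
  have set: "set_pmf (pmf_of_multiset (mset rs)) = set rs" using ne by simp
  have "integrable (measure_pmf (pmf_of_multiset (mset rs))) f"
    by (rule integrable_measure_pmf_finite) (simp add: set)
  then show "integrable (eigenvalue_distribution A) f"
    unfolding eigenvalue_distribution_def pr using f by (subst integrable_distr_eq) auto
  have "(\<integral>x. f x \<partial>eigenvalue_distribution A) = (\<integral>x. f x \<partial>measure_pmf (pmf_of_multiset (mset rs)))"
    unfolding eigenvalue_distribution_def pr using f by (subst integral_distr) auto
  also have "\<dots> = (\<Sum>r\<in>set rs. f r * (real (count (mset rs) r) / length rs))"
    by (subst integral_measure_pmf_real[of "set rs"]) (use ne in auto)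
  also have "\<dots> = (\<Sum>r\<in>set rs. real (count_list rs r) * f r) / length rs"
    by (simp add: sum_divide_distrib mult.commute count_mset)
  also have "(\<Sum>r\<in>set rs. real (count_list rs r) * f r) = (\<Sum>r\<leftarrow>rs. f r)"
    by (rule sum_count_list_mult) auto
  finally show "(\<integral>x. f x \<partial>eigenvalue_distribution A) = (\<Sum>r\<leftarrow>rs. f r) / length rs" .
qed

text \<open>Powers of \<open>x\<close> are unbounded, so integrability under the mixture has to come
  from the averaged absolute integral \<open>fin\<close>. Positive and negative part are treated by
  the nonnegative integral of a mixture and then recombined.\<close>

lemma integral_bind_integrable:
  fixes f :: "real \<Rightarrow> real"
  assumes K: "K \<in> M \<rightarrow>\<^sub>M subprob_algebra borel" and f: "f \<in> borel_measurable borel"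
    and int: "\<And>w. w \<in> space M \<Longrightarrow> integrable (K w) f"
    and fin: "integrable M (\<lambda>w. \<integral>x. \<bar>f x\<bar> \<partial>K w)" and ne: "space M \<noteq> {}"
  shows "integrable (M \<bind> K) f" and "(\<integral>x. f x \<partial>(M \<bind> K)) = (\<integral>w. (\<integral>x. f x \<partial>K w) \<partial>M)"
proof -
  have setsK: "sets (K w) = sets borel" if "w \<in> space M" for w
    using measurable_space[OF K that] by (simp add: space_subprob_algebra)
  have setsB: "sets (M \<bind> K) = sets borel"
    using sets_bind[OF setsK ne] by simp
  have part: "(\<integral>\<^sup>+x. ennreal (g x) \<partial>(M \<bind> K)) = (\<integral>w. (\<integral>x. g x \<partial>K w) \<partial>M)
      \<and> integrable M (\<lambda>w. \<integral>x. g x \<partial>K w) \<and> integrable (M \<bind> K) g"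
    if g: "g \<in> borel_measurable borel" and bd: "\<And>x. 0 \<le> g x" "\<And>x. g x \<le> \<bar>f x\<bar>" for g
  proof -
    have gi: "integrable (K w) g" if w: "w \<in> space M" for w
      by (rule Bochner_Integration.integrable_bound[OF int[OF w]])
         (use g bd setsK[OF w] in \<open>auto simp: measurable_cong_sets[OF setsK[OF w] refl]\<close>)
    have meas: "(\<lambda>w. \<integral>x. g x \<partial>K w) \<in> borel_measurable M"
      using measurable_compose[OF K integral_measurable_subprob_algebra[OF g]] .
    have I: "integrable M (\<lambda>w. \<integral>x. g x \<partial>K w)"
    proof (rule Bochner_Integration.integrable_bound[OF fin meas], rule AE_I2)
      fix w assume w: "w \<in> space M"
      have "(\<integral>x. g x \<partial>K w) \<le> (\<integral>x. \<bar>f x\<bar> \<partial>K w)"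
        by (intro integral_mono gi w) (use int[OF w] bd in auto)
      moreover have "0 \<le> (\<integral>x. g x \<partial>K w)" using bd by (intro integral_nonneg_AE) auto
      ultimately show "norm (\<integral>x. g x \<partial>K w) \<le> norm (\<integral>x. \<bar>f x\<bar> \<partial>K w)" by simp
    qed
    have "(\<integral>\<^sup>+x. ennreal (g x) \<partial>(M \<bind> K)) = (\<integral>\<^sup>+w. \<integral>\<^sup>+x. ennreal (g x) \<partial>K w \<partial>M)"
      by (rule nn_integral_bind[OF _ K]) (use g in simp)
    also have "\<dots> = (\<integral>\<^sup>+w. ennreal (\<integral>x. g x \<partial>K w) \<partial>M)"
      by (intro nn_integral_cong nn_integral_eq_integral gi) (use bd in auto)
    also have "\<dots> = ennreal (\<integral>w. (\<integral>x. g x \<partial>K w) \<partial>M)"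
      by (rule nn_integral_eq_integral[OF I]) (auto intro!: AE_I2 integral_nonneg_AE bd)
    finally have eq: "(\<integral>\<^sup>+x. ennreal (g x) \<partial>(M \<bind> K)) = ennreal (\<integral>w. (\<integral>x. g x \<partial>K w) \<partial>M)" .
    have "integrable (M \<bind> K) g"
      by (rule integrableI_nonneg) (use g bd eq in \<open>auto simp: measurable_cong_sets[OF setsB refl]\<close>)
    then show ?thesis using eq I by auto
  qed
  have part': "(\<integral>x. g x \<partial>(M \<bind> K)) = (\<integral>w. (\<integral>x. g x \<partial>K w) \<partial>M)"
    if g: "g \<in> borel_measurable borel" and bd: "\<And>x. 0 \<le> g x" "\<And>x. g x \<le> \<bar>f x\<bar>" for g
  proof -
    have "0 \<le> (\<integral>w. (\<integral>x. g x \<partial>K w) \<partial>M)" by (auto intro!: integral_nonneg_AE AE_I2 bd)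
    moreover have "ennreal (\<integral>x. g x \<partial>(M \<bind> K)) = (\<integral>\<^sup>+x. ennreal (g x) \<partial>(M \<bind> K))"
      by (rule nn_integral_eq_integral[symmetric]) (use part[OF g bd] bd in auto)
    moreover have "0 \<le> (\<integral>x. g x \<partial>(M \<bind> K))" by (auto intro!: integral_nonneg_AE AE_I2 bd)
    ultimately show ?thesis using part[OF g bd] by simp
  qed
  define p where "p x = max 0 (f x)" for x
  define n where "n x = max 0 (- f x)" for x
  have pm: "p \<in> borel_measurable borel" "n \<in> borel_measurable borel"
    unfolding p_def[abs_def] n_def[abs_def] using f by auto
  have pb: "0 \<le> p x" "p x \<le> \<bar>f x\<bar>" "0 \<le> n x" "n x \<le> \<bar>f x\<bar>" for x by (auto simp: p_def n_def)
  have fpn: "f = (\<lambda>x. p x - n x)" by (auto simp: p_def n_def)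
  have ip: "integrable (M \<bind> K) p" "integrable (M \<bind> K) n" 
    "integrable M (\<lambda>w. \<integral>x. p x \<partial>K w)" "integrable M (\<lambda>w. \<integral>x. n x \<partial>K w)"
    using part[OF pm(1) pb(1,2)] part[OF pm(2) pb(3,4)] by auto
  then show "integrable (M \<bind> K) f" by (subst fpn) auto
  have "(\<integral>x. f x \<partial>K w) = (\<integral>x. p x \<partial>K w) - (\<integral>x. n x \<partial>K w)" if w: "w \<in> space M" for w
  proof -
    have "integrable (K w) p" "integrable (K w) n"
      by (rule Bochner_Integration.integrable_bound[OF int[OF w]];
          use pm pb setsK[OF w] in \<open>auto simp: measurable_cong_sets[OF setsK[OF w] refl]\<close>)+
    then show ?thesis by (subst fpn) (rule Bochner_Integration.integral_diff)
  qed
  then have "(\<integral>w. (\<integral>x. f x \<partial>K w) \<partial>M) = (\<integral>w. (\<integral>x. p x \<partial>K w) - (\<integral>x. n x \<partial>K w) \<partial>M)"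
    by (rule Bochner_Integration.integral_cong[OF refl])
  also have "\<dots> = (\<integral>w. (\<integral>x. p x \<partial>K w) \<partial>M) - (\<integral>w. (\<integral>x. n x \<partial>K w) \<partial>M)"
    using ip by (intro Bochner_Integration.integral_diff) auto
  also have "\<dots> = (\<integral>x. p x \<partial>(M \<bind> K)) - (\<integral>x. n x \<partial>(M \<bind> K))"
    using part'[OF pm(1) pb(1,2)] part'[OF pm(2) pb(3,4)] by simp
  also have "\<dots> = (\<integral>x. f x \<partial>(M \<bind> K))"
    using ip by (subst fpn) (auto simp: Bochner_Integration.integral_diff)
  finally show "(\<integral>x. f x \<partial>(M \<bind> K)) = (\<integral>w. (\<integral>x. f x \<partial>K w) \<partial>M)" ..
qed

text \<open>Weierstrass on the growing intervals \<open>[-n, n]\<close> with error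
  \<open>1 / (n + 1)\<close>. Pointwise convergence is enough, because it is only summed over the
  finitely many eigenvalues of a matrix.\<close>

lemma continuous_limit_of_polynomials:
  fixes f :: "real \<Rightarrow> real"
  assumes "continuous_on UNIV f"
  obtains a :: "nat \<Rightarrow> nat \<Rightarrow> real" and d :: "nat \<Rightarrow> nat"
    where "\<And>x. (\<lambda>n. \<Sum>i\<le>d n. a n i * x ^ i) \<longlonglongrightarrow> f x"
proof -
  have "\<exists>a d. \<forall>x\<in>{- real n..real n}. \<bar>f x - (\<Sum>i\<le>d. a i * x ^ i)\<bar> < 1 / real (Suc n)" for n
  proof -
    have "continuous_on {- real n..real n} f" using assms continuous_on_subset by blast
    then obtain g where g: "real_polynomial_function g" "\<And>x. x \<in> {- real n..real n} \<Longrightarrow> \<bar>f x - g x\<bar> < 1 / real (Suc n)"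
      using Stone_Weierstrass_real_polynomial_function[OF compact_Icc, of "- real n" "real n" f "1 / real (Suc n)"] by auto
    then show ?thesis unfolding real_polynomial_function_iff_sum by fast
  qed
  then obtain a d where ad: "\<And>n x. x \<in> {- real n..real n} \<Longrightarrow> \<bar>f x - (\<Sum>i\<le>d n. a n i * x ^ i)\<bar> < 1 / real (Suc n)"
    by metis
  show thesis
  proof (rule that)
    fix x
    obtain m where m: "\<bar>x\<bar> \<le> real m" using real_arch_simple by blast
    have "(\<lambda>n. f x - (\<Sum>i\<le>d n. a n i * x ^ i)) \<longlonglongrightarrow> 0"
    proof (rule Lim_null_comparison[OF _ LIMSEQ_inverse_real_of_nat])
      show "\<forall>\<^sub>F n in sequentially. norm (f x - (\<Sum>i\<le>d n. a n i * x ^ i)) \<le> inverse (real (Suc n))"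
        using eventually_ge_at_top[of m]
      proof eventually_elim
        case (elim n)
        then have "x \<in> {- real n..real n}" using m by (auto simp: abs_le_iff)
        then show ?case using ad[of x n] by (simp add: inverse_eq_divide)
      qed
    qed
    from tendsto_diff[OF tendsto_const[of "f x"] this]
    show "(\<lambda>n. \<Sum>i\<le>d n. a n i * x ^ i) \<longlonglongrightarrow> f x" by simp
  qed
qed

text \<open>
  Eigenvalues are not polynomial in the matrix entries, but traces of powers are, and by Weierstrass
  they determine the eigenvalue counting functions as pointwise limits.
\<close>

lemma eigenvalue_distribution_measurable:
  assumes M: "space M \<noteq> {}"
    and A: "\<And>w. w \<in> space M \<Longrightarrow> A w \<in> carrier_mat n n"
    and sym: "\<And>w i j. w \<in> space M \<Longrightarrow> i < n \<Longrightarrow> j < n \<Longrightarrow> A w $$ (i, j) = A w $$ (j, i)"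
    and tr: "\<And>k. (\<lambda>w. \<Sum>i<n. (A w ^\<^sub>m k) $$ (i, i)) \<in> borel_measurable M" and n: "n > 0"
  shows "(\<lambda>w. eigenvalue_distribution (A w)) \<in> M \<rightarrow>\<^sub>M subprob_algebra borel"
proof -
  have "\<exists>rs. char_poly (A w) = (\<Prod>r\<leftarrow>rs. [:- r, 1:]) \<and> length rs = n" if "w \<in> space M" for w
    using symmetric_char_poly_splits[of "A w" n] A sym that by metis
  \<comment> \<open>\<open>rs\<close> is an arbitrary pointwise choice without any measurability;
    only sums over all of its entries are shown to be measurable.\<close>
  then obtain rs where cp: "\<And>w. w \<in> space M \<Longrightarrow> char_poly (A w) = (\<Prod>r\<leftarrow>rs w. [:- r, 1:])"
    and len: "\<And>w. w \<in> space M \<Longrightarrow> length (rs w) = n" by metis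
  have lim: "(\<lambda>w. \<Sum>r\<leftarrow>rs w. f r) \<in> borel_measurable M"
    if F: "\<And>k. (\<lambda>w. \<Sum>r\<leftarrow>rs w. F k r) \<in> borel_measurable M" and lim: "\<And>x. (\<lambda>k. F k x) \<longlonglongrightarrow> f x"
    for F :: "nat \<Rightarrow> real \<Rightarrow> real" and f
  proof (rule borel_measurable_LIMSEQ_real[OF _ F])
    fix w
    show "(\<lambda>k. \<Sum>r\<leftarrow>rs w. F k r) \<longlonglongrightarrow> (\<Sum>r\<leftarrow>rs w. f r)"
    proof -
      have "(\<lambda>k. \<Sum>r\<leftarrow>xs. F k r) \<longlonglongrightarrow> (\<Sum>r\<leftarrow>xs. f r)" for xs
        by (induction xs) (auto intro!: tendsto_add lim)
      then show ?thesis .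
    qed
  qed
  have pow: "(\<lambda>w. \<Sum>r\<leftarrow>rs w. r ^ k) \<in> borel_measurable M" for k
    using tr[of k] by (rule measurable_cong[THEN iffD1, rotated]) (use trace_power_eq_sum_roots[OF A cp] in auto)
  have poly: "(\<lambda>w. \<Sum>r\<leftarrow>rs w. \<Sum>i\<le>d. a i * r ^ i) \<in> borel_measurable M" for a :: "nat \<Rightarrow> real" and d
  proof -
    have "(\<Sum>r\<leftarrow>xs. \<Sum>i\<le>d. a i * r ^ i) = (\<Sum>i\<le>d. a i * (\<Sum>r\<leftarrow>xs. r ^ i))" for xs
      by (induction xs) (auto simp: sum.distrib distrib_left)
    then show ?thesis using pow by simp
  qed
  have cont: "(\<lambda>w. \<Sum>r\<leftarrow>rs w. f r) \<in> borel_measurable M" if cont: "continuous_on UNIV f" for f :: "real \<Rightarrow> real"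
  proof -
    obtain a d where "\<And>x. (\<lambda>n. \<Sum>i\<le>d n. a n i * x ^ i) \<longlonglongrightarrow> f x"
      using continuous_limit_of_polynomials[OF cont] by blast
    then show ?thesis by (intro lim[OF poly])
  qed
  \<comment> \<open>For \<open>k > 0\<close> the ramp equals 1 up to \<open>t\<close> and vanishes
    from \<open>t + 1 / k\<close> on, so the ramps tend to the indicator of the closed half-line.
    Half-lines form an intersection-stable generator of the Borel sets.\<close>
  have ind: "(\<lambda>w. \<Sum>r\<leftarrow>rs w. indicator {..t} r :: real) \<in> borel_measurable M" for t :: real
  proof (rule lim)
    show "(\<lambda>w. \<Sum>r\<leftarrow>rs w. max 0 (1 - real k * max 0 (r - t))) \<in> borel_measurable M" for k
      by (rule cont) (intro continuous_intros)
    show "(\<lambda>k. max 0 (1 - real k * max 0 (x - t))) \<longlonglongrightarrow> indicator {..t} x" for x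
    proof (cases "x \<le> t")
      case False
      obtain m where m: "1 / (x - t) \<le> real m" using real_arch_simple by blast
      have "\<forall>\<^sub>F k in sequentially. max 0 (1 - real k * max 0 (x - t)) = 0"
        using eventually_ge_at_top[of m]
      proof eventually_elim
        case (elim k)
        then have "1 / (x - t) \<le> real k" using m by linarith
        then show ?case using False by (simp add: field_simps max_def)
      qed
      then show ?thesis using False by (simp add: tendsto_eventually)
    qed (simp add: max_def)
  qed
  show ?thesis
  proof (rule measurable_subprob_algebra_generated[where \<Omega> = UNIV and G = "range atMost"])
    show "sets borel = sigma_sets UNIV (range (atMost :: real \<Rightarrow> real set))"
      by (simp add: borel_eq_atMost)
    show "Int_stable (range (atMost :: real \<Rightarrow> real set))"
      by (auto simp: Int_stable_def)
    fix w assume w: "w \<in> space M"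
    interpret E: real_distribution "eigenvalue_distribution (A w)"
      by (rule real_distribution_eigenvalue_distribution)
    show "subprob_space (eigenvalue_distribution (A w))" "sets (eigenvalue_distribution (A w)) = sets borel"
      by (simp_all add: E.subprob_space_axioms)
  next
    fix S assume "S \<in> range (atMost :: real \<Rightarrow> real set)"
    then obtain t where S: "S = {..t}" by auto
    have "emeasure (eigenvalue_distribution (A w)) S = ennreal ((\<Sum>r\<leftarrow>rs w. indicator {..t} r) / real n)" if w: "w \<in> space M" for w
    proof -
      interpret E: real_distribution "eigenvalue_distribution (A w)"
        by (rule real_distribution_eigenvalue_distribution)
      have "(\<Sum>r\<leftarrow>rs w. indicator {..t} r) / real n = (\<integral>x. indicator {..t} x \<partial>eigenvalue_distribution (A w))"
        by (subst integral_eigenvalue_distribution(2)[OF cp[OF w]]) (use len[OF w] n in auto)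
      also have "\<dots> = measure (eigenvalue_distribution (A w)) {..t}" by simp
      finally show ?thesis by (simp add: S E.emeasure_eq_measure)
    qed
    then show "(\<lambda>w. emeasure (eigenvalue_distribution (A w)) S) \<in> borel_measurable M"
      by (subst measurable_cong) (use ind in auto)
  next
    have "emeasure (eigenvalue_distribution (A w)) UNIV = 1" for w
    proof -
      interpret E: real_distribution "eigenvalue_distribution (A w)"
        by (rule real_distribution_eigenvalue_distribution)
      show ?thesis using E.emeasure_space_1 by simp
    qed
    then show "(\<lambda>w. emeasure (eigenvalue_distribution (A w)) UNIV) \<in> borel_measurable M" by simp
  qed auto
qed

section \<open>Moments of the weighted regular tree\<close>

unbundle no vec_syntax
no_notation Matrix.vec_index (infixl "$" 100)
unbundle fps_syntax
declare class_semiring.nat_pow_Suc [simp del] class_semiring.finsum_Suc [simp del]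

text \<open>
  If \<open>Y\<^sub>1, \<dots>, Y\<^sub>e\<close> are independent copies of a random power series \<open>Y\<close> with \<open>E[Y ^ j] = y j\<close>, then
  \<open>sum_pow y e n\<close> is \<open>E[(Y\<^sub>1 + \<dots> + Y\<^sub>e) ^ n]\<close>; the recursion singles out the summand chosen by the first
  factor, and makes sense for real \<open>e\<close>. Let \<open>R\<close> be the generating function, with \<open>z\<close> marking pairs of
  steps, of closed walks at a vertex with \<open>e\<close> children in the weighted tree, so \<open>R = 1 / (1 - \<Sum> b\<^sub>i^2 z R\<^sub>i)\<close> over the
  children; then \<open>res_pow m e p = E[R ^ p]\<close> and \<open>edge_pow m e j = E[(b^2 z R) ^ j]\<close>, where \<open>m\<close> lists
  the even moments of the weight \<open>b\<close>.
\<close>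

fun sum_pow :: "(nat \<Rightarrow> real fps) \<Rightarrow> real \<Rightarrow> nat \<Rightarrow> real fps" where
  "sum_pow y e 0 = 1"
| "sum_pow y e (Suc n) =
     fps_const e * (\<Sum>j\<le>n. of_nat (n choose j) * y (Suc j) * sum_pow y (e - 1) (n - j))"

text \<open>The tree cut off at depth \<open>n\<close>, where the generating function is replaced by
  1. The binomial coefficient is that of the negative binomial series for
  \<open>1 / (1 - Y) ^ p\<close>; truncated subtraction makes it 1 at \<open>q = 0\<close> and 0
  elsewhere when \<open>p = 0\<close>, as the zeroth power requires.\<close>

fun res_pow_aux :: "(nat \<Rightarrow> real) \<Rightarrow> real \<Rightarrow> nat \<Rightarrow> nat \<Rightarrow> real fps" where
  "res_pow_aux m e 0 p = 1"
| "res_pow_aux m e (Suc n) p = Abs_fps (\<lambda>k. \<Sum>q\<le>k. real ((q + p - 1) choose q) *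
     sum_pow (\<lambda>j. fps_const (m j) * fps_X ^ j * res_pow_aux m e n j) e q $ k)"

text \<open>The diagonal is a legitimate limit: coefficient \<open>k\<close> no longer changes once
  the depth is at least \<open>k\<close>.\<close>

definition res_pow :: "(nat \<Rightarrow> real) \<Rightarrow> real \<Rightarrow> nat \<Rightarrow> real fps" where
  "res_pow m e p = Abs_fps (\<lambda>k. res_pow_aux m e k p $ k)"

definition edge_pow :: "(nat \<Rightarrow> real) \<Rightarrow> real \<Rightarrow> nat \<Rightarrow> real fps" where
  "edge_pow m e j = fps_const (m j) * fps_X ^ j * res_pow m e j"

text \<open>The case \<open>p = 1\<close> of the same series, where every binomial coefficient is 1,
  at a root with \<open>d\<close> children whose descendants have \<open>d - 1\<close> children
  each.\<close>

definition tree_moment :: "(nat \<Rightarrow> real) \<Rightarrow> nat \<Rightarrow> nat \<Rightarrow> real" where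
  "tree_moment m d k = (\<Sum>q\<le>k. sum_pow (edge_pow m (real (d - 1))) (real d) q $ k)"

lemma sum_pow_Suc_nth:
  "sum_pow y e (Suc n) $ k = e * (\<Sum>j\<le>n. real (n choose j) *
     (\<Sum>i\<le>k. y (Suc j) $ i * sum_pow y (e - 1) (n - j) $ (k - i)))"
  unfolding sum_pow.simps(2) fps_mult_left_const_nth fps_sum_nth mult.assoc fps_of_nat[symmetric]
  by (simp add: fps_mult_nth atLeast0AtMost)

declare sum_pow.simps(2) [simp del]

lemma const_X_power_mult_nth:
  "(fps_const (c::real) * fps_X ^ j * f) $ i = (if i < j then 0 else c * f $ (i - j))"
  by (simp add: mult.assoc fps_X_power_mult_nth)

text \<open>For natural \<open>e\<close> the coefficients are polynomials with nonnegative
  coefficients in those of \<open>y\<close>. An arbitrary class \<open>A\<close> closed under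
  nonnegative constants, sums and products captures this: suitable choices of \<open>A\<close> yield
  nonnegativity, continuity and congruence without repeating the induction.\<close>

lemma sum_pow_nth_closed:
  fixes A :: "('a \<Rightarrow> real) set"
  assumes const: "\<And>c. c \<ge> 0 \<Longrightarrow> (\<lambda>_. c) \<in> A"
    and add: "\<And>f g. f \<in> A \<Longrightarrow> g \<in> A \<Longrightarrow> (\<lambda>x. f x + g x) \<in> A"
    and mult: "\<And>f g. f \<in> A \<Longrightarrow> g \<in> A \<Longrightarrow> (\<lambda>x. f x * g x) \<in> A"
    and y: "\<And>i j. i \<le> k \<Longrightarrow> (\<lambda>x. y x (Suc j) $ i) \<in> A"
  shows "(\<lambda>x. sum_pow (y x) (real e) n $ k) \<in> A"
  using y
proof (induction n arbitrary: e k rule: less_induct)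
  case (less n)
  have sum: "(\<lambda>x. \<Sum>i\<in>I. f i x) \<in> A" if "finite I" "\<And>i. i \<in> I \<Longrightarrow> f i \<in> A" for I :: "nat set" and f
    using that by (induction I) (auto intro!: add simp: const)
  show ?case
  proof (cases n)
    case 0
    then show ?thesis by (simp add: const)
  next
    case (Suc n')
    show ?thesis
    proof (cases e)
      \<comment> \<open>The factor \<open>e = 0\<close> stops the recursion before its argument
        \<open>e - 1\<close> becomes negative.\<close>
      case 0
      then show ?thesis by (simp add: Suc sum_pow_Suc_nth const)
    next
      case e: (Suc e')
      have "(\<lambda>x. sum_pow (y x) (real e') (n' - j) $ (k - i)) \<in> A" for i j
        by (rule less.IH) (use Suc less.prems in auto)
      then have "(\<lambda>x. real (Suc e') * (\<Sum>j\<le>n'. real (n' choose j) *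
          (\<Sum>i\<le>k. y x (Suc j) $ i * sum_pow (y x) (real e') (n' - j) $ (k - i)))) \<in> A"
        by (intro sum add mult const less.prems) auto
      then show ?thesis by (simp add: e Suc sum_pow_Suc_nth)
    qed
  qed
qed

lemma sum_pow_nth_cong:
  assumes "\<And>i j. i \<le> k \<Longrightarrow> y (Suc j) $ i = y' (Suc j) $ i"
  shows "sum_pow y e n $ k = sum_pow y' e n $ k"
  using assms
proof (induction n arbitrary: e k rule: less_induct)
  case (less n)
  then show ?case by (cases n) (auto simp: sum_pow_Suc_nth intro!: sum.cong)
qed

text \<open>\<open>y j\<close> has order at least \<open>j\<close>, so an \<open>n\<close>-th power
  of a sum has order at least \<open>n\<close>. This is why sums over \<open>q\<close> may be cut
  at, or extended beyond, the coefficient index.\<close>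

lemma sum_pow_nth_eq_0:
  assumes "\<And>i j. i < j \<Longrightarrow> y j $ i = 0" "k < n"
  shows "sum_pow y e n $ k = 0"
  using assms(2)
proof (induction n arbitrary: e k rule: less_induct)
  case (less n)
  then obtain n' where n: "n = Suc n'" by (cases n) auto
  have *: "y (Suc j) $ i * sum_pow y (e - 1) (n' - j) $ (k - i) = 0" if "j \<le> n'" "i \<le> k" for i j
  proof (cases "i < Suc j")
    case False
    then have "k - i < n' - j" "n' - j < n" using less.prems that n by auto
    then show ?thesis using less.IH by simp
  qed (simp add: assms(1))
  show ?case unfolding n sum_pow_Suc_nth by (simp add: * del: mult_eq_0_iff)
qed

text \<open>Every use of the next level comes with a factor \<open>fps_X ^ j\<close> with
  \<open>j \<ge> 1\<close>, so one level of depth is paid for by at least one degree.\<close>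

lemma res_pow_aux_stable:
  assumes "k \<le> n"
  shows "res_pow_aux m e (Suc n) p $ k = res_pow_aux m e n p $ k"
  using assms
proof (induction n arbitrary: k p)
  case 0
  then show ?case by simp
next
  case (Suc n)
  show ?case
    unfolding res_pow_aux.simps(2)[of m e "Suc n" p] res_pow_aux.simps(2)[of m e n p] fps_nth_Abs_fps
    by (intro sum.cong refl arg_cong2[of _ _ _ _ "(*)"] sum_pow_nth_cong)
       (use Suc in \<open>simp add: const_X_power_mult_nth del: power_Suc res_pow_aux.simps\<close>)
qed

lemma res_pow_aux_eq_res_pow:
  assumes "k \<le> n"
  shows "res_pow_aux m e n p $ k = res_pow m e p $ k"
  using assms by (induction n rule: dec_induct) (auto simp: res_pow_def res_pow_aux_stable simp del: res_pow_aux.simps)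

lemma edge_pow_nth: "edge_pow m e j $ i = (if i < j then 0 else m j * res_pow m e j $ (i - j))"
  by (simp add: edge_pow_def const_X_power_mult_nth)

text \<open>The truncated recursion becomes a fixed point equation. Its right side involves
  \<open>res_pow\<close> only at coefficients below \<open>k\<close>, so it still serves as a
  recursion in \<open>k\<close>.\<close>

lemma res_pow_nth:
  "res_pow m e p $ k = (\<Sum>q\<le>k. real ((q + p - 1) choose q) * sum_pow (edge_pow m e) e q $ k)"
proof -
  have "res_pow m e p $ k = res_pow_aux m e (Suc k) p $ k"
    by (rule res_pow_aux_eq_res_pow[symmetric]) simp
  also have "\<dots> = (\<Sum>q\<le>k. real ((q + p - 1) choose q) * sum_pow (edge_pow m e) e q $ k)"
    unfolding res_pow_aux.simps(2) fps_nth_Abs_fps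
    by (intro sum.cong refl arg_cong2[of _ _ _ _ "(*)"] sum_pow_nth_cong)
       (simp add: const_X_power_mult_nth edge_pow_nth res_pow_aux_eq_res_pow del: power_Suc)
  finally show ?thesis .
qed

lemma res_pow_nth_closed:
  fixes A :: "('a \<Rightarrow> real) set"
  assumes const: "\<And>c. c \<ge> 0 \<Longrightarrow> (\<lambda>_. c) \<in> A"
    and add: "\<And>f g. f \<in> A \<Longrightarrow> g \<in> A \<Longrightarrow> (\<lambda>x. f x + g x) \<in> A"
    and mult: "\<And>f g. f \<in> A \<Longrightarrow> g \<in> A \<Longrightarrow> (\<lambda>x. f x * g x) \<in> A"
    and m: "\<And>j. 1 \<le> j \<Longrightarrow> j \<le> k \<Longrightarrow> (\<lambda>x. m x j) \<in> A"
  shows "(\<lambda>x. res_pow (m x) (real e) p $ k) \<in> A"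
  using m
proof (induction k arbitrary: p rule: less_induct)
  case (less k)
  have sum: "(\<lambda>x. \<Sum>i\<in>I. f i x) \<in> A" if "finite I" "\<And>i. i \<in> I \<Longrightarrow> f i \<in> A" for I :: "nat set" and f
    using that by (induction I) (auto intro!: add simp: const)
  have "(\<lambda>x. edge_pow (m x) (real e) (Suc j) $ i) \<in> A" if "i \<le> k" for i j
  proof (cases "i < Suc j")
    case False
    then have "(\<lambda>x. m x (Suc j) * res_pow (m x) (real e) (Suc j) $ (i - Suc j)) \<in> A"
      by (intro mult less.prems less.IH) (use that in auto)
    then show ?thesis using False by (simp add: edge_pow_nth)
  qed (simp add: edge_pow_nth const)
  then show ?case
    unfolding res_pow_nth by (intro sum mult const sum_pow_nth_closed add) auto
qed

lemma edge_pow_nth_closed: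
  fixes A :: "('a \<Rightarrow> real) set"
  assumes const: "\<And>c. c \<ge> 0 \<Longrightarrow> (\<lambda>_. c) \<in> A"
    and add: "\<And>f g. f \<in> A \<Longrightarrow> g \<in> A \<Longrightarrow> (\<lambda>x. f x + g x) \<in> A"
    and mult: "\<And>f g. f \<in> A \<Longrightarrow> g \<in> A \<Longrightarrow> (\<lambda>x. f x * g x) \<in> A"
    and m: "\<And>j. 1 \<le> j \<Longrightarrow> j \<le> i \<Longrightarrow> (\<lambda>x. m x j) \<in> A"
  shows "(\<lambda>x. edge_pow (m x) (real e) (Suc j) $ i) \<in> A"
proof (cases "i < Suc j")
  case False
  then have "(\<lambda>x. m x (Suc j) * res_pow (m x) (real e) (Suc j) $ (i - Suc j)) \<in> A"
    by (intro mult m res_pow_nth_closed const add) auto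
  then show ?thesis using False by (simp add: edge_pow_nth)
qed (simp add: edge_pow_nth const)

lemma tree_moment_closed:
  fixes A :: "('a \<Rightarrow> real) set"
  assumes const: "\<And>c. c \<ge> 0 \<Longrightarrow> (\<lambda>_. c) \<in> A"
    and add: "\<And>f g. f \<in> A \<Longrightarrow> g \<in> A \<Longrightarrow> (\<lambda>x. f x + g x) \<in> A"
    and mult: "\<And>f g. f \<in> A \<Longrightarrow> g \<in> A \<Longrightarrow> (\<lambda>x. f x * g x) \<in> A"
    and m: "\<And>j. 1 \<le> j \<Longrightarrow> j \<le> k \<Longrightarrow> (\<lambda>x. m x j) \<in> A"
  shows "(\<lambda>x. tree_moment (m x) d k) \<in> A"
proof -
  have sum: "(\<lambda>x. \<Sum>i\<in>I. f i x) \<in> A" if "finite I" "\<And>i. i \<in> I \<Longrightarrow> f i \<in> A" for I :: "nat set" and f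
    using that by (induction I) (auto intro!: add simp: const)
  show ?thesis
    unfolding tree_moment_def
    by (intro sum sum_pow_nth_closed edge_pow_nth_closed const add mult m) auto
qed

lemma tree_moment_cong:
  assumes "\<And>j. 1 \<le> j \<Longrightarrow> j \<le> k \<Longrightarrow> m j = m' j"
  shows "tree_moment m d k = tree_moment m' d k"
proof -
  define M where "M b = (if b then m else m')" for b
  have "(\<lambda>b. tree_moment (M b) d k) \<in> {f. f True = f False}"
    by (rule tree_moment_closed) (use assms in \<open>auto simp: M_def\<close>)
  then show ?thesis by (simp add: M_def)
qed

text \<open>The parameter \<open>Some n\<close> selects the \<open>n\<close>-th sequence and
  \<open>None\<close> the limit; the class of functions continuous at \<open>None\<close> is closed
  under sums and products.\<close>

lemma tree_moment_tendsto:
  assumes "\<And>j. 1 \<le> j \<Longrightarrow> j \<le> k \<Longrightarrow> (\<lambda>n. ms n j) \<longlonglongrightarrow> m j"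
  shows "(\<lambda>n. tree_moment (ms n) d k) \<longlonglongrightarrow> tree_moment m d k"
proof -
  define M where "M b = (case b of None \<Rightarrow> m | Some n \<Rightarrow> ms n)" for b
  have "(\<lambda>b. tree_moment (M b) d k) \<in> {f. (\<lambda>n. f (Some n)) \<longlonglongrightarrow> f None}"
    by (rule tree_moment_closed) (use assms in \<open>auto simp: M_def intro!: tendsto_add tendsto_mult\<close>)
  then show ?thesis by (simp add: M_def)
qed

lemma nth_nonneg:
  assumes "\<And>j. 1 \<le> j \<Longrightarrow> m j \<ge> 0"
  shows res_pow_nth_nonneg: "res_pow m (real e) p $ k \<ge> 0"
    and edge_pow_nth_nonneg: "edge_pow m (real e) (Suc j) $ k \<ge> 0"
    and sum_pow_edge_pow_nth_nonneg: "sum_pow (edge_pow m (real e)) (real e') q $ k \<ge> 0"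
proof -
  have *: "(\<lambda>_::unit. res_pow m (real e) p $ k) \<in> {f. f () \<ge> 0}"
    by (rule res_pow_nth_closed) (use assms in auto)
  then show "res_pow m (real e) p $ k \<ge> 0" by simp
  have E: "(\<lambda>_::unit. edge_pow m (real e) (Suc j) $ k) \<in> {f. f () \<ge> 0}" for j k
    by (rule edge_pow_nth_closed) (use assms in auto)
  then show "edge_pow m (real e) (Suc j) $ k \<ge> 0" by simp
  have "(\<lambda>_::unit. sum_pow (edge_pow m (real e)) (real e') q $ k) \<in> {f. f () \<ge> 0}"
    by (rule sum_pow_nth_closed) (use E in auto)
  then show "sum_pow (edge_pow m (real e)) (real e') q $ k \<ge> 0" by simp
qed

text \<open>A closed walk of \<open>2 * k\<close> steps meets \<open>m k\<close> only if it runs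
  along a single edge all the time. That edge is at the root, and there are \<open>d\<close> of
  them; all other walks involve lower moments only.\<close>

lemma tree_moment_affine:
  assumes "k \<ge> 1"
  shows "tree_moment m d k = real d * m k + tree_moment (m(k := 0)) d k"
proof -
  define y where "y = edge_pow m (real (d - 1))"
  define y' where "y' = edge_pow (m(k := 0)) (real (d - 1))"
  have res: "res_pow m (real (d - 1)) p $ i = res_pow (m(k := 0)) (real (d - 1)) p $ i" if "i < k" for i p
  proof -
    have "(\<lambda>b. res_pow (if b then m else m(k := 0)) (real (d - 1)) p $ i) \<in> {f. f True = f False}"
      by (rule res_pow_nth_closed) (use that in auto)
    then show ?thesis by simp
  qed
  have yy: "y (Suc j) $ i = y' (Suc j) $ i + (if Suc j = k \<and> i = k then m k else 0)" if "i \<le> k" for i j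
    using that assms res[of "i - Suc j" "Suc j"]
    by (auto simp: y_def y'_def edge_pow_nth res_pow_nth)
  \<comment> \<open>\<open>y\<close> and \<open>y'\<close> differ only in coefficient
    \<open>k\<close> of index \<open>k\<close>. Using that coefficient exhausts the degree, so the
    remaining factors contribute their constant term, which is nonzero only for
    \<open>j = n\<close>.\<close>
  have sp: "sum_pow y e (Suc n) $ k = sum_pow y' e (Suc n) $ k + (if Suc n = k then e * m k else 0)" for e n
  proof -
    have *: "(\<Sum>i\<le>k. y (Suc j) $ i * sum_pow y (e - 1) (n - j) $ (k - i)) =
       (\<Sum>i\<le>k. y' (Suc j) $ i * sum_pow y' (e - 1) (n - j) $ (k - i)) +
        (if Suc j = k \<and> j = n then m k else 0)" if "j \<le> n" for j
    proof -
      have "(\<Sum>i\<le>k. y (Suc j) $ i * sum_pow y (e - 1) (n - j) $ (k - i)) =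
        (\<Sum>i\<le>k. y' (Suc j) $ i * sum_pow y' (e - 1) (n - j) $ (k - i) +
           (if i = k then if Suc j = k \<and> j = n then m k else 0 else 0))"
      proof (rule sum.cong[OF refl])
        fix i assume i: "i \<in> {..k}"
        show "y (Suc j) $ i * sum_pow y (e - 1) (n - j) $ (k - i) =
          y' (Suc j) $ i * sum_pow y' (e - 1) (n - j) $ (k - i) +
           (if i = k then if Suc j = k \<and> j = n then m k else 0 else 0)"
        proof (cases "i = 0")
          case True
          then show ?thesis using assms by (simp add: y_def y'_def edge_pow_nth)
        next
          case False
          have "sum_pow y (e - 1) (n - j) $ (k - i) = sum_pow y' (e - 1) (n - j) $ (k - i)"
            by (rule sum_pow_nth_cong) (use False i assms in \<open>auto simp: yy\<close>)
          moreover have "sum_pow y' (e - 1) (n - j) $ 0 = (if j = n then 1 else 0)"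
            using that sum_pow_nth_eq_0[of y' 0 "n - j"] by (auto simp: y'_def edge_pow_nth)
          ultimately show ?thesis using i by (auto simp: yy algebra_simps)
        qed
      qed
      also have "\<dots> = (\<Sum>i\<le>k. y' (Suc j) $ i * sum_pow y' (e - 1) (n - j) $ (k - i)) +
        (if Suc j = k \<and> j = n then m k else 0)"
        by (subst sum.distrib) (simp add: sum.delta)
      finally show ?thesis .
    qed
    have "sum_pow y e (Suc n) $ k = e * (\<Sum>j\<le>n. real (n choose j) *
        (\<Sum>i\<le>k. y' (Suc j) $ i * sum_pow y' (e - 1) (n - j) $ (k - i)) +
         (if j = n then if Suc n = k then m k else 0 else 0))"
      unfolding sum_pow_Suc_nth
      by (intro arg_cong2[of _ _ _ _ "(*)"] sum.cong refl) (auto simp: * algebra_simps)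
    also have "\<dots> = sum_pow y' e (Suc n) $ k + (if Suc n = k then e * m k else 0)"
      by (subst sum.distrib) (auto simp: sum.delta sum_pow_Suc_nth algebra_simps)
    finally show ?thesis .
  qed
  have "sum_pow y (real d) q $ k = sum_pow y' (real d) q $ k + (if q = k then real d * m k else 0)" for q
    using sp assms by (cases q) auto
  then have "tree_moment m d k = (\<Sum>q\<le>k. sum_pow y' (real d) q $ k + (if q = k then real d * m k else 0))"
    by (simp add: tree_moment_def y_def)
  also have "\<dots> = real d * m k + tree_moment (m(k := 0)) d k"
    by (subst sum.distrib) (simp add: tree_moment_def y'_def)
  finally show ?thesis .
qed

text \<open>Multiplying the weights by \<open>sqrt c\<close> amounts to substituting
  \<open>c * z\<close> for \<open>z\<close>; this is followed through the recursion up to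
  \<open>tree_moment_scale\<close>.\<close>

lemma sum_pow_nth_scale:
  assumes "\<And>i j. i \<le> k \<Longrightarrow> y' (Suc j) $ i = c ^ i * y (Suc j) $ i"
  shows "sum_pow y' e n $ k = c ^ k * sum_pow y e n $ k"
  using assms
proof (induction n arbitrary: e k rule: less_induct)
  case (less n)
  show ?case
  proof (cases n)
    case 0
    then show ?thesis by (cases k) auto
  next
    case (Suc n')
    have "y' (Suc j) $ i * sum_pow y' (e - 1) (n' - j) $ (k - i) =
      c ^ k * (y (Suc j) $ i * sum_pow y (e - 1) (n' - j) $ (k - i))" if "i \<le> k" for i j
    proof -
      have "sum_pow y' (e - 1) (n' - j) $ (k - i) = c ^ (k - i) * sum_pow y (e - 1) (n' - j) $ (k - i)"
        by (rule less.IH) (use less.prems Suc in auto)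
      moreover have "c ^ k = c ^ i * c ^ (k - i)"
        using that by (simp flip: power_add)
      ultimately show ?thesis
        using that less.prems[of i j] by (simp add: mult_ac)
    qed
    then show ?thesis
      by (simp add: Suc sum_pow_Suc_nth sum_distrib_left mult_ac)
  qed
qed

lemma power_split_mult: "j \<le> i \<Longrightarrow> c ^ j * x * (c ^ (i - j) * y) = c ^ i * (x * y :: real)"
  using power_add[of c j "i - j"] by simp

lemma res_pow_nth_scale: "res_pow (\<lambda>j. c ^ j * m j) e p $ k = c ^ k * res_pow m e p $ k"
proof (induction k arbitrary: p rule: less_induct)
  case (less k)
  have "sum_pow (edge_pow (\<lambda>j. c ^ j * m j) e) e q $ k = c ^ k * sum_pow (edge_pow m e) e q $ k" for q
    by (rule sum_pow_nth_scale)
       (use less in \<open>auto simp: edge_pow_nth power_split_mult simp del: power_Suc\<close>)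
  then show ?case by (simp add: res_pow_nth sum_distrib_left mult_ac)
qed

lemma tree_moment_scale: "tree_moment (\<lambda>j. c ^ j * m j) d k = c ^ k * tree_moment m d k"
proof -
  have "sum_pow (edge_pow (\<lambda>j. c ^ j * m j) e) e' q $ k = c ^ k * sum_pow (edge_pow m e) e' q $ k" for q e e'
    by (rule sum_pow_nth_scale)
       (auto simp: edge_pow_nth res_pow_nth_scale power_split_mult simp del: power_Suc)
  then show ?thesis by (simp add: tree_moment_def sum_distrib_left)
qed

section \<open>Factorial growth of the tree moments\<close>

definition partial_eval :: "nat \<Rightarrow> real \<Rightarrow> real fps \<Rightarrow> real" where
  "partial_eval n z f = (\<Sum>k\<le>n. f $ k * z ^ k)"

lemma partial_eval_mono:
  assumes "z \<ge> 0" "\<And>k. k \<le> n \<Longrightarrow> f $ k \<le> g $ k"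
  shows "partial_eval n z f \<le> partial_eval n z g"
  unfolding partial_eval_def using assms by (intro sum_mono mult_right_mono) auto

lemma partial_eval_one: "partial_eval n z 1 = 1"
  by (induction n) (auto simp: partial_eval_def)

lemma partial_eval_add: "partial_eval n z (f + g) = partial_eval n z f + partial_eval n z g"
  by (simp add: partial_eval_def distrib_right sum.distrib)

lemma partial_eval_const_mult: "partial_eval n z (fps_const c * f) = c * partial_eval n z f"
  by (simp add: partial_eval_def sum_distrib_left mult.assoc)

text \<open>Truncated values need no radius of convergence; for nonnegative coefficients the
  triangle of index pairs of a product lies in a rectangle. The condition \<open>nm\<close> lets the
  rectangle be narrower when low coefficients of \<open>f\<close> vanish, and the degree gained in
  this way drives the later induction.\<close>

lemma partial_eval_mult_le_general:
  assumes z: "z \<ge> 0" and f: "\<And>k. f $ k \<ge> 0" and g: "\<And>k. g $ k \<ge> 0"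
    and nm: "\<And>i j. i + j \<le> n \<Longrightarrow> f $ i \<noteq> 0 \<Longrightarrow> j \<le> m"
  shows "partial_eval n z (f * g) \<le> partial_eval n z f * partial_eval m z g"
proof -
  let ?h = "\<lambda>(i, j). (f $ i * z ^ i) * (g $ j * z ^ j)"
  have "partial_eval n z (f * g) = (\<Sum>k\<le>n. \<Sum>i\<le>k. ?h (i, k - i))"
    unfolding partial_eval_def fps_mult_nth sum_distrib_right atLeast0AtMost
    by (intro sum.cong refl) (auto simp: power_add[symmetric] mult_ac)
  also have "\<dots> = sum ?h {(i, j). i + j \<le> n}"
    by (subst sum.triangle_reindex_eq) auto
  also have "\<dots> = sum ?h {(i, j). i + j \<le> n \<and> f $ i \<noteq> 0}"
    by (intro sum.mono_neutral_right) (auto intro: finite_subset[of _ "{..n} \<times> {..n}"])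
  also have "\<dots> \<le> sum ?h ({..n} \<times> {..m})"
    by (intro sum_mono2) (auto simp: f g z dest: nm)
  also have "\<dots> = partial_eval n z f * partial_eval m z g"
    by (simp add: partial_eval_def sum_product sum.cartesian_product)
  finally show ?thesis .
qed

lemma partial_eval_mult_le:
  assumes "z \<ge> 0" "\<And>k. f $ k \<ge> 0" "\<And>k. g $ k \<ge> 0"
  shows "partial_eval n z (f * g) \<le> partial_eval n z f * partial_eval n z g"
  by (rule partial_eval_mult_le_general) (use assms in auto)

lemma partial_eval_mult_le_Suc:
  assumes "z \<ge> 0" "\<And>k. f $ k \<ge> 0" "\<And>k. g $ k \<ge> 0" "f $ 0 = 0"
  shows "partial_eval (Suc n) z (f * g) \<le> partial_eval (Suc n) z f * partial_eval n z g"
proof (rule partial_eval_mult_le_general)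
  fix i j assume "i + j \<le> Suc n" "f $ i \<noteq> 0"
  then show "j \<le> n" using assms(4) by (cases i) auto
qed (use assms in auto)

lemma fps_mult_nth_mono:
  fixes f g f' g' :: "real fps"
  assumes "\<And>i. i \<le> k \<Longrightarrow> f $ i \<le> f' $ i" "\<And>i. i \<le> k \<Longrightarrow> g $ i \<le> g' $ i"
    and "\<And>i. f' $ i \<ge> 0" "\<And>i. g $ i \<ge> 0"
  shows "(f * g) $ k \<le> (f' * g') $ k"
  unfolding fps_mult_nth using assms by (intro sum_mono mult_mono) auto

text \<open>The arguments are raised one at a time, \<open>q\<close> to \<open>2 * k\<close> and,
  after reflecting the binomial coefficient, \<open>j\<close> to \<open>2 * i\<close>; the resulting
  central-type coefficient is exactly the ratio of factorials.\<close>

lemma binomial_mult_fact_le: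
  assumes "j \<le> 2 * i" "q \<le> 2 * k"
  shows "real ((j + q) choose j) * fact (2 * i) * fact (2 * k) \<le> fact (2 * (i + k))"
proof -
  have "(j + q) choose j \<le> (2 * i + 2 * k) choose (2 * i)"
  proof -
    have "(j + q) choose j \<le> (j + 2 * k) choose j"
      using assms by (intro binomial_right_mono) auto
    also have "\<dots> = (j + 2 * k) choose (2 * k)"
      by (subst binomial_symmetric) auto
    also have "\<dots> \<le> (2 * i + 2 * k) choose (2 * k)"
      using assms by (intro binomial_right_mono) auto
    also have "\<dots> = (2 * i + 2 * k) choose (2 * i)"
      by (subst binomial_symmetric) auto
    finally show ?thesis .
  qed
  then have "real ((j + q) choose j) \<le> real ((2 * i + 2 * k) choose (2 * i))"
    by (rule of_nat_mono)
  then have "real ((j + q) choose j) * (fact (2 * i) * fact (2 * k))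
      \<le> real ((2 * i + 2 * k) choose (2 * i)) * (fact (2 * i) * fact (2 * k))"
    by (intro mult_right_mono) auto
  also have "\<dots> = fact (2 * (i + k))"
  proof -
    have "fact (2 * i) * fact (2 * k) * ((2 * i + 2 * k) choose (2 * i)) = (fact (2 * i + 2 * k) :: nat)"
      using binomial_fact_lemma[of "2 * i" "2 * i + 2 * k"] by simp
    from arg_cong[OF this, of real] show ?thesis
      by (simp add: distrib_left mult.commute del: fact_Suc)
  qed
  finally show ?thesis by (simp add: mult.assoc)
qed

context
  fixes m :: "nat \<Rightarrow> real" and d :: nat
  assumes m_nonneg: "\<And>j. 1 \<le> j \<Longrightarrow> m j \<ge> 0"
begin

text \<open>
  Dividing the coefficient of \<open>z ^ k\<close> by \<open>(2k)!\<close> absorbs the binomial coefficients of the recursion, which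
  turns it into coefficientwise inequalities between products of power series.
\<close>

definition norm_sum :: "nat \<Rightarrow> real fps" where
  "norm_sum e = Abs_fps (\<lambda>k. (\<Sum>q\<le>k. sum_pow (edge_pow m (real (d - 1))) (real e) q $ k) / fact (2 * k))"

definition norm_edge :: "real fps" where
  "norm_edge = Abs_fps (\<lambda>i. (\<Sum>j<i. edge_pow m (real (d - 1)) (Suc j) $ i) / fact (2 * i))"

definition norm_moment :: "real fps" where
  "norm_moment = Abs_fps (\<lambda>j. if j = 0 then 0 else m j / fact (2 * j))"

lemma norm_nonneg: "norm_sum e $ k \<ge> 0" "norm_edge $ k \<ge> 0" "norm_moment $ k \<ge> 0"
  using m_nonneg
  by (auto simp: norm_sum_def norm_edge_def norm_moment_def
       intro!: divide_nonneg_nonneg sum_nonneg sum_pow_edge_pow_nth_nonneg edge_pow_nth_nonneg)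

lemma norm_sum_0: "norm_sum 0 = 1"
proof (rule fps_ext)
  fix k
  have "sum_pow (edge_pow m (real (d - 1))) 0 q $ k = (if q = 0 \<and> k = 0 then 1 else 0)" for q
    by (cases q) (auto simp: sum_pow_Suc_nth)
  then show "norm_sum 0 $ k = 1 $ k" by (simp add: norm_sum_def)
qed

text \<open>Reindexing \<open>q\<close> into the further factors \<open>j\<close> falling on the
  chosen child and those falling elsewhere decouples the two, except for the binomial coefficient.
  Nonzero terms satisfy \<open>Suc j \<le> i\<close> and at most \<open>k - i\<close> other factors,
  and there that coefficient is at most the ratio of factorials introduced by the
  normalisation.\<close>

lemma norm_sum_Suc_le:
  "norm_sum (Suc e) $ k \<le> (1 + fps_const (real (Suc e)) * norm_edge * norm_sum e) $ k"
proof -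
  let ?y = "edge_pow m (real (d - 1))" and ?s = "sum_pow (edge_pow m (real (d - 1))) (real e)"
  have y0: "?y j $ i = 0" if "i < j" for i j using that by (simp add: edge_pow_nth)
  have ynn: "?y (Suc j) $ i \<ge> 0" for j i using edge_pow_nth_nonneg m_nonneg by simp
  have snn: "?s q $ i \<ge> 0" for q i using sum_pow_edge_pow_nth_nonneg m_nonneg by simp
  have term_le: "real ((j + q) choose j) * (?y (Suc j) $ i * ?s q $ (k - i))
      \<le> fact (2 * k) * ((?y (Suc j) $ i / fact (2 * i)) * (?s q $ (k - i) / fact (2 * (k - i))))"
    if "i \<le> k" for i j q
  proof (cases "Suc j \<le> i \<and> q \<le> k - i")
    case True
    have "real ((j + q) choose j) * fact (2 * i) * fact (2 * (k - i)) \<le> fact (2 * (i + (k - i)))"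
      by (rule binomial_mult_fact_le) (use True in auto)
    then have "real ((j + q) choose j) \<le> fact (2 * k) / (fact (2 * i) * fact (2 * (k - i)))"
      using that by (simp add: field_simps)
    then have "real ((j + q) choose j) * (?y (Suc j) $ i * ?s q $ (k - i)) \<le>
        fact (2 * k) / (fact (2 * i) * fact (2 * (k - i))) * (?y (Suc j) $ i * ?s q $ (k - i))"
      by (intro mult_right_mono mult_nonneg_nonneg ynn snn)
    then show ?thesis by simp
  next
    case False
    then have "?y (Suc j) $ i = 0 \<or> ?s q $ (k - i) = 0"
      using y0 sum_pow_nth_eq_0[of ?y, OF y0] by (auto simp: not_le less_Suc_eq_le)
    then show ?thesis by auto
  qed
  have "(\<Sum>q\<le>k. sum_pow ?y (real (Suc e)) q $ k)
      = (if k = 0 then 1 else 0) + (\<Sum>q<k. sum_pow ?y (real (Suc e)) (Suc q) $ k)"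
    by (subst lessThan_Suc_atMost[symmetric], subst sum.lessThan_Suc_shift) auto
  also have "(\<Sum>q<k. sum_pow ?y (real (Suc e)) (Suc q) $ k)
      = real (Suc e) * (\<Sum>q<k. \<Sum>j\<le>q. \<Sum>i\<le>k. real (q choose j) * (?y (Suc j) $ i * ?s (q - j) $ (k - i)))"
    by (simp add: sum_pow_Suc_nth sum_distrib_left)
  finally have total: "(\<Sum>q\<le>k. sum_pow ?y (real (Suc e)) q $ k) = (if k = 0 then 1 else 0) +
      real (Suc e) * (\<Sum>q<k. \<Sum>j\<le>q. \<Sum>i\<le>k. real (q choose j) * (?y (Suc j) $ i * ?s (q - j) $ (k - i)))" .
  have "(\<Sum>q<k. \<Sum>j\<le>q. \<Sum>i\<le>k. real (q choose j) * (?y (Suc j) $ i * ?s (q - j) $ (k - i)))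
      = (\<Sum>i\<le>k. \<Sum>q<k. \<Sum>j\<le>q. real (q choose j) * (?y (Suc j) $ i * ?s (q - j) $ (k - i)))"
    by (subst (2) sum.swap, subst sum.swap) (rule refl)
  also have "\<dots> = (\<Sum>i\<le>k. \<Sum>(j, q)\<in>{(j, q). j + q < k}. real ((j + q) choose j) * (?y (Suc j) $ i * ?s q $ (k - i)))"
    by (subst sum.triangle_reindex) (auto intro!: sum.cong)
  also have "\<dots> \<le> (\<Sum>i\<le>k. \<Sum>(j, q)\<in>{(j, q). j + q < k}.
       fact (2 * k) * ((?y (Suc j) $ i / fact (2 * i)) * (?s q $ (k - i) / fact (2 * (k - i)))))"
  proof (intro sum_mono)
    fix i and x :: "nat \<times> nat" assume i: "i \<in> {..k}"
    obtain j q where x: "x = (j, q)" by (cases x)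
    show "(case x of (j, q) \<Rightarrow> real ((j + q) choose j) * (?y (Suc j) $ i * ?s q $ (k - i)))
      \<le> (case x of (j, q) \<Rightarrow>
       fact (2 * k) * ((?y (Suc j) $ i / fact (2 * i)) * (?s q $ (k - i) / fact (2 * (k - i)))))"
      unfolding x prod.case by (rule term_le) (use i in simp)
  qed
  \<comment> \<open>The triangle \<open>j + q < k\<close> may be replaced by a rectangle depending
    on \<open>i\<close>: terms outside the rectangle vanish by order, and the added ones are
    nonnegative.\<close>
  also have "\<dots> \<le> (\<Sum>i\<le>k. \<Sum>(j, q)\<in>{..<i} \<times> {..k - i}.
       fact (2 * k) * ((?y (Suc j) $ i / fact (2 * i)) * (?s q $ (k - i) / fact (2 * (k - i)))))"
  proof (intro sum_mono)
    fix i assume i: "i \<in> {..k}"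
    let ?f = "\<lambda>(j, q). fact (2 * k) * ((?y (Suc j) $ i / fact (2 * i)) * (?s q $ (k - i) / fact (2 * (k - i))))"
    have fin: "finite {(j, q). j + q < k}"
      by (rule finite_subset[of _ "{..k} \<times> {..k}"]) auto
    have "sum ?f {(j, q). j + q < k} = sum ?f ({(j, q). j + q < k} \<inter> {..<i} \<times> {..k - i})"
    proof (intro sum.mono_neutral_right ballI)
      fix x assume x: "x \<in> {(j, q). j + q < k} - {(j, q). j + q < k} \<inter> {..<i} \<times> {..k - i}"
      obtain j q where jq: "x = (j, q)" by (cases x)
      have "?y (Suc j) $ i = 0 \<or> ?s q $ (k - i) = 0"
        using x jq y0 sum_pow_nth_eq_0[of ?y, OF y0] by (auto simp: not_le not_less less_Suc_eq_le)
      then show "?f x = 0" using jq by auto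
    qed (use fin in auto)
    also have "\<dots> \<le> sum ?f ({..<i} \<times> {..k - i})"
      using i by (intro sum_mono2) (auto intro!: mult_nonneg_nonneg divide_nonneg_nonneg ynn snn)
    finally show "sum ?f {(j, q). j + q < k} \<le> sum ?f ({..<i} \<times> {..k - i})" .
  qed
  also have "\<dots> = fact (2 * k) * (\<Sum>i\<le>k. norm_edge $ i * norm_sum e $ (k - i))"
    unfolding norm_edge_def norm_sum_def fps_nth_Abs_fps sum_divide_distrib sum.cartesian_product[symmetric]
    unfolding sum_product by (simp only: sum_distrib_left)
  finally have "(\<Sum>q\<le>k. sum_pow ?y (real (Suc e)) q $ k)
     \<le> (if k = 0 then 1 else 0) + real (Suc e) * (fact (2 * k) * (\<Sum>i\<le>k. norm_edge $ i * norm_sum e $ (k - i)))"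
    unfolding total by (intro add_left_mono mult_left_mono) auto
  then have "norm_sum (Suc e) $ k \<le>
    ((if k = 0 then 1 else 0) + real (Suc e) * (fact (2 * k) * (\<Sum>i\<le>k. norm_edge $ i * norm_sum e $ (k - i)))) / fact (2 * k)"
    unfolding norm_sum_def fps_nth_Abs_fps by (intro divide_right_mono) auto
  also have "\<dots> = (1 + fps_const (real (Suc e)) * norm_edge * norm_sum e) $ k"
    unfolding mult.assoc fps_add_nth fps_mult_left_const_nth
    by (simp add: fps_mult_nth atLeast0AtMost add_divide_distrib del: of_nat_Suc)
  finally show ?thesis .
qed

text \<open>The negative binomial coefficient of \<open>res_pow\<close> is absorbed by the same
  factorial estimate; the share \<open>fact (2 * Suc j)\<close> is left to normalise the moment of
  the edge weight.\<close>

lemma norm_edge_le: "norm_edge $ i \<le> (norm_moment * norm_sum (d - 1)) $ i"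
proof -
  have res: "res_pow m (real (d - 1)) (Suc j) $ l
      \<le> fact (2 * (Suc j + l)) / fact (2 * Suc j) * norm_sum (d - 1) $ l" for j l
  proof -
    have "res_pow m (real (d - 1)) (Suc j) $ l \<le>
      (\<Sum>q\<le>l. fact (2 * (Suc j + l)) / (fact (2 * Suc j) * fact (2 * l)) *
         sum_pow (edge_pow m (real (d - 1))) (real (d - 1)) q $ l)"
      unfolding res_pow_nth
    proof (intro sum_mono mult_right_mono sum_pow_edge_pow_nth_nonneg m_nonneg)
      fix q assume "q \<in> {..l}"
      then have "real ((j + q) choose j) * fact (2 * Suc j) * fact (2 * l) \<le> fact (2 * (Suc j + l))"
        by (intro binomial_mult_fact_le) auto
      moreover have "q + Suc j - 1 choose q = (j + q) choose j"
        using binomial_symmetric[of q "q + j"] by (simp add: add.commute)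
      ultimately show "real (q + Suc j - 1 choose q) \<le> fact (2 * (Suc j + l)) / (fact (2 * Suc j) * fact (2 * l))"
        by (simp only: pos_le_divide_eq mult_pos_pos fact_gt_zero mult.assoc)
    qed auto
    then show ?thesis by (simp add: norm_sum_def sum_distrib_left sum_divide_distrib)
  qed
  have "norm_edge $ i \<le> (\<Sum>j<i. m (Suc j) / fact (2 * Suc j) * norm_sum (d - 1) $ (i - Suc j))"
    unfolding norm_edge_def fps_nth_Abs_fps sum_divide_distrib
  proof (intro sum_mono)
    fix j assume j: "j \<in> {..<i}"
    have "edge_pow m (real (d - 1)) (Suc j) $ i / fact (2 * i) =
       m (Suc j) * res_pow m (real (d - 1)) (Suc j) $ (i - Suc j) / fact (2 * i)"
      using j by (simp add: edge_pow_nth)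
    also have "\<dots> \<le> m (Suc j) * (fact (2 * (Suc j + (i - Suc j))) / fact (2 * Suc j) * norm_sum (d - 1) $ (i - Suc j)) / fact (2 * i)"
      by (intro divide_right_mono mult_left_mono res m_nonneg) auto
    also have "\<dots> = m (Suc j) / fact (2 * Suc j) * norm_sum (d - 1) $ (i - Suc j)"
    proof -
      have "Suc j + (i - Suc j) = i" using j by simp
      then show ?thesis by (simp only:) (simp add: field_simps del: fact_Suc mult_Suc_right)
    qed
    finally show "edge_pow m (real (d - 1)) (Suc j) $ i / fact (2 * i) \<le>
      m (Suc j) / fact (2 * Suc j) * norm_sum (d - 1) $ (i - Suc j)" .
  qed
  also have "\<dots> = (\<Sum>j<i. norm_moment $ Suc j * norm_sum (d - 1) $ (i - Suc j))"
    by (simp add: norm_moment_def)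
  also have "\<dots> = (norm_moment * norm_sum (d - 1)) $ i"
    unfolding fps_mult_nth atLeast0AtMost lessThan_Suc_atMost[symmetric] sum.lessThan_Suc_shift
    by (simp add: norm_moment_def)
  finally show ?thesis .
qed

lemma tree_moment_eq_norm_sum: "tree_moment m d k = fact (2 * k) * norm_sum d $ k"
  by (simp add: tree_moment_def norm_sum_def)

text \<open>A bootstrap in the degree. \<open>norm_moment\<close> has no constant term, so the edge
  series up to degree \<open>Suc n\<close> needs \<open>norm_sum\<close> only up to degree
  \<open>n\<close>, where it is at most 2 by \<open>4 * real d * u \<le> 1\<close>. The resulting
  bound \<open>2 * u\<close> lets each further child add at most \<open>4 * u\<close>, which
  restores the claim.\<close>

lemma partial_eval_norm_sum_le:
  assumes g: "\<And>n. partial_eval n z norm_moment \<le> u" and z: "z \<ge> 0" and u: "u \<ge> 0" "4 * real d * u \<le> 1"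
    and e: "e \<le> d"
  shows "partial_eval n z norm_edge \<le> 2 * u \<and> partial_eval n z (norm_sum e) \<le> 1 + 4 * real e * u"
  using e
proof (induction n arbitrary: e)
  case 0
  have "norm_sum e $ 0 = 1" by (simp add: norm_sum_def)
  then show ?case using u by (simp add: partial_eval_def norm_edge_def)
next
  case (Suc n)
  have 2: "1 + 4 * real e * u \<le> 2" if "e \<le> d" for e
  proof -
    have "4 * real e * u \<le> 4 * real d * u" using that u by (intro mult_right_mono) auto
    then show ?thesis using u by simp
  qed
  have "partial_eval (Suc n) z norm_edge \<le> partial_eval (Suc n) z (norm_moment * norm_sum (d - 1))"
    by (intro partial_eval_mono z norm_edge_le)
  also have "\<dots> \<le> partial_eval (Suc n) z norm_moment * partial_eval n z (norm_sum (d - 1))"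
    by (intro partial_eval_mult_le_Suc z norm_nonneg) (simp add: norm_moment_def)
  also have "\<dots> \<le> u * 2"
  proof (intro mult_mono g u)
    show "partial_eval n z (norm_sum (d - 1)) \<le> 2"
      using Suc.IH[of "d - 1"] 2[of "d - 1"] by simp
  qed (auto simp: partial_eval_def intro!: sum_nonneg mult_nonneg_nonneg norm_nonneg zero_le_power z)
  finally have edge: "partial_eval (Suc n) z norm_edge \<le> 2 * u" by simp
  have "partial_eval (Suc n) z (norm_sum e) \<le> 1 + 4 * real e * u"
    using Suc.prems
  proof (induction e)
    case 0
    show ?case by (simp add: norm_sum_0 partial_eval_one)
  next
    case (Suc e)
    have "partial_eval (Suc n) z (norm_sum (Suc e)) \<le>
      partial_eval (Suc n) z (1 + fps_const (real (Suc e)) * norm_edge * norm_sum e)"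
      by (intro partial_eval_mono z norm_sum_Suc_le)
    also have "\<dots> = 1 + real (Suc e) * partial_eval (Suc n) z (norm_edge * norm_sum e)"
      by (simp only: partial_eval_add partial_eval_const_mult partial_eval_one mult.assoc)
    also have "\<dots> \<le> 1 + real (Suc e) * (2 * u * 2)"
    proof (intro add_left_mono mult_left_mono)
      have "partial_eval (Suc n) z (norm_edge * norm_sum e) \<le>
         partial_eval (Suc n) z norm_edge * partial_eval (Suc n) z (norm_sum e)"
        by (intro partial_eval_mult_le z norm_nonneg)
      also have "\<dots> \<le> (2 * u) * 2"
        using Suc 2[of e] edge u
        by (intro mult_mono) (auto simp: partial_eval_def intro!: sum_nonneg mult_nonneg_nonneg norm_nonneg
          zero_le_power z simp del: sum.atMost_Suc)
      finally show "partial_eval (Suc n) z (norm_edge * norm_sum e) \<le> 2 * u * 2" .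
    qed auto
    finally show ?case by (simp add: algebra_simps)
  qed
  with edge show ?case by simp
qed

text \<open>The induction step for the bound \<open>K ^ (j - 1) * fact (2 * j)\<close> on
  eigenmoments: setting \<open>m k\<close> to zero leaves \<open>d ^ k - d\<close> times the next
  moment, so exactly this factor must appear on the right.\<close>

lemma tree_moment_le:
  fixes K :: real
  assumes K: "K = 12 * (real d)\<^sup>2" and d: "d \<ge> 2" and k: "k \<ge> 2"
    and m: "\<And>j. 1 \<le> j \<Longrightarrow> j < k \<Longrightarrow> m j \<le> K ^ (j - 1) * fact (2 * j)" "\<And>j. k \<le> j \<Longrightarrow> m j = 0"
  shows "tree_moment m d k \<le> (real d ^ k - real d) * (K ^ (k - 1) * fact (2 * k))"
proof -
  \<comment> \<open>Half of \<open>1 / K\<close>, the radius suggested by the bound on the moments,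
    so that their normalised series sums to at most \<open>1 / K\<close> at
    \<open>z\<close>.\<close>
  define z where "z = 1 / (2 * K)"
  have K0: "K > 0" using K d by simp
  have z0: "z > 0" using K0 by (simp add: z_def)
  have mom: "norm_moment $ j \<le> (if j = 0 then 0 else K ^ (j - 1))" for j
    using m[of j] K0 by (cases "j < k") (auto simp: norm_moment_def divide_le_eq)
  have g: "partial_eval n z norm_moment \<le> 1 / K" for n
  proof -
    have "partial_eval n z norm_moment \<le> (\<Sum>j\<le>n. (if j = 0 then 0 else K ^ (j - 1)) * z ^ j)"
      unfolding partial_eval_def using mom z0 by (intro sum_mono mult_right_mono) auto
    also have "\<dots> = (\<Sum>j<n. (1 / 2) ^ Suc j / K)"
      unfolding lessThan_Suc_atMost[symmetric] sum.lessThan_Suc_shift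
      using K0 by (auto simp: z_def power_divide power_mult_distrib field_simps intro!: sum.cong)
    also have "\<dots> = (1 - (1 / 2) ^ n) / K"
      by (induction n) (use K0 in \<open>auto simp: field_simps\<close>)
    also have "\<dots> \<le> 1 / K" using K0 by (intro divide_right_mono) auto
    finally show ?thesis .
  qed
  have dK: "12 * real d * (1 / K) = 1 / real d" using d by (simp add: K power2_eq_square)
  have uK: "4 * real d * (1 / K) \<le> 1"
  proof -
    have "4 * real d * (1 / K) \<le> 12 * real d * (1 / K)" using K0 by (intro mult_right_mono) auto
    also have "\<dots> \<le> 1" unfolding dK using d by simp
    finally show ?thesis .
  qed
  note bnd = partial_eval_norm_sum_le[OF g less_imp_le[OF z0] _ uK]
  \<comment> \<open>One factor is the generating function at the chosen child, the other the one of
    the remaining children of the root.\<close>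
  define F where "F = norm_sum (d - 1) * norm_sum (d - 1)"
  have Fnn: "F $ l \<ge> 0" for l unfolding F_def fps_mult_nth by (intro sum_nonneg mult_nonneg_nonneg norm_nonneg)
  have F0: "F $ 0 = 1" by (simp add: F_def norm_sum_def)
  have PF: "partial_eval n z F \<le> 1 + 1 / real d" for n
  proof -
    \<comment> \<open>Here the 12 in \<open>K\<close> is spent: 4 on the bootstrap bound and 3 on
      \<open>(1 + t)^2 \<le> 1 + 3 * t\<close>. The two factors \<open>d\<close> in \<open>K\<close>
      pay for the \<open>d\<close> in the bound and for the gain \<open>1 / d\<close> in the excess
      of \<open>F\<close> over 1.\<close>
    define t where "t = 4 * real (d - 1) * (1 / K)"
    have t: "0 \<le> t" "t \<le> 1 / (3 * real d)"
    proof -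
      have "t \<le> 4 * real d * (1 / K)" unfolding t_def using K0 by (intro mult_right_mono) auto
      also have "\<dots> = 1 / (3 * real d)" using d by (simp add: K power2_eq_square)
      finally show "t \<le> 1 / (3 * real d)" .
    qed (use K0 in \<open>auto simp: t_def\<close>)
    have "1 / (3 * real d) \<le> 1" using d by simp
    with t have "t \<le> 1" by linarith
    have "partial_eval n z F \<le> partial_eval n z (norm_sum (d - 1)) * partial_eval n z (norm_sum (d - 1))"
      unfolding F_def using z0 by (intro partial_eval_mult_le norm_nonneg) auto
    also have "\<dots> \<le> (1 + t) * (1 + t)"
      using bnd[of "d - 1" n] K0 t
      by (intro mult_mono) (auto simp: t_def partial_eval_def intro!: sum_nonneg mult_nonneg_nonneg norm_nonneg zero_le_power less_imp_le[OF z0])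
    also have "\<dots> = 1 + t * (2 + t)" by (simp add: algebra_simps)
    also have "\<dots> \<le> 1 + t * 3" using t \<open>t \<le> 1\<close> by (intro add_left_mono mult_left_mono) auto
    also have "\<dots> \<le> 1 + 1 / real d" using t by simp
    finally show ?thesis .
  qed
  have Fl: "F $ l \<le> (1 / real d) * (2 * K) ^ l" if "l \<ge> 1" for l
  proof -
    have "1 + F $ l * z ^ l = (\<Sum>k\<in>{0, l}. F $ k * z ^ k)"
      using that F0 by simp
    also have "\<dots> \<le> partial_eval l z F"
      unfolding partial_eval_def using z0 by (intro sum_mono2) (auto intro!: mult_nonneg_nonneg Fnn)
    also have "\<dots> \<le> 1 + 1 / real d" by (rule PF)
    finally have "F $ l * z ^ l \<le> 1 / real d" by simp
    then show ?thesis using K0 by (simp add: z_def power_divide power_mult_distrib field_simps)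
  qed
  obtain d' where d': "d = Suc d'" using d by (cases d) auto
  have "norm_sum d $ k \<le> (1 + fps_const (real d) * norm_edge * norm_sum (d - 1)) $ k"
    using norm_sum_Suc_le[of d'] by (simp add: d')
  also have "\<dots> = real d * (norm_edge * norm_sum (d - 1)) $ k"
    using k by (simp add: mult.assoc)
  also have "\<dots> \<le> real d * (norm_moment * F) $ k"
  proof (intro mult_left_mono)
    show "(norm_edge * norm_sum (d - 1)) $ k \<le> (norm_moment * F) $ k"
      unfolding F_def mult.assoc[symmetric]
      by (intro fps_mult_nth_mono norm_edge_le norm_nonneg)
         (auto simp: fps_mult_nth intro!: sum_nonneg mult_nonneg_nonneg norm_nonneg)
  qed auto
  \<comment> \<open>As \<open>m k = 0\<close>, only coefficients of \<open>F\<close> of positive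
    degree occur. Each is small by a factor \<open>1 / d\<close>, which cancels the \<open>d\<close>
    choices of the first child; the powers of 2 lost in the extraction sum to
    \<open>2 ^ k - 2\<close>.\<close>
  also have "(norm_moment * F) $ k \<le> (\<Sum>i\<in>{1..<k}. K ^ (i - 1) * ((1 / real d) * (2 * K) ^ (k - i)))"
  proof -
    have "norm_moment $ 0 = 0" "norm_moment $ k = 0" using m k by (auto simp: norm_moment_def)
    then have "(norm_moment * F) $ k = (\<Sum>i\<in>{1..<k}. norm_moment $ i * F $ (k - i))"
      unfolding fps_mult_nth using k by (intro sum.mono_neutral_right) (auto simp: not_less_eq_eq order_less_le)
    also have "\<dots> \<le> (\<Sum>i\<in>{1..<k}. K ^ (i - 1) * ((1 / real d) * (2 * K) ^ (k - i)))"
    proof (intro sum_mono mult_mono)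
      fix i assume i: "i \<in> {1..<k}"
      show "norm_moment $ i \<le> K ^ (i - 1)" using mom[of i] i by simp
      show "F $ (k - i) \<le> 1 / real d * (2 * K) ^ (k - i)" by (rule Fl) (use i in auto)
    qed (use K0 Fnn in auto)
    finally show ?thesis .
  qed
  also have "\<dots> = (\<Sum>i\<in>{1..<k}. 2 ^ (k - i)) * (K ^ (k - 1) / real d)"
    unfolding sum_distrib_right
  proof (intro sum.cong refl)
    fix i assume "i \<in> {1..<k}"
    then have "K ^ (k - 1) = K ^ (i - 1) * K ^ (k - i)" by (simp flip: power_add)
    then show "K ^ (i - 1) * (1 / real d * (2 * K) ^ (k - i)) = 2 ^ (k - i) * (K ^ (k - 1) / real d)"
      by (simp add: power_mult_distrib)
  qed
  also have "(\<Sum>i\<in>{1..<k}. 2 ^ (k - i)) = (2::real) ^ k - 2"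
  proof -
    have "(\<Sum>i\<in>{1..<k}. 2 ^ (k - i)) = (\<Sum>i\<in>{1..<k}. (2::real) ^ i)"
      by (rule sum.reindex_bij_witness[of _ "\<lambda>i. k - i" "\<lambda>i. k - i"]) auto
    also have "\<dots> = 2 ^ k - 2"
      using k by (induction k rule: dec_induct) (auto simp: numeral_2_eq_2)
    finally show ?thesis .
  qed
  finally have "norm_sum d $ k \<le> (2 ^ k - 2) * K ^ (k - 1)" using d by simp
  also have "\<dots> \<le> (real d ^ k - real d) * K ^ (k - 1)"
  proof (intro mult_right_mono)
    have "(2::real) ^ (k - 1) - 1 \<le> real d ^ (k - 1) - 1" "(2::real) ^ (k - 1) \<ge> 1"
      using d by (auto intro!: power_mono)
    then have "2 * ((2::real) ^ (k - 1) - 1) \<le> real d * (real d ^ (k - 1) - 1)"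
      using d by (intro mult_mono) auto
    then show "(2::real) ^ k - 2 \<le> real d ^ k - real d"
      using k by (cases k) (auto simp: algebra_simps)
  qed (use K0 in auto)
  finally show ?thesis
    by (simp add: tree_moment_eq_norm_sum mult_ac)
qed

end

section \<open>Expansion in powers of $1/d$\<close>

text \<open>The negative binomial series for \<open>r = 1 / (1 - Y)\<close>, finite in each degree
  since \<open>Y\<close> has no constant term. By Pascal's rule, multiplying the series for
  \<open>p + 1\<close> by \<open>1 - Y\<close> gives the one for \<open>p\<close>. The extra factor
  \<open>Z\<close> prepares the weighted versions that follow.\<close>

lemma geometric_power_nth:
  fixes Y r Z :: "real fps"
  assumes r: "r * (1 - Y) = 1" and Y0: "Y $ 0 = 0" and N: "i \<le> N"
  shows "(\<Sum>q\<le>N. real ((q + p - 1) choose q) * (Y ^ q * Z) $ i) = (r ^ p * Z) $ i"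
proof -
  have zero: "(Y ^ q) $ l = 0" if "l < q" for l q
    using startsby_zero_power_prefix[OF Y0, of q] that by auto
  have pw: "(\<Sum>q\<le>l. real ((q + p - 1) choose q) * (Y ^ q) $ l) = (r ^ p) $ l" for l p
  proof (induction p arbitrary: l)
    case 0
    have "real ((q + 0 - 1) choose q) * (Y ^ q) $ l = (if q = 0 then 1 $ l else 0)" for q
      by (cases q) auto
    then show ?case by (simp only:) (simp add: sum.delta)
  next
    case (Suc p)
    define S where "S p = Abs_fps (\<lambda>l. \<Sum>q\<le>l. real ((q + p - 1) choose q) * (Y ^ q) $ l)" for p
    have S: "S p = r ^ p" by (rule fps_ext) (simp only: S_def fps_nth_Abs_fps Suc.IH)
    have ext: "S p $ l = (\<Sum>q\<le>M. real ((q + p - 1) choose q) * (Y ^ q) $ l)" if "l \<le> M" for l M p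
      unfolding S_def fps_nth_Abs_fps using that zero by (intro sum.mono_neutral_left) auto
    have "(S (Suc p) * (1 - Y)) $ l = S p $ l" for l
    proof -
      have "(Y * S (Suc p)) $ l = (\<Sum>q\<le>l. real ((q + p) choose q) * (Y ^ Suc q) $ l)"
      proof -
        have "(Y * S (Suc p)) $ l = (\<Sum>i=0..l. Y $ i * (\<Sum>q\<le>l. real ((q + p) choose q) * (Y ^ q) $ (l - i)))"
          unfolding fps_mult_nth by (intro sum.cong refl arg_cong2[of _ _ _ _ "(*)"], subst ext[of _ l]) auto
        also have "\<dots> = (\<Sum>q\<le>l. real ((q + p) choose q) * (Y ^ Suc q) $ l)"
          unfolding power_Suc fps_mult_nth sum_distrib_left by (subst sum.swap) (simp add: mult_ac)
        finally show ?thesis .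
      qed
      also have "\<dots> = (\<Sum>q\<le>Suc l. if q = 0 then 0 else real ((q + p - 1) choose (q - 1)) * (Y ^ q) $ l)"
        by (subst sum.atMost_Suc_shift) simp
      finally have 1: "(Y * S (Suc p)) $ l = \<dots>" .
      have "(S (Suc p) * (1 - Y)) $ l = S (Suc p) $ l - (Y * S (Suc p)) $ l"
        by (simp add: algebra_simps)
      also have "\<dots> = (\<Sum>q\<le>Suc l. real ((q + p) choose q) * (Y ^ q) $ l
         - (if q = 0 then 0 else real ((q + p - 1) choose (q - 1)) * (Y ^ q) $ l))"
        unfolding 1 sum_subtractf by (subst ext[of l "Suc l"]) auto
      also have "\<dots> = (\<Sum>q\<le>Suc l. real ((q + p - 1) choose q) * (Y ^ q) $ l)"
      proof (intro sum.cong refl)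
        fix q
        have "q = 0 \<or> real ((q + p) choose q) = real ((q + p - 1) choose (q - 1)) + real ((q + p - 1) choose q)"
          by (cases q) auto
        then show "real ((q + p) choose q) * (Y ^ q) $ l
         - (if q = 0 then 0 else real ((q + p - 1) choose (q - 1)) * (Y ^ q) $ l)
          = real ((q + p - 1) choose q) * (Y ^ q) $ l" by (auto simp: algebra_simps)
      qed
      also have "\<dots> = S p $ l" by (subst ext[of l "Suc l"]) auto
      finally show ?thesis .
    qed
    then have "S (Suc p) * (1 - Y) = r ^ p" by (intro fps_ext) (simp add: S)
    then have "S (Suc p) * ((1 - Y) * r) = r ^ p * r" by (simp add: mult.assoc[symmetric])
    then have "S (Suc p) = r ^ Suc p" using r by (simp add: mult.commute)
    then have "S (Suc p) $ l = (r ^ Suc p) $ l" by (rule arg_cong)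
    then show ?case unfolding S_def fps_nth_Abs_fps .
  qed
  have "(r ^ p * Z) $ i = (\<Sum>l=0..i. (\<Sum>q\<le>N. real ((q + p - 1) choose q) * (Y ^ q) $ l) * Z $ (i - l))"
    unfolding fps_mult_nth pw[symmetric]
    by (intro sum.cong refl arg_cong2[of _ _ _ _ "(*)"] sum.mono_neutral_left) (use N zero in auto)
  also have "\<dots> = (\<Sum>q\<le>N. real ((q + p - 1) choose q) * (Y ^ q * Z) $ i)"
    unfolding fps_mult_nth sum_distrib_left sum_distrib_right by (subst sum.swap) (simp add: mult_ac)
  finally show ?thesis ..
qed

text \<open>The formal counterpart of differentiating the series in \<open>Y\<close>: the factor
  \<open>q\<close> is absorbed into the binomial coefficient, turning \<open>p\<close> into
  \<open>p + 1\<close>. Shifting the index costs one term, hence the strict bound on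
  \<open>i\<close>.\<close>

lemma geometric_power_nth_deriv:
  fixes Y r Z :: "real fps"
  assumes r: "r * (1 - Y) = 1" and Y0: "Y $ 0 = 0" and N: "i < N"
  shows "(\<Sum>q\<le>N. real ((q + p - 1) choose q) * real q * (Y ^ (q - 1) * Z) $ i) = real p * (r ^ (p + 1) * Z) $ i"
proof -
  obtain M where M: "N = Suc M" using N by (cases N) auto
  have b: "real ((Suc q + p - 1) choose Suc q) * real (Suc q) = real p * real ((q + (p + 1) - 1) choose q)" for q
  proof -
    have "Suc q * ((q + p) choose Suc q) = p * ((q + p) choose q)"
      using Suc_times_binomial_add[of q "p - 1"] by (cases p) (auto simp: algebra_simps)
    then have "real (Suc q) * real ((q + p) choose Suc q) = real p * real ((q + p) choose q)"
      by (simp only: of_nat_mult[symmetric])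
    then show ?thesis by (simp add: mult.commute del: of_nat_Suc)
  qed
  have "(\<Sum>q\<le>N. real ((q + p - 1) choose q) * real q * (Y ^ (q - 1) * Z) $ i) =
     (\<Sum>q\<le>M. real p * (real ((q + (p + 1) - 1) choose q) * (Y ^ q * Z) $ i))"
    unfolding M by (subst sum.atMost_Suc_shift) (simp only: b of_nat_0 mult_zero_right mult_zero_left add_0 diff_Suc_1 mult.assoc)
  also have "\<dots> = real p * (r ^ (p + 1) * Z) $ i"
    unfolding sum_distrib_left[symmetric] by (subst geometric_power_nth[OF r Y0]) (use N M in auto)
  finally show ?thesis .
qed

lemma geometric_power_nth_deriv2:
  fixes Y r Z :: "real fps"
  assumes r: "r * (1 - Y) = 1" and Y0: "Y $ 0 = 0" and N: "Suc i < N"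
  shows "(\<Sum>q\<le>N. real ((q + p - 1) choose q) * (real q * (real q - 1)) * (Y ^ (q - 2) * Z) $ i)
    = real p * (real p + 1) * (r ^ (p + 2) * Z) $ i"
proof -
  obtain M where M: "N = Suc (Suc M)" using N by (cases N; cases "N - 1") auto
  have b1: "real ((Suc q + p - 1) choose Suc q) * real (Suc q) = real p * real ((q + (p + 1) - 1) choose q)" for q p
  proof -
    have "Suc q * ((q + p) choose Suc q) = p * ((q + p) choose q)"
      using Suc_times_binomial_add[of q "p - 1"] by (cases p) (auto simp: algebra_simps)
    then have "real (Suc q) * real ((q + p) choose Suc q) = real p * real ((q + p) choose q)"
      by (simp only: of_nat_mult[symmetric])
    then show ?thesis by (simp add: mult.commute del: of_nat_Suc)
  qed
  have b: "real ((Suc (Suc q) + p - 1) choose Suc (Suc q)) * (real (Suc (Suc q)) * (real (Suc (Suc q)) - 1)) =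
    real p * (real p + 1) * real ((q + (p + 2) - 1) choose q)" for q
  proof -
    have "real ((Suc (Suc q) + p - 1) choose Suc (Suc q)) * real (Suc (Suc q)) * real (Suc q) =
      real p * (real ((Suc q + (p + 1) - 1) choose Suc q) * real (Suc q))"
      by (subst b1) simp
    also have "\<dots> = real p * (real (p + 1) * real ((q + (p + 1 + 1) - 1) choose q))"
      by (subst b1) (rule refl)
    finally show ?thesis by (simp add: mult_ac add_ac)
  qed
  have "(\<Sum>q\<le>N. real ((q + p - 1) choose q) * (real q * (real q - 1)) * (Y ^ (q - 2) * Z) $ i) =
     (\<Sum>q\<le>M. real p * (real p + 1) * (real ((q + (p + 2) - 1) choose q) * (Y ^ q * Z) $ i))"
    unfolding M sum.atMost_Suc_shift b by (simp add: mult.assoc)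
  also have "\<dots> = real p * (real p + 1) * (r ^ (p + 2) * Z) $ i"
    unfolding sum_distrib_left[symmetric] by (subst geometric_power_nth[OF r Y0]) (use N M in auto)
  finally show ?thesis .
qed

definition expands :: "(nat \<Rightarrow> real) \<Rightarrow> real \<Rightarrow> real \<Rightarrow> bool" where
  "expands f a b \<longleftrightarrow> (\<lambda>d. f d - a - b / real d) \<in> O(\<lambda>d. 1 / (real d)\<^sup>2)"

lemma inverse_nat_bigo: "(\<lambda>d. 1 / real d) \<in> O(\<lambda>_. 1)" "(\<lambda>d. 1 / (real d)\<^sup>2) \<in> O(\<lambda>_. 1)"
proof -
  have "1 / real d \<le> 1" for d by (cases d) auto
  then show "(\<lambda>d. 1 / real d) \<in> O(\<lambda>_. 1)" by (intro bigoI[of _ 1]) auto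
  have "(1 / real d)\<^sup>2 \<le> 1" for d by (intro power_le_one) (cases d; auto)+
  then have "1 / (real d)\<^sup>2 \<le> 1" for d by (simp add: power_divide)
  then show "(\<lambda>d. 1 / (real d)\<^sup>2) \<in> O(\<lambda>_. 1)" by (intro bigoI[of _ 1]) auto
qed

lemma expands_const: "expands (\<lambda>_. c) c 0"
  by (simp add: expands_def)

lemma expands_cong:
  assumes "eventually (\<lambda>d. f d = f' d) at_top"
  shows "expands f a b = expands f' a b"
  unfolding expands_def by (intro landau_o.big.in_cong) (use assms in eventually_elim, simp)

lemma expands_add:
  assumes "expands f a b" "expands f' a' b'"
  shows "expands (\<lambda>d. f d + f' d) (a + a') (b + b')"
proof -
  have "(\<lambda>d. (f d - a - b / real d) + (f' d - a' - b' / real d)) \<in> O(\<lambda>d. 1 / (real d)\<^sup>2)"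
    using assms unfolding expands_def by (rule sum_in_bigo)
  then show ?thesis unfolding expands_def by (simp add: algebra_simps add_divide_distrib)
qed

lemma expands_sum:
  assumes "\<And>i. i \<in> I \<Longrightarrow> expands (f i) (a i) (b i)"
  shows "expands (\<lambda>d. \<Sum>i\<in>I. f i d) (\<Sum>i\<in>I. a i) (\<Sum>i\<in>I. b i)"
  using assms
  by (induction I rule: infinite_finite_induct) (auto intro: expands_add simp: expands_const)

lemma expands_bounded: "expands f a b \<Longrightarrow> f \<in> O(\<lambda>_. 1)"
proof -
  assume "expands f a b"
  then have "(\<lambda>d. f d - a - b / real d) \<in> O(\<lambda>_. 1)"
    unfolding expands_def by (rule landau_o.big_trans[OF _ inverse_nat_bigo(2)])
  moreover have "(\<lambda>d. a + b * (1 / real d)) \<in> O(\<lambda>_. 1)"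
  proof (intro sum_in_bigo)
    show "(\<lambda>d. b * (1 / real d)) \<in> O(\<lambda>_. 1)"
    proof (intro bigoI[of _ "\<bar>b\<bar>"] always_eventually allI)
      fix d show "norm (b * (1 / real d)) \<le> \<bar>b\<bar> * norm (1::real)"
        by (cases d) (auto simp: abs_mult field_simps)
    qed
  qed auto
  ultimately have "(\<lambda>d. (f d - a - b / real d) + (a + b * (1 / real d))) \<in> O(\<lambda>_. 1)"
    by (rule sum_in_bigo)
  then show ?thesis by simp
qed

lemma expands_mult:
  assumes "expands f a b" "expands f' a' b'"
  shows "expands (\<lambda>d. f d * f' d) (a * a') (a * b' + b * a')"
proof -
  define r where "r d = f d - a - b / real d" for d
  define r' where "r' d = f' d - a' - b' / real d" for d
  have r: "r \<in> O(\<lambda>d. 1 / (real d)\<^sup>2)" "r' \<in> O(\<lambda>d. 1 / (real d)\<^sup>2)"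
    using assms by (auto simp: expands_def r_def[abs_def] r'_def[abs_def])
  have "expands (\<lambda>d. a + b / real d) a b" by (simp add: expands_def)
  note ab = expands_bounded[OF this]
  have "(\<lambda>d. r d * f' d) \<in> O(\<lambda>d. 1 / (real d)\<^sup>2 * 1)"
    by (intro landau_o.big.mult r expands_bounded[OF assms(2)])
  moreover have "(\<lambda>d. (a + b / real d) * r' d) \<in> O(\<lambda>d. 1 * (1 / (real d)\<^sup>2))"
    by (intro landau_o.big.mult r ab)
  moreover have "(\<lambda>d. b * b' * (1 / (real d)\<^sup>2)) \<in> O(\<lambda>d. 1 / (real d)\<^sup>2)"
    by (intro bigoI[of _ "\<bar>b * b'\<bar>"]) (auto simp: abs_mult)
  ultimately have "(\<lambda>d. r d * f' d + (a + b / real d) * r' d + b * b' * (1 / (real d)\<^sup>2)) \<in> O(\<lambda>d. 1 / (real d)\<^sup>2)"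
    by (intro sum_in_bigo) (auto simp del: times_divide_eq_right)
  moreover have "r d * f' d + (a + b / real d) * r' d + b * b' * (1 / (real d)\<^sup>2)
      = f d * f' d - a * a' - (a * b' + b * a') / real d" for d
  proof -
    define x where "x = 1 / real d"
    have x: "u / real d = u * x" "1 / (real d)\<^sup>2 = x * x" for u
      by (auto simp: x_def power2_eq_square)
    show ?thesis unfolding r_def r'_def x by (simp add: algebra_simps)
  qed
  ultimately show ?thesis unfolding expands_def by simp
qed

definition expands_fps :: "nat \<Rightarrow> (nat \<Rightarrow> real fps) \<Rightarrow> real fps \<Rightarrow> real fps \<Rightarrow> bool" where
  "expands_fps k f g h \<longleftrightarrow> (\<forall>i\<le>k. expands (\<lambda>d. f d $ i) (g $ i) (h $ i))"

lemma expands_fps_mult: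
  assumes "expands_fps k f g h" "expands_fps k f' g' h'"
  shows "expands_fps k (\<lambda>d. f d * f' d) (g * g') (g * h' + h * g')"
  unfolding expands_fps_def fps_add_nth fps_mult_nth sum.distrib[symmetric]
  by (intro allI impI expands_sum expands_mult) (use assms in \<open>auto simp: expands_fps_def\<close>)

lemma expands_fps_sum:
  assumes "\<And>i. i \<in> I \<Longrightarrow> expands_fps k (f i) (g i) (h i)"
  shows "expands_fps k (\<lambda>d. \<Sum>i\<in>I. f i d) (\<Sum>i\<in>I. g i) (\<Sum>i\<in>I. h i)"
  using assms unfolding expands_fps_def fps_sum_nth by (auto intro!: expands_sum)

lemma expands_fps_const:
  assumes "expands f a b"
  shows "expands_fps k (\<lambda>d. fps_const (f d)) (fps_const a) (fps_const b)"
  unfolding expands_fps_def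
proof (intro allI impI)
  fix i assume "i \<le> k"
  show "expands (\<lambda>d. fps_const (f d) $ i) (fps_const a $ i) (fps_const b $ i)"
    using assms by (cases i) (auto simp: expands_const)
qed

lemma expands_fps_cong:
  assumes "eventually (\<lambda>d. f d = f' d) at_top"
  shows "expands_fps k f g h = expands_fps k f' g h"
  unfolding expands_fps_def
  by (intro all_cong expands_cong) (use assms in eventually_elim, simp)

text \<open>Putting \<open>e = d - c\<close> in the recursion of \<open>sum_pow\<close> and
  normalising \<open>y j\<close> by \<open>d ^ j\<close> leaves these prefactors, with
  \<open>j\<close> the number of factors that choose the same summand: one gives the leading order,
  two contribute at order \<open>1 / d\<close>, and three or more are negligible.\<close>

lemma expands_falling:
  shows "expands (\<lambda>d. (real d - c) / real d) 1 (- c)"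
    and "expands (\<lambda>d. (real d - c) / (real d)\<^sup>2) 0 1"
    and "j \<ge> 3 \<Longrightarrow> expands (\<lambda>d. (real d - c) / real d ^ j) 0 0"
proof -
  have ev: "eventually (\<lambda>d::nat. d > 0) at_top" by (rule eventually_gt_at_top)
  have "(\<lambda>d. (real d - c) / real d - 1 - (- c) / real d) \<in> O(\<lambda>d. 1 / (real d)\<^sup>2) \<longleftrightarrow>
     (\<lambda>d::nat. 0::real) \<in> O(\<lambda>d. 1 / (real d)\<^sup>2)"
    by (intro landau_o.big.in_cong) (use ev in eventually_elim, simp add: field_simps)
  then show "expands (\<lambda>d. (real d - c) / real d) 1 (- c)" unfolding expands_def by simp
  have "(\<lambda>d. (real d - c) / (real d)\<^sup>2 - 0 - 1 / real d) \<in> O(\<lambda>d. 1 / (real d)\<^sup>2) \<longleftrightarrow>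
     (\<lambda>d. - c * (1 / (real d)\<^sup>2)) \<in> O(\<lambda>d. 1 / (real d)\<^sup>2)"
    by (intro landau_o.big.in_cong) (use ev in eventually_elim, simp add: field_simps power2_eq_square)
  moreover have "(\<lambda>d. - c * (1 / (real d)\<^sup>2)) \<in> O(\<lambda>d. 1 / (real d)\<^sup>2)"
    by (intro bigoI[of _ "\<bar>c\<bar>"]) (auto simp: abs_mult)
  ultimately show "expands (\<lambda>d. (real d - c) / (real d)\<^sup>2) 0 1" unfolding expands_def by blast
  assume j: "j \<ge> 3"
  show "expands (\<lambda>d. (real d - c) / real d ^ j) 0 0"
    unfolding expands_def
  proof (rule bigoI[of _ "1 + \<bar>c\<bar>"])
    show "\<forall>\<^sub>F d in sequentially. norm ((real d - c) / real d ^ j - 0 - 0 / real d) \<le> (1 + \<bar>c\<bar>) * norm (1 / (real d)\<^sup>2)"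
      using ev
    proof eventually_elim
      case (elim d)
      have "\<bar>real d - c\<bar> \<le> (1 + \<bar>c\<bar>) * real d"
        using elim mult_left_mono[of 1 "real d" "\<bar>c\<bar>"] by (simp add: algebra_simps)
      then have "\<bar>real d - c\<bar> / real d ^ j \<le> (1 + \<bar>c\<bar>) * real d / real d ^ j"
        using elim by (intro divide_right_mono) auto
      also have "\<dots> \<le> (1 + \<bar>c\<bar>) * real d / real d ^ 3"
        using elim j by (intro divide_left_mono power_increasing) auto
      also have "\<dots> = (1 + \<bar>c\<bar>) * (1 / (real d)\<^sup>2)"
        using elim by (simp add: power2_eq_square power3_eq_cube)
      finally show ?case using elim by (simp add: abs_mult)
    qed
  qed
qed

text \<open>
  The coefficient of \<open>1 / d\<close> in \<open>sum_pow y (d - c) n\<close> when \<open>d * y 1\<close> expands as \<open>Y + Y' / d\<close> and \<open>d^2 * y 2\<close>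
  tends to \<open>Y2\<close>: at this order at most one pair of factors chooses the same summand.
\<close>

definition sum_pow_corr :: "real fps \<Rightarrow> real fps \<Rightarrow> real fps \<Rightarrow> real \<Rightarrow> nat \<Rightarrow> real fps" where
  "sum_pow_corr Y Y' Y2 c n = fps_const (real n) * (Y ^ (n - 1) * (Y' - fps_const c * Y))
     + fps_const (real n * (real n - 1)) * (Y ^ (n - 2) * (fps_const (1 / 2) * (Y2 - Y * Y)))"

text \<open>With an abstract element \<open>H\<close> for one half, the two sides differ by a
  multiple of \<open>H * 2 - 1\<close>, which makes the claim a polynomial identity.\<close>

lemma sum_pow_corr_Suc_aux:
  fixes H P C K :: "'a :: comm_ring_1"
  assumes H: "H * 2 = 1"
  shows "- C * (Y * (Y * (Y * P))) + (Y * ((K + 2) * (Y * P * (Y' - (C + 1) * Y)) +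
       (K + 2) * (K + 1) * (P * (H * (Y2 - Y * Y)))) + Y' * (Y * (Y * P))) + (K + 2) * (Y2 * (Y * P)) =
     (K + 3) * (Y * (Y * P) * (Y' - C * Y)) + (K + 3) * (K + 2) * (Y * P * (H * (Y2 - Y * Y)))" (is "?L = ?R")
proof -
  have "?L - ?R = (H * 2 - 1) * ((K + 2) * (Y * Y * Y * P - Y2 * Y * P))"
    by (simp add: algebra_simps)
  then show ?thesis using H by simp
qed

text \<open>The first-order part of the recursion of \<open>sum_pow\<close>. The three groups on the
  left come from the prefactor \<open>d - c\<close>, from the corrections of the chosen summand and
  of the others (one fewer, hence \<open>c + 1\<close>), and from a single repetition of the chosen
  summand.\<close>

lemma sum_pow_corr_Suc:
  "fps_const (- c) * (Y * Y ^ n) + (Y * sum_pow_corr Y Y' Y2 (c + 1) n + Y' * Y ^ n)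
     + fps_const (real n) * (Y2 * Y ^ (n - 1)) = sum_pow_corr Y Y' Y2 c (Suc n)"
proof -
  have const: "fps_const (real n) = of_nat n" for n by (simp add: fps_of_nat)
  have half: "fps_const (1 / 2 :: real) * 2 = 1"
    by (simp add: fps_const_mult[symmetric] numeral_fps_const)
  \<comment> \<open>The small cases are separate because the exponents \<open>n - 1\<close> and
    \<open>n - 2\<close> are truncated there.\<close>
  consider "n = 0" | "n = 1" | k where "n = Suc (Suc k)"
    by (metis One_nat_def not0_implies_Suc)
  then show ?thesis
  proof cases
    case 3
    define H where "H = fps_const (1 / 2 :: real)"
    have H: "H * 2 = 1" unfolding H_def by (rule half)
    have c: "fps_const (- c) = - fps_const c" "fps_const (c + 1) = fps_const c + 1"
      "fps_const (real (Suc (Suc k)) * (real (Suc (Suc k)) - 1)) = (of_nat k + 2) * (of_nat k + 1)"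
      "fps_const (real (Suc (Suc (Suc k))) * (real (Suc (Suc (Suc k))) - 1)) = (of_nat k + 3) * (of_nat k + 2)"
      "fps_const (real (Suc (Suc k))) = of_nat k + 2"
      "fps_const (real (Suc (Suc (Suc k)))) = of_nat k + 3"
      by (simp_all add: fps_const_mult[symmetric] fps_const_add[symmetric] fps_of_nat numeral_fps_const
        del: fps_const_mult fps_const_add fps_const_neg, simp_all add: fps_of_nat[symmetric] numeral_fps_const algebra_simps)
    have d: "Suc (Suc k) - 1 = Suc k" "Suc (Suc k) - 2 = k" "Suc (Suc (Suc k)) - 1 = Suc (Suc k)"
      "Suc (Suc (Suc k)) - 2 = Suc k" by auto
    show ?thesis
      unfolding 3 sum_pow_corr_def c d H_def[symmetric] power_Suc
      by (rule sum_pow_corr_Suc_aux) (rule H)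
  qed (auto simp: sum_pow_corr_def algebra_simps half[unfolded mult.commute[of _ "2::real fps"]] fps_const_add[symmetric] fps_const_mult[symmetric]
      fps_const_neg[symmetric] numeral_fps_const[symmetric] simp del: fps_const_add fps_const_mult fps_const_neg)
qed

lemma expands_fps_sum_pow:
  assumes 1: "expands_fps k (\<lambda>d. fps_const (real d) * y d 1) Y Y'"
    and 2: "expands_fps k (\<lambda>d. fps_const (real d ^ 2) * y d 2) Y2 H2"
    and 3: "\<And>j. j \<ge> 3 \<Longrightarrow> \<exists>g h. expands_fps k (\<lambda>d. fps_const (real d ^ j) * y d j) g h"
  shows "expands_fps k (\<lambda>d. sum_pow (y d) (real d - c) n) (Y ^ n) (sum_pow_corr Y Y' Y2 c n)"
proof (induction n arbitrary: c rule: less_induct)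
  case (less n)
  show ?case
  proof (cases n)
    case 0
    show ?thesis unfolding expands_fps_def
    proof (intro allI impI)
      fix i
      show "expands (\<lambda>d. sum_pow (y d) (real d - c) n $ i) (Y ^ n $ i) (sum_pow_corr Y Y' Y2 c n $ i)"
        by (cases i) (auto simp: 0 sum_pow_corr_def expands_const)
    qed
  next
    case (Suc n')
    define G where "G j = (if j = 0 then Y * Y ^ n' else 0)" for j :: nat
    define H where "H j = (if j = 0 then fps_const (- c) * (Y * Y ^ n') + (Y * sum_pow_corr Y Y' Y2 (c + 1) n' + Y' * Y ^ n')
       else if j = 1 then fps_const (real n') * (Y2 * Y ^ (n' - 1)) else 0)" for j :: nat
    have IH: "expands_fps k (\<lambda>d. sum_pow (y d) (real d - c - 1) (n' - j)) (Y ^ (n' - j)) (sum_pow_corr Y Y' Y2 (c + 1) (n' - j))" for j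
      using less.IH[of "n' - j" "c + 1"] by (simp add: Suc algebra_simps)
    have "expands_fps k (\<lambda>d. fps_const (real (n' choose j)) * (fps_const ((real d - c) / real d ^ Suc j) *
        (fps_const (real d ^ Suc j) * y d (Suc j) * sum_pow (y d) (real d - c - 1) (n' - j)))) (G j) (H j)" for j
    proof -
      consider "j = 0" | "j = 1" | "j \<ge> 2" by linarith
      then show ?thesis
      proof cases
        case j: 1
        have "expands_fps k (\<lambda>d. fps_const (real (n' choose j)) * (fps_const ((real d - c) / real d ^ Suc j) *
           (fps_const (real d ^ Suc j) * y d (Suc j) * sum_pow (y d) (real d - c - 1) (n' - j))))
           (fps_const 1 * (fps_const 1 * (Y * Y ^ n')))
           (fps_const 1 * (fps_const 1 * (Y * sum_pow_corr Y Y' Y2 (c + 1) n' + Y' * Y ^ n') + fps_const (- c) * (Y * Y ^ n'))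
             + fps_const 0 * (fps_const 1 * (Y * Y ^ n')))"
          using 1 expands_falling(1)[of c] IH[of j] expands_const[of 1]
          by (intro expands_fps_mult expands_fps_const) (auto simp: j)
        then show ?thesis by (simp add: j G_def H_def algebra_simps)
      next
        case j: 2
        have "expands_fps k (\<lambda>d. fps_const (real (n' choose j)) * (fps_const ((real d - c) / real d ^ Suc j) *
           (fps_const (real d ^ Suc j) * y d (Suc j) * sum_pow (y d) (real d - c - 1) (n' - j))))
           (fps_const (real n') * (fps_const 0 * (Y2 * Y ^ (n' - 1))))
           (fps_const (real n') * (fps_const 0 * (Y2 * sum_pow_corr Y Y' Y2 (c + 1) (n' - 1) + H2 * Y ^ (n' - 1)) + fps_const 1 * (Y2 * Y ^ (n' - 1)))
             + fps_const 0 * (fps_const 0 * (Y2 * Y ^ (n' - 1))))"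
          using 2 expands_falling(2)[of c] IH[of j] expands_const[of "real n'"]
          by (intro expands_fps_mult expands_fps_const) (auto simp: j numeral_2_eq_2)
        then show ?thesis by (simp add: j G_def H_def)
      next
        case j: 3
        obtain g h where gh: "expands_fps k (\<lambda>d. fps_const (real d ^ Suc j) * y d (Suc j)) g h"
          using 3[of "Suc j"] j by auto
        have "expands_fps k (\<lambda>d. fps_const (real (n' choose j)) * (fps_const ((real d - c) / real d ^ Suc j) *
           (fps_const (real d ^ Suc j) * y d (Suc j) * sum_pow (y d) (real d - c - 1) (n' - j))))
           (fps_const (real (n' choose j)) * (fps_const 0 * (g * Y ^ (n' - j))))
           (fps_const (real (n' choose j)) * (fps_const 0 * (g * sum_pow_corr Y Y' Y2 (c + 1) (n' - j) + h * Y ^ (n' - j)) + fps_const 0 * (g * Y ^ (n' - j)))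
             + fps_const 0 * (fps_const 0 * (g * Y ^ (n' - j))))"
          using gh expands_falling(3)[of "Suc j" c] j
          by (intro expands_fps_mult expands_fps_const expands_const IH) auto
        then show ?thesis using j by (simp add: G_def H_def)
      qed
    qed
    then have "expands_fps k (\<lambda>d. \<Sum>j\<le>n'. fps_const (real (n' choose j)) * (fps_const ((real d - c) / real d ^ Suc j) *
        (fps_const (real d ^ Suc j) * y d (Suc j) * sum_pow (y d) (real d - c - 1) (n' - j))))
        (\<Sum>j\<le>n'. G j) (\<Sum>j\<le>n'. H j)"
      by (intro expands_fps_sum)
    also have "(\<Sum>j\<le>n'. G j) = Y ^ n"
      by (simp add: G_def sum.delta Suc)
    also have "(\<Sum>j\<le>n'. H j) = H 0 + H 1"
    proof (cases n')
      case (Suc n'')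
      have "(\<Sum>j\<le>n'. H j) = (\<Sum>j\<in>{0, 1}. H j)"
        by (intro sum.mono_neutral_right) (auto simp: H_def Suc)
      then show ?thesis by simp
    qed (simp add: H_def)
    also have "\<dots> = sum_pow_corr Y Y' Y2 c n"
      unfolding Suc sum_pow_corr_Suc[symmetric] by (simp add: H_def)
    finally show ?thesis
    proof (rule iffD1[OF expands_fps_cong, rotated])
      show "\<forall>\<^sub>F d in sequentially. (\<Sum>j\<le>n'. fps_const (real (n' choose j)) * (fps_const ((real d - c) / real d ^ Suc j) *
        (fps_const (real d ^ Suc j) * y d (Suc j) * sum_pow (y d) (real d - c - 1) (n' - j))))
          = sum_pow (y d) (real d - c) n"
        using eventually_gt_at_top[of 0]
      proof eventually_elim
        case (elim d)
        have "fps_const ((real d - c) / real d ^ Suc j) * (fps_const (real d ^ Suc j) * z) = fps_const (real d - c) * z" for j z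
        proof -
          have "(real d - c) / real d ^ Suc j * real d ^ Suc j = real d - c" using elim by simp
          then show ?thesis by (simp only: mult.assoc[symmetric] fps_const_mult)
        qed
        then show ?case
          unfolding Suc sum_pow.simps(2) sum_distrib_left mult.assoc
          by (intro sum.cong refl) (simp add: fps_of_nat mult_ac)
      qed
    qed
  qed
qed

lemma geometric_corr_sum:
  fixes Y r :: "real fps"
  assumes r: "r * (1 - Y) = 1" and Y0: "Y $ 0 = 0"
  shows "(\<Sum>q\<le>i + 2. real ((q + p - 1) choose q) * sum_pow_corr Y Y' Y2 c q $ i) =
     (fps_const (real p) * r ^ (p + 1) * (Y' - fps_const c * Y)
       + fps_const (real p * (real p + 1) / 2) * r ^ (p + 2) * (Y2 - Y * Y)) $ i"
proof -
  have "(\<Sum>q\<le>i + 2. real ((q + p - 1) choose q) * sum_pow_corr Y Y' Y2 c q $ i) =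
    (\<Sum>q\<le>i + 2. real ((q + p - 1) choose q) * real q * (Y ^ (q - 1) * (Y' - fps_const c * Y)) $ i) +
    (\<Sum>q\<le>i + 2. real ((q + p - 1) choose q) * (real q * (real q - 1)) * (Y ^ (q - 2) * (fps_const (1 / 2) * (Y2 - Y * Y))) $ i)"
    unfolding sum.distrib[symmetric] sum_pow_corr_def fps_add_nth fps_mult_left_const_nth
    by (simp only: distrib_left mult.assoc)
  also have "\<dots> = real p * (r ^ (p + 1) * (Y' - fps_const c * Y)) $ i
     + real p * (real p + 1) * (r ^ (p + 2) * (fps_const (1 / 2) * (Y2 - Y * Y))) $ i"
    by (intro arg_cong2[of _ _ _ _ "(+)"] geometric_power_nth_deriv[OF r Y0] geometric_power_nth_deriv2[OF r Y0]) auto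
  also have "r ^ (p + 2) * (fps_const (1 / 2) * (Y2 - Y * Y)) = fps_const (1 / 2) * (r ^ (p + 2) * (Y2 - Y * Y))"
    by (simp only: mult_ac)
  finally have "(\<Sum>q\<le>i + 2. real ((q + p - 1) choose q) * sum_pow_corr Y Y' Y2 c q $ i) =
      real p * (r ^ (p + 1) * (Y' - fps_const c * Y)) $ i
      + real p * (real p + 1) * (fps_const (1 / 2) * (r ^ (p + 2) * (Y2 - Y * Y))) $ i" .
  then show ?thesis
    by (simp only: fps_add_nth fps_mult_left_const_nth mult.assoc times_divide_eq_right times_divide_eq_left mult_1_left)
qed

text \<open>\<open>s\<close> is the Catalan series of the semicircle, and the weights are divided by
  \<open>sqrt d\<close>. The first part is an induction on the coefficient index, since the
  expansions of \<open>y\<close> in degree \<open>i\<close> need the resolvent only in lower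
  degrees. Of the moments, only the first two enter the correction.\<close>

lemma expands_res_pow:
  fixes s :: "real fps"
  assumes s: "s = 1 + fps_const (1 / 4) * fps_X * s ^ 2"
    and M: "\<And>j. 1 \<le> j \<Longrightarrow> j \<le> k \<Longrightarrow> expands (\<lambda>d. M d j) (s $ j) 0"
  shows "i \<le> k \<Longrightarrow> expands (\<lambda>d. res_pow (\<lambda>j. M d j / real d ^ j) (real (d - 1)) p $ i) ((s ^ p) $ i)
          ((fps_const (real p * (real p + 1) / 2) * s ^ p * (s - 1) ^ 2 - fps_const (real p) * s ^ (p + 1) * (s - 1)) $ i)"
    and "expands (\<lambda>d. tree_moment (\<lambda>j. M d j / real d ^ j) d k) (s $ k) 0"
proof -
  define Y where "Y = fps_const (1 / 4) * fps_X * s"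
  \<comment> \<open>The predicted coefficient of \<open>1 / d\<close> in \<open>res_pow\<close>.
    Being explicit for all \<open>p\<close>, it can be verified by substitution instead of solving a
    recursion.\<close>
  define h where "h p = fps_const (real p * (real p + 1) / 2) * s ^ p * (s - 1) ^ 2 - fps_const (real p) * s ^ (p + 1) * (s - 1)" for p
  define y where "y d = edge_pow (\<lambda>j. M d j / real d ^ j) (real (d - 1))" for d
  \<comment> \<open>This is \<open>fps_const (s $ 1) * fps_X * h 1\<close>, the first-order term of
    \<open>d * y 1\<close>, rewritten with \<open>h 1 = - (s * (s - 1))\<close>.\<close>
  define Y' where "Y' = - (Y * (s - 1))"
  have Ys: "Y * s = s - 1"
  proof -
    have "s - 1 = fps_const (1 / 4) * fps_X * s ^ 2" by (subst (1) s) simp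
    then show ?thesis by (simp add: Y_def power2_eq_square mult_ac)
  qed
  have Y0: "Y $ 0 = 0" by (simp add: Y_def mult.assoc)
  have r: "s * (1 - Y) = 1" using Ys by (simp add: algebra_simps)
  have s0: "s $ 0 = 1" by (subst s) (simp add: mult.assoc)
  have s1: "s $ Suc 0 = 1 / 4" by (subst s) (simp add: mult.assoc power2_eq_square s0)
  have s2: "s $ 2 = 1 / 8"
    by (subst s) (simp add: mult.assoc s0 power2_eq_square fps_mult_nth numeral_2_eq_2 s1)
  have h1: "h 1 = - (s * (s - 1))"
  proof -
    have "h 1 = s * (s - 1) ^ 2 - s ^ 2 * (s - 1)" by (simp add: h_def power2_eq_square)
    then show ?thesis by (simp add: algebra_simps power2_eq_square)
  qed
  have sp0: "sum_pow (y d) e q $ i = 0" if "i < q" for d e q i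
    by (rule sum_pow_nth_eq_0) (auto simp: y_def edge_pow_nth that)
  have step: "expands_fps i (\<lambda>d. fps_const (real d ^ j) * y d j) (fps_const (s $ j) * fps_X ^ j * s ^ j) (fps_const (s $ j) * fps_X ^ j * h j)"
    if "i \<le> k" "j \<ge> 1" and IH: "\<And>l p. l < i \<Longrightarrow> expands (\<lambda>d. res_pow (\<lambda>j. M d j / real d ^ j) (real (d - 1)) p $ l) ((s ^ p) $ l) (h p $ l)"
    for i j
    unfolding expands_fps_def
  proof (intro allI impI)
    fix l assume l: "l \<le> i"
    show "expands (\<lambda>d. (fps_const (real d ^ j) * y d j) $ l) ((fps_const (s $ j) * fps_X ^ j * s ^ j) $ l)
       ((fps_const (s $ j) * fps_X ^ j * h j) $ l)"
    proof (cases "l < j")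
      case True
      then show ?thesis by (simp add: y_def edge_pow_nth const_X_power_mult_nth expands_const)
    next
      case False
      have "expands (\<lambda>d. M d j * res_pow (\<lambda>j. M d j / real d ^ j) (real (d - 1)) j $ (l - j)) (s $ j * (s ^ j) $ (l - j))
          (s $ j * h j $ (l - j) + 0 * (s ^ j) $ (l - j))"
        by (intro expands_mult M IH) (use that l False in auto)
      moreover have "\<forall>\<^sub>F d in sequentially. M d j * res_pow (\<lambda>j. M d j / real d ^ j) (real (d - 1)) j $ (l - j) = (fps_const (real d ^ j) * y d j) $ l"
        using eventually_gt_at_top[of 0] by eventually_elim (use False in \<open>simp add: y_def edge_pow_nth\<close>)
      ultimately show ?thesis
        using False by (subst expands_cong[symmetric]) (auto simp: const_X_power_mult_nth)
    qed
  qed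
  have sp: "expands_fps i (\<lambda>d. sum_pow (y d) (real d - c) q) (Y ^ q) (sum_pow_corr Y Y' (fps_const 2 * (Y * Y)) c q)"
    if "i \<le> k" and IH: "\<And>l p. l < i \<Longrightarrow> expands (\<lambda>d. res_pow (\<lambda>j. M d j / real d ^ j) (real (d - 1)) p $ l) ((s ^ p) $ l) (h p $ l)"
    for i q c
  proof (rule expands_fps_sum_pow)
    have "fps_const (s $ 1) * fps_X ^ 1 * s ^ 1 = Y" by (simp add: Y_def s1)
    moreover have "fps_const (s $ 1) * fps_X ^ 1 * h 1 = Y'"
      by (simp add: Y'_def Y_def h1[simplified] s1 mult_ac)
    ultimately show "expands_fps i (\<lambda>d. fps_const (real d) * y d 1) Y Y'"
      using step[OF that(1), of 1] IH by simp
    have c: "fps_const (1 / 8 :: real) = fps_const 2 * (fps_const (1 / 4) * fps_const (1 / 4))" by simp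
    have "fps_const (s $ 2) * fps_X ^ 2 * s ^ 2 = fps_const 2 * (Y * Y)"
      unfolding s2 Y_def c by (simp only: mult_ac power2_eq_square)
    then show "expands_fps i (\<lambda>d. fps_const (real d ^ 2) * y d 2) (fps_const 2 * (Y * Y)) (fps_const (s $ 2) * fps_X ^ 2 * h 2)"
      using step[OF that(1), of 2] IH by simp
    show "\<exists>g h. expands_fps i (\<lambda>d. fps_const (real d ^ j) * y d j) g h" if "j \<ge> 3" for j
      using step[OF \<open>i \<le> k\<close>, of j] IH that by (intro exI) auto
  qed
  have main: "expands (\<lambda>d. \<Sum>q\<le>i + 2. real ((q + p - 1) choose q) * sum_pow (y d) (real d - c) q $ i) ((s ^ p) $ i)
    ((fps_const (real p) * s ^ (p + 1) * (Y' - fps_const c * Y) + fps_const (real p * (real p + 1) / 2) * s ^ (p + 2) * (Y * Y)) $ i)"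
    if "i \<le> k" and IH: "\<And>l p. l < i \<Longrightarrow> expands (\<lambda>d. res_pow (\<lambda>j. M d j / real d ^ j) (real (d - 1)) p $ l) ((s ^ p) $ l) (h p $ l)"
    for i p c
  proof -
    have e: "expands (\<lambda>d. \<Sum>q\<le>i + 2. real ((q + p - 1) choose q) * sum_pow (y d) (real d - c) q $ i)
      (\<Sum>q\<le>i + 2. real ((q + p - 1) choose q) * (Y ^ q) $ i)
      (\<Sum>q\<le>i + 2. real ((q + p - 1) choose q) * sum_pow_corr Y Y' (fps_const 2 * (Y * Y)) c q $ i + 0 * (Y ^ q) $ i)"
      using sp[OF that] by (intro expands_sum expands_mult expands_const) (auto simp: expands_fps_def)
    have g: "(\<Sum>q\<le>i + 2. real ((q + p - 1) choose q) * (Y ^ q) $ i) = (s ^ p) $ i"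
      using geometric_power_nth[OF r Y0, of i "i + 2" p 1] by simp
    have two: "fps_const 2 * (Y * Y) - Y * Y = Y * Y"
      by (simp add: numeral_fps_const[symmetric])
    show ?thesis
      using e unfolding g mult_zero_left add_0_right
        geometric_corr_sum[OF r Y0, of p Y' "fps_const 2 * (Y * Y)" c i] two .
  qed
  \<comment> \<open>Below the root one child is missing, so \<open>c = 1\<close>; with
    \<open>Y * s = s - 1\<close> the general correction collapses to \<open>h p\<close>.\<close>
  have corr: "fps_const (real p) * s ^ (p + 1) * (Y' - Y) + fps_const (real p * (real p + 1) / 2) * s ^ (p + 2) * (Y * Y) = h p" for p
  proof -
    have a: "s ^ (p + 1) * (Y' - Y) = - (s ^ (p + 1) * (s - 1))"
    proof -
      have "s ^ (p + 1) * (Y' - Y) = - (s ^ p * (Y * s) * s)" by (simp add: Y'_def algebra_simps)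
      then show ?thesis unfolding Ys by (simp add: algebra_simps)
    qed
    have b: "s ^ (p + 2) * (Y * Y) = s ^ p * (s - 1) ^ 2"
      unfolding Ys[symmetric] by (simp add: power_add power2_eq_square mult_ac)
    show ?thesis unfolding mult.assoc a b h_def by (simp add: mult.assoc)
  qed
  show R: "expands (\<lambda>d. res_pow (\<lambda>j. M d j / real d ^ j) (real (d - 1)) p $ i) ((s ^ p) $ i) (h p $ i)" if "i \<le> k" for i p
    using that
  proof (induction i arbitrary: p rule: less_induct)
    case (less i)
    have "expands (\<lambda>d. \<Sum>q\<le>i + 2. real ((q + p - 1) choose q) * sum_pow (y d) (real d - 1) q $ i) ((s ^ p) $ i) (h p $ i)"
    proof -
      have "expands (\<lambda>d. \<Sum>q\<le>i + 2. real ((q + p - 1) choose q) * sum_pow (y d) (real d - 1) q $ i) ((s ^ p) $ i)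
       ((fps_const (real p) * s ^ (p + 1) * (Y' - fps_const 1 * Y) + fps_const (real p * (real p + 1) / 2) * s ^ (p + 2) * (Y * Y)) $ i)"
      proof (rule main[OF less.prems])
        fix l p assume "l < i"
        then show "expands (\<lambda>d. res_pow (\<lambda>j. M d j / real d ^ j) (real (d - 1)) p $ l) ((s ^ p) $ l) (h p $ l)"
          using less.prems by (intro less.IH) auto
      qed
      then show ?thesis unfolding fps_const_1_eq_1 mult_1_left corr .
    qed
    moreover have "\<forall>\<^sub>F d in sequentially. (\<Sum>q\<le>i + 2. real ((q + p - 1) choose q) * sum_pow (y d) (real d - 1) q $ i)
       = res_pow (\<lambda>j. M d j / real d ^ j) (real (d - 1)) p $ i"
      using eventually_gt_at_top[of 0]
    proof eventually_elim
      case (elim d)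
      then have "real d - 1 = real (d - 1)" by simp
      moreover have "(\<Sum>q\<le>i + 2. real ((q + p - 1) choose q) * sum_pow (y d) (real (d - 1)) q $ i)
         = (\<Sum>q\<le>i. real ((q + p - 1) choose q) * sum_pow (y d) (real (d - 1)) q $ i)"
        by (intro sum.mono_neutral_right) (auto simp: sp0)
      ultimately show ?case unfolding res_pow_nth by (simp only: y_def)
    qed
    ultimately show ?case by (simp add: expands_cong)
  qed
  \<comment> \<open>At the root \<open>c = 0\<close> and \<open>p = 1\<close>. Compared with
    \<open>corr\<close> only the term of the missing child is gone, and what remains cancels after
    substituting \<open>Y * s = s - 1\<close>.\<close>
  have z: "fps_const (real 1) * s ^ (1 + 1) * (Y' - fps_const 0 * Y) + fps_const (real 1 * (real 1 + 1) / 2) * s ^ (1 + 2) * (Y * Y) = 0"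
  proof -
    have "s ^ 2 * Y' + s ^ 3 * (Y * Y) = - (s * (Y * s) * (s - 1)) + s * (Y * s) * (Y * s)"
      by (simp add: Y'_def power2_eq_square power3_eq_cube mult_ac)
    also have "\<dots> = 0" unfolding Ys by (simp add: algebra_simps)
    finally show ?thesis by (simp add: numeral_2_eq_2 numeral_3_eq_3)
  qed
  have "expands (\<lambda>d. \<Sum>q\<le>k + 2. real ((q + 1 - 1) choose q) * sum_pow (y d) (real d - 0) q $ k) ((s ^ 1) $ k) 0"
  proof -
    have "expands (\<lambda>d. \<Sum>q\<le>k + 2. real ((q + 1 - 1) choose q) * sum_pow (y d) (real d - 0) q $ k) ((s ^ 1) $ k)
     ((fps_const (real 1) * s ^ (1 + 1) * (Y' - fps_const 0 * Y) + fps_const (real 1 * (real 1 + 1) / 2) * s ^ (1 + 2) * (Y * Y)) $ k)"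
      by (rule main[OF order_refl]) (rule R, rule less_imp_le)
    then show ?thesis unfolding z fps_zero_nth .
  qed
  moreover have "(\<Sum>q\<le>k + 2. real ((q + 1 - 1) choose q) * sum_pow (y d) (real d - 0) q $ k) = tree_moment (\<lambda>j. M d j / real d ^ j) d k" for d
  proof -
    have "(\<Sum>q\<le>k + 2. real ((q + 1 - 1) choose q) * sum_pow (y d) (real d - 0) q $ k)
       = (\<Sum>q\<le>k. real ((q + 1 - 1) choose q) * sum_pow (y d) (real d - 0) q $ k)"
      by (intro sum.mono_neutral_right) (auto simp: sp0)
    then show ?thesis by (simp add: tree_moment_def y_def)
  qed
  ultimately show "expands (\<lambda>d. tree_moment (\<lambda>j. M d j / real d ^ j) d k) (s $ k) 0" by simp
qed

section \<open>Moments of an eigendistribution\<close>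

definition eigen_moments :: "nat \<Rightarrow> (nat \<Rightarrow> real) \<Rightarrow> bool" where
  "eigen_moments d m \<longleftrightarrow> m 1 = 1 / 4 \<and> (\<forall>k\<ge>1. real d ^ k * m k = tree_moment m d k)"

text \<open>Solves the fixed point equation for its top moment. The factor on the left is zero for
  \<open>k = 1\<close>, which reflects the freedom to scale and is why the second moment must be
  prescribed.\<close>

lemma eigen_moments_rec:
  assumes "eigen_moments d m" "k \<ge> 1"
  shows "(real d ^ k - real d) * m k = tree_moment (\<lambda>j. if j < k then m j else 0) d k"
proof -
  have "real d ^ k * m k = real d * m k + tree_moment (m(k := 0)) d k"
    using assms tree_moment_affine[of k m d] by (auto simp: eigen_moments_def)
  moreover have "tree_moment (m(k := 0)) d k = tree_moment (\<lambda>j. if j < k then m j else 0) d k"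
    by (rule tree_moment_cong) auto
  ultimately show ?thesis by (simp add: algebra_simps)
qed

lemma power_minus_self_pos:
  assumes "d \<ge> 2" "k \<ge> 2"
  shows "real d ^ k - real d > 0"
proof -
  have "real d ^ 1 < real d ^ k" using assms by (intro power_strict_increasing) auto
  then show ?thesis by simp
qed

lemma eigen_moments_unique:
  assumes "eigen_moments d m" "eigen_moments d m'" "d \<ge> 2" "k \<ge> 1"
  shows "m k = m' k"
  using assms(4)
proof (induction k rule: less_induct)
  case (less k)
  show ?case
  proof (cases "k = 1")
    case True
    then show ?thesis using assms by (simp add: eigen_moments_def)
  next
    case False
    have "tree_moment (\<lambda>j. if j < k then m j else 0) d k = tree_moment (\<lambda>j. if j < k then m' j else 0) d k"
      by (rule tree_moment_cong) (use less in auto)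
    then have "(real d ^ k - real d) * m k = (real d ^ k - real d) * m' k"
      using eigen_moments_rec[OF assms(1) less.prems] eigen_moments_rec[OF assms(2) less.prems] by simp
    then show ?thesis using power_minus_self_pos[of d k] assms False less.prems by auto
  qed
qed

lemma eigen_moments_le:
  assumes "eigen_moments d m" "d \<ge> 2" "k \<ge> 1" and nonneg: "\<And>j. m j \<ge> 0"
  shows "m k \<le> (12 * (real d)\<^sup>2) ^ (k - 1) * fact (2 * k)"
  using assms(3)
proof (induction k rule: less_induct)
  case (less k)
  show ?case
  proof (cases "k = 1")
    case True
    then show ?thesis using assms by (simp add: eigen_moments_def)
  next
    case False
    have "(real d ^ k - real d) * m k = tree_moment (\<lambda>j. if j < k then m j else 0) d k"
      by (rule eigen_moments_rec) (use assms less in auto)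
    also have "\<dots> \<le> (real d ^ k - real d) * ((12 * (real d)\<^sup>2) ^ (k - 1) * fact (2 * k))"
      by (rule tree_moment_le[OF _ refl]) (use assms less False in auto)
    finally show ?thesis using power_minus_self_pos[of d k] assms False less.prems by simp
  qed
qed

text \<open>The expansion of \<open>tree_moment\<close> requires its top argument to expand as well,
  which is what has to be proved. Since that argument enters with the small factor
  \<open>d / d ^ k\<close> after normalisation, it is replaced by its limit and the discrepancy is
  solved for.\<close>

lemma eigen_moments_asymptotics:
  fixes s :: "real fps"
  assumes s: "s = 1 + fps_const (1 / 4) * fps_X * s ^ 2"
    and m: "\<And>d. d \<ge> 2 \<Longrightarrow> eigen_moments d (m d)" and k: "k \<ge> 1"
  shows "(\<lambda>d. m d k - s $ k) \<in> O(\<lambda>d. 1 / (real d)\<^sup>2)"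
  using k
proof (induction k rule: less_induct)
  case (less k)
  have ev: "eventually (\<lambda>d::nat. d \<ge> 2) at_top" by (rule eventually_ge_at_top)
  show ?case
  proof (cases "k = 1")
    case True
    have "s $ 0 = 1" by (subst s) (simp add: mult.assoc)
    then have "s $ Suc 0 = 1 / 4" by (subst s) (simp add: mult.assoc power2_eq_square)
    moreover have "(\<lambda>d. m d 1 - 1 / 4) \<in> O(\<lambda>d. 1 / (real d)\<^sup>2) \<longleftrightarrow> (\<lambda>d::nat. 0::real) \<in> O(\<lambda>d. 1 / (real d)\<^sup>2)"
      by (intro landau_o.big.in_cong) (use ev in eventually_elim, use m in \<open>auto simp: eigen_moments_def\<close>)
    ultimately show ?thesis using True by (simp only: One_nat_def) simp
  next
    case False
    \<comment> \<open>The unknown \<open>k\<close>-th moment is replaced by \<open>s $ k\<close>;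
      the lower ones expand by induction.\<close>
    define M where "M d = (m d)(k := s $ k)" for d
    have "expands (\<lambda>d. tree_moment (\<lambda>j. M d j / real d ^ j) d k) (s $ k) 0"
    proof (rule expands_res_pow(2)[OF s])
      fix j assume j: "1 \<le> j" "j \<le> k"
      show "expands (\<lambda>d. M d j) (s $ j) 0"
        using less.IH[of j] j by (cases "j = k") (auto simp: M_def expands_const expands_def)
    qed
    moreover have "\<forall>\<^sub>F d in sequentially. tree_moment (\<lambda>j. M d j / real d ^ j) d k - s $ k
       = (1 - 1 / real d ^ (k - 1)) * (m d k - s $ k)"
      using ev
    proof eventually_elim
      case (elim d)
      define T where "T = tree_moment ((m d)(k := 0)) d k"
      have 1: "real d ^ k * m d k = real d * m d k + T"
        using m[OF elim] tree_moment_affine[of k "m d" d] less.prems by (auto simp: eigen_moments_def T_def)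
      have 2: "tree_moment (M d) d k = real d * s $ k + T"
        using tree_moment_affine[of k "M d" d] less.prems by (simp add: M_def T_def)
      have "tree_moment (\<lambda>j. M d j / real d ^ j) d k = (1 / real d) ^ k * tree_moment (M d) d k"
        unfolding tree_moment_scale[symmetric] by (simp add: power_divide)
      also have "\<dots> = (real d ^ k * m d k - real d * m d k + real d * s $ k) / real d ^ k"
        using 1 2 by (simp add: power_divide)
      also have "\<dots> = m d k - (m d k - s $ k) / real d ^ (k - 1)"
        using elim less.prems by (cases k) (auto simp: field_simps)
      finally show ?case by (simp add: field_simps)
    qed
    ultimately have "(\<lambda>d. (1 - 1 / real d ^ (k - 1)) * (m d k - s $ k)) \<in> O(\<lambda>d. 1 / (real d)\<^sup>2)"
      unfolding expands_def by (subst (asm) landau_o.big.in_cong) (auto elim!: eventually_mono)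
    moreover have "(\<lambda>d. m d k - s $ k) \<in> O(\<lambda>d. (1 - 1 / real d ^ (k - 1)) * (m d k - s $ k))"
    proof (rule bigoI[of _ 2])
      show "\<forall>\<^sub>F d in sequentially. norm (m d k - s $ k) \<le> 2 * norm ((1 - 1 / real d ^ (k - 1)) * (m d k - s $ k))"
        using ev
      proof eventually_elim
        case (elim d)
        have "real d ^ 1 \<le> real d ^ (k - 1)" using elim False less.prems by (intro power_increasing) auto
        moreover have "2 \<le> real d ^ 1" using elim by simp
        ultimately have "real d ^ (k - 1) \<ge> 2" by linarith
        then have "1 / real d ^ (k - 1) \<le> 1 / 2" using elim by (intro divide_left_mono) auto
        then have "1 \<le> 2 * \<bar>1 - 1 / real d ^ (k - 1)\<bar>" by simp
        then show ?case
          using mult_right_mono[of 1 "2 * \<bar>1 - 1 / real d ^ (k - 1)\<bar>" "\<bar>m d k - s $ k\<bar>"] by (simp add: abs_mult)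
      qed
    qed
    ultimately show ?thesis by (rule landau_o.big_trans[rotated])
  qed
qed

text \<open>Expansion by set partitions of the factors according to the summand they choose. Falling
  factorials of \<open>e\<close> count the distinct summands; for instance 6, 3 and 4 count the
  partitions of four factors of types 2+1+1, 2+2 and 3+1.\<close>

lemma sum_pow_table:
  assumes z: "\<And>i j. i < j \<Longrightarrow> y j $ i = 0"
  shows "sum_pow y e (Suc 0) $ k = e * y 1 $ k"
    and "sum_pow y e 2 $ 2 = e * (e - 1) * (y 1 $ 1)\<^sup>2 + e * y 2 $ 2"
    and "sum_pow y e 2 $ 3 = e * (e - 1) * (2 * y 1 $ 1 * y 1 $ 2) + e * y 2 $ 3"
    and "sum_pow y e 2 $ 4 = e * (e - 1) * (2 * y 1 $ 1 * y 1 $ 3 + (y 1 $ 2)\<^sup>2) + e * y 2 $ 4"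
    and "sum_pow y e 3 $ 3 = e * (e - 1) * (e - 2) * (y 1 $ 1) ^ 3 + 3 * e * (e - 1) * (y 1 $ 1 * y 2 $ 2) + e * y 3 $ 3"
    and "sum_pow y e 3 $ 4 = 3 * e * (e - 1) * (e - 2) * ((y 1 $ 1)\<^sup>2 * y 1 $ 2)
       + 3 * e * (e - 1) * (y 1 $ 1 * y 2 $ 3 + y 1 $ 2 * y 2 $ 2) + e * y 3 $ 4"
    and "sum_pow y e 4 $ 4 = e * (e - 1) * (e - 2) * (e - 3) * (y 1 $ 1) ^ 4
       + 6 * e * (e - 1) * (e - 2) * ((y 1 $ 1)\<^sup>2 * y 2 $ 2) + 3 * e * (e - 1) * (y 2 $ 2)\<^sup>2
       + 4 * e * (e - 1) * (y 1 $ 1 * y 3 $ 3) + e * y 4 $ 4"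
proof -
  have S0: "sum_pow y e 0 $ k = (if k = 0 then 1 else 0)" for e k by simp
  have S1: "sum_pow y e (Suc 0) $ k = e * y 1 $ k" for e k
    by (simp add: sum_pow_Suc_nth if_distrib[of "\<lambda>x. _ * x"] sum.delta cong: if_cong)
  have S2: "sum_pow y e (Suc (Suc 0)) $ k = e * ((\<Sum>i\<le>k. y 1 $ i * ((e - 1) * y 1 $ (k - i))) + y 2 $ k)" for e k
    unfolding sum_pow_Suc_nth[of y e "Suc 0"]
    by (simp add: S1 if_distrib[of "\<lambda>x. _ * x"] sum.delta numeral_2_eq_2 cong: if_cong)
  note sums = sum.atMost_Suc eval_nat_numeral z
  show "sum_pow y e (Suc 0) $ k = e * y 1 $ k" by (rule S1)
  have S22: "sum_pow y e 2 $ 2 = e * (e - 1) * (y 1 $ 1)\<^sup>2 + e * y 2 $ 2"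
    and S23: "sum_pow y e 2 $ 3 = e * (e - 1) * (2 * y 1 $ 1 * y 1 $ 2) + e * y 2 $ 3"
    and S24: "sum_pow y e 2 $ 4 = e * (e - 1) * (2 * y 1 $ 1 * y 1 $ 3 + (y 1 $ 2)\<^sup>2) + e * y 2 $ 4" for e
    by (simp_all add: S2 sums algebra_simps)
  show "sum_pow y e 2 $ 2 = e * (e - 1) * (y 1 $ 1)\<^sup>2 + e * y 2 $ 2"
    "sum_pow y e 2 $ 3 = e * (e - 1) * (2 * y 1 $ 1 * y 1 $ 2) + e * y 2 $ 3"
    "sum_pow y e 2 $ 4 = e * (e - 1) * (2 * y 1 $ 1 * y 1 $ 3 + (y 1 $ 2)\<^sup>2) + e * y 2 $ 4"
    by (fact S22 S23 S24)+
  have S3: "sum_pow y e (Suc (Suc (Suc 0))) $ k = e * ((\<Sum>i\<le>k. y 1 $ i * sum_pow y (e - 1) (Suc (Suc 0)) $ (k - i))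
     + 2 * (\<Sum>i\<le>k. y 2 $ i * ((e - 1) * y 1 $ (k - i))) + y 3 $ k)" for e k
    unfolding sum_pow_Suc_nth[of y e "Suc (Suc 0)"]
    by (simp add: S1 if_distrib[of "\<lambda>x. _ * x"] sum.delta numeral_2_eq_2 numeral_3_eq_3 cong: if_cong)
  have S33: "sum_pow y e 3 $ 3 = e * (e - 1) * (e - 2) * (y 1 $ 1) ^ 3 + 3 * e * (e - 1) * (y 1 $ 1 * y 2 $ 2) + e * y 3 $ 3"
   and S34: "sum_pow y e 3 $ 4 = 3 * e * (e - 1) * (e - 2) * ((y 1 $ 1)\<^sup>2 * y 1 $ 2)
       + 3 * e * (e - 1) * (y 1 $ 1 * y 2 $ 3 + y 1 $ 2 * y 2 $ 2) + e * y 3 $ 4" for e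
    by (simp_all add: S3 S2 sums algebra_simps)
  show "sum_pow y e 3 $ 3 = e * (e - 1) * (e - 2) * (y 1 $ 1) ^ 3 + 3 * e * (e - 1) * (y 1 $ 1 * y 2 $ 2) + e * y 3 $ 3"
    "sum_pow y e 3 $ 4 = 3 * e * (e - 1) * (e - 2) * ((y 1 $ 1)\<^sup>2 * y 1 $ 2)
       + 3 * e * (e - 1) * (y 1 $ 1 * y 2 $ 3 + y 1 $ 2 * y 2 $ 2) + e * y 3 $ 4"
    by (fact S33 S34)+
  have S4: "sum_pow y e (Suc (Suc (Suc (Suc 0)))) $ k = e * ((\<Sum>i\<le>k. y 1 $ i * sum_pow y (e - 1) (Suc (Suc (Suc 0))) $ (k - i))
     + 3 * (\<Sum>i\<le>k. y 2 $ i * sum_pow y (e - 1) (Suc (Suc 0)) $ (k - i))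
     + 3 * (\<Sum>i\<le>k. y 3 $ i * ((e - 1) * y 1 $ (k - i))) + y 4 $ k)" for e k
    unfolding sum_pow_Suc_nth[of y e "Suc (Suc (Suc 0))"]
    by (simp add: S1 if_distrib[of "\<lambda>x. _ * x"] sum.delta eval_nat_numeral cong: if_cong)
  show "sum_pow y e 4 $ 4 = e * (e - 1) * (e - 2) * (e - 3) * (y 1 $ 1) ^ 4
       + 6 * e * (e - 1) * (e - 2) * ((y 1 $ 1)\<^sup>2 * y 2 $ 2) + 3 * e * (e - 1) * (y 2 $ 2)\<^sup>2
       + 4 * e * (e - 1) * (y 1 $ 1 * y 3 $ 3) + e * y 4 $ 4"
    by (simp add: S4 S3 S2 sums algebra_simps)
qed

lemma res_pow_table:
  shows "res_pow m e p $ 0 = 1"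
    and "res_pow m e p $ 1 = real p * (e * m 1)"
    and "res_pow m e p $ 2 = real p * (e * (m 1 * (e * m 1)))
      + real p * (real p + 1) / 2 * (e * (e - 1) * (m 1)\<^sup>2 + e * m 2)"
    and "res_pow m e 1 $ 3 = e * (m 1 * res_pow m e 1 $ 2) + (e * (e - 1) * (2 * m 1 * (m 1 * (e * m 1))) + e * (m 2 * (2 * (e * m 1))))
      + (e * (e - 1) * (e - 2) * m 1 ^ 3 + 3 * e * (e - 1) * (m 1 * m 2) + e * m 3)"
proof -
  have z: "edge_pow m e j $ i = 0" if "i < j" for i j using that by (simp add: edge_pow_nth)
  note tab = sum_pow_table[of "edge_pow m e", OF z]
  have c: "real (Suc p choose 2) = real p * (real p + 1) / 2" for p
    by (simp add: choose_two) (simp add: real_of_nat_div algebra_simps)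
  show R0: "res_pow m e p $ 0 = 1" for p by (simp add: res_pow_nth)
  have R1: "res_pow m e p $ Suc 0 = real p * (e * m 1)" for p
    by (simp add: res_pow_nth[of m e p "Suc 0"] tab(1) edge_pow_nth R0)
  then show "res_pow m e p $ 1 = real p * (e * m 1)" by simp
  show "res_pow m e p $ 2 = real p * (e * (m 1 * (e * m 1)))
      + real p * (real p + 1) / 2 * (e * (e - 1) * (m 1)\<^sup>2 + e * m 2)"
    unfolding res_pow_nth[of m e p 2]
    using tab(1)[of e 2] tab(2)[of e] c[of p]
    by (simp add: numeral_2_eq_2 edge_pow_nth R0 R1)
  show "res_pow m e 1 $ 3 = e * (m 1 * res_pow m e 1 $ 2) + (e * (e - 1) * (2 * m 1 * (m 1 * (e * m 1))) + e * (m 2 * (2 * (e * m 1))))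
      + (e * (e - 1) * (e - 2) * m 1 ^ 3 + 3 * e * (e - 1) * (m 1 * m 2) + e * m 3)"
    unfolding res_pow_nth[of m e 1 3]
    using tab(1)[of e 3] tab(3,5)[of e]
    by (simp add: eval_nat_numeral edge_pow_nth R0 R1)
qed

text \<open>After substituting the lower moments, the equation for \<open>m k\<close> has leading
  factor \<open>D ^ k - D\<close>, which cancels for \<open>k = 2\<close> and \<open>k = 3\<close>.
  For \<open>k = 4\<close> only \<open>D * (D - 1)\<close> divides the other side, and the remaining
  factor \<open>D ^ 2 + D + 1\<close> survives as the denominator.\<close>

lemma eigen_moments_values:
  assumes em: "eigen_moments d m" and d: "d \<ge> 2"
  shows "m 2 = 1 / 8" "m 3 = 5 / 64" "m 4 = 7 / 128 + 1 / (128 * ((real d)\<^sup>2 + real d + 1))"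
proof -
  define D where "D = real d"
  define y where "y = edge_pow m (D - 1)"
  have D: "real (d - 1) = D - 1" "D \<ge> 2" using d by (auto simp: D_def)
  have z: "y j $ i = 0" if "i < j" for i j using that by (simp add: y_def edge_pow_nth)
  note tab = sum_pow_table[of y, OF z]
  have rt: "res_pow m (D - 1) 1 $ 1 = (D - 1) * m 1" "res_pow m (D - 1) 2 $ 1 = 2 * ((D - 1) * m 1)"
     "res_pow m (D - 1) 3 $ 1 = 3 * ((D - 1) * m 1)"
    using res_pow_table(2)[of m "D - 1"] by auto
  have y: "y 1 $ 1 = m 1" "y 1 $ 2 = m 1 * ((D - 1) * m 1)" "y 1 $ 3 = m 1 * res_pow m (D - 1) 1 $ 2" "y 1 $ 4 = m 1 * res_pow m (D - 1) 1 $ 3"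
    "y 2 $ 2 = m 2" "y 2 $ 3 = m 2 * (2 * ((D - 1) * m 1))" "y 2 $ 4 = m 2 * res_pow m (D - 1) 2 $ 2"
    "y 3 $ 3 = m 3" "y 3 $ 4 = m 3 * (3 * ((D - 1) * m 1))" "y 4 $ 4 = m 4"
    unfolding y_def edge_pow_nth using rt res_pow_table(1)[of m "D - 1"] by auto
  have m1: "m 1 = 1 / 4" using em by (simp add: eigen_moments_def)
  have T: "D ^ k * m k = (\<Sum>q\<le>k. sum_pow y D q $ k)" if "k \<ge> 1" for k
    using em that unfolding eigen_moments_def tree_moment_def y_def D(1) D_def[symmetric] by blast
  have "D ^ 2 * m 2 = D * (m 1 * ((D - 1) * m 1)) + (D * (D - 1) * (m 1)\<^sup>2 + D * m 2)"
    using T[of 2] tab(1)[of D 2] tab(2)[of D] y by (simp add: numeral_2_eq_2)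
  from this[unfolded m1] have "D * (D - 1) * (m 2 - 1 / 8) = 0"
    by (simp add: power2_eq_square field_simps)
  then show m2: "m 2 = 1 / 8" using D by simp
  have r2: "res_pow m (D - 1) 1 $ 2 = (D - 1) * (1 / 4 * ((D - 1) * (1 / 4))) + ((D - 1) * (D - 2) / 16 + (D - 1) / 8)"
    "res_pow m (D - 1) 2 $ 2 = 2 * ((D - 1) * (1 / 4 * ((D - 1) * (1 / 4)))) + 3 * ((D - 1) * (D - 2) / 16 + (D - 1) / 8)"
    unfolding res_pow_table(3) m1 m2 by (simp_all add: power2_eq_square)
  have e3: "D ^ 3 * m 3 = D * y 1 $ 3 + (D * (D - 1) * (2 * y 1 $ 1 * y 1 $ 2) + D * y 2 $ 3)
     + (D * (D - 1) * (D - 2) * (y 1 $ 1) ^ 3 + 3 * D * (D - 1) * (y 1 $ 1 * y 2 $ 2) + D * y 3 $ 3)" (is "_ = ?R3")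
    using T[of 3] tab(1)[of D 3] tab(3,5)[of D] by (simp add: numeral_2_eq_2 numeral_3_eq_3)
  have "64 * (?R3 - D * m 3) = 5 * (D ^ 3 - D)"
    unfolding y r2 m1 m2 by (simp add: power2_eq_square power3_eq_cube field_simps)
  then have "64 * (D ^ 3 * m 3 - D * m 3) = 5 * (D ^ 3 - D)" by (simp only: e3)
  then have "D * (D - 1) * (D + 1) * (64 * m 3 - 5) = 0"
    by (simp add: power3_eq_cube algebra_simps)
  then show m3: "m 3 = 5 / 64" using D by auto
  have r3: "res_pow m (D - 1) 1 $ 3 = (D - 1) * (1 / 4 * res_pow m (D - 1) 1 $ 2) + ((D - 1) * (D - 2) * (2 * (1 / 4) * (1 / 4 * ((D - 1) * (1 / 4)))) + (D - 1) * (1 / 8 * (2 * ((D - 1) * (1 / 4)))))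
      + ((D - 1) * (D - 2) * (D - 3) / 64 + 3 * (D - 1) * (D - 2) / 32 + (D - 1) * (5 / 64))"
    unfolding res_pow_table(4) m1 m2 m3 by (simp add: power3_eq_cube)
  have e4: "D ^ 4 * m 4 = D * y 1 $ 4 + (D * (D - 1) * (2 * y 1 $ 1 * y 1 $ 3 + (y 1 $ 2)\<^sup>2) + D * y 2 $ 4)
     + (3 * D * (D - 1) * (D - 2) * ((y 1 $ 1)\<^sup>2 * y 1 $ 2)
       + 3 * D * (D - 1) * (y 1 $ 1 * y 2 $ 3 + y 1 $ 2 * y 2 $ 2) + D * y 3 $ 4)
     + (D * (D - 1) * (D - 2) * (D - 3) * (y 1 $ 1) ^ 4
       + 6 * D * (D - 1) * (D - 2) * ((y 1 $ 1)\<^sup>2 * y 2 $ 2) + 3 * D * (D - 1) * (y 2 $ 2)\<^sup>2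
       + 4 * D * (D - 1) * (y 1 $ 1 * y 3 $ 3) + D * y 4 $ 4)" (is "_ = ?R4")
    using T[of 4] tab(1)[of D 4] tab(4,6,7)[of D] by (simp add: eval_nat_numeral)
  have "128 * (?R4 - D * m 4) = D * (D - 1) * (7 * (D ^ 2 + D + 1) + 1)"
    unfolding y r3 r2 m1 m2 m3 by (simp add: power2_eq_square power3_eq_cube power4_eq_xxxx field_simps)
  then have "128 * (D ^ 4 * m 4 - D * m 4) = D * (D - 1) * (7 * (D ^ 2 + D + 1) + 1)" by (simp only: e4)
  then have "D * (D - 1) * (128 * (D ^ 2 + D + 1) * m 4 - (7 * (D ^ 2 + D + 1) + 1)) = 0"
    by (simp add: power2_eq_square power4_eq_xxxx algebra_simps)
  then have "128 * (D ^ 2 + D + 1) * m 4 = 7 * (D ^ 2 + D + 1) + 1" using D by auto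
  moreover have "D ^ 2 + D + 1 > 0" using D by (smt (verit) zero_le_power2)
  ultimately have "m 4 = 7 / 128 + 1 / (128 * (D ^ 2 + D + 1))"
    by (simp add: field_simps)
  then show "m 4 = 7 / 128 + 1 / (128 * ((real d)\<^sup>2 + real d + 1))" by (simp add: D_def)
qed

section \<open>Convergence and determinacy of moments\<close>

lemma real_distribution_const_integrable: "real_distribution M \<Longrightarrow> integrable M (\<lambda>_. c :: real)"
  unfolding real_distribution_def using prob_space.axioms(1) finite_measure.integrable_const by blast

lemma real_distribution_measurable_iff: "real_distribution M \<Longrightarrow> f \<in> measurable M N \<longleftrightarrow> f \<in> measurable borel N"
  using measurable_cong_sets[of M borel N N] real_distribution.events_eq_borel[of M] by auto

lemma integrable_power_of_even_power:
  fixes M :: "real measure"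
  assumes M: "real_distribution M" and int: "integrable M (\<lambda>x. x ^ (2 * k))"
  shows "integrable M (\<lambda>x. x ^ k)"
proof (rule Bochner_Integration.integrable_bound)
  show "integrable M (\<lambda>x. 1 + x ^ (2 * k))"
    using int real_distribution_const_integrable[OF M, of 1] by simp
  show "(\<lambda>x. x ^ k) \<in> borel_measurable M"
    by (simp add: real_distribution_measurable_iff[OF M])
  have "\<bar>x ^ k\<bar> \<le> 1 + x ^ (2 * k)" for x :: real
  proof -
    have "0 \<le> (\<bar>x ^ k\<bar> - 1)\<^sup>2" by simp
    then have "2 * \<bar>x ^ k\<bar> \<le> 1 + (x ^ k)\<^sup>2"
      by (simp only: power2_diff power2_abs) simp
    then have "2 * \<bar>x ^ k\<bar> \<le> 1 + x ^ (2 * k)"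
      by (simp only: power_even_eq)
    then show ?thesis by linarith
  qed
  then show "AE x in M. norm (x ^ k) \<le> norm (1 + x ^ (2 * k))" by (intro AE_I2) (simp add: abs_of_nonneg)
qed

text \<open>Weak convergence controls bounded continuous functions only. The uniform bounds
  \<open>B\<close> on moments of twice the order supply uniform integrability: truncation errors are
  small simultaneously for all \<open>M n\<close> and for \<open>M'\<close>.\<close>

lemma weak_limit_moments:
  fixes M :: "nat \<Rightarrow> real measure"
  assumes M: "\<And>n. real_distribution (M n)" and M': "real_distribution M'" and wc: "weak_conv_m M M'"
    and int: "\<And>n k. integrable (M n) (\<lambda>x. x ^ k)"
    and lim: "\<And>k. (\<lambda>n. moment (M n) k) \<longlonglongrightarrow> c k"
  shows "integrable M' (\<lambda>x. x ^ k)" and "moment M' k = c k"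
proof -
  have "\<exists>B. \<forall>n. \<bar>moment (M n) k\<bar> \<le> B" for k
    using convergent_imp_Bseq[of "\<lambda>n. moment (M n) k"] lim[of k]
    unfolding convergent_def Bseq_def by auto
  then obtain B where B: "\<And>n k. \<bar>moment (M n) k\<bar> \<le> B k" by metis
  have bdd_conv: "(\<lambda>n. \<integral>x. f x \<partial>M n) \<longlonglongrightarrow> (\<integral>x. f x \<partial>M')"
    if "continuous_on UNIV f" "\<And>x. \<bar>f x\<bar> \<le> R" for f :: "real \<Rightarrow> real" and R
    by (rule weak_conv_imp_integral_bdd_continuous_conv[OF M M' wc, of f R])
       (use that in \<open>auto simp: continuous_on_eq_continuous_at\<close>)
  \<comment> \<open>A Fatou argument: the truncations at height \<open>N\<close> are bounded and
    continuous, so their integrals pass to the limit with the bound, and monotone convergence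
    removes the truncation.\<close>
  have even: "integrable M' (\<lambda>x. x ^ (2 * j)) \<and> (\<integral>x. x ^ (2 * j) \<partial>M') \<le> B (2 * j)" for j
  proof -
    define f where "f N x = min (x ^ (2 * j)) (real N)" for N and x :: real
    have f: "0 \<le> f N x" "f N x \<le> x ^ (2 * j)" "\<bar>f N x\<bar> \<le> real N" "f N \<in> borel_measurable borel" for N x
      by (auto simp: f_def[abs_def])
    have fi: "integrable M f'" if "real_distribution M" "f' = f N" for M f' N
    proof (rule Bochner_Integration.integrable_bound[OF real_distribution_const_integrable[OF that(1), of "real N"]])
      show "f' \<in> borel_measurable M" using f that by (simp add: real_distribution_measurable_iff)
      show "AE x in M. norm (f' x) \<le> norm (real N)" using f that by (intro AE_I2) auto
    qed
    have le: "(\<integral>x. f N x \<partial>M') \<le> B (2 * j)" for N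
    proof (rule LIMSEQ_le_const2[OF bdd_conv])
      show "continuous_on UNIV (f N)" unfolding f_def by (intro continuous_intros)
      show "\<bar>f N x\<bar> \<le> real N" for x by (rule f)
      show "\<exists>N'. \<forall>n\<ge>N'. (\<integral>x. f N x \<partial>M n) \<le> B (2 * j)"
      proof (intro exI allI impI)
        fix n
        have "(\<integral>x. f N x \<partial>M n) \<le> (\<integral>x. x ^ (2 * j) \<partial>M n)"
          by (intro integral_mono fi[OF M refl] int f)
        then show "(\<integral>x. f N x \<partial>M n) \<le> B (2 * j)" using B[of n "2 * j"] by (simp add: moment_def)
      qed
    qed
    have mono: "incseq (\<lambda>N. f N x)" for x unfolding incseq_def f_def by auto
    have conv: "(\<lambda>N. f N x) \<longlonglongrightarrow> x ^ (2 * j)" for x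
    proof -
      obtain m where m: "x ^ (2 * j) \<le> real m" using real_arch_simple by blast
      have "\<forall>\<^sub>F N in sequentially. f N x = x ^ (2 * j)"
        using eventually_ge_at_top[of m]
      proof eventually_elim
        case (elim N)
        then have "x ^ (2 * j) \<le> real N" using m by linarith
        then show ?case by (simp add: f_def)
      qed
      then show ?thesis by (rule tendsto_eventually)
    qed
    have seq: "incseq (\<lambda>N. \<integral>x. f N x \<partial>M')"
      by (intro incseq_SucI integral_mono fi[OF M' refl]) (auto simp: f_def)
    obtain L where L: "(\<lambda>N. \<integral>x. f N x \<partial>M') \<longlonglongrightarrow> L"
      using incseq_convergent[OF seq, of "B (2 * j)"] le by blast
    have meas: "(\<lambda>x. x ^ (2 * j)) \<in> borel_measurable M'"
      by (simp add: real_distribution_measurable_iff[OF M'])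
    have *: "integrable M' (\<lambda>x. x ^ (2 * j))" "(\<integral>x. x ^ (2 * j) \<partial>M') = L"
      using integral_monotone_convergence[of M' f "\<lambda>x. x ^ (2 * j)" L, OF fi[OF M' refl] _ _ L meas] mono conv
        integrable_monotone_convergence[of M' f "\<lambda>x. x ^ (2 * j)" L, OF fi[OF M' refl] _ _ L meas] by auto
    then show ?thesis using LIMSEQ_le_const2[OF L] le by auto
  qed
  show int': "integrable M' (\<lambda>x. x ^ k)" for k
    by (rule integrable_power_of_even_power[OF M']) (use even in auto)
  have B0: "0 \<le> B k" for k using B[of 0 k] by linarith
  \<comment> \<open>Clipping \<open>x ^ k\<close> to absolute value \<open>N + 1\<close> costs at
    most \<open>x ^ (2 * k) / (N + 1)\<close>; this is incurred once along the sequence and once in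
    the limit, hence the factor 2.\<close>
  have dist: "\<bar>c k - moment M' k\<bar> \<le> 2 * B (2 * k) / real (Suc N)" for N
  proof -
    define g where "g x = max (- real (Suc N)) (min (real (Suc N)) (x ^ k))" for x :: real
    have gb: "\<bar>g x\<bar> \<le> real (Suc N)" for x unfolding g_def by auto
    have gm: "g \<in> borel_measurable borel" unfolding g_def[abs_def] by measurable
    have gi: "integrable M g" if "real_distribution M" for M
    proof (rule Bochner_Integration.integrable_bound[OF real_distribution_const_integrable[OF that, of "real (Suc N)"]])
      show "g \<in> borel_measurable M" using gm that by (simp add: real_distribution_measurable_iff)
      show "AE x in M. norm (g x) \<le> norm (real (Suc N))" using gb by (intro AE_I2) auto
    qed
    have diff: "\<bar>x ^ k - g x\<bar> \<le> x ^ (2 * k) / real (Suc N)" for x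
    proof (cases "\<bar>x ^ k\<bar> \<le> real (Suc N)")
      case True
      then have "g x = x ^ k" by (auto simp: g_def)
      then show ?thesis by simp
    next
      case False
      have "\<bar>x ^ k - g x\<bar> \<le> \<bar>x ^ k\<bar>" unfolding g_def by auto
      moreover have "\<bar>x ^ k\<bar> * real (Suc N) \<le> \<bar>x ^ k\<bar> * \<bar>x ^ k\<bar>"
        using False by (intro mult_left_mono) auto
      moreover have "\<bar>x ^ k\<bar> * \<bar>x ^ k\<bar> = x ^ (2 * k)"
        by (simp only: power_even_eq power2_eq_square[symmetric] power2_abs)
      ultimately show ?thesis by (simp add: le_divide_eq del: of_nat_Suc) (meson mult_right_mono of_nat_0_le_iff order_trans)
    qed
    have close: "\<bar>(\<integral>x. x ^ k \<partial>M) - (\<integral>x. g x \<partial>M)\<bar> \<le> B (2 * k) / real (Suc N)"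
      if "real_distribution M" "\<And>k. integrable M (\<lambda>x. x ^ k)" "(\<integral>x. x ^ (2 * k) \<partial>M) \<le> B (2 * k)" for M
    proof -
      have "\<bar>(\<integral>x. x ^ k \<partial>M) - (\<integral>x. g x \<partial>M)\<bar> = \<bar>\<integral>x. x ^ k - g x \<partial>M\<bar>"
        using that gi by (subst Bochner_Integration.integral_diff) auto
      also have "\<dots> \<le> (\<integral>x. \<bar>x ^ k - g x\<bar> \<partial>M)" by (rule integral_abs_bound)
      also have "\<dots> \<le> (\<integral>x. x ^ (2 * k) / real (Suc N) \<partial>M)"
        using that gi diff by (intro integral_mono) auto
      also have "\<dots> = (\<integral>x. x ^ (2 * k) \<partial>M) / real (Suc N)" by simp
      also have "\<dots> \<le> B (2 * k) / real (Suc N)" using that by (intro divide_right_mono) auto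
      finally show ?thesis .
    qed
    have "(\<lambda>n. (\<integral>x. x ^ k \<partial>M n) - (\<integral>x. g x \<partial>M n)) \<longlonglongrightarrow> c k - (\<integral>x. g x \<partial>M')"
    proof (intro tendsto_diff)
      show "(\<lambda>n. \<integral>x. x ^ k \<partial>M n) \<longlonglongrightarrow> c k" using lim[of k] by (simp add: moment_def)
      show "(\<lambda>n. \<integral>x. g x \<partial>M n) \<longlonglongrightarrow> (\<integral>x. g x \<partial>M')"
        by (rule bdd_conv[OF _ gb]) (unfold g_def, intro continuous_intros)
    qed
    then have "\<bar>c k - (\<integral>x. g x \<partial>M')\<bar> \<le> B (2 * k) / real (Suc N)"
    proof (rule LIMSEQ_le_const2[OF tendsto_rabs], intro exI allI impI)
      fix n
      show "\<bar>(\<integral>x. x ^ k \<partial>M n) - (\<integral>x. g x \<partial>M n)\<bar> \<le> B (2 * k) / real (Suc N)"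
        by (rule close[OF M int]) (use B[of n "2 * k"] in \<open>auto simp: moment_def\<close>)
    qed
    moreover have "\<bar>(\<integral>x. x ^ k \<partial>M') - (\<integral>x. g x \<partial>M')\<bar> \<le> B (2 * k) / real (Suc N)"
      by (rule close[OF M' int']) (use even[of k] in auto)
    ultimately show ?thesis unfolding moment_def by linarith
  qed
  have "(\<lambda>N. 2 * B (2 * k) * inverse (real (Suc N))) \<longlonglongrightarrow> 2 * B (2 * k) * 0"
    by (intro tendsto_mult tendsto_const LIMSEQ_inverse_real_of_nat)
  then have "\<bar>c k - moment M' k\<bar> \<le> 2 * B (2 * k) * 0"
  proof (rule LIMSEQ_le_const, intro exI allI impI)
    fix N show "\<bar>c k - moment M' k\<bar> \<le> 2 * B (2 * k) * inverse (real (Suc N))"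
      using dist[of N] by (simp only: divide_inverse)
  qed
  then show "moment M' k = c k" by simp
qed

lemma tight_of_second_moments:
  fixes M :: "nat \<Rightarrow> real measure"
  assumes M: "\<And>n. real_distribution (M n)" and int: "\<And>n. integrable (M n) (\<lambda>x. x\<^sup>2)"
    and B: "\<And>n. moment (M n) 2 \<le> B"
  shows "tight M"
  unfolding tight_def
proof (intro conjI allI impI)
  show "real_distribution (M n)" for n by (rule M)
  fix \<epsilon> :: real assume \<epsilon>: "\<epsilon> > 0"
  \<comment> \<open>Chosen such that \<open>a \<ge> 1\<close> and \<open>\<epsilon> * a\<close>
    exceeds the absolute value of \<open>B\<close>; hence so does \<open>\<epsilon> * a * a\<close>,
    as Chebyshev's inequality needs.\<close>
  define a where "a = 1 + (\<bar>B\<bar> + 1) / \<epsilon>"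
  have a1: "a \<ge> 1" using \<epsilon> by (simp add: a_def)
  have aB: "\<bar>B\<bar> < \<epsilon> * a"
  proof -
    have "\<epsilon> * a = \<epsilon> + \<bar>B\<bar> + 1" using \<epsilon> by (simp add: a_def field_simps)
    then show ?thesis using \<epsilon> by simp
  qed
  have "1 - \<epsilon> < measure (M n) {- a - 1<..a}" for n
  proof -
    interpret real_distribution "M n" by (rule M)
    have "measure (M n) {x \<in> space (M n). a\<^sup>2 \<le> x\<^sup>2} \<le> (\<integral>x. x\<^sup>2 \<partial>M n) / a\<^sup>2"
      by (rule integral_Markov_inequality_measure[where A = "{}"]) (use int a1 in auto)
    also have "\<dots> \<le> \<bar>B\<bar> / a\<^sup>2"
      using B[of n] by (intro divide_right_mono) (auto simp: moment_def)
    also have "\<dots> < \<epsilon>"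
    proof -
      have "\<epsilon> * a * 1 \<le> \<epsilon> * a * a" using a1 \<epsilon> by (intro mult_left_mono) auto
      then show ?thesis using aB a1 by (simp add: divide_less_eq power2_eq_square)
    qed
    finally have 1: "measure (M n) {x \<in> space (M n). a\<^sup>2 \<le> x\<^sup>2} < \<epsilon>" .
    have "{x \<in> space (M n). \<not> a\<^sup>2 \<le> x\<^sup>2} \<subseteq> {- a - 1<..a}"
    proof
      fix x assume "x \<in> {x \<in> space (M n). \<not> a\<^sup>2 \<le> x\<^sup>2}"
      then have "\<bar>x\<bar> < \<bar>a\<bar>" by (simp add: abs_le_square_iff[symmetric])
      then show "x \<in> {- a - 1<..a}" using a1 by auto
    qed
    then have "measure (M n) {x \<in> space (M n). \<not> a\<^sup>2 \<le> x\<^sup>2} \<le> measure (M n) {- a - 1<..a}"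
      by (intro finite_measure_mono) auto
    moreover have "measure (M n) {x \<in> space (M n). \<not> a\<^sup>2 \<le> x\<^sup>2} = 1 - measure (M n) {x \<in> space (M n). a\<^sup>2 \<le> x\<^sup>2}"
      by (rule prob_neg) auto
    ultimately show ?thesis using 1 by simp
  qed
  moreover have "- a - 1 < a" using a1 by simp
  ultimately show "\<exists>a b. a < b \<and> (\<forall>n. 1 - \<epsilon> < measure (M n) {a<..b})" by blast
qed

lemma tight_of_convergent_moments:
  fixes M :: "nat \<Rightarrow> real measure"
  assumes M: "\<And>n. real_distribution (M n)" and int: "\<And>n k. integrable (M n) (\<lambda>x. x ^ k)"
    and lim: "\<And>k. (\<lambda>n. moment (M n) k) \<longlonglongrightarrow> c k"
  shows "tight M"
proof -
  obtain B where "\<And>n. \<bar>moment (M n) 2\<bar> \<le> B"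
    using convergent_imp_Bseq[of "\<lambda>n. moment (M n) 2"] lim[of 2]
    unfolding convergent_def Bseq_def by auto
  then show ?thesis
    by (intro tight_of_second_moments[where B = B] M int) (auto simp: abs_le_iff)
qed

text \<open>Determinacy is not assumed, so a weakly convergent subsequence from tightness is used:
  its limit has the required moments whichever subsequence is taken.\<close>

lemma limit_of_moments_is_moments:
  fixes M :: "nat \<Rightarrow> real measure"
  assumes M: "\<And>n. real_distribution (M n)" and int: "\<And>n k. integrable (M n) (\<lambda>x. x ^ k)"
    and lim: "\<And>k. (\<lambda>n. moment (M n) k) \<longlonglongrightarrow> c k"
  obtains M' where "real_distribution M'" "\<And>k. integrable M' (\<lambda>x. x ^ k)" "\<And>k. moment M' k = c k"
proof -
  obtain r M' where r: "strict_mono (r :: nat \<Rightarrow> nat)" "real_distribution M'" "weak_conv_m (M \<circ> id \<circ> r) M'"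
    using tight_imp_convergent_subsubsequence[OF tight_of_convergent_moments[OF assms], of id] by (auto simp: strict_mono_def)
  have "(\<lambda>n. moment ((M \<circ> id \<circ> r) n) k) \<longlonglongrightarrow> c k" for k
    using LIMSEQ_subseq_LIMSEQ[OF lim r(1)] by (simp add: comp_def)
  then have "integrable M' (\<lambda>x. x ^ k) \<and> moment M' k = c k" for k
    using weak_limit_moments[OF _ r(2,3), of c k] M int by (auto simp: comp_def)
  then show thesis using r that by blast
qed

text \<open>The method of moments: every subsequential weak limit has the moments of
  \<open>M'\<close> and equals it by \<open>det\<close>; tightness then gives convergence of the
  whole sequence.\<close>

lemma weak_conv_of_convergent_moments:
  fixes M :: "nat \<Rightarrow> real measure"
  assumes M: "\<And>n. real_distribution (M n)" and int: "\<And>n k. integrable (M n) (\<lambda>x. x ^ k)"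
    and M': "real_distribution M'"
    and lim: "\<And>k. (\<lambda>n. moment (M n) k) \<longlonglongrightarrow> moment M' k"
    and det: "\<And>\<nu>. real_distribution \<nu> \<Longrightarrow> (\<And>k. integrable \<nu> (\<lambda>x. x ^ k)) \<Longrightarrow> (\<And>k. moment \<nu> k = moment M' k) \<Longrightarrow> \<nu> = M'"
  shows "weak_conv_m M M'"
proof (rule tight_subseq_weak_converge[OF M M' tight_of_convergent_moments[OF M int lim]])
  fix s :: "nat \<Rightarrow> nat" and \<nu>
  assume s: "strict_mono s" and \<nu>: "real_distribution \<nu>" "weak_conv_m (M \<circ> s) \<nu>"
  have lim': "(\<lambda>n. moment ((M \<circ> s) n) k) \<longlonglongrightarrow> moment M' k" for k
    using LIMSEQ_subseq_LIMSEQ[OF lim s] by (simp add: comp_def)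
  have "integrable \<nu> (\<lambda>x. x ^ k) \<and> moment \<nu> k = moment M' k" for k
    using weak_limit_moments[OF _ \<nu> _ lim', of k] M int by (auto simp: comp_def)
  then have "\<nu> = M'" using det \<nu> by blast
  then show "weak_conv_m (M \<circ> s) M'" using \<nu> by simp
qed

section \<open>Determinacy from factorial moment bounds\<close>

lemma integrable_exp_of_moment_bound:
  fixes M :: "real measure"
  assumes M: "real_distribution M" and int: "\<And>k. integrable M (\<lambda>x. x ^ k)"
    and bd: "\<And>k. moment M (2 * k) \<le> A * C ^ k * fact (2 * k)" and C: "C > 0" and c: "c = 1 / (2 * C + 2)"
  shows "integrable M (\<lambda>x. exp (c * \<bar>x\<bar>))"
proof -
  \<comment> \<open>Ratio of the geometric series dominating the expected cosh series. The choice of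
    \<open>c\<close> keeps \<open>c\<close> and \<open>c * C\<close> below one half, so the ratio is
    less than 1.\<close>
  define q where "q = c\<^sup>2 * C"
  have c0: "c > 0" using C c by simp
  have "q \<le> 1 / 2"
  proof -
    have "c \<le> 1 / 2" "c * C \<le> 1 / 2" using C by (auto simp: c field_simps)
    then have "c * (c * C) \<le> 1 * (1 / 2)" using c0 C by (intro mult_mono) auto
    then show ?thesis by (simp add: q_def power2_eq_square mult.assoc)
  qed
  then have q: "0 \<le> q" "q < 1" using C c0 by (auto simp: q_def)
  have A0: "A \<ge> 0"
  proof -
    have "moment M 0 = 1"
      using prob_space.prob_space[of M] M unfolding moment_def real_distribution_def by simp
    then show ?thesis using bd[of 0] by simp
  qed
  \<comment> \<open>The terms of \<open>cosh (c * x)\<close>, which involves only even powers and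
    hence only the moments that are bounded; twice cosh dominates the exponential of the absolute
    value.\<close>
  define f where "f k x = (c * x) ^ (2 * k) / fact (2 * k)" for k and x :: real
  have f0: "f k x \<ge> 0" for k x by (auto simp: f_def power_mult)
  have fi: "integrable M (f k)" for k
    using int[of "2 * k"] unfolding f_def[abs_def] by (simp add: power_mult_distrib)
  have fint: "(\<integral>x. f k x \<partial>M) \<le> A * q ^ k" for k
  proof -
    have "(\<integral>x. f k x \<partial>M) = c ^ (2 * k) * moment M (2 * k) / fact (2 * k)"
      unfolding f_def moment_def power_mult_distrib by simp
    also have "\<dots> \<le> c ^ (2 * k) * (A * C ^ k * fact (2 * k)) / fact (2 * k)"
      using c0 by (intro divide_right_mono mult_left_mono bd) auto
    also have "\<dots> = A * q ^ k" unfolding q_def power_mult power_mult_distrib by simp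
    finally show ?thesis .
  qed
  have summ: "summable (\<lambda>k. A * q ^ k)" using q by (intro summable_mult summable_geometric) auto
  have "(\<integral>\<^sup>+x. ennreal (cosh (c * x)) \<partial>M) = (\<integral>\<^sup>+x. (\<Sum>k. ennreal (f k x)) \<partial>M)"
  proof (intro nn_integral_cong)
    fix x
    have "(\<lambda>n. if even n then (c * x) ^ n /\<^sub>R fact n else 0) sums cosh (c * x)"
      by (rule cosh_converges)
    then have "(\<lambda>k. if even (2 * k) then (c * x) ^ (2 * k) /\<^sub>R fact (2 * k) else 0) sums cosh (c * x)"
      by (subst sums_mono_reindex[of "\<lambda>k. 2 * k"]) (auto simp: strict_mono_def elim!: evenE)
    then have "(\<lambda>k. f k x) sums cosh (c * x)" by (simp add: f_def divide_inverse mult.commute)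
    then show "ennreal (cosh (c * x)) = (\<Sum>k. ennreal (f k x))"
      using f0 by (metis suminf_ennreal2 sums_iff)
  qed
  also have "\<dots> = (\<Sum>k. \<integral>\<^sup>+x. ennreal (f k x) \<partial>M)"
    by (rule nn_integral_suminf) (use fi in auto)
  also have "\<dots> = (\<Sum>k. ennreal (\<integral>x. f k x \<partial>M))"
    by (intro suminf_cong nn_integral_eq_integral fi AE_I2 f0)
  also have "\<dots> \<le> (\<Sum>k. ennreal (A * q ^ k))"
    by (intro suminf_le ennreal_leI fint) auto
  also have "\<dots> = ennreal (\<Sum>k. A * q ^ k)"
    by (rule suminf_ennreal2[OF _ summ]) (use A0 q in auto)
  finally have fin: "(\<integral>\<^sup>+x. ennreal (cosh (c * x)) \<partial>M) < \<infinity>" by (simp add: order_le_less_trans)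
  have cm: "(\<lambda>x. cosh (c * x)) \<in> borel_measurable M"
    unfolding real_distribution_measurable_iff[OF M]
    by (intro borel_measurable_continuous_onI continuous_intros)
  have "integrable M (\<lambda>x. cosh (c * x))"
    by (rule integrableI_nonneg[OF cm _ fin]) (auto intro!: AE_I2 cosh_real_nonneg)
  then have "integrable M (\<lambda>x. 2 * cosh (c * x))" by simp
  then show ?thesis
  proof (rule Bochner_Integration.integrable_bound)
    show "(\<lambda>x. exp (c * \<bar>x\<bar>)) \<in> borel_measurable M"
      unfolding real_distribution_measurable_iff[OF M] by measurable
    have "exp (c * \<bar>x\<bar>) \<le> 2 * cosh (c * x)" for x
      by (cases "x \<ge> 0") (auto simp: cosh_def)
    then show "AE x in M. norm (exp (c * \<bar>x\<bar>)) \<le> norm (2 * cosh (c * x))"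
      by (intro AE_I2) (auto simp: cosh_real_nonneg abs_of_nonneg)
  qed
qed

text \<open>
  With an exponential moment of order \<open>c\<close>, the Taylor series of the characteristic function about any
  point converges within radius \<open>c / 2\<close>, so equality of all the integrals of \<open>x ^ n * iexp (t * x)\<close>
  propagates from \<open>t\<close> to \<open>t + h\<close>.
\<close>

lemma moment_series_step:
  fixes M :: "real measure"
  assumes M: "real_distribution M" and ex: "integrable M (\<lambda>x. exp (c * \<bar>x\<bar>))" and c: "c > 0" and h: "\<bar>h\<bar> \<le> c / 2"
  shows "(\<lambda>N. \<Sum>m<N. (\<i> * of_real h) ^ m / fact m * (CLINT x|M. of_real (x ^ (n + m)) * iexp (t * x)))
    \<longlonglongrightarrow> (CLINT x|M. of_real (x ^ n) * iexp ((t + h) * x))"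
    and "complex_integrable M (\<lambda>x. of_real (x ^ n) * iexp (t * x))"
proof -
  \<comment> \<open>Half of the exponential moment absorbs the power \<open>x ^ n\<close>, by
    comparison with one term of the exponential series; the other half remains for the Taylor
    series. Hence the radius \<open>c / 2\<close>.\<close>
  have pw: "\<bar>x\<bar> ^ n * exp (c / 2 * \<bar>x\<bar>) \<le> fact n * (2 / c) ^ n * exp (c * \<bar>x\<bar>)" for n and x :: real
  proof -
    have "(\<Sum>m\<in>{n}. (c / 2 * \<bar>x\<bar>) ^ m /\<^sub>R fact m) \<le> exp (c / 2 * \<bar>x\<bar>)"
      unfolding exp_def using c by (intro sum_le_suminf summable_exp_generic) auto
    then have "(c / 2 * \<bar>x\<bar>) ^ n / fact n \<le> exp (c / 2 * \<bar>x\<bar>)"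
      by (simp only: sum.insert finite.emptyI empty_iff sum.empty add_0_right simp_thms real_scaleR_def divide_inverse mult.commute)
    then have "(c / 2 * \<bar>x\<bar>) ^ n \<le> fact n * exp (c / 2 * \<bar>x\<bar>)"
      by (simp only: pos_divide_le_eq[OF fact_gt_zero] mult.commute)
    then have "(2 / c) ^ n * (c / 2 * \<bar>x\<bar>) ^ n \<le> (2 / c) ^ n * (fact n * exp (c / 2 * \<bar>x\<bar>))"
      using c by (intro mult_left_mono) auto
    moreover have "(2 / c) ^ n * (c / 2 * \<bar>x\<bar>) ^ n = \<bar>x\<bar> ^ n"
      using c by (simp flip: power_mult_distrib)
    ultimately have "\<bar>x\<bar> ^ n \<le> fact n * (2 / c) ^ n * exp (c / 2 * \<bar>x\<bar>)"
      by (simp only: mult_ac)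
    then have "\<bar>x\<bar> ^ n * exp (c / 2 * \<bar>x\<bar>) \<le> fact n * (2 / c) ^ n * exp (c / 2 * \<bar>x\<bar>) * exp (c / 2 * \<bar>x\<bar>)"
      by (intro mult_right_mono) auto
    also have "\<dots> = fact n * (2 / c) ^ n * exp (c * \<bar>x\<bar>)"
      by (simp add: mult.assoc exp_add[symmetric])
    finally show ?thesis .
  qed
  have meas: "(\<lambda>x. of_real (x ^ n) * iexp (t * x)) \<in> borel_measurable M" for n t
    unfolding real_distribution_measurable_iff[OF M]
    by (intro borel_measurable_continuous_onI continuous_intros)
  show ci: "complex_integrable M (\<lambda>x. of_real (x ^ n) * iexp (t * x))" for n t
  proof (rule Bochner_Integration.integrable_bound[OF _ meas])
    show "integrable M (\<lambda>x. fact n * (2 / c) ^ n * exp (c * \<bar>x\<bar>))" using ex by simp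
    have "\<bar>x\<bar> ^ n \<le> \<bar>x\<bar> ^ n * exp (c / 2 * \<bar>x\<bar>)" for x :: real
      using c mult_left_mono[of 1 "exp (c / 2 * \<bar>x\<bar>)" "\<bar>x\<bar> ^ n"] by simp
    then have "\<bar>x\<bar> ^ n \<le> fact n * (2 / c) ^ n * exp (c * \<bar>x\<bar>)" for x :: real
      using pw[of x n] order_trans by blast
    then show "AE x in M. norm (of_real (x ^ n) * iexp (t * x)) \<le> norm (fact n * (2 / c) ^ n * exp (c * \<bar>x\<bar>))"
      using c by (intro AE_I2) (simp add: norm_mult power_abs norm_power abs_of_nonneg)
  qed
  define S where "S N x = (\<Sum>m<N. (\<i> * of_real h) ^ m / fact m * (of_real (x ^ (n + m)) * iexp (t * x)))" for N x
  have S_eq: "S N x = of_real (x ^ n) * iexp (t * x) * (\<Sum>m<N. (\<i> * of_real h * of_real x) ^ m /\<^sub>R fact m)" for N x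
    unfolding S_def sum_distrib_left
    by (intro sum.cong refl) (simp add: power_add power_mult_distrib scaleR_conv_of_real divide_inverse mult_ac)
  have "(\<lambda>N. CLINT x|M. S N x) \<longlonglongrightarrow> (CLINT x|M. of_real (x ^ n) * iexp ((t + h) * x))"
  proof (rule integral_dominated_convergence[where w = "\<lambda>x. fact n * (2 / c) ^ n * exp (c * \<bar>x\<bar>)"])
    show "(\<lambda>x. of_real (x ^ n) * iexp ((t + h) * x)) \<in> borel_measurable M" by (rule meas)
    show "S N \<in> borel_measurable M" for N
      unfolding S_def[abs_def] by (intro borel_measurable_sum borel_measurable_times meas) auto
    show "integrable M (\<lambda>x. fact n * (2 / c) ^ n * exp (c * \<bar>x\<bar>))" using ex by simp
    show "AE x in M. (\<lambda>N. S N x) \<longlonglongrightarrow> of_real (x ^ n) * iexp ((t + h) * x)"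
    proof (rule AE_I2)
      fix x
      have "(\<lambda>m. (\<i> * of_real h * of_real x) ^ m /\<^sub>R fact m) sums exp (\<i> * of_real h * of_real x :: complex)"
        by (rule exp_converges)
      then have "(\<lambda>N. S N x) \<longlonglongrightarrow> of_real (x ^ n) * iexp (t * x) * exp (\<i> * of_real h * of_real x)"
        unfolding S_eq sums_def by (intro tendsto_mult tendsto_const)
      also have "of_real (x ^ n) * iexp (t * x) * exp (\<i> * of_real h * of_real x) = of_real (x ^ n) * iexp ((t + h) * x)"
        by (simp add: mult.assoc exp_add[symmetric] algebra_simps)
      finally show "(\<lambda>N. S N x) \<longlonglongrightarrow> of_real (x ^ n) * iexp ((t + h) * x)" .
    qed
    show "AE x in M. norm (S N x) \<le> fact n * (2 / c) ^ n * exp (c * \<bar>x\<bar>)" for N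
    proof (rule AE_I2)
      fix x
      have "norm (\<Sum>m<N. (\<i> * of_real h * of_real x :: complex) ^ m /\<^sub>R fact m) \<le> (\<Sum>m<N. \<bar>h * x\<bar> ^ m /\<^sub>R fact m)"
        by (rule order_trans[OF norm_sum]) (auto intro!: sum_mono simp: norm_mult norm_power abs_mult)
      also have "\<dots> \<le> exp \<bar>h * x\<bar>"
        unfolding exp_def by (intro sum_le_suminf summable_exp_generic) auto
      also have "\<dots> \<le> exp (c / 2 * \<bar>x\<bar>)"
        using mult_right_mono[OF h, of "\<bar>x\<bar>"] by (simp add: abs_mult)
      finally have "norm (\<Sum>m<N. (\<i> * of_real h * of_real x :: complex) ^ m /\<^sub>R fact m) \<le> exp (c / 2 * \<bar>x\<bar>)" .
      then have "norm (S N x) \<le> \<bar>x\<bar> ^ n * exp (c / 2 * \<bar>x\<bar>)"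
        unfolding S_eq norm_mult by (simp add: norm_power power_abs mult_left_mono)
      then show "norm (S N x) \<le> fact n * (2 / c) ^ n * exp (c * \<bar>x\<bar>)" using pw[of x n] by linarith
    qed
  qed
  also have "(\<lambda>N. CLINT x|M. S N x) = (\<lambda>N. \<Sum>m<N. (\<i> * of_real h) ^ m / fact m * (CLINT x|M. of_real (x ^ (n + m)) * iexp (t * x)))"
  proof
    fix N
    show "(CLINT x|M. S N x) = (\<Sum>m<N. (\<i> * of_real h) ^ m / fact m * (CLINT x|M. of_real (x ^ (n + m)) * iexp (t * x)))"
      unfolding S_def
      by (subst Bochner_Integration.integral_sum[OF integrable_mult_right[OF ci]]) (simp only: integral_mult_right_zero)
  qed
  finally show "(\<lambda>N. \<Sum>m<N. (\<i> * of_real h) ^ m / fact m * (CLINT x|M. of_real (x ^ (n + m)) * iexp (t * x)))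
    \<longlonglongrightarrow> (CLINT x|M. of_real (x ^ n) * iexp ((t + h) * x))" .
qed

text \<open>\<open>P 0\<close> is equality of moments. The admissible step length does not depend on
  the point, so finitely many equal steps reach any \<open>t\<close>, where \<open>n = 0\<close>
  gives equality of characteristic functions.\<close>

lemma moment_determinacy:
  fixes M M' :: "real measure"
  assumes M: "real_distribution M" "\<And>k. integrable M (\<lambda>x. x ^ k)"
    and M': "real_distribution M'" "\<And>k. integrable M' (\<lambda>x. x ^ k)"
    and eq: "\<And>k. moment M k = moment M' k"
    and bd: "\<And>k. moment M (2 * k) \<le> A * C ^ k * fact (2 * k)" and C: "C > 0"
  shows "M = M'"
proof -
  define c where "c = 1 / (2 * C + 2)"
  have c0: "c > 0" using C by (simp add: c_def)
  have ex: "integrable M (\<lambda>x. exp (c * \<bar>x\<bar>))"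
    by (rule integrable_exp_of_moment_bound[OF M bd C c_def])
  have ex': "integrable M' (\<lambda>x. exp (c * \<bar>x\<bar>))"
    by (rule integrable_exp_of_moment_bound[OF M' _ C c_def]) (use bd eq in simp)
  define P where "P t \<longleftrightarrow> (\<forall>n. (CLINT x|M. of_real (x ^ n) * iexp (t * x)) = (CLINT x|M'. of_real (x ^ n) * iexp (t * x)))" for t
  have step: "P (t + h)" if "P t" "\<bar>h\<bar> \<le> c / 2" for t h
    unfolding P_def
  proof
    fix n
    show "(CLINT x|M. of_real (x ^ n) * iexp ((t + h) * x)) = (CLINT x|M'. of_real (x ^ n) * iexp ((t + h) * x))"
      using moment_series_step(1)[OF M(1) ex c0 that(2), of n t] moment_series_step(1)[OF M'(1) ex' c0 that(2), of n t]
        \<open>P t\<close> unfolding P_def by (simp add: LIMSEQ_unique)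
  qed
  have P0: "P 0" unfolding P_def
  proof
    fix n
    have "(CLINT x|M. of_real (x ^ n)) = complex_of_real (moment M n)" for M
      unfolding moment_def by (rule integral_complex_of_real)
    then show "(CLINT x|M. of_real (x ^ n) * iexp (0 * x)) = (CLINT x|M'. of_real (x ^ n) * iexp (0 * x))"
      using eq by simp
  qed
  have P: "P t" for t
  proof -
    obtain N where "\<bar>t\<bar> / (c / 2) < real N" using reals_Archimedean2 by blast
    then have N: "\<bar>t\<bar> / (c / 2) < real (Suc N)" by simp
    define h where "h = t / real (Suc N)"
    have h: "\<bar>h\<bar> \<le> c / 2" using N c0 by (simp add: h_def abs_divide field_simps)
    have "P (real j * h)" for j
    proof (induction j)
      case (Suc j)
      have "real (Suc j) * h = real j * h + h" by (simp add: algebra_simps)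
      then show ?case using step[OF Suc h] by simp
    qed (simp add: P0)
    from this[of "Suc N"] show ?thesis by (simp add: h_def del: of_nat_Suc)
  qed
  have "char M t = char M' t" for t
    using P[of t] unfolding P_def char_def by (auto dest: spec[of _ 0])
  then show ?thesis using Levy_uniqueness[OF M(1) M'(1)] by blast
qed

section \<open>Moments of the semicircle\<close>

definition semicircle_integral :: "nat \<Rightarrow> real" where
  "semicircle_integral k = integral {-1..1} (\<lambda>x. x ^ k * sqrt (1 - x\<^sup>2))"

lemma semicircle_integrand_continuous: "continuous_on S (\<lambda>x::real. x ^ k * sqrt (1 - x\<^sup>2))"
  by (intro continuous_intros)

lemma semicircle_moment_eq: "semicircle_moment k = 2 / pi * semicircle_integral k"
proof -
  have nn: "0 \<le> indicator {-1..1} x * (2 / pi) * sqrt (1 - x\<^sup>2)" for x :: real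
    by (cases "x \<in> {-1..1}") (auto simp: abs_square_le_1 abs_le_iff)
  have "semicircle_moment k = (\<integral>x. (indicator {-1..1} x * (2 / pi) * sqrt (1 - x\<^sup>2)) *\<^sub>R x ^ k \<partial>lborel)"
    unfolding semicircle_moment_def moment_def semicircle_def
    by (subst integral_density) (use nn in auto)
  also have "\<dots> = (\<integral>x. 2 / pi * (indicator {-1..1} x *\<^sub>R (x ^ k * sqrt (1 - x\<^sup>2))) \<partial>lborel)"
    by (intro Bochner_Integration.integral_cong) (auto simp: indicator_def)
  also have "\<dots> = 2 / pi * (LINT x:{-1..1}|lborel. x ^ k * sqrt (1 - x\<^sup>2))"
    by (simp add: set_lebesgue_integral_def)
  also have "(LINT x:{-1..1}|lborel. x ^ k * sqrt (1 - x\<^sup>2)) = semicircle_integral k"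
    unfolding semicircle_integral_def
    by (intro set_borel_integral_eq_integral borel_integrable_atLeastAtMost' semicircle_integrand_continuous)
  finally show ?thesis .
qed

lemma semicircle_integral_0: "semicircle_integral 0 = pi / 2"
proof -
  have "((\<lambda>x. sqrt (1 - x\<^sup>2)) has_integral ((1 * sqrt (1 - 1\<^sup>2) + arcsin 1) / 2 - ((- 1) * sqrt (1 - (- 1)\<^sup>2) + arcsin (- 1)) / 2)) {-1..1}"
  \<comment> \<open>The version for open intervals is needed, since \<open>arcsin\<close> is not
    differentiable at the endpoints.\<close>
  proof (rule fundamental_theorem_of_calculus_interior)
    show "continuous_on {-1..1} (\<lambda>x. (x * sqrt (1 - x\<^sup>2) + arcsin x) / 2)"
      by (intro continuous_intros) auto
    fix x :: real assume x: "x \<in> {-1<..<1}"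
    have pos: "1 - x\<^sup>2 > 0" using x by (simp add: abs_square_less_1 abs_less_iff)
    have "((\<lambda>x. (x * sqrt (1 - x\<^sup>2) + arcsin x) / 2) has_real_derivative sqrt (1 - x\<^sup>2)) (at x)"
    proof -
      have sq: "sqrt (1 - x\<^sup>2) > 0" "sqrt (1 - x\<^sup>2) * sqrt (1 - x\<^sup>2) = 1 - x\<^sup>2" using pos by auto
      have "((\<lambda>x. (x * sqrt (1 - x\<^sup>2) + arcsin x) / 2) has_real_derivative
          ((1 * sqrt (1 - x\<^sup>2) + (inverse (sqrt (1 - x\<^sup>2)) / 2 * (0 - 2 * x)) * x) + inverse (sqrt (1 - x\<^sup>2))) / 2) (at x)"
        using x pos by (auto intro!: derivative_eq_intros simp: power2_eq_square)
      also have "((1 * sqrt (1 - x\<^sup>2) + (inverse (sqrt (1 - x\<^sup>2)) / 2 * (0 - 2 * x)) * x) + inverse (sqrt (1 - x\<^sup>2))) / 2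
          = sqrt (1 - x\<^sup>2)"
      proof -
        have "inverse (sqrt (1 - x\<^sup>2)) * (1 - x\<^sup>2) = sqrt (1 - x\<^sup>2)"
          using sq by (simp add: field_simps)
        then show ?thesis by (simp add: algebra_simps power2_eq_square)
      qed
      finally show ?thesis .
    qed
    then show "((\<lambda>x. (x * sqrt (1 - x\<^sup>2) + arcsin x) / 2) has_vector_derivative sqrt (1 - x\<^sup>2)) (at x)"
      by (simp add: has_real_derivative_iff_has_vector_derivative)
  qed simp
  then have "integral {-1..1} (\<lambda>x. sqrt (1 - x\<^sup>2)) = pi / 2"
    by (intro integral_unique) simp
  then show ?thesis by (simp add: semicircle_integral_def)
qed

lemma semicircle_integral_rec: "real (k + 4) * semicircle_integral (k + 2) = real (k + 1) * semicircle_integral k"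
proof -
  \<comment> \<open>\<open>x ^ (k + 1)\<close> times the 3/2-power of \<open>1 - x^2\<close>: it
    vanishes at both endpoints, and its derivative is a combination of the integrands of orders
    \<open>k\<close> and \<open>k + 2\<close>.\<close>
  let ?F = "\<lambda>x::real. x ^ (k + 1) * ((1 - x\<^sup>2) * sqrt (1 - x\<^sup>2))"
  let ?f = "\<lambda>x::real. real (k + 1) * (x ^ k * sqrt (1 - x\<^sup>2)) - real (k + 4) * (x ^ (k + 2) * sqrt (1 - x\<^sup>2))"
  have "(?f has_integral (?F 1 - ?F (- 1))) {-1..1}"
  proof (rule fundamental_theorem_of_calculus_interior)
    show "continuous_on {-1..1} ?F" by (intro continuous_intros)
    fix x :: real assume x: "x \<in> {-1<..<1}"
    have pos: "1 - x\<^sup>2 > 0" using x by (simp add: abs_square_less_1 abs_less_iff)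
    have sq: "sqrt (1 - x\<^sup>2) > 0" "sqrt (1 - x\<^sup>2) * sqrt (1 - x\<^sup>2) = 1 - x\<^sup>2" using pos by auto
    have D1: "((\<lambda>x. x ^ (k + 1)) has_real_derivative real (k + 1) * x ^ k) (at x)"
      using DERIV_pow[of "k + 1" x] by simp
    have D2: "((\<lambda>x. (1 - x\<^sup>2) * sqrt (1 - x\<^sup>2)) has_real_derivative
        ((0 - 2 * x) * sqrt (1 - x\<^sup>2) + (inverse (sqrt (1 - x\<^sup>2)) / 2 * (0 - 2 * x)) * (1 - x\<^sup>2))) (at x)"
      using pos by (auto intro!: derivative_eq_intros simp: power2_eq_square)
    have "(?F has_real_derivative
        real (k + 1) * x ^ k * ((1 - x\<^sup>2) * sqrt (1 - x\<^sup>2))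
        + ((0 - 2 * x) * sqrt (1 - x\<^sup>2) + (inverse (sqrt (1 - x\<^sup>2)) / 2 * (0 - 2 * x)) * (1 - x\<^sup>2)) * x ^ (k + 1)) (at x)"
      by (rule DERIV_mult[OF D1 D2])
    also have "real (k + 1) * x ^ k * ((1 - x\<^sup>2) * sqrt (1 - x\<^sup>2))
        + ((0 - 2 * x) * sqrt (1 - x\<^sup>2) + (inverse (sqrt (1 - x\<^sup>2)) / 2 * (0 - 2 * x)) * (1 - x\<^sup>2)) * x ^ (k + 1) = ?f x"
    proof -
      have "inverse (sqrt (1 - x\<^sup>2)) * (1 - x\<^sup>2) = sqrt (1 - x\<^sup>2)"
        using sq by (simp add: field_simps)
      then have t: "inverse (sqrt (1 - x\<^sup>2)) / 2 * (0 - 2 * x) * (1 - x\<^sup>2) = - x * sqrt (1 - x\<^sup>2)"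
        by (simp add: mult_ac)
      show ?thesis unfolding t by (simp add: algebra_simps power2_eq_square)
    qed
    finally show "(?F has_vector_derivative ?f x) (at x)"
      by (simp add: has_real_derivative_iff_has_vector_derivative)
  qed simp
  then have "integral {-1..1} ?f = 0" by (intro integral_unique) simp
  moreover have "integral {-1..1} ?f = real (k + 1) * semicircle_integral k - real (k + 4) * semicircle_integral (k + 2)"
    unfolding semicircle_integral_def
    by (subst integral_diff)
       (auto intro!: integrable_continuous_interval continuous_intros simp del: of_nat_add)
  ultimately show ?thesis by simp
qed

lemma semicircle_moment_0: "semicircle_moment 0 = 1"
  by (simp add: semicircle_moment_eq semicircle_integral_0)

lemma semicircle_moment_rec: "real (2 * k + 4) * semicircle_moment (2 * Suc k) = real (2 * k + 1) * semicircle_moment (2 * k)"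
proof -
  have "real (2 * k + 4) * (2 / pi * semicircle_integral (2 * k + 2)) = 2 / pi * (real (2 * k + 4) * semicircle_integral (2 * k + 2))"
    by (simp only: mult_ac)
  also have "\<dots> = 2 / pi * (real (2 * k + 1) * semicircle_integral (2 * k))"
    by (simp only: semicircle_integral_rec)
  also have "\<dots> = real (2 * k + 1) * (2 / pi * semicircle_integral (2 * k))"
    by (simp only: mult_ac)
  finally show ?thesis by (simp add: semicircle_moment_eq)
qed

lemma semicircle_moment_values:
  "semicircle_moment 2 = 1 / 4" "semicircle_moment 4 = 1 / 8" "semicircle_moment 6 = 5 / 64" "semicircle_moment 8 = 7 / 128"
proof -
  show 2: "semicircle_moment 2 = 1 / 4" using semicircle_moment_rec[of 0] semicircle_moment_0 by simp
  show 4: "semicircle_moment 4 = 1 / 8" using semicircle_moment_rec[of 1] 2 by simp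
  show 6: "semicircle_moment 6 = 5 / 64" using semicircle_moment_rec[of 2] 4 by simp
  show 8: "semicircle_moment 8 = 7 / 128" using semicircle_moment_rec[of 3] 6 by simp
qed

text \<open>
  With \<open>s\<close> the generating function of the even moments, the recursion says that \<open>g = 1 - z s / 2\<close> solves
  \<open>2 (1 - z) g' = - g\<close>, hence \<open>g ^ 2 = 1 - z\<close>.
\<close>

lemma semicircle_generating_function:
  fixes s :: "real fps"
  assumes s_def: "s = Abs_fps (\<lambda>k. semicircle_moment (2 * k))"
  shows "s = 1 + fps_const (1 / 4) * fps_X * s ^ 2"
proof -
  define g where "g = 1 - fps_const (1 / 2) * fps_X * s"
  have g0: "g $ 0 = 1" by (simp add: g_def mult.assoc)
  have gS: "g $ Suc n = - semicircle_moment (2 * n) / 2" for n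
    by (simp add: g_def mult.assoc s_def)
  have ode: "fps_const 2 * ((1 - fps_X) * fps_deriv g) = - g"
  proof (rule fps_ext)
    fix n
    show "(fps_const 2 * ((1 - fps_X) * fps_deriv g)) $ n = (- g) $ n"
    proof (cases n)
      case 0
      then show ?thesis using gS[of 0] g0 semicircle_moment_0 by (simp add: left_diff_distrib)
    next
      case (Suc k)
      have "(fps_const 2 * ((1 - fps_X) * fps_deriv g)) $ n = 2 * (real (Suc (Suc k)) * g $ Suc (Suc k) - real (Suc k) * g $ Suc k)"
        by (simp add: Suc left_diff_distrib)
      also have "\<dots> = - (real (2 * k + 4) * semicircle_moment (2 * Suc k)) / 2 + real (Suc k) * semicircle_moment (2 * k)"
        unfolding gS by (simp add: field_simps)
      also have "\<dots> = semicircle_moment (2 * k) / 2"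
        unfolding semicircle_moment_rec by (simp add: field_simps)
      finally show ?thesis by (simp add: Suc gS)
    qed
  qed
  \<comment> \<open>Squaring turns the equation for \<open>g\<close> into
    \<open>(1 - z) * h' = - h\<close>, whose coefficient recursion stops after the linear term; no
    square root of a series is required.\<close>
  define h where "h = g ^ 2"
  have h0: "h $ 0 = 1" by (simp add: h_def power2_eq_square g0)
  have "(1 - fps_X) * fps_deriv h = g * (fps_const 2 * ((1 - fps_X) * fps_deriv g))"
    by (simp add: h_def power2_eq_square numeral_fps_const[symmetric] algebra_simps)
  also have "\<dots> = - h" unfolding ode by (simp add: h_def power2_eq_square)
  finally have hode: "(1 - fps_X) * fps_deriv h = - h" .
  have h1: "h $ 1 = - 1"
    using arg_cong[OF hode, of "\<lambda>f. f $ 0"] h0 by (simp add: left_diff_distrib)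
  have hrec: "real (Suc (Suc n)) * h $ Suc (Suc n) = real n * h $ Suc n" for n
    using arg_cong[OF hode, of "\<lambda>f. f $ Suc n"] by (simp add: left_diff_distrib algebra_simps)
  have h2: "h $ Suc (Suc n) = 0" for n
  proof (induction n)
    case 0
    then show ?case using hrec[of 0] by simp
  next
    case (Suc n)
    have "real (Suc (Suc (Suc n))) * h $ Suc (Suc (Suc n)) = 0" using hrec[of "Suc n"] Suc by simp
    then show ?case by (simp del: of_nat_Suc)
  qed
  have "h = 1 - fps_X"
  proof (rule fps_ext)
    fix n
    consider "n = 0" | "n = 1" | k where "n = Suc (Suc k)" by (metis One_nat_def not0_implies_Suc)
    then show "h $ n = (1 - fps_X) $ n" using h0 h1 h2 by cases auto
  qed
  \<comment> \<open>The definition of \<open>g\<close> squared, with terms grouped so that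
    comparison with \<open>1 - fps_X\<close> leaves the quadratic equation times one factor
    \<open>fps_X\<close>.\<close>
  moreover have "h = 1 - fps_X * s + fps_X * (fps_const (1 / 4) * fps_X * s ^ 2)"
  proof -
    define H where "H = fps_const (1 / 2 :: real)"
    have "H * H = fps_const (1 / 4)" "2 * H = 1" "H * 2 = 1"
      by (simp_all add: H_def numeral_fps_const)
    moreover have "h = 1 - (2 * H) * (fps_X * s) + fps_X * ((H * H) * fps_X * s ^ 2)"
      unfolding h_def g_def H_def[symmetric] by (simp add: algebra_simps power2_eq_square)
    ultimately show ?thesis by simp
  qed
  ultimately have "fps_X * s = fps_X * (1 + fps_const (1 / 4) * fps_X * s ^ 2)"
    by (simp add: algebra_simps)
  then show ?thesis by (simp only: mult_cancel_left fps_X_neq_zero simp_thms)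
qed

section \<open>Regular graphs with few cycles\<close>

definition reduced_words :: "nat \<Rightarrow> nat \<Rightarrow> nat list set" where
  "reduced_words d r = {w. set w \<subseteq> {..<d} \<and> length w \<le> r \<and> distinct_adj w}"

text \<open>
  The reduced words are the vertices of a ball of the \<open>d\<close>-regular tree, whose edges are coloured by letters;
  \<open>letter_swap d r i\<close> exchanges the endpoints of the edges of colour \<open>i\<close>.
\<close>

definition letter_swap :: "nat \<Rightarrow> nat \<Rightarrow> nat \<Rightarrow> nat list \<Rightarrow> nat list" where
  "letter_swap d r i w =
     (if w \<notin> reduced_words d r then w
      else if w \<noteq> [] \<and> hd w = i then tl w else if length w < r then i # w else w)"

lemma finite_reduced_words: "finite (reduced_words d r)"
  by (rule finite_subset[OF _ finite_lists_length_le[of "{..<d}" r]]) (auto simp: reduced_words_def)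

lemma letter_swap_involution:
  assumes "i < d"
  shows "letter_swap d r i (letter_swap d r i w) = w"
proof (cases "w \<in> reduced_words d r")
  case True
  show ?thesis
  proof (cases w)
    case Nil
    then show ?thesis using True assms by (auto simp: letter_swap_def reduced_words_def)
  next
    case (Cons a v)
    show ?thesis
    proof (cases "a = i")
      case True
      have "v \<in> reduced_words d r" "length v < r" "v = [] \<or> hd v \<noteq> i"
        using \<open>w \<in> _\<close> Cons True by (auto simp: reduced_words_def distinct_adj_Cons)
      then show ?thesis using Cons True \<open>w \<in> _\<close> by (auto simp: letter_swap_def)
    next
      case False
      have "length w < r \<Longrightarrow> i # w \<in> reduced_words d r"
        using \<open>w \<in> _\<close> Cons False assms by (auto simp: reduced_words_def distinct_adj_Cons)
      then show ?thesis using Cons False \<open>w \<in> _\<close> by (auto simp: letter_swap_def)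
    qed
  qed
qed (simp add: letter_swap_def)

lemma letter_swap_permutes:
  assumes "i < d"
  shows "letter_swap d r i permutes reduced_words d r"
  unfolding permutes_def
proof (intro conjI allI impI)
  show "x \<notin> reduced_words d r \<Longrightarrow> letter_swap d r i x = x" for x by (simp add: letter_swap_def)
  show "\<exists>!x. letter_swap d r i x = y" for y
    using letter_swap_involution[OF assms] by metis
qed

definition word_perms :: "nat \<Rightarrow> nat \<Rightarrow> (nat list \<Rightarrow> nat list) set" where
  "word_perms d r = {f. f permutes reduced_words d r}"

lemma finite_word_perms: "finite (word_perms d r)"
  unfolding word_perms_def by (rule finite_permutations[OF finite_reduced_words])

definition perm_label :: "nat \<Rightarrow> nat \<Rightarrow> (nat list \<Rightarrow> nat list) \<Rightarrow> nat" where
  "perm_label d r = (SOME b. bij_betw b (word_perms d r) {0..<card (word_perms d r)})"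

lemma perm_label: "bij_betw (perm_label d r) (word_perms d r) {0..<card (word_perms d r)}"
  unfolding perm_label_def by (rule someI_ex[OF ex_bij_betw_finite_nat[OF finite_word_perms]])

text \<open>All permutations of the words serve as vertices, not only the group generated by the
  swaps: this gives a disjoint union of copies of its Cayley graph, with the same local structure
  and an easy vertex count. Labels are needed because vertices are numbers.\<close>

definition cayley_graph :: "nat \<Rightarrow> nat \<Rightarrow> fin_graph" where
  "cayley_graph d r = \<lparr>nverts = card (word_perms d r),
     edges = {{perm_label d r f, perm_label d r (letter_swap d r i \<circ> f)} | f i. f \<in> word_perms d r \<and> i < d}\<rparr>"

lemma letter_swap_comp:
  assumes "f \<in> word_perms d r" "i < d"
  shows "letter_swap d r i \<circ> f \<in> word_perms d r"
  using assms permutes_compose[OF _ letter_swap_permutes] by (auto simp: word_perms_def)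

lemma perm_label_inj:
  assumes "f \<in> word_perms d r" "g \<in> word_perms d r"
  shows "perm_label d r f = perm_label d r g \<longleftrightarrow> f = g"
  using assms perm_label[of d r] by (auto simp: bij_betw_def inj_on_def)

lemma letter_swap_comp_involution: "i < d \<Longrightarrow> letter_swap d r i \<circ> (letter_swap d r i \<circ> f) = f"
  by (auto simp: letter_swap_involution)

lemma letter_swap_Nil: "i < d \<Longrightarrow> r \<ge> 1 \<Longrightarrow> letter_swap d r i [] = [i]"
  by (auto simp: letter_swap_def reduced_words_def)

text \<open>Evaluation at the preimage of the empty word turns identities between products of swaps
  into statements about single words.\<close>

lemma word_perms_preimage_Nil:
  assumes "f \<in> word_perms d r"
  obtains u where "f u = []"
  using assms permutes_surj[of f] by (auto simp: word_perms_def surj_def) metis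

lemma letter_swap_comp_neq:
  assumes "f \<in> word_perms d r" "i < d" "r \<ge> 1"
  shows "letter_swap d r i \<circ> f \<noteq> f"
proof
  assume eq: "letter_swap d r i \<circ> f = f"
  obtain u where "f u = []" using word_perms_preimage_Nil[OF assms(1)] .
  then show False using fun_cong[OF eq, of u] letter_swap_Nil[of i d r] assms by simp
qed

lemma letter_swap_comp_inj:
  assumes "f \<in> word_perms d r" "i < d" "j < d" "r \<ge> 1" "letter_swap d r i \<circ> f = letter_swap d r j \<circ> f"
  shows "i = j"
proof -
  obtain u where "f u = []" using word_perms_preimage_Nil[OF assms(1)] .
  then have "letter_swap d r i [] = letter_swap d r j []" using assms(5) by (metis comp_apply)
  then show ?thesis using assms by (simp add: letter_swap_Nil)
qed

lemma perm_label_less: "f \<in> word_perms d r \<Longrightarrow> perm_label d r f < card (word_perms d r)"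
  using perm_label[of d r] by (auto simp: bij_betw_def)

lemma cayley_graph_edge_iff:
  assumes f: "f \<in> word_perms d r" and g: "g \<in> word_perms d r"
  shows "{perm_label d r f, perm_label d r g} \<in> edges (cayley_graph d r) \<longleftrightarrow> (\<exists>i<d. g = letter_swap d r i \<circ> f)"
proof
  assume "{perm_label d r f, perm_label d r g} \<in> edges (cayley_graph d r)"
  then obtain h i where hi: "h \<in> word_perms d r" "i < d"
    "{perm_label d r f, perm_label d r g} = {perm_label d r h, perm_label d r (letter_swap d r i \<circ> h)}"
    by (auto simp: cayley_graph_def)
  then have "(f = h \<and> g = letter_swap d r i \<circ> h) \<or> (g = h \<and> f = letter_swap d r i \<circ> h)"
    using f g by (auto simp: doubleton_eq_iff perm_label_inj letter_swap_comp)
  then show "\<exists>i<d. g = letter_swap d r i \<circ> f"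
    using hi(2) letter_swap_comp_involution by metis
next
  assume "\<exists>i<d. g = letter_swap d r i \<circ> f"
  then show "{perm_label d r f, perm_label d r g} \<in> edges (cayley_graph d r)"
    using f by (auto simp: cayley_graph_def)
qed

lemma simple_cayley_graph:
  assumes "r \<ge> 1"
  shows "simple_graph (cayley_graph d r)"
  unfolding simple_graph_def
proof
  fix e assume "e \<in> edges (cayley_graph d r)"
  then obtain f i where fi: "f \<in> word_perms d r" "i < d" "e = {perm_label d r f, perm_label d r (letter_swap d r i \<circ> f)}"
    by (auto simp: cayley_graph_def)
  have g: "letter_swap d r i \<circ> f \<in> word_perms d r" using fi letter_swap_comp by blast
  have "perm_label d r f \<noteq> perm_label d r (letter_swap d r i \<circ> f)"
    using fi g letter_swap_comp_neq[OF fi(1,2) assms] by (metis perm_label_inj)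
  then show "e \<in> {e. e \<subseteq> {..<nverts (cayley_graph d r)} \<and> card e = 2}"
    using fi g by (auto simp: cayley_graph_def perm_label_less)
qed

lemma regular_cayley_graph:
  assumes r: "r \<ge> 1"
  shows "regular_graph d (cayley_graph d r)"
  unfolding regular_graph_def
proof (intro conjI allI impI)
  show "simple_graph (cayley_graph d r)" by (rule simple_cayley_graph[OF r])
  fix v assume "v < nverts (cayley_graph d r)"
  then have "v \<in> perm_label d r ` word_perms d r"
    using perm_label[of d r] by (auto simp: cayley_graph_def bij_betw_def)
  then obtain f where f: "f \<in> word_perms d r" "v = perm_label d r f" by auto
  have "{e \<in> edges (cayley_graph d r). v \<in> e} = (\<lambda>i. {v, perm_label d r (letter_swap d r i \<circ> f)}) ` {..<d}"
  proof (intro equalityI subsetI)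
    fix e assume "e \<in> {e \<in> edges (cayley_graph d r). v \<in> e}"
    then obtain h i where hi: "h \<in> word_perms d r" "i < d" "e = {perm_label d r h, perm_label d r (letter_swap d r i \<circ> h)}" "v \<in> e"
      by (auto simp: cayley_graph_def)
    then have "f = h \<or> f = letter_swap d r i \<circ> h"
      using f by (auto simp: perm_label_inj letter_swap_comp)
    then have "e = {v, perm_label d r (letter_swap d r i \<circ> f)}"
      using hi f letter_swap_comp_involution[OF hi(2), of r h] by auto
    then show "e \<in> (\<lambda>i. {v, perm_label d r (letter_swap d r i \<circ> f)}) ` {..<d}" using hi by auto
  next
    fix e assume "e \<in> (\<lambda>i. {v, perm_label d r (letter_swap d r i \<circ> f)}) ` {..<d}"
    then show "e \<in> {e \<in> edges (cayley_graph d r). v \<in> e}" using f by (auto simp: cayley_graph_def)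
  qed
  moreover have "inj_on (\<lambda>i. {v, perm_label d r (letter_swap d r i \<circ> f)}) {..<d}"
  proof (rule inj_onI)
    fix i j assume ij: "i \<in> {..<d}" "j \<in> {..<d}"
      "{v, perm_label d r (letter_swap d r i \<circ> f)} = {v, perm_label d r (letter_swap d r j \<circ> f)}"
    then have "perm_label d r (letter_swap d r i \<circ> f) = perm_label d r (letter_swap d r j \<circ> f)"
      by (auto simp: doubleton_eq_iff)
    then have "letter_swap d r i \<circ> f = letter_swap d r j \<circ> f"
      using ij f by (simp add: perm_label_inj letter_swap_comp)
    then show "i = j" using letter_swap_comp_inj[OF f(1) _ _ r] ij by auto
  qed
  ultimately show "card {e \<in> edges (cayley_graph d r). v \<in> e} = d"
    by (simp add: card_image)
qed

text \<open>
  Along a cycle consecutive colours differ, so the letters applied to the empty word pile up to a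
  reduced word as long as the cycle, which could only be empty if letters were lost beyond length \<open>r\<close>.
\<close>

lemma cayley_graph_no_short_cycles:
  assumes k: "3 \<le> k" "k \<le> r"
  shows "cycles (cayley_graph d r) k = {}"
proof (rule ccontr)
  assume "cycles (cayley_graph d r) k \<noteq> {}"
  then obtain vs where vs: "distinct vs" "length vs = k"
    and edge: "\<And>i. i < k \<Longrightarrow> {vs ! i, vs ! (Suc i mod k)} \<in> edges (cayley_graph d r)"
    unfolding cycles_def by blast
  have sub: "e \<subseteq> {..<card (word_perms d r)}" if "e \<in> edges (cayley_graph d r)" for e
    using simple_cayley_graph[of r d] k that by (auto simp: simple_graph_def cayley_graph_def)
  have "\<exists>f. f \<in> word_perms d r \<and> vs ! i = perm_label d r f" if "i < k" for i
  proof -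
    have "vs ! i \<in> {0..<card (word_perms d r)}" using sub[OF edge[OF that]] by auto
    then show ?thesis using perm_label[of d r] by (auto simp: bij_betw_def image_iff)
  qed
  then obtain F where F: "\<And>i. i < k \<Longrightarrow> F i \<in> word_perms d r" "\<And>i. i < k \<Longrightarrow> vs ! i = perm_label d r (F i)"
    by metis
  have mk: "i mod k < k" for i using k by simp
  have "\<exists>c<d. F (Suc i mod k) = letter_swap d r c \<circ> F i" if "i < k" for i
    using edge[OF that] F(1)[OF that] F(1)[OF mk] unfolding F(2)[OF that] F(2)[OF mk]
    by (simp add: cayley_graph_edge_iff)
  then obtain c where c: "\<And>i. i < k \<Longrightarrow> c i < d" "\<And>i. i < k \<Longrightarrow> F (Suc i mod k) = letter_swap d r (c i) \<circ> F i"
    by metis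
  have Fne: "F i \<noteq> F j" if "i < k" "j < k" "i \<noteq> j" for i j
    using vs F that by (metis nth_eq_iff_index_eq)
  have cne: "c (Suc i) \<noteq> c i" if "Suc i < k" for i
  proof
    assume eq: "c (Suc i) = c i"
    have "F (Suc (Suc i) mod k) = letter_swap d r (c i) \<circ> F (Suc i)"
      using c(2)[OF that] eq by simp
    moreover have "F (Suc i) = letter_swap d r (c i) \<circ> F i"
      using c(2)[of i] that by simp
    ultimately have "F (Suc (Suc i) mod k) = F i"
      using letter_swap_comp_involution[of "c i" d r "F i"] c(1)[of i] that by simp
    \<comment> \<open>Equal consecutive colours would lead back after two steps, which is impossible
      on a cycle of length at least 3.\<close>
    moreover have "Suc (Suc i) mod k \<noteq> i"
      using k that by (cases "Suc (Suc i) = k") (auto simp: mod_if)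
    ultimately show False using Fne[of "Suc (Suc i) mod k" i] that mk by auto
  qed
  obtain u where u: "F 0 u = []" using word_perms_preimage_Nil[OF F(1)[of 0]] k by auto
  \<comment> \<open>The letter just pushed is the last colour used and differs from the next one, so
    the next swap pushes again; lengths stay below \<open>k\<close>, hence below the cutoff
    \<open>r\<close>.\<close>
  have "length (F i u) = i \<and> (\<forall>j. i = Suc j \<longrightarrow> hd (F i u) = c j) \<and> F i u \<in> reduced_words d r" if "i < k" for i
    using that
  proof (induction i)
    case 0
    then show ?case using u by (simp add: reduced_words_def)
  next
    case (Suc i)
    then have IH: "length (F i u) = i" "F i u \<in> reduced_words d r" "F i u \<noteq> [] \<Longrightarrow> hd (F i u) \<noteq> c i"
      using cne[of "i - 1"] by (cases i; auto)+
    have "F (Suc i) = letter_swap d r (c i) \<circ> F i" using c(2)[of i] Suc.prems by simp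
    then have eq: "F (Suc i) u = c i # F i u"
      using IH Suc.prems k by (auto simp: letter_swap_def)
    have "c i < d" using c(1)[of i] Suc.prems by simp
    then have "c i # F i u \<in> reduced_words d r"
      using IH Suc.prems k by (auto simp: reduced_words_def distinct_adj_Cons)
    then show ?case using eq IH by simp
  qed
  note piles = this[of "k - 1"]
  have L: "length (F (k - 1) u) = k - 1" "hd (F (k - 1) u) = c (k - 2)"
      "F (k - 1) u \<in> reduced_words d r"
  proof -
    have "k - 1 = Suc (k - 2)" using k by simp
    moreover have "\<forall>j. k - 1 = Suc j \<longrightarrow> hd (F (k - 1) u) = c j" using piles k by simp
    ultimately show "hd (F (k - 1) u) = c (k - 2)" by blast
  qed (use k piles in auto)
  \<comment> \<open>The closing swap removes at most one letter from a word of length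
    \<open>k - 1 \<ge> 2\<close>, so it cannot produce the empty word.\<close>
  have "F 0 = letter_swap d r (c (k - 1)) \<circ> F (k - 1)"
    using c(2)[of "k - 1"] k by simp
  then have "[] = letter_swap d r (c (k - 1)) (F (k - 1) u)" using u by (metis comp_apply)
  moreover have "F (k - 1) u \<noteq> []" "tl (F (k - 1) u) \<noteq> []" using L k by (auto simp flip: length_greater_0_conv)
  ultimately show False using L by (auto simp: letter_swap_def split: if_splits)
qed

lemma card_word_perms_ge:
  assumes d: "d \<ge> 2"
  shows "card (word_perms d r) \<ge> r"
proof -
  have "{..r} \<subseteq> length ` reduced_words d r"
  proof
    fix l assume l: "l \<in> {..r}"
    \<comment> \<open>Alternating letters 0 and 1, available as \<open>d \<ge> 2\<close>, give a
      reduced word of every length.\<close>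
    define w where "w = map (\<lambda>i::nat. i mod 2) [0..<l]"
    have "distinct_adj w"
      unfolding distinct_adj_conv_nth w_def by (auto simp: mod_Suc)
    moreover have "set w \<subseteq> {..<d}" using d by (auto simp: w_def intro: less_le_trans[OF mod_less_divisor])
    ultimately have "w \<in> reduced_words d r" using l by (simp add: reduced_words_def w_def)
    then show "l \<in> length ` reduced_words d r" by (rule rev_image_eqI) (simp add: w_def)
  qed
  then have "card {..r} \<le> card (length ` reduced_words d r)"
    by (intro card_mono finite_imageI finite_reduced_words)
  also have "\<dots> \<le> card (reduced_words d r)" by (intro card_image_le finite_reduced_words)
  also have "\<dots> \<le> fact (card (reduced_words d r))" by (rule fact_ge_self)
  also have "\<dots> = card (word_perms d r)"
    unfolding word_perms_def by (rule card_permutations[OF refl finite_reduced_words, symmetric])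
  finally show ?thesis by simp
qed

text \<open>The \<open>i\<close>-th graph has no cycle of length between 3 and \<open>i + 1\<close>,
  so every cycle count is eventually zero.\<close>

lemma few_cycles_sequence_exists:
  assumes d: "d \<ge> 2"
  shows "\<exists>G. few_cycles_sequence d G"
proof
  define G where "G i = cayley_graph d (Suc i)" for i
  show "few_cycles_sequence d G"
    unfolding few_cycles_sequence_def
  proof (intro conjI allI impI)
    show "regular_graph d (G i)" for i by (simp add: G_def regular_cayley_graph)
    show "filterlim (\<lambda>i. nverts (G i)) at_top sequentially"
    proof (rule filterlim_at_top_mono[OF filterlim_Suc])
      show "\<forall>\<^sub>F i in sequentially. Suc i \<le> nverts (G i)"
        using card_word_perms_ge[OF d] by (auto simp: G_def cayley_graph_def)
    qed
    fix k :: nat assume k: "k \<ge> 3"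
    have "\<forall>\<^sub>F i in sequentially. real (card (cycles (G i) k)) = 0"
      using eventually_ge_at_top[of k]
      by eventually_elim (use k in \<open>simp add: G_def cayley_graph_no_short_cycles\<close>)
    then have "(\<lambda>i. real (card (cycles (G i) k))) \<in> o(\<lambda>i. real (nverts (G i))) \<longleftrightarrow>
        (\<lambda>i. 0) \<in> o(\<lambda>i. real (nverts (G i)))"
      by (rule landau_o.small.in_cong)
    then show "(\<lambda>i. real (card (cycles (G i) k))) \<in> o(\<lambda>i. real (nverts (G i)))" by simp
  qed
qed

section \<open>Walks in locally tree-like graphs\<close>

definition nbrs :: "'a set set \<Rightarrow> 'a set \<Rightarrow> 'a \<Rightarrow> 'a set" where
  "nbrs E U x = {u \<in> U. {x, u} \<in> E}"

text \<open>Walks are confined to \<open>U\<close>, so that removing a visited vertex from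
  \<open>U\<close> expresses the passage to the branches hanging off it.\<close>

fun walk_sum :: "'a set set \<Rightarrow> ('a set \<Rightarrow> real) \<Rightarrow> 'a set \<Rightarrow> nat \<Rightarrow> 'a \<Rightarrow> 'a \<Rightarrow> real" where
  "walk_sum E w U 0 x y = of_bool (x = y)"
| "walk_sum E w U (Suc k) x y = (\<Sum>u\<in>nbrs E U x. w {x, u} * walk_sum E w U k u y)"

definition adj :: "'a set set \<Rightarrow> 'a set \<Rightarrow> ('a \<times> 'a) set" where
  "adj E U = {(a, b). a \<in> U \<and> b \<in> U \<and> {a, b} \<in> E}"

definition reach :: "'a set set \<Rightarrow> 'a set \<Rightarrow> nat \<Rightarrow> 'a \<Rightarrow> 'a set" where
  "reach E U n x = {z. \<exists>i\<le>n. (x, z) \<in> adj E U ^^ i}"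

text \<open>
  \<open>U\<close> is the set of vertices not yet visited, and \<open>e\<close> the number of children of \<open>x\<close>, which is
  \<open>d\<close> for the root and \<open>d - 1\<close> below it.
\<close>

fun tree_like :: "'a set set \<Rightarrow> nat \<Rightarrow> nat \<Rightarrow> nat \<Rightarrow> 'a set \<Rightarrow> 'a \<Rightarrow> bool" where
  "tree_like E d 0 e U x \<longleftrightarrow> True"
| "tree_like E d (Suc n) e U x \<longleftrightarrow> card (nbrs E U x) = e \<and>
     (\<forall>y\<in>nbrs E U x. tree_like E d n (d - 1) (U - {x}) y) \<and>
     (\<forall>y\<in>nbrs E U x. \<forall>y'\<in>nbrs E U x. y \<noteq> y' \<longrightarrow> reach E (U - {x}) n y \<inter> reach E (U - {x}) n y' = {})"

text \<open>The continued fraction for the diagonal resolvent entry of a tree with given weights,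
  cut at depth \<open>n\<close>; the random series \<open>R\<close> of the moment recursion, before
  taking expectations.\<close>

fun tree_res :: "'a set set \<Rightarrow> ('a set \<Rightarrow> real) \<Rightarrow> nat \<Rightarrow> 'a set \<Rightarrow> 'a \<Rightarrow> real fps" where
  "tree_res E w 0 U x = 1"
| "tree_res E w (Suc n) U x =
     inverse (1 - (\<Sum>y\<in>nbrs E U x. fps_const ((w {x, y})\<^sup>2) * fps_X * tree_res E w n (U - {x}) y))"

lemma nbrs_subset: "nbrs E U x \<subseteq> U" by (auto simp: nbrs_def)

lemma finite_nbrs: "finite U \<Longrightarrow> finite (nbrs E U x)"
  using finite_subset[OF nbrs_subset] .

lemma adj_sym: "(a, b) \<in> adj E U \<Longrightarrow> (b, a) \<in> adj E U"
  by (auto simp: adj_def insert_commute)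

lemma relpow_adj_sym: "(a, b) \<in> adj E U ^^ i \<Longrightarrow> (b, a) \<in> adj E U ^^ i"
proof (induction i arbitrary: b)
  case (Suc i)
  then obtain c where "(a, c) \<in> adj E U ^^ i" "(c, b) \<in> adj E U" by auto
  then show ?case using Suc.IH adj_sym by (metis relpow_Suc_I2)
qed auto

lemma adj_nbrs: "a \<in> U \<Longrightarrow> (a, b) \<in> adj E U \<longleftrightarrow> b \<in> nbrs E U a"
  by (auto simp: adj_def nbrs_def)

lemma reachI: "i \<le> n \<Longrightarrow> (x, z) \<in> adj E U ^^ i \<Longrightarrow> z \<in> reach E U n x"
  by (auto simp: reach_def)

lemma reach_sym: "z \<in> reach E U n x \<longleftrightarrow> x \<in> reach E U n z"
proof -
  have "(x, z) \<in> adj E U ^^ i \<longleftrightarrow> (z, x) \<in> adj E U ^^ i" for i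
    by (meson relpow_adj_sym)
  then show ?thesis by (simp add: reach_def)
qed

lemma walk_sum_nonzero_relpow:
  assumes "x \<in> U" "walk_sum E w U k x y \<noteq> 0"
  shows "(x, y) \<in> adj E U ^^ k"
  using assms
proof (induction k arbitrary: x)
  case (Suc k)
  obtain u where u: "u \<in> nbrs E U x" "w {x, u} * walk_sum E w U k u y \<noteq> 0"
    using Suc.prems(2) by (auto elim: sum.not_neutral_contains_not_neutral)
  then have "(u, y) \<in> adj E U ^^ k" using Suc.IH[of u] nbrs_subset by fastforce
  moreover have "(x, u) \<in> adj E U" using u Suc.prems adj_nbrs by metis
  ultimately show ?case by (metis relpow_Suc_I2)
qed (auto split: if_splits)

text \<open>Such a walk has a vertex within \<open>n\<close> steps of both ends, which would lie in
  both balls.\<close>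

lemma walk_sum_eq_0_of_disjoint_reach:
  assumes "x \<in> U" "reach E U n x \<inter> reach E U n y = {}" "k \<le> 2 * n"
  shows "walk_sum E w U k x y = 0"
proof (rule ccontr)
  assume "walk_sum E w U k x y \<noteq> 0"
  then have "(x, y) \<in> adj E U ^^ k" by (rule walk_sum_nonzero_relpow[OF assms(1)])
  then have "(x, y) \<in> adj E U ^^ min k n O adj E U ^^ (k - min k n)"
    unfolding relpow_add[symmetric] by simp
  then obtain z where "(x, z) \<in> adj E U ^^ min k n" "(z, y) \<in> adj E U ^^ (k - min k n)"
    by blast
  then have "z \<in> reach E U n x" "y \<in> reach E U n z"
    using assms(3) by (auto intro: reachI[of "min k n"] reachI[of "k - min k n"])
  then have "z \<in> reach E U n x" "z \<in> reach E U n y" using reach_sym[of y E U n z] by simp_all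
  then show False using assms(2) by auto
qed

text \<open>The walk is cut at its first arrival at \<open>x\<close>: \<open>j\<close> steps
  avoiding \<open>x\<close>, then the edge from \<open>y\<close> to \<open>x\<close>, then an
  arbitrary closed walk at \<open>x\<close>.\<close>

lemma walk_sum_last_passage:
  assumes U: "finite U" "x \<in> U" and x: "{x, x} \<notin> E" and u: "u \<in> U - {x}"
  shows "walk_sum E w U k u x =
    (\<Sum>j<k. (\<Sum>y\<in>nbrs E U x. walk_sum E w (U - {x}) j u y * w {x, y}) * walk_sum E w U (k - 1 - j) x x)"
  using u
proof (induction k arbitrary: u)
  case (Suc k)
  let ?V = "U - {x}"
  have fin: "finite (nbrs E U u)" for u by (rule finite_nbrs[OF U(1)])
  have nb: "nbrs E U u = (if {u, x} \<in> E then {x} else {}) \<union> nbrs E ?V u" "x \<notin> nbrs E ?V u"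
    using U(2) unfolding nbrs_def by (simp_all, blast)
  have "walk_sum E w U (Suc k) u x = (if {u, x} \<in> E then w {u, x} * walk_sum E w U k x x else 0)
     + (\<Sum>v\<in>nbrs E ?V u. w {u, v} * walk_sum E w U k v x)"
    unfolding walk_sum.simps(2)[of E w U k u x] nb(1)
    using nb(2) finite_nbrs[of ?V] U by (subst sum.union_disjoint) auto
  also have "(if {u, x} \<in> E then w {u, x} * walk_sum E w U k x x else 0) =
     (\<Sum>y\<in>nbrs E U x. walk_sum E w ?V 0 u y * w {x, y}) * walk_sum E w U k x x"
  proof -
    have "(\<Sum>y\<in>nbrs E U x. walk_sum E w ?V 0 u y * w {x, y}) = (\<Sum>y\<in>nbrs E U x. if y = u then w {x, u} else 0)"
      by (intro sum.cong) auto
    also have "\<dots> = (if u \<in> nbrs E U x then w {x, u} else 0)"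
      using fin by (simp add: sum.delta)
    also have "\<dots> = (if {u, x} \<in> E then w {u, x} else 0)"
      using Suc.prems by (auto simp: nbrs_def insert_commute)
    finally show ?thesis by simp
  qed
  also have "(\<Sum>v\<in>nbrs E ?V u. w {u, v} * walk_sum E w U k v x) =
    (\<Sum>v\<in>nbrs E ?V u. w {u, v} * (\<Sum>j<k. (\<Sum>y\<in>nbrs E U x. walk_sum E w ?V j v y * w {x, y}) * walk_sum E w U (k - 1 - j) x x))"
    using Suc.IH nbrs_subset[of E ?V u] by (intro sum.cong refl) auto
  also have "\<dots> = (\<Sum>j<k. (\<Sum>v\<in>nbrs E ?V u. \<Sum>y\<in>nbrs E U x. w {u, v} * (walk_sum E w ?V j v y * w {x, y})) * walk_sum E w U (k - 1 - j) x x)"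
    unfolding sum_distrib_left sum_distrib_right by (subst sum.swap) (simp add: mult_ac)
  also have "\<dots> = (\<Sum>j<k. (\<Sum>y\<in>nbrs E U x. walk_sum E w ?V (Suc j) u y * w {x, y}) * walk_sum E w U (k - 1 - j) x x)"
  proof -
    have "(\<Sum>v\<in>nbrs E ?V u. \<Sum>y\<in>nbrs E U x. w {u, v} * (walk_sum E w ?V j v y * w {x, y}))
      = (\<Sum>y\<in>nbrs E U x. walk_sum E w ?V (Suc j) u y * w {x, y})" for j
      by (subst sum.swap) (simp add: sum_distrib_right sum_distrib_left mult_ac)
    then show ?thesis by (simp only:)
  qed
  finally show ?case
    by (subst sum.lessThan_Suc_shift) simp
qed simp

lemma walk_sum_first_return:
  assumes U: "finite U" "x \<in> U" and x: "{x, x} \<notin> E"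
  shows "walk_sum E w U (Suc k) x x =
    (\<Sum>j<k. (\<Sum>y\<in>nbrs E U x. \<Sum>y'\<in>nbrs E U x. w {x, y} * (walk_sum E w (U - {x}) j y y' * w {x, y'}))
       * walk_sum E w U (k - 1 - j) x x)"
proof -
  have sub: "nbrs E U x \<subseteq> U - {x}" using x by (auto simp: nbrs_def)
  have "walk_sum E w U (Suc k) x x = (\<Sum>y\<in>nbrs E U x. w {x, y} *
     (\<Sum>j<k. (\<Sum>y'\<in>nbrs E U x. walk_sum E w (U - {x}) j y y' * w {x, y'}) * walk_sum E w U (k - 1 - j) x x))"
    unfolding walk_sum.simps using sub by (intro sum.cong refl) (simp add: walk_sum_last_passage[OF assms] subset_iff)
  also have "\<dots> = (\<Sum>j<k. (\<Sum>y\<in>nbrs E U x. \<Sum>y'\<in>nbrs E U x. w {x, y} * (walk_sum E w (U - {x}) j y y' * w {x, y'}))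
       * walk_sum E w U (k - 1 - j) x x)"
    unfolding sum_distrib_left sum_distrib_right by (subst sum.swap) (simp add: mult_ac)
  finally show ?thesis .
qed

lemma tree_res_unfold:
  fixes G :: "real fps"
  shows "inverse (1 - fps_X * G) $ 0 = 1"
    and "inverse (1 - fps_X * G) $ Suc k = (\<Sum>i\<le>k. G $ i * inverse (1 - fps_X * G) $ (k - i))"
proof -
  define f where "f = inverse (1 - fps_X * G)"
  have "f * (1 - fps_X * G) = 1" unfolding f_def by (rule inverse_mult_eq_1) simp
  then have f: "f = 1 + fps_X * (G * f)" by (simp add: algebra_simps)
  have "f $ 0 = 1" by (subst f) simp
  moreover have "f $ Suc k = (\<Sum>i\<le>k. G $ i * f $ (k - i))"
  proof -
    have "f $ Suc k = (G * f) $ k" using arg_cong[OF f, of "\<lambda>h. h $ Suc k"] by simp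
    then show ?thesis by (simp add: fps_mult_nth atLeast0AtMost)
  qed
  ultimately show "inverse (1 - fps_X * G) $ 0 = 1"
    "inverse (1 - fps_X * G) $ Suc k = (\<Sum>i\<le>k. G $ i * inverse (1 - fps_X * G) $ (k - i))"
    by (simp_all add: f_def)
qed

text \<open>In the first-return decomposition, an excursion leaving through \<open>y\<close> and
  returning through a different child would join two disjoint balls. The diagonal excursions that
  remain reproduce the continued fraction, and parity is inherited from the children.\<close>

lemma walk_sum_tree_like:
  assumes "tree_like E d n e U x" "finite U" "x \<in> U" "\<And>v. {v, v} \<notin> E"
  shows "k \<le> n \<Longrightarrow> walk_sum E w U (2 * k) x x = tree_res E w n U x $ k"
    and "k < n \<Longrightarrow> walk_sum E w U (2 * k + 1) x x = 0"
proof -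
  have "(\<forall>k\<le>n. walk_sum E w U (2 * k) x x = tree_res E w n U x $ k) \<and> (\<forall>k<n. walk_sum E w U (2 * k + 1) x x = 0)"
    using assms
  proof (induction n arbitrary: e U x)
    case (Suc n)
    let ?V = "U - {x}" and ?N = "nbrs E U x"
    have tl: "\<And>y. y \<in> ?N \<Longrightarrow> tree_like E d n (d - 1) ?V y"
      and disj: "\<And>y y'. y \<in> ?N \<Longrightarrow> y' \<in> ?N \<Longrightarrow> y \<noteq> y' \<Longrightarrow> reach E ?V n y \<inter> reach E ?V n y' = {}"
      using Suc.prems(1) by auto
    have sub: "?N \<subseteq> ?V" using Suc.prems(4) by (auto simp: nbrs_def)
    have IH: "k \<le> n \<Longrightarrow> walk_sum E w ?V (2 * k) y y = tree_res E w n ?V y $ k"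
      "k < n \<Longrightarrow> walk_sum E w ?V (2 * k + 1) y y = 0" if "y \<in> ?N" for y k
      using Suc.IH[OF tl[OF that]] Suc.prems that sub by auto
    define G where "G = (\<Sum>y\<in>?N. fps_const ((w {x, y})\<^sup>2) * tree_res E w n ?V y)"
    define D where "D j = (\<Sum>y\<in>?N. (w {x, y})\<^sup>2 * walk_sum E w ?V j y y)" for j
    have Deven: "D (2 * k) = G $ k" if "k \<le> n" for k
      unfolding D_def G_def using IH(1) that by (simp add: fps_sum_nth)
    have Dodd: "D (2 * k + 1) = 0" if "k < n" for k
      unfolding D_def using IH(2) that by simp
    \<comment> \<open>The bound on \<open>k\<close> makes every excursion length \<open>j\<close> at
      most \<open>2 * n\<close>, the range in which disjoint balls of radius \<open>n\<close>
      exclude crossings.\<close>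
    have ret: "walk_sum E w U (Suc k) x x = (\<Sum>j<k. D j * walk_sum E w U (k - 1 - j) x x)" if "k \<le> 2 * n + 1" for k
    proof -
      have "(\<Sum>y\<in>?N. \<Sum>y'\<in>?N. w {x, y} * (walk_sum E w ?V j y y' * w {x, y'})) = D j" if "j < k" for j
      proof -
        have "(\<Sum>y'\<in>?N. w {x, y} * (walk_sum E w ?V j y y' * w {x, y'})) = (w {x, y})\<^sup>2 * walk_sum E w ?V j y y"
          if y: "y \<in> ?N" for y
        proof -
          have "(\<Sum>y'\<in>?N. w {x, y} * (walk_sum E w ?V j y y' * w {x, y'}))
             = (\<Sum>y'\<in>?N. if y' = y then (w {x, y})\<^sup>2 * walk_sum E w ?V j y y else 0)"
          proof (intro sum.cong refl)
            fix y' assume y': "y' \<in> ?N"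
            show "w {x, y} * (walk_sum E w ?V j y y' * w {x, y'}) = (if y' = y then (w {x, y})\<^sup>2 * walk_sum E w ?V j y y else 0)"
            proof (cases "y' = y")
              case False
              have "walk_sum E w ?V j y y' = 0"
                by (rule walk_sum_eq_0_of_disjoint_reach[OF _ disj]) (use y y' False sub \<open>j < k\<close> \<open>k \<le> 2 * n + 1\<close> in auto)
              then show ?thesis using False by simp
            qed (simp add: power2_eq_square)
          qed
          also have "\<dots> = (w {x, y})\<^sup>2 * walk_sum E w ?V j y y"
            using y finite_nbrs[OF Suc.prems(2)] by (simp add: sum.delta)
          finally show ?thesis .
        qed
        then show ?thesis by (simp add: D_def)
      qed
      then show ?thesis
        using Suc.prems by (subst walk_sum_first_return) auto
    qed
    have fG: "tree_res E w (Suc n) U x = inverse (1 - fps_X * G)"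
      by (simp add: G_def sum_distrib_left mult_ac)
    have main: "(k \<le> Suc n \<longrightarrow> walk_sum E w U (2 * k) x x = inverse (1 - fps_X * G) $ k) \<and> (k < Suc n \<longrightarrow> walk_sum E w U (2 * k + 1) x x = 0)" for k
    proof (induction k rule: less_induct)
      case (less k)
      have even: "walk_sum E w U (2 * k) x x = inverse (1 - fps_X * G) $ k" if k: "k \<le> Suc n"
      proof (cases k)
        case 0
        then show ?thesis by (simp add: tree_res_unfold)
      next
        case (Suc k')
        have "walk_sum E w U (2 * k) x x = (\<Sum>j<2 * k' + 1. D j * walk_sum E w U (2 * k' - j) x x)"
          using ret[of "2 * k' + 1"] Suc k by simp
        also have "\<dots> = (\<Sum>j\<in>(\<lambda>i. 2 * i) ` {..k'}. D j * walk_sum E w U (2 * k' - j) x x)"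
        proof (rule sum.mono_neutral_right)
          show "\<forall>j\<in>{..<2 * k' + 1} - (\<lambda>i. 2 * i) ` {..k'}. D j * walk_sum E w U (2 * k' - j) x x = 0"
          proof
            fix j assume j: "j \<in> {..<2 * k' + 1} - (\<lambda>i. 2 * i) ` {..k'}"
            then have "odd j" by (auto elim!: evenE)
            then obtain i where "j = 2 * i + 1" by (elim oddE)
            then have "D j = 0" using Dodd[of i] j Suc k by auto
            then show "D j * walk_sum E w U (2 * k' - j) x x = 0" by simp
          qed
        qed auto
        also have "\<dots> = (\<Sum>i\<le>k'. D (2 * i) * walk_sum E w U (2 * (k' - i)) x x)"
          by (subst sum.reindex) (auto simp: inj_on_def diff_mult_distrib2)
        also have "\<dots> = (\<Sum>i\<le>k'. G $ i * inverse (1 - fps_X * G) $ (k' - i))"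
          using Deven less.IH Suc k by (intro sum.cong refl) auto
        also have "\<dots> = inverse (1 - fps_X * G) $ k" unfolding Suc by (rule tree_res_unfold(2)[symmetric])
        finally show ?thesis .
      qed
      moreover have "walk_sum E w U (2 * k + 1) x x = 0" if k: "k < Suc n"
      proof -
        have "walk_sum E w U (2 * k + 1) x x = (\<Sum>j<2 * k. D j * walk_sum E w U (2 * k - 1 - j) x x)"
          using ret[of "2 * k"] k by simp
        also have "\<dots> = 0"
        proof (intro sum.neutral ballI)
          fix j assume j: "j \<in> {..<2 * k}"
          show "D j * walk_sum E w U (2 * k - 1 - j) x x = 0"
          proof (cases "even j")
            case True
            then obtain i where i: "j = 2 * i" by (elim evenE)
            then have "2 * k - 1 - j = 2 * (k - i - 1) + 1" "k - i - 1 < k" using j by auto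
            then show ?thesis using less.IH[of "k - i - 1"] k by simp
          next
            case False
            then obtain i where "j = 2 * i + 1" by (elim oddE)
            then show ?thesis using Dodd[of i] j k by auto
          qed
        qed
        finally show ?thesis .
      qed
      ultimately show ?case by blast
    qed
    then show ?case unfolding fG by blast
  qed simp
  then show "k \<le> n \<Longrightarrow> walk_sum E w U (2 * k) x x = tree_res E w n U x $ k"
    "k < n \<Longrightarrow> walk_sum E w U (2 * k + 1) x x = 0" by auto
qed

lemma weighted_adjacency_power:
  assumes "simple_graph G" "i < nverts G" "j < nverts G"
  shows "(weighted_adjacency G w ^\<^sub>m k) $$ (i, j) = walk_sum (edges G) w {..<nverts G} k i j"
proof -
  let ?A = "weighted_adjacency G w" and ?N = "nverts G"
  have A: "?A \<in> carrier_mat ?N ?N" by (simp add: weighted_adjacency_def)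
  \<comment> \<open>Matrix powers grow on the right, whereas \<open>walk_sum\<close> splits off the
    first step on the left.\<close>
  have comm: "?A ^\<^sub>m Suc k = ?A * ?A ^\<^sub>m k" for k
  proof (induction k)
    case 0
    then show ?case using A by simp
  next
    case (Suc k)
    have "?A ^\<^sub>m Suc (Suc k) = (?A * ?A ^\<^sub>m k) * ?A" using Suc by simp
    also have "\<dots> = ?A * (?A ^\<^sub>m k * ?A)" using A by (intro assoc_mult_mat) auto
    finally show ?case by simp
  qed
  show ?thesis
    using assms(2)
  proof (induction k arbitrary: i)
    case 0
    then show ?case using assms(3) A by simp
  next
    case (Suc k)
    have "(?A ^\<^sub>m Suc k) $$ (i, j) = (\<Sum>u<?N. ?A $$ (i, u) * (?A ^\<^sub>m k) $$ (u, j))"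
      unfolding comm using A Suc.prems assms(3) by (simp add: scalar_prod_def atLeast0LessThan)
    also have "\<dots> = (\<Sum>u<?N. if {i, u} \<in> edges G then w {i, u} * walk_sum (edges G) w {..<?N} k u j else 0)"
      using Suc by (intro sum.cong refl) (auto simp: weighted_adjacency_def)
    also have "\<dots> = (\<Sum>u\<in>nbrs (edges G) {..<?N} i. w {i, u} * walk_sum (edges G) w {..<?N} k u j)"
      by (simp add: nbrs_def sum.inter_filter flip: lessThan_iff)
    finally show ?case by simp
  qed
qed

section \<open>Short cycles and exceptional vertices\<close>

lemma reach_refl: "x \<in> reach E U n x" by (auto simp: reach_def intro!: exI[of _ 0])

lemma reach_subset: "x \<in> U \<Longrightarrow> reach E U n x \<subseteq> U"
proof
  fix z assume "x \<in> U" "z \<in> reach E U n x"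
  then obtain i where "(x, z) \<in> adj E U ^^ i" by (auto simp: reach_def)
  then show "z \<in> U" using \<open>x \<in> U\<close> by (cases i) (auto simp: adj_def)
qed

lemma relpow_mono_set: "R \<subseteq> S \<Longrightarrow> (R :: ('a \<times> 'a) set) ^^ i \<subseteq> S ^^ i"
  by (induction i) auto

lemma reach_nbr_subset:
  assumes "x \<in> U" "y \<in> nbrs E U x" "V \<subseteq> U"
  shows "reach E V n y \<subseteq> reach E U (Suc n) x"
proof
  fix z assume "z \<in> reach E V n y"
  then obtain i where i: "i \<le> n" "(y, z) \<in> adj E V ^^ i" by (auto simp: reach_def)
  have "adj E V \<subseteq> adj E U" using assms by (auto simp: adj_def)
  then have "(y, z) \<in> adj E U ^^ i" using i relpow_mono_set by blast
  moreover have "(x, y) \<in> adj E U" using assms adj_nbrs by metis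
  ultimately have "(x, z) \<in> adj E U ^^ Suc i" by (rule relpow_Suc_I2[rotated])
  then show "z \<in> reach E U (Suc n) x" using i by (auto simp: reach_def intro!: exI[of _ "Suc i"])
qed

text \<open>The base is \<open>d + 1\<close> rather than \<open>d\<close> so that the starting
  vertex is absorbed: \<open>1 + d * (d + 1) ^ n\<close> is at most the next power.\<close>

lemma card_reach_le:
  assumes U: "finite U" and deg: "\<And>u. u \<in> U \<Longrightarrow> card (nbrs E U u) \<le> d" and x: "x \<in> U"
  shows "card (reach E U n x) \<le> (d + 1) ^ n"
  using x
proof (induction n arbitrary: x)
  case 0
  have "reach E U 0 x = {x}" by (auto simp: reach_def)
  then show ?case by simp
next
  case (Suc n)
  have fin: "finite (nbrs E U x)" by (rule finite_nbrs[OF U])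
  have "reach E U (Suc n) x \<subseteq> insert x (\<Union>u\<in>nbrs E U x. reach E U n u)"
  proof
    fix z assume "z \<in> reach E U (Suc n) x"
    then obtain i where i: "i \<le> Suc n" "(x, z) \<in> adj E U ^^ i" by (auto simp: reach_def)
    show "z \<in> insert x (\<Union>u\<in>nbrs E U x. reach E U n u)"
    proof (cases i)
      case (Suc i')
      then obtain u where "(x, u) \<in> adj E U" "(u, z) \<in> adj E U ^^ i'" using i by (metis relpow_Suc_D2)
      then show ?thesis using i Suc adj_nbrs[OF \<open>x \<in> U\<close>] by (auto simp: reach_def)
    qed (use i in auto)
  qed
  then have "card (reach E U (Suc n) x) \<le> card (insert x (\<Union>u\<in>nbrs E U x. reach E U n u))"
  proof (rule card_mono[rotated])
    have "finite (reach E U n u)" if "u \<in> nbrs E U x" for u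
      by (rule finite_subset[OF reach_subset U]) (rule subsetD[OF nbrs_subset that])
    then show "finite (insert x (\<Union>u\<in>nbrs E U x. reach E U n u))" using fin by simp
  qed
  also have "\<dots> \<le> Suc (card (\<Union>u\<in>nbrs E U x. reach E U n u))"
    by (rule card_insert_le_m1) auto
  finally have 1: "card (reach E U (Suc n) x) \<le> Suc (card (\<Union>u\<in>nbrs E U x. reach E U n u))" .
  have "card (\<Union>u\<in>nbrs E U x. reach E U n u) \<le> (\<Sum>u\<in>nbrs E U x. card (reach E U n u))"
    by (rule card_UN_le[OF fin])
  also have "\<dots> \<le> (\<Sum>u\<in>nbrs E U x. (d + 1) ^ n)"
    by (rule sum_mono, rule Suc.IH, erule subsetD[OF nbrs_subset])
  also have "\<dots> \<le> d * (d + 1) ^ n" using deg[OF Suc.prems] by simp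
  finally have "card (reach E U (Suc n) x) \<le> Suc (d * (d + 1) ^ n)" using 1 by simp
  also have "\<dots> \<le> (d + 1) ^ Suc n" by simp
  finally show ?case .
qed

text \<open>If the first vertex already occurs on the path obtained by induction, the loop is
  removed by passing to the suffix that starts there.\<close>

lemma relpow_adj_path:
  assumes "(a, b) \<in> adj E U ^^ j" "a \<in> U"
  obtains ps where "ps \<noteq> []" "hd ps = a" "last ps = b" "distinct ps" "length ps \<le> Suc j" "set ps \<subseteq> U"
    "successively (\<lambda>u v. {u, v} \<in> E) ps"
proof -
  have "\<exists>ps. ps \<noteq> [] \<and> hd ps = a \<and> last ps = b \<and> distinct ps \<and> length ps \<le> Suc j \<and> set ps \<subseteq> U \<and>
    successively (\<lambda>u v. {u, v} \<in> E) ps"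
    using assms
  proof (induction j arbitrary: a)
    case 0
    then show ?case by (intro exI[of _ "[a]"]) auto
  next
    case (Suc j)
    then obtain c where c: "(a, c) \<in> adj E U" "(c, b) \<in> adj E U ^^ j" by (metis relpow_Suc_D2)
    then have "c \<in> U" "{a, c} \<in> E" by (auto simp: adj_def)
    then obtain ps where ps: "ps \<noteq> []" "hd ps = c" "last ps = b" "distinct ps" "length ps \<le> Suc j" "set ps \<subseteq> U"
      "successively (\<lambda>u v. {u, v} \<in> E) ps" using Suc.IH[OF c(2)] by blast
    show ?case
    proof (cases "a \<in> set ps")
      case False
      then show ?thesis using ps \<open>{a, c} \<in> E\<close> Suc.prems
        by (intro exI[of _ "a # ps"]) (auto simp: successively_Cons)
    next
      case True
      then obtain as bs where ab: "ps = as @ a # bs" by (meson split_list)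
      then show ?thesis using ps Suc.prems
        by (intro exI[of _ "a # bs"]) (auto simp: successively_append_iff)
    qed
  qed
  then show thesis using that by blast
qed

definition is_cycle :: "'a set set \<Rightarrow> 'a list \<Rightarrow> bool" where
  "is_cycle E vs \<longleftrightarrow> distinct vs \<and> length vs \<ge> 3 \<and> (\<forall>i<length vs. {vs ! i, vs ! (Suc i mod length vs)} \<in> E)"

text \<open>A simple path between the two neighbours that avoids \<open>x\<close> is closed up by
  prepending \<open>x\<close>; distinctness of the neighbours ensures length at least 3.\<close>

lemma cycle_of_two_neighbours:
  assumes x: "x \<in> U" "{x, x} \<notin> E" and y: "y \<in> nbrs E U x" "y' \<in> nbrs E U x" "y \<noteq> y'"
    and path: "(y, y') \<in> adj E (U - {x}) ^^ j"
  obtains vs where "is_cycle E vs" "length vs \<le> j + 2" "set vs \<subseteq> U" "x \<in> set vs"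
proof -
  have yV: "y \<in> U - {x}" using x y by (auto simp: nbrs_def)
  obtain ps where ps: "ps \<noteq> []" "hd ps = y" "last ps = y'" "distinct ps" "length ps \<le> Suc j" "set ps \<subseteq> U - {x}"
    "successively (\<lambda>u v. {u, v} \<in> E) ps" using relpow_adj_path[OF path yV] .
  have l2: "length ps \<ge> 2"
    using ps y by (cases ps; cases "tl ps") auto
  have suc: "successively (\<lambda>u v. {u, v} \<in> E) (x # ps)"
    using ps y by (auto simp: successively_Cons nbrs_def)
  have "is_cycle E (x # ps)" unfolding is_cycle_def
  proof (intro conjI allI impI)
    fix i assume i: "i < length (x # ps)"
    show "{(x # ps) ! i, (x # ps) ! (Suc i mod length (x # ps))} \<in> E"
    proof (cases "Suc i = length (x # ps)")
      case True
      then have "(x # ps) ! i = y'" using ps by (metis diff_Suc_1 last_ConsR last_conv_nth list.distinct(1))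
      then show ?thesis using True y by (simp add: nbrs_def insert_commute)
    next
      case False
      then have "Suc i < length (x # ps)" using i by simp
      then show ?thesis using suc by (simp add: successively_conv_nth)
    qed
  qed (use ps l2 in auto)
  then show thesis using that[of "x # ps"] ps x by auto
qed

text \<open>Each way to fail yields two neighbours of \<open>x\<close> joined outside
  \<open>x\<close> by a walk of at most \<open>2 * n + 1\<close> steps, hence a cycle of length at
  most \<open>2 * n + 3\<close> through \<open>x\<close>. This is excluded at radius
  \<open>Suc n\<close>, since \<open>x\<close> belongs to its own ball.\<close>

lemma tree_like_of_no_cycles:
  assumes U: "finite U" "x \<in> U" and loop: "\<And>v. {v, v} \<notin> E"
    and deg: "card (nbrs E U x) = e" "\<And>z. z \<in> reach E U n x \<Longrightarrow> z \<noteq> x \<Longrightarrow> card (nbrs E U z) = d"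
    and cyc: "\<And>vs. is_cycle E vs \<Longrightarrow> length vs \<le> 2 * n + 1 \<Longrightarrow> set vs \<subseteq> U \<Longrightarrow> set vs \<inter> reach E U n x = {}"
  shows "tree_like E d n e U x"
  using assms
proof (induction n arbitrary: e U x)
  case (Suc n)
  let ?V = "U - {x}"
  have sub: "reach E ?V n y \<subseteq> reach E U (Suc n) x - {x}" if "y \<in> nbrs E U x" for y
  proof -
    have "y \<in> ?V" using that loop by (auto simp: nbrs_def)
    then have "reach E ?V n y \<subseteq> ?V" by (rule reach_subset)
    then show ?thesis using reach_nbr_subset[OF Suc.prems(2) that, of ?V n] by blast
  qed
  have nocyc: False if y: "y \<in> nbrs E U x" "y' \<in> nbrs E U x" "y \<noteq> y'" "(y, y') \<in> adj E ?V ^^ j" "j \<le> 2 * n + 1" for y y' j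
  proof -
    obtain vs where "is_cycle E vs" "length vs \<le> j + 2" "set vs \<subseteq> U" "x \<in> set vs"
      using cycle_of_two_neighbours[OF Suc.prems(2) loop y(1-4)] .
    moreover have "x \<in> reach E U (Suc n) x" by (rule reach_refl)
    ultimately show False using Suc.prems(6)[of vs] y(5) by auto
  qed
  have "tree_like E d n (d - 1) ?V y" if y: "y \<in> nbrs E U x" for y
  proof (rule Suc.IH)
    show "finite ?V" "y \<in> ?V" "\<And>v. {v, v} \<notin> E" using Suc.prems y by (auto simp: nbrs_def)
    have yr: "y \<in> reach E U (Suc n) x" "y \<noteq> x" using sub[OF y] reach_refl[of y E ?V n] by auto
    have fin: "finite (nbrs E U z)" for z by (rule finite_nbrs[OF Suc.prems(1)])
    have nbV: "nbrs E ?V z = nbrs E U z - {x}" for z by (auto simp: nbrs_def)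
    have "x \<in> nbrs E U y" using y Suc.prems(2) by (auto simp: nbrs_def insert_commute)
    then show "card (nbrs E ?V y) = d - 1"
      using Suc.prems(5)[OF yr] fin by (simp add: nbV)
    show "card (nbrs E ?V z) = d" if z: "z \<in> reach E ?V n y" "z \<noteq> y" for z
    proof -
      have zr: "z \<in> reach E U (Suc n) x" "z \<noteq> x" using sub[OF y] z by auto
      have "x \<notin> nbrs E U z"
      proof
        assume "x \<in> nbrs E U z"
        moreover have "z \<in> U" using zr reach_subset[OF Suc.prems(2)] by blast
        ultimately have "z \<in> nbrs E U x" by (auto simp: nbrs_def insert_commute)
        moreover obtain j where "j \<le> n" "(y, z) \<in> adj E ?V ^^ j" using z by (auto simp: reach_def)
        ultimately show False using nocyc[OF y, of z j] z by auto
      qed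
      then show ?thesis using Suc.prems(5)[OF zr] by (simp add: nbV)
    qed
    show "set vs \<inter> reach E ?V n y = {}" if "is_cycle E vs" "length vs \<le> 2 * n + 1" "set vs \<subseteq> ?V" for vs
      using Suc.prems(6)[of vs] that sub[OF y] by auto
  qed
  moreover have "reach E ?V n y \<inter> reach E ?V n y' = {}" if y: "y \<in> nbrs E U x" "y' \<in> nbrs E U x" "y \<noteq> y'" for y y'
  proof (rule ccontr)
    assume "reach E ?V n y \<inter> reach E ?V n y' \<noteq> {}"
    then obtain z where "z \<in> reach E ?V n y" "z \<in> reach E ?V n y'" by auto
    then obtain i j where ij: "i \<le> n" "j \<le> n" "(y, z) \<in> adj E ?V ^^ i" "(y', z) \<in> adj E ?V ^^ j"
      by (auto simp: reach_def)
    have "(y, y') \<in> adj E ?V ^^ (i + j)"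
      unfolding relpow_add using ij relpow_adj_sym by (meson relcomp.relcompI)
    then show False using nocyc[OF y, of "i + j"] ij by simp
  qed
  ultimately show ?case using Suc.prems(4) by simp
qed simp

lemma card_nbrs_regular:
  assumes G: "regular_graph d G" and v: "v < nverts G"
  shows "card (nbrs (edges G) {..<nverts G} v) = d"
proof -
  have sg: "e \<in> edges G \<Longrightarrow> e \<subseteq> {..<nverts G} \<and> card e = 2" for e
    using G by (auto simp: regular_graph_def simple_graph_def)
  have "bij_betw (\<lambda>u. {v, u}) (nbrs (edges G) {..<nverts G} v) {e \<in> edges G. v \<in> e}"
    unfolding bij_betw_def
  proof
    show "inj_on (\<lambda>u. {v, u}) (nbrs (edges G) {..<nverts G} v)"
      by (auto simp: inj_on_def doubleton_eq_iff)
    show "(\<lambda>u. {v, u}) ` nbrs (edges G) {..<nverts G} v = {e \<in> edges G. v \<in> e}"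
    proof (intro equalityI subsetI)
      fix e assume e: "e \<in> {e \<in> edges G. v \<in> e}"
      then obtain a b where "e = {a, b}" using sg[of e] by (auto simp: card_2_iff)
      then obtain u where u: "e = {v, u}" using e by auto
      then have "u \<in> nbrs (edges G) {..<nverts G} v" using e sg[of e] by (auto simp: nbrs_def)
      then show "e \<in> (\<lambda>u. {v, u}) ` nbrs (edges G) {..<nverts G} v" using u by auto
    qed (auto simp: nbrs_def)
  qed
  then show ?thesis using bij_betw_same_card G v by (fastforce simp: regular_graph_def)
qed

text \<open>An exceptional vertex lies within distance \<open>n\<close> of a short cycle; a cycle of
  length \<open>k\<close> has at most \<open>k\<close> vertices, and each ball has at most
  \<open>(d + 1) ^ n\<close>.\<close>

lemma card_not_tree_like_le:
  assumes G: "regular_graph d G"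
  shows "card {v \<in> {..<nverts G}. \<not> tree_like (edges G) d n d {..<nverts G} v}
    \<le> (\<Sum>k\<in>{3..2 * n + 1}. card (cycles G k) * (k * (d + 1) ^ n))"
proof -
  let ?E = "edges G" and ?U = "{..<nverts G}"
  have sg: "e \<in> ?E \<Longrightarrow> e \<subseteq> ?U \<and> card e = 2" for e
    using G by (auto simp: regular_graph_def simple_graph_def)
  have loop: "{v, v} \<notin> ?E" for v using sg[of "{v, v}"] by auto
  have finE: "finite ?E" by (rule finite_subset[of _ "Pow ?U"]) (use sg in auto)
  have finC: "finite (cycles G k)" for k
    by (rule finite_subset[of _ "Pow ?E"]) (use finE in \<open>auto simp: cycles_def\<close>)
  have cyc: "is_cycle ?E vs \<Longrightarrow> {{vs ! i, vs ! (Suc i mod length vs)} | i. i < length vs} \<in> cycles G (length vs)" for vs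
    by (auto simp: is_cycle_def cycles_def)
  have cov: "finite (\<Union>C) \<and> card (\<Union>C) \<le> k \<and> \<Union>C \<subseteq> ?U" if C: "C \<in> cycles G k" for C k
  proof -
    obtain vs where vs: "length vs = k" "C = {{vs ! i, vs ! (Suc i mod k)} | i. i < k}" "C \<subseteq> ?E"
      using C unfolding cycles_def by blast
    have "\<Union>C \<subseteq> set vs"
    proof
      fix z assume "z \<in> \<Union>C"
      then obtain i where i: "i < k" "z \<in> {vs ! i, vs ! (Suc i mod k)}" using vs(2) by auto
      then have "vs ! (Suc i mod k) \<in> set vs" "vs ! i \<in> set vs"
        using vs(1) by (auto intro!: nth_mem mod_less_divisor)
      then show "z \<in> set vs" using i(2) by auto
    qed
    then have "finite (\<Union>C)" "card (\<Union>C) \<le> card (set vs)" by (auto intro: finite_subset card_mono)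
    moreover have "card (set vs) \<le> k" using vs card_length by metis
    moreover have "\<Union>C \<subseteq> ?U" by (rule Union_least) (use vs(3) sg in auto)
    ultimately show ?thesis by linarith
  qed
  have deg: "card (nbrs ?E ?U u) \<le> d" if "u \<in> ?U" for u using card_nbrs_regular[OF G] that by simp
  have "{v \<in> ?U. \<not> tree_like ?E d n d ?U v} \<subseteq> (\<Union>k\<in>{3..2 * n + 1}. \<Union>C\<in>cycles G k. \<Union>z\<in>\<Union>C. reach ?E ?U n z)"
  proof
    fix v assume v: "v \<in> {v \<in> ?U. \<not> tree_like ?E d n d ?U v}"
    have "\<not> (\<forall>vs. is_cycle ?E vs \<longrightarrow> length vs \<le> 2 * n + 1 \<longrightarrow> set vs \<subseteq> ?U \<longrightarrow> set vs \<inter> reach ?E ?U n v = {})"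
    proof
      assume a: "\<forall>vs. is_cycle ?E vs \<longrightarrow> length vs \<le> 2 * n + 1 \<longrightarrow> set vs \<subseteq> ?U \<longrightarrow> set vs \<inter> reach ?E ?U n v = {}"
      have "tree_like ?E d n d ?U v"
      proof (rule tree_like_of_no_cycles)
        show "card (nbrs ?E ?U v) = d" using card_nbrs_regular[OF G] v by simp
        show "card (nbrs ?E ?U z) = d" if "z \<in> reach ?E ?U n v" "z \<noteq> v" for z
          using card_nbrs_regular[OF G] reach_subset[of v ?U ?E n] v that by blast
      qed (use v loop a in auto)
      then show False using v by simp
    qed
    then obtain vs z where vs: "is_cycle ?E vs" "length vs \<le> 2 * n + 1" "z \<in> set vs" "z \<in> reach ?E ?U n v" by auto
    define C where "C = {{vs ! i, vs ! (Suc i mod length vs)} | i. i < length vs}"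
    have "C \<in> cycles G (length vs)" unfolding C_def by (rule cyc[OF vs(1)])
    moreover have "z \<in> \<Union>C"
    proof -
      obtain i where "i < length vs" "z = vs ! i" using vs(3) by (auto simp: in_set_conv_nth)
      then show ?thesis unfolding C_def by blast
    qed
    moreover have "v \<in> reach ?E ?U n z" using vs(4) reach_sym by metis
    moreover have "length vs \<in> {3..2 * n + 1}" using vs by (auto simp: is_cycle_def)
    ultimately show "v \<in> (\<Union>k\<in>{3..2 * n + 1}. \<Union>C\<in>cycles G k. \<Union>z\<in>\<Union>C. reach ?E ?U n z)" by blast
  qed
  moreover have "finite (\<Union>k\<in>{3..2 * n + 1}. \<Union>C\<in>cycles G k. \<Union>z\<in>\<Union>C. reach ?E ?U n z)"
  proof (rule finite_subset[of _ ?U])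
    show "(\<Union>k\<in>{3..2 * n + 1}. \<Union>C\<in>cycles G k. \<Union>z\<in>\<Union>C. reach ?E ?U n z) \<subseteq> ?U"
    proof (intro UN_least)
      fix k C z assume "C \<in> cycles G k" "z \<in> \<Union>C"
      then have "z \<in> ?U" using cov by blast
      then show "reach ?E ?U n z \<subseteq> ?U" by (rule reach_subset)
    qed
  qed simp
  ultimately have "card {v \<in> ?U. \<not> tree_like ?E d n d ?U v} \<le> card (\<Union>k\<in>{3..2 * n + 1}. \<Union>C\<in>cycles G k. \<Union>z\<in>\<Union>C. reach ?E ?U n z)"
    by (rule card_mono[rotated])
  also have "\<dots> \<le> (\<Sum>k\<in>{3..2 * n + 1}. card (\<Union>C\<in>cycles G k. \<Union>z\<in>\<Union>C. reach ?E ?U n z))"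
    by (rule card_UN_le) simp
  also have "\<dots> \<le> (\<Sum>k\<in>{3..2 * n + 1}. \<Sum>C\<in>cycles G k. card (\<Union>z\<in>\<Union>C. reach ?E ?U n z))"
    by (intro sum_mono card_UN_le finC)
  also have "\<dots> \<le> (\<Sum>k\<in>{3..2 * n + 1}. \<Sum>C\<in>cycles G k. k * (d + 1) ^ n)"
  proof (intro sum_mono)
    fix k C assume C: "C \<in> cycles G k"
    have "card (\<Union>z\<in>\<Union>C. reach ?E ?U n z) \<le> (\<Sum>z\<in>\<Union>C. card (reach ?E ?U n z))"
      by (rule card_UN_le) (use cov[OF C] in blast)
    also have "\<dots> \<le> (\<Sum>z\<in>\<Union>C. (d + 1) ^ n)"
    proof (rule sum_mono)
      fix z assume "z \<in> \<Union>C"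
      then have "z \<in> ?U" using cov[OF C] by blast
      then show "card (reach ?E ?U n z) \<le> (d + 1) ^ n" using deg by (intro card_reach_le) auto
    qed
    also have "\<dots> = card (\<Union>C) * (d + 1) ^ n" by simp
    also have "\<dots> \<le> k * (d + 1) ^ n" using cov[OF C] by (intro mult_right_mono) auto
    finally show "card (\<Union>z\<in>\<Union>C. reach ?E ?U n z) \<le> k * (d + 1) ^ n" .
  qed
  also have "\<dots> = (\<Sum>k\<in>{3..2 * n + 1}. card (cycles G k) * (k * (d + 1) ^ n))" by simp
  finally show ?thesis .
qed

section \<open>Random weights\<close>

text \<open>Unlike mere integrability, this is stable under products, so integrability of
  polynomials in the weights never needs separate estimates.\<close>

definition all_moments :: "'a measure \<Rightarrow> ('a \<Rightarrow> real) \<Rightarrow> bool" where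
  "all_moments M f \<longleftrightarrow> f \<in> borel_measurable M \<and> (\<forall>k. integrable M (\<lambda>w. f w ^ k))"

lemma all_moments_measurable: "all_moments M f \<Longrightarrow> f \<in> borel_measurable M"
  by (simp add: all_moments_def)

lemma all_moments_integrable: "all_moments M f \<Longrightarrow> integrable M f"
  unfolding all_moments_def using power_one_right by (metis (no_types, lifting) ext)

lemma all_moments_integrable_power: "all_moments M f \<Longrightarrow> integrable M (\<lambda>w. f w ^ k)"
  by (simp add: all_moments_def)

lemma all_moments_const: "prob_space M \<Longrightarrow> all_moments M (\<lambda>_. c)"
  unfolding all_moments_def using finite_measure.integrable_const[OF prob_space.axioms(1)] by auto

lemma abs_le_one_plus_square: "\<bar>a\<bar> \<le> 1 + a\<^sup>2" for a :: real
proof -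
  have "0 \<le> (\<bar>a\<bar> - 1)\<^sup>2" by simp
  also have "(\<bar>a\<bar> - 1)\<^sup>2 = a\<^sup>2 - 2 * \<bar>a\<bar> + 1" by (simp add: power2_diff)
  finally show ?thesis by linarith
qed

lemma abs_mult_le_squares: "\<bar>a * b\<bar> \<le> a\<^sup>2 + b\<^sup>2" for a b :: real
proof -
  have "0 \<le> (\<bar>a\<bar> - \<bar>b\<bar>)\<^sup>2" by simp
  also have "(\<bar>a\<bar> - \<bar>b\<bar>)\<^sup>2 = a\<^sup>2 + b\<^sup>2 - 2 * \<bar>a * b\<bar>" by (simp add: power2_diff abs_mult)
  finally show ?thesis by linarith
qed

lemma all_moments_mult:
  assumes "all_moments M f" "all_moments M g"
  shows "all_moments M (\<lambda>w. f w * g w)"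
  unfolding all_moments_def
proof (intro conjI allI)
  show meas: "(\<lambda>w. f w * g w) \<in> borel_measurable M"
    by (intro borel_measurable_times all_moments_measurable assms)
  fix k
  show "integrable M (\<lambda>w. (f w * g w) ^ k)"
  proof (rule Bochner_Integration.integrable_bound)
    show "integrable M (\<lambda>w. f w ^ (2 * k) + g w ^ (2 * k))" using assms by (simp add: all_moments_def)
    show "(\<lambda>w. (f w * g w) ^ k) \<in> borel_measurable M" using meas by simp
    have "\<bar>(a * b) ^ k\<bar> \<le> a ^ (2 * k) + b ^ (2 * k)" for a b :: real
      using abs_mult_le_squares[of "a ^ k" "b ^ k"] by (simp only: power_mult_distrib power_even_eq)
    then show "AE w in M. norm ((f w * g w) ^ k) \<le> norm (f w ^ (2 * k) + g w ^ (2 * k))"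
      by (intro AE_I2) (simp add: abs_of_nonneg)
  qed
qed

lemma abs_add_power_le: "\<bar>(a + b) ^ k\<bar> \<le> 2 ^ k * (\<bar>a ^ k\<bar> + \<bar>b ^ k\<bar>)" for a b :: real
proof -
  have "\<bar>a + b\<bar> ^ k \<le> (2 * max \<bar>a\<bar> \<bar>b\<bar>) ^ k" by (intro power_mono) auto
  also have "\<dots> = 2 ^ k * max \<bar>a\<bar> \<bar>b\<bar> ^ k" by (simp only: power_mult_distrib)
  also have "max \<bar>a\<bar> \<bar>b\<bar> ^ k \<le> \<bar>a\<bar> ^ k + \<bar>b\<bar> ^ k" by (simp add: max_def)
  finally show ?thesis by (simp add: power_abs)
qed

lemma all_moments_add:
  assumes "all_moments M f" "all_moments M g"
  shows "all_moments M (\<lambda>w. f w + g w)"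
  unfolding all_moments_def
proof (intro conjI allI)
  show meas: "(\<lambda>w. f w + g w) \<in> borel_measurable M"
    by (intro borel_measurable_add all_moments_measurable assms)
  fix k
  show "integrable M (\<lambda>w. (f w + g w) ^ k)"
  proof (rule Bochner_Integration.integrable_bound)
    show "integrable M (\<lambda>w. 2 ^ k * (\<bar>f w ^ k\<bar> + \<bar>g w ^ k\<bar>))" using assms by (simp add: all_moments_def)
    show "(\<lambda>w. (f w + g w) ^ k) \<in> borel_measurable M" using meas by simp
    show "AE w in M. norm ((f w + g w) ^ k) \<le> norm (2 ^ k * (\<bar>f w ^ k\<bar> + \<bar>g w ^ k\<bar>))"
      using abs_add_power_le by (intro AE_I2) (simp add: abs_mult)
  qed
qed

lemma all_moments_sum:
  assumes "prob_space M" "\<And>i. i \<in> I \<Longrightarrow> all_moments M (f i)"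
  shows "all_moments M (\<lambda>w. \<Sum>i\<in>I. f i w)"
  using assms(2)
  by (induction I rule: infinite_finite_induct) (auto intro: all_moments_add simp: all_moments_const[OF assms(1)])

lemma abs_sum_power_even_le:
  fixes c :: "'a \<Rightarrow> real"
  assumes p: "p \<ge> 1" and A: "finite A"
  shows "(\<Sum>u\<in>A. c u) ^ (2 * p) \<le> real (card A) ^ (2 * p) * (\<Sum>u\<in>A. c u ^ (2 * p))"
proof (cases "A = {}")
  case True
  then show ?thesis using p by (cases p) auto
next
  case False
  obtain u0 where u0: "u0 \<in> A" "\<And>u. u \<in> A \<Longrightarrow> \<bar>c u\<bar> \<le> \<bar>c u0\<bar>"
  proof -
    have fin: "finite ((\<lambda>u. \<bar>c u\<bar>) ` A)" "(\<lambda>u. \<bar>c u\<bar>) ` A \<noteq> {}" using A False by auto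
    from Max_in[OF this] obtain u0 where u0: "u0 \<in> A" "Max ((\<lambda>u. \<bar>c u\<bar>) ` A) = \<bar>c u0\<bar>" by blast
    have "\<bar>c u\<bar> \<le> \<bar>c u0\<bar>" if "u \<in> A" for u
      using Max_ge[OF fin(1), of "\<bar>c u\<bar>"] that u0(2) by simp
    with u0(1) show thesis by (rule that)
  qed
  have "\<bar>\<Sum>u\<in>A. c u\<bar> \<le> (\<Sum>u\<in>A. \<bar>c u0\<bar>)"
    by (rule order_trans[OF sum_abs sum_mono[OF u0(2)]])
  then have "\<bar>\<Sum>u\<in>A. c u\<bar> \<le> real (card A) * \<bar>c u0\<bar>" by simp
  then have "\<bar>\<Sum>u\<in>A. c u\<bar> ^ (2 * p) \<le> (real (card A) * \<bar>c u0\<bar>) ^ (2 * p)"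
    by (intro power_mono) auto
  also have "\<dots> = real (card A) ^ (2 * p) * c u0 ^ (2 * p)"
    by (simp add: power_mult_distrib power_even_abs)
  also have "\<dots> \<le> real (card A) ^ (2 * p) * (\<Sum>u\<in>A. c u ^ (2 * p))"
    by (intro mult_left_mono member_le_sum u0 A) auto
  finally show ?thesis by (simp add: power_even_abs)
qed

text \<open>Dependence as a plain condition on functions of the weights, instead of sigma-algebras:
  under a product measure, disjoint dependence sets reduce independence to Fubini.\<close>

definition depends_on :: "'i set \<Rightarrow> (('i \<Rightarrow> 'a) \<Rightarrow> 'b) \<Rightarrow> bool" where
  "depends_on K f \<longleftrightarrow> (\<forall>w w'. (\<forall>e\<in>K. w e = w' e) \<longrightarrow> f w = f w')"

lemma depends_onD: "depends_on K f \<Longrightarrow> (\<And>e. e \<in> K \<Longrightarrow> w e = w' e) \<Longrightarrow> f w = f w'"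
  by (simp add: depends_on_def)

lemma weight_distribution_prob_space: "weight_distribution W \<Longrightarrow> prob_space W"
  by (simp add: weight_distribution_def real_distribution_def)

lemma weight_distribution_sets: "weight_distribution W \<Longrightarrow> sets W = sets borel"
  by (simp add: weight_distribution_def real_distribution.events_eq_borel)

lemma prob_space_weights: "weight_distribution W \<Longrightarrow> prob_space (PiM E (\<lambda>_. W))"
  by (intro prob_space_PiM weight_distribution_prob_space)

lemma integral_weight_component:
  assumes W: "weight_distribution W" and e: "e \<in> E"
  shows "all_moments (PiM E (\<lambda>_. W)) (\<lambda>w. w e)"
    and "(\<integral>w. w e ^ k \<partial>PiM E (\<lambda>_. W)) = moment W k"
proof -
  have meas: "(\<lambda>x. x ^ k) \<in> borel_measurable W" for k
    using weight_distribution_sets[OF W] by (subst measurable_cong_sets[of W borel borel borel]) auto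
  have comp: "(\<lambda>w. w e) \<in> PiM E (\<lambda>_. W) \<rightarrow>\<^sub>M W" using e by measurable
  have d: "distr (PiM E (\<lambda>_. W)) W (\<lambda>w. w e) = W"
    by (rule distr_PiM_component[OF weight_distribution_prob_space[OF W] e])
  have "integrable (distr (PiM E (\<lambda>_. W)) W (\<lambda>w. w e)) (\<lambda>x. x ^ k)" for k
    unfolding d using W by (simp add: weight_distribution_def)
  then have "integrable (PiM E (\<lambda>_. W)) (\<lambda>w. w e ^ k)" for k
    by (subst (asm) integrable_distr_eq[OF comp meas])
  moreover have "(\<lambda>w. w e) \<in> borel_measurable (PiM E (\<lambda>_. W))"
    using measurable_compose[OF comp meas[of 1]] by simp
  ultimately show "all_moments (PiM E (\<lambda>_. W)) (\<lambda>w. w e)" by (simp add: all_moments_def)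
  have "(\<integral>w. w e ^ k \<partial>PiM E (\<lambda>_. W)) = (\<integral>x. x ^ k \<partial>distr (PiM E (\<lambda>_. W)) W (\<lambda>w. w e))"
    by (rule integral_distr[OF comp meas, symmetric])
  then show "(\<integral>w. w e ^ k \<partial>PiM E (\<lambda>_. W)) = moment W k" unfolding d moment_def .
qed

text \<open>The index set is split at \<open>K\<close>: \<open>f\<close> reads only coordinates in
  \<open>E \<inter> K\<close> and \<open>g\<close> only the others, so the iterated integral
  factors.\<close>

lemma integral_mult_disjoint:
  fixes E :: "'i set" and f g :: "('i \<Rightarrow> real) \<Rightarrow> real"
  assumes W: "weight_distribution W" and E: "finite E"
    and f: "integrable (PiM E (\<lambda>_. W)) f" "depends_on K f"
    and g: "integrable (PiM E (\<lambda>_. W)) g" "depends_on L g"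
    and fg: "integrable (PiM E (\<lambda>_. W)) (\<lambda>w. f w * g w)" and KL: "K \<inter> L = {}"
  shows "(\<integral>w. f w * g w \<partial>PiM E (\<lambda>_. W)) = (\<integral>w. f w \<partial>PiM E (\<lambda>_. W)) * (\<integral>w. g w \<partial>PiM E (\<lambda>_. W :: real measure))"
proof -
  interpret W: prob_space W by (rule weight_distribution_prob_space[OF W])
  interpret product_sigma_finite "\<lambda>_ :: 'i. W" by unfold_locales
  define I where "I = E \<inter> K"
  define J where "J = E - K"
  have IJ: "I \<inter> J = {}" "finite I" "finite J" "I \<union> J = E" using E by (auto simp: I_def J_def)
  have fold: "(\<integral>w. h w \<partial>PiM E (\<lambda>_. W)) = (\<integral>x. (\<integral>y. h (merge I J (x, y)) \<partial>PiM J (\<lambda>_. W)) \<partial>PiM I (\<lambda>_. W))"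
    if "integrable (PiM E (\<lambda>_. W)) h" for h :: "('i \<Rightarrow> real) \<Rightarrow> real"
    using product_integral_fold[OF IJ(1-3), of h] that unfolding IJ(4) by blast
  \<comment> \<open>The value filled in on the other block is immaterial, because \<open>f\<close>
    does not read it; likewise for \<open>G\<close>.\<close>
  define F where "F x = f (merge I J (x, undefined))" for x
  define G where "G y = g (merge I J (undefined, y))" for y
  have fF: "f (merge I J (x, y)) = F x" for x y
    unfolding F_def by (rule depends_onD[OF f(2)]) (auto simp: merge_def J_def)
  have gG: "g (merge I J (x, y)) = G y" for x y
    unfolding G_def by (rule depends_onD[OF g(2)]) (use KL in \<open>auto simp: merge_def I_def\<close>)
  interpret PI: prob_space "PiM I (\<lambda>_. W)" by (rule prob_space_weights[OF W])
  interpret PJ: prob_space "PiM J (\<lambda>_. W)" by (rule prob_space_weights[OF W])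
  have "(\<integral>w. f w * g w \<partial>PiM E (\<lambda>_. W)) = (\<integral>x. F x \<partial>PiM I (\<lambda>_. W)) * (\<integral>y. G y \<partial>PiM J (\<lambda>_. W))"
    unfolding fold[OF fg] fF gG by simp
  moreover have "(\<integral>w. f w \<partial>PiM E (\<lambda>_. W)) = (\<integral>x. F x \<partial>PiM I (\<lambda>_. W))"
    unfolding fold[OF f(1)] fF by (simp add: PJ.prob_space)
  moreover have "(\<integral>w. g w \<partial>PiM E (\<lambda>_. W)) = (\<integral>y. G y \<partial>PiM J (\<lambda>_. W))"
    unfolding fold[OF g(1)] gG by (simp add: PI.prob_space)
  ultimately show ?thesis by simp
qed

text \<open>Stated coefficientwise, which avoids a measurable structure on power series.\<close>

definition random_fps :: "('i \<Rightarrow> 'a) measure \<Rightarrow> 'i set \<Rightarrow> (('i \<Rightarrow> 'a) \<Rightarrow> real fps) \<Rightarrow> bool" where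
  "random_fps M K F \<longleftrightarrow> (\<forall>k. all_moments M (\<lambda>w. F w $ k) \<and> depends_on K (\<lambda>w. F w $ k))"

lemma random_fps_mono: "random_fps M K F \<Longrightarrow> K \<subseteq> L \<Longrightarrow> random_fps M L F"
  unfolding random_fps_def depends_on_def by blast

lemma random_fps_deterministic: "prob_space M \<Longrightarrow> random_fps M K (\<lambda>_. f)"
  by (auto simp: random_fps_def depends_on_def all_moments_const)

lemma random_fps_const: "all_moments M f \<Longrightarrow> depends_on K f \<Longrightarrow> prob_space M \<Longrightarrow> random_fps M K (\<lambda>w. fps_const (f w))"
  unfolding random_fps_def
proof
  fix k assume "all_moments M f" "depends_on K f" "prob_space M"
  then show "all_moments M (\<lambda>w. fps_const (f w) $ k) \<and> depends_on K (\<lambda>w. fps_const (f w) $ k)"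
    by (cases k) (auto simp: all_moments_const depends_on_def)
qed

lemma random_fps_mult:
  fixes M :: "('i \<Rightarrow> 'a) measure"
  assumes M: "prob_space M" and F: "random_fps M K F" and G: "random_fps M K G"
  shows "random_fps M K (\<lambda>w. F w * G w)"
  unfolding random_fps_def
proof (intro allI conjI)
  fix k
  show "all_moments M (\<lambda>w. (F w * G w) $ k)"
    unfolding fps_mult_nth using F G by (intro all_moments_sum[OF M] all_moments_mult) (auto simp: random_fps_def)
  show "depends_on K (\<lambda>w. (F w * G w) $ k)"
    unfolding depends_on_def
  proof (intro allI impI)
    fix w w' :: "'i \<Rightarrow> 'a" assume w: "\<forall>e\<in>K. w e = w' e"
    have "F w $ i = F w' $ i" "G w $ i = G w' $ i" for i
      using F G w unfolding random_fps_def depends_on_def by blast+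
    then show "(F w * G w) $ k = (F w' * G w') $ k" by (simp add: fps_mult_nth)
  qed
qed

lemma random_fps_power:
  assumes M: "prob_space M" and F: "random_fps M K F"
  shows "random_fps M K (\<lambda>w. F w ^ p)"
proof (induction p)
  case 0
  show ?case using random_fps_deterministic[OF M, of K 1] by simp
next
  case (Suc p)
  then show ?case using random_fps_mult[OF M F] by simp
qed

lemma random_fps_sum:
  fixes M :: "('i \<Rightarrow> 'a) measure"
  assumes M: "prob_space M" and F: "\<And>y. y \<in> B \<Longrightarrow> random_fps M (K y) (F y)"
  shows "random_fps M (\<Union>y\<in>B. K y) (\<lambda>w. \<Sum>y\<in>B. F y w)"
  unfolding random_fps_def
proof (intro allI conjI)
  fix k
  show "all_moments M (\<lambda>w. (\<Sum>y\<in>B. F y w) $ k)"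
    unfolding fps_sum_nth using F by (intro all_moments_sum[OF M]) (auto simp: random_fps_def)
  show "depends_on (\<Union>y\<in>B. K y) (\<lambda>w. (\<Sum>y\<in>B. F y w) $ k)"
    unfolding depends_on_def fps_sum_nth
  proof (intro allI impI sum.cong refl)
    fix w w' :: "'i \<Rightarrow> 'a" and y assume w: "\<forall>e\<in>(\<Union>y\<in>B. K y). w e = w' e" "y \<in> B"
    then show "F y w $ k = F y w' $ k"
      using F[OF w(2)] unfolding random_fps_def by (auto intro: depends_onD[of "K y"])
  qed
qed

lemma random_fps_geometric:
  fixes M :: "('i \<Rightarrow> 'a) measure"
  assumes M: "prob_space M" and G: "random_fps M K G"
  shows "random_fps M K (\<lambda>w. inverse (1 - fps_X * G w))"
  unfolding random_fps_def
proof (intro allI)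
  fix k
  show "all_moments M (\<lambda>w. inverse (1 - fps_X * G w) $ k) \<and> depends_on K (\<lambda>w. inverse (1 - fps_X * G w) $ k)"
  proof (induction k rule: less_induct)
    case (less k)
    show ?case
    proof (cases k)
      case 0
      then show ?thesis by (simp add: tree_res_unfold all_moments_const[OF M] depends_on_def)
    next
      case (Suc k')
      have IH: "all_moments M (\<lambda>w. inverse (1 - fps_X * G w) $ (k' - i))" "depends_on K (\<lambda>w. inverse (1 - fps_X * G w) $ (k' - i))" for i
        using less.IH[of "k' - i"] Suc by auto
      show ?thesis
        unfolding Suc tree_res_unfold(2)
      proof
        show "all_moments M (\<lambda>w. \<Sum>i\<le>k'. G w $ i * inverse (1 - fps_X * G w) $ (k' - i))"
          using G IH by (intro all_moments_sum[OF M] all_moments_mult) (auto simp: random_fps_def)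
        show "depends_on K (\<lambda>w. \<Sum>i\<le>k'. G w $ i * inverse (1 - fps_X * G w) $ (k' - i))"
          unfolding depends_on_def
        proof (intro allI impI sum.cong refl arg_cong2[of _ _ _ _ "(*)"])
          fix w w' :: "'i \<Rightarrow> 'a" and i assume w: "\<forall>e\<in>K. w e = w' e"
          show "G w $ i = G w' $ i" using G w unfolding random_fps_def depends_on_def by blast
          show "inverse (1 - fps_X * G w) $ (k' - i) = inverse (1 - fps_X * G w') $ (k' - i)"
            using IH(2)[of i] w unfolding depends_on_def by blast
        qed
      qed
    qed
  qed
qed

text \<open>The first of \<open>q\<close> factors selects \<open>y\<close>; the others are expanded
  binomially into \<open>y\<close> and the rest. Independence separates the two, and the rest has
  one summand fewer, which is the recursion of \<open>sum_pow\<close>.\<close>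

lemma expectation_sum_pow:
  fixes F :: "'b \<Rightarrow> ('i \<Rightarrow> real) \<Rightarrow> real fps"
  assumes W: "weight_distribution W" and E: "finite E" and B: "finite B"
    and F: "\<And>y. y \<in> B \<Longrightarrow> random_fps (PiM E (\<lambda>_. W)) (D y) (F y)"
    and disj: "\<And>y y'. y \<in> B \<Longrightarrow> y' \<in> B \<Longrightarrow> y \<noteq> y' \<Longrightarrow> D y \<inter> D y' = {}"
    and exp: "\<And>y j k. y \<in> B \<Longrightarrow> (\<integral>w. (F y w ^ Suc j) $ k \<partial>PiM E (\<lambda>_. W)) = Y (Suc j) $ k"
  shows "(\<integral>w. ((\<Sum>y\<in>B. F y w) ^ q) $ k \<partial>PiM E (\<lambda>_. W)) = sum_pow Y (real (card B)) q $ k"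
  using B F disj exp
proof (induction q arbitrary: B k rule: less_induct)
  case (less q)
  let ?P = "PiM E (\<lambda>_. W)"
  interpret P: prob_space ?P by (rule prob_space_weights[OF W])
  note P = P.prob_space_axioms
  show ?case
  proof (cases q)
    case 0
    then show ?thesis by (simp add: P.prob_space)
  next
    case (Suc n)
    define S where "S y w = (\<Sum>z\<in>B - {y}. F z w)" for y w
    have Srf: "random_fps ?P (\<Union>z\<in>B - {y}. D z) (\<lambda>w. S y w ^ p)" for y p
      unfolding S_def by (intro random_fps_power[OF P] random_fps_sum[OF P]) (use less.prems(2) in auto)
    have Frf: "random_fps ?P (D y) (\<lambda>w. F y w ^ p)" if "y \<in> B" for y p
      by (intro random_fps_power[OF P] less.prems(2) that)
    have am: "all_moments ?P (\<lambda>w. F y w ^ p $ i * S y w ^ p' $ i')" if "y \<in> B" for y p p' i i'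
      using Srf Frf[OF that] by (intro all_moments_mult) (auto simp: random_fps_def)
    have expand: "((\<Sum>y\<in>B. F y w) ^ q) $ k = (\<Sum>y\<in>B. \<Sum>j\<le>n. real (n choose j) *
        (\<Sum>i\<le>k. F y w ^ Suc j $ i * S y w ^ (n - j) $ (k - i)))" for w
    proof -
      have "(\<Sum>y\<in>B. F y w) ^ q = (\<Sum>y\<in>B. F y w * (F y w + S y w) ^ n)"
      proof -
        have "(\<Sum>y\<in>B. F y w) = F z w + S z w" if "z \<in> B" for z
          unfolding S_def using that less.prems(1) by (simp add: sum.remove)
        then show ?thesis unfolding Suc power_Suc sum_distrib_right by simp
      qed
      also have "\<dots> = (\<Sum>y\<in>B. \<Sum>j\<le>n. fps_const (real (n choose j)) * (F y w ^ Suc j * S y w ^ (n - j)))"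
        unfolding binomial_ring sum_distrib_left by (intro sum.cong refl) (simp add: fps_of_nat mult_ac)
      finally show ?thesis 
        by (simp only: fps_sum_nth fps_mult_left_const_nth) (simp only: fps_mult_nth atLeast0AtMost)
    qed
    have prod_term: "(\<integral>w. F y w ^ Suc j $ i * S y w ^ (n - j) $ (k - i) \<partial>?P)
        = Y (Suc j) $ i * sum_pow Y (real (card B) - 1) (n - j) $ (k - i)" if y: "y \<in> B" for y i j
    proof -
      have "(\<integral>w. F y w ^ Suc j $ i * S y w ^ (n - j) $ (k - i) \<partial>?P)
        = (\<integral>w. F y w ^ Suc j $ i \<partial>?P) * (\<integral>w. S y w ^ (n - j) $ (k - i) \<partial>?P)"
      proof (rule integral_mult_disjoint[OF W E])
        show "integrable ?P (\<lambda>w. F y w ^ Suc j $ i)" "depends_on (D y) (\<lambda>w. F y w ^ Suc j $ i)"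
          using Frf[OF y, of "Suc j"] unfolding random_fps_def by (blast intro: all_moments_integrable)+
        show "integrable ?P (\<lambda>w. S y w ^ (n - j) $ (k - i))" "depends_on (\<Union>z\<in>B - {y}. D z) (\<lambda>w. S y w ^ (n - j) $ (k - i))"
          using Srf[of y "n - j"] unfolding random_fps_def by (blast intro: all_moments_integrable)+
        show "integrable ?P (\<lambda>w. F y w ^ Suc j $ i * S y w ^ (n - j) $ (k - i))"
          by (rule all_moments_integrable[OF am[OF y]])
        show "D y \<inter> (\<Union>z\<in>B - {y}. D z) = {}" using less.prems(3) y by blast
      qed
      also have "(\<integral>w. F y w ^ Suc j $ i \<partial>?P) = Y (Suc j) $ i" by (rule less.prems(4)[OF y])
      also have "(\<integral>w. S y w ^ (n - j) $ (k - i) \<partial>?P) = sum_pow Y (real (card (B - {y}))) (n - j) $ (k - i)"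
        unfolding S_def by (rule less.IH) (use Suc less.prems in auto)
      also have "real (card (B - {y})) = real (card B) - 1"
        using y less.prems(1) by (simp add: card_Diff_singleton card_gt_0_iff of_nat_diff Suc_leI)
          (metis One_nat_def Suc_leI card_gt_0_iff empty_iff of_nat_1 of_nat_diff)
      finally show ?thesis .
    qed
    have "(\<integral>w. ((\<Sum>y\<in>B. F y w) ^ q) $ k \<partial>?P) = (\<Sum>y\<in>B. \<Sum>j\<le>n. real (n choose j) *
        (\<Sum>i\<le>k. \<integral>w. F y w ^ Suc j $ i * S y w ^ (n - j) $ (k - i) \<partial>?P))"
    proof -
      have i1: "integrable ?P (\<lambda>w. F y w ^ Suc j $ i * S y w ^ (n - j) $ (k - i))" if "y \<in> B" for y i j
        by (rule all_moments_integrable[OF am[OF that]])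
      have i2: "integrable ?P (\<lambda>w. \<Sum>i\<le>k. F y w ^ Suc j $ i * S y w ^ (n - j) $ (k - i))" if "y \<in> B" for y j
        by (intro Bochner_Integration.integrable_sum i1 that)
      show ?thesis
        unfolding expand
        apply (subst Bochner_Integration.integral_sum)
         apply (intro Bochner_Integration.integrable_sum integrable_mult_right i2, assumption)
        apply (intro sum.cong refl)
        apply (subst Bochner_Integration.integral_sum)
         apply (intro integrable_mult_right i2, assumption)
        apply (intro sum.cong refl)
        apply (subst integral_mult_right_zero)
        apply (subst Bochner_Integration.integral_sum)
         apply (rule i1, assumption)
        apply (rule refl)
        done
    qed
    also have "\<dots> = (\<Sum>y\<in>B. \<Sum>j\<le>n. real (n choose j) *
        (\<Sum>i\<le>k. Y (Suc j) $ i * sum_pow Y (real (card B) - 1) (n - j) $ (k - i)))"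
      by (simp only: prod_term cong: sum.cong)
    also have "\<dots> = sum_pow Y (real (card B)) q $ k"
      by (simp add: Suc sum_pow_Suc_nth)
    finally show ?thesis .
  qed
qed

text \<open>Locality: only weights on edges inside the ball are read, so disjoint balls give
  independent resolvents.\<close>

lemma random_fps_tree_res:
  assumes W: "weight_distribution W" and x: "x \<in> U" and E2: "\<And>e. e \<in> E \<Longrightarrow> card e = 2"
  shows "random_fps (PiM E (\<lambda>_. W)) {e \<in> E. e \<subseteq> reach E U n x} (\<lambda>w. tree_res E w n U x)"
  using x
proof (induction n arbitrary: U x)
  case 0
  then show ?case by (simp add: random_fps_deterministic[OF prob_space_weights[OF W]])
next
  case (Suc n)
  note P = prob_space_weights[OF W, of E]
  have loop: "{v, v} \<notin> E" for v using E2[of "{v, v}"] by auto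
  have rn: "reach E (U - {x}) n y \<subseteq> reach E U (Suc n) x" "y \<in> U - {x}" "{x, y} \<in> E" "{x, y} \<subseteq> reach E U (Suc n) x"
    if y: "y \<in> nbrs E U x" for y
  proof -
    show r: "reach E (U - {x}) n y \<subseteq> reach E U (Suc n) x"
      by (rule reach_nbr_subset[OF Suc.prems y]) auto
    show "y \<in> U - {x}" "{x, y} \<in> E" using y loop by (auto simp: nbrs_def)
    show "{x, y} \<subseteq> reach E U (Suc n) x" using r reach_refl[of y E "U - {x}" n] reach_refl[of x E U "Suc n"] by auto
  qed
  have "random_fps (PiM E (\<lambda>_. W)) (\<Union>y\<in>nbrs E U x. {e \<in> E. e \<subseteq> reach E U (Suc n) x})
     (\<lambda>w. \<Sum>y\<in>nbrs E U x. fps_const ((w {x, y})\<^sup>2) * tree_res E w n (U - {x}) y)"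
  proof (rule random_fps_sum[OF P])
    fix y assume y: "y \<in> nbrs E U x"
    have "random_fps (PiM E (\<lambda>_. W)) {e \<in> E. e \<subseteq> reach E U (Suc n) x} (\<lambda>w. tree_res E w n (U - {x}) y)"
      by (rule random_fps_mono[OF Suc.IH[OF rn(2)[OF y]]]) (use rn(1)[OF y] in auto)
    moreover have "random_fps (PiM E (\<lambda>_. W)) {e \<in> E. e \<subseteq> reach E U (Suc n) x} (\<lambda>w. fps_const ((w {x, y})\<^sup>2))"
    proof (rule random_fps_const[OF _ _ P])
      show "all_moments (PiM E (\<lambda>_. W)) (\<lambda>w. (w {x, y})\<^sup>2)"
        unfolding power2_eq_square using integral_weight_component(1)[OF W rn(3)[OF y]] by (intro all_moments_mult)
      show "depends_on {e \<in> E. e \<subseteq> reach E U (Suc n) x} (\<lambda>w. (w {x, y})\<^sup>2)"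
        using rn(3,4)[OF y] by (auto simp: depends_on_def)
    qed
    ultimately show "random_fps (PiM E (\<lambda>_. W)) {e \<in> E. e \<subseteq> reach E U (Suc n) x}
       (\<lambda>w. fps_const ((w {x, y})\<^sup>2) * tree_res E w n (U - {x}) y)"
      by (intro random_fps_mult[OF P])
  qed
  then have "random_fps (PiM E (\<lambda>_. W)) {e \<in> E. e \<subseteq> reach E U (Suc n) x}
     (\<lambda>w. \<Sum>y\<in>nbrs E U x. fps_const ((w {x, y})\<^sup>2) * tree_res E w n (U - {x}) y)"
    by (rule random_fps_mono) auto
  from random_fps_geometric[OF P this] show ?case
    by (simp add: sum_distrib_left mult_ac)
qed

text \<open>One level of the tree, with unspecified expectations \<open>R p\<close> at the children,
  so that it serves both below the root and at the root. The edge to a child is independent of the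
  child's resolvent, and different branches are independent of each other.\<close>

lemma expectation_tree_res_step:
  assumes W: "weight_distribution W" and E: "finite E" and U: "finite U" "x \<in> U" and E2: "\<And>e. e \<in> E \<Longrightarrow> card e = 2"
    and tl: "tree_like E d (Suc n) e U x"
    and IH: "\<And>y p k. y \<in> nbrs E U x \<Longrightarrow> (\<integral>w. (tree_res E w n (U - {x}) y ^ p) $ k \<partial>PiM E (\<lambda>_. W)) = R p $ k"
  shows "(\<integral>w. (tree_res E w (Suc n) U x ^ p) $ k \<partial>PiM E (\<lambda>_. W)) = (\<Sum>q\<le>k. real ((q + p - 1) choose q) *
     sum_pow (\<lambda>j. fps_const (moment W (2 * j)) * fps_X ^ j * R j) (real e) q $ k)"
proof -
  let ?P = "PiM E (\<lambda>_. W)" and ?V = "U - {x}" and ?N = "nbrs E U x"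
  interpret P: prob_space ?P by (rule prob_space_weights[OF W])
  note P = P.prob_space_axioms
  have loop: "{v, v} \<notin> E" for v using E2[of "{v, v}"] by auto
  define F where "F y w = fps_const ((w {x, y})\<^sup>2) * fps_X * tree_res E w n ?V y" for y w
  define L where "L y = {e \<in> E. e \<subseteq> reach E ?V n y}" for y
  define D where "D y = insert {x, y} (L y)" for y
  have yV: "y \<in> ?V" "{x, y} \<in> E" if "y \<in> ?N" for y using that loop by (auto simp: nbrs_def)
  have rV: "reach E ?V n y \<subseteq> ?V" if "y \<in> ?N" for y by (rule reach_subset[OF yV(1)[OF that]])
  have Rrf: "random_fps ?P (L y) (\<lambda>w. tree_res E w n ?V y)" if "y \<in> ?N" for y
    unfolding L_def by (rule random_fps_tree_res[OF W yV(1)[OF that] E2])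
  have we: "all_moments ?P (\<lambda>w. (w {x, y}) ^ j)" if "y \<in> ?N" for y j
  proof (induction j)
    case (Suc j)
    then show ?case using integral_weight_component(1)[OF W yV(2)[OF that]] by (simp add: all_moments_mult)
  qed (simp add: all_moments_const[OF P])
  have Frf: "random_fps ?P (D y) (F y)" if y: "y \<in> ?N" for y
    unfolding F_def
  proof (intro random_fps_mult[OF P])
    show "random_fps ?P (D y) (\<lambda>w. fps_const ((w {x, y})\<^sup>2))"
      by (rule random_fps_const[OF we[OF y] _ P]) (auto simp: depends_on_def D_def)
    show "random_fps ?P (D y) (\<lambda>w. fps_X)" by (rule random_fps_deterministic[OF P])
    show "random_fps ?P (D y) (\<lambda>w. tree_res E w n ?V y)"
      by (rule random_fps_mono[OF Rrf[OF y]]) (auto simp: D_def)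
  qed
  have disj: "D y \<inter> D y' = {}" if y: "y \<in> ?N" "y' \<in> ?N" "y \<noteq> y'" for y y'
  proof -
    have rd: "reach E ?V n y \<inter> reach E ?V n y' = {}" using tl y by auto
    have "{x, y} \<notin> L y'" "{x, y'} \<notin> L y" using rV[OF y(1)] rV[OF y(2)] by (auto simp: L_def)
    moreover have "{x, y} \<noteq> {x, y'}" using y(3) by (auto simp: doubleton_eq_iff)
    \<comment> \<open>An edge inside two disjoint balls would be empty, whereas edges have two
      elements.\<close>
    moreover have "e \<notin> L y'" if "e \<in> L y" for e
    proof
      assume "e \<in> L y'"
      then have "e = {}" using that rd by (auto simp: L_def)
      then show False using E2[of e] that by (auto simp: L_def)
    qed
    ultimately show ?thesis unfolding D_def by auto
  qed
  have exp: "(\<integral>w. (F y w ^ Suc j) $ k \<partial>?P) = (fps_const (moment W (2 * Suc j)) * fps_X ^ Suc j * R (Suc j)) $ k"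
    if y: "y \<in> ?N" for y j k
  proof -
    define p where "p = Suc j"
    have "F y w ^ p = fps_const ((w {x, y}) ^ (2 * p)) * fps_X ^ p * tree_res E w n ?V y ^ p" for w
      unfolding F_def power_mult_distrib fps_const_power power_mult ..
    then have nth: "(F y w ^ p) $ k = (if k < p then 0 else (w {x, y}) ^ (2 * p) * (tree_res E w n ?V y ^ p) $ (k - p))" for w
      by (simp only: const_X_power_mult_nth)
    have "(\<integral>w. (F y w ^ p) $ k \<partial>?P) = (fps_const (moment W (2 * p)) * fps_X ^ p * R p) $ k"
    proof (cases "k < p")
      case True
      then show ?thesis unfolding nth const_X_power_mult_nth by simp
    next
      case False
      have rp: "random_fps ?P (L y) (\<lambda>w. tree_res E w n ?V y ^ p)"
        by (rule random_fps_power[OF P Rrf[OF y]])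
      have "(\<integral>w. (w {x, y}) ^ (2 * p) * (tree_res E w n ?V y ^ p) $ (k - p) \<partial>?P) =
        (\<integral>w. (w {x, y}) ^ (2 * p) \<partial>?P) * (\<integral>w. (tree_res E w n ?V y ^ p) $ (k - p) \<partial>?P)"
      proof (rule integral_mult_disjoint[OF W E])
        show "integrable ?P (\<lambda>w. (w {x, y}) ^ (2 * p))" by (rule all_moments_integrable[OF we[OF y]])
        show "depends_on {{x, y}} (\<lambda>w. (w {x, y}) ^ (2 * p))" by (simp add: depends_on_def)
        show "integrable ?P (\<lambda>w. (tree_res E w n ?V y ^ p) $ (k - p))"
          "depends_on (L y) (\<lambda>w. (tree_res E w n ?V y ^ p) $ (k - p))"
          using rp unfolding random_fps_def by (blast intro: all_moments_integrable)+
        show "integrable ?P (\<lambda>w. (w {x, y}) ^ (2 * p) * (tree_res E w n ?V y ^ p) $ (k - p))"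
          using rp we[OF y] unfolding random_fps_def by (intro all_moments_integrable all_moments_mult) auto
        show "{{x, y}} \<inter> L y = {}" using rV[OF y] by (auto simp: L_def)
      qed
      also have "\<dots> = moment W (2 * p) * R p $ (k - p)"
        by (simp only: integral_weight_component(2)[OF W yV(2)[OF y]] IH[OF y])
      finally show ?thesis unfolding nth const_X_power_mult_nth using False by simp
    qed
    then show ?thesis by (simp only: p_def)
  qed
  define S where "S w = (\<Sum>y\<in>?N. F y w)" for w
  have S0: "S w $ 0 = 0" for w by (simp add: S_def F_def fps_sum_nth mult.assoc)
  have res: "tree_res E w (Suc n) U x = inverse (1 - S w)" for w
    by (simp add: S_def F_def)
  have "(tree_res E w (Suc n) U x ^ p) $ k = (\<Sum>q\<le>k. real ((q + p - 1) choose q) * (S w ^ q) $ k)" for w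
  proof -
    have "inverse (1 - S w) * (1 - S w) = 1" by (rule inverse_mult_eq_1) (simp add: S0)
    from geometric_power_nth[OF this S0 order_refl, of p 1 k] show ?thesis unfolding res by simp
  qed
  moreover have "random_fps ?P (\<Union>y\<in>?N. D y) (\<lambda>w. S w ^ q)" for q
    unfolding S_def by (intro random_fps_power[OF P] random_fps_sum[OF P] Frf)
  then have int: "integrable ?P (\<lambda>w. (S w ^ q) $ k)" for q
    unfolding random_fps_def by (blast intro: all_moments_integrable)
  ultimately have "(\<integral>w. (tree_res E w (Suc n) U x ^ p) $ k \<partial>?P) =
      (\<Sum>q\<le>k. real ((q + p - 1) choose q) * (\<integral>w. (S w ^ q) $ k \<partial>?P))"
    by (simp only: Bochner_Integration.integral_sum[OF integrable_mult_right[OF int]] integral_mult_right_zero)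
  also have "\<dots> = (\<Sum>q\<le>k. real ((q + p - 1) choose q) *
     sum_pow (\<lambda>j. fps_const (moment W (2 * j)) * fps_X ^ j * R j) (real e) q $ k)"
  proof -
    have "card ?N = e" using tl by simp
    then show ?thesis
      unfolding S_def using expectation_sum_pow[OF W E finite_nbrs[OF U(1)] Frf disj exp] by simp
  qed
  finally show ?thesis .
qed

lemma expectation_tree_res:
  assumes W: "weight_distribution W" and E: "finite E" and E2: "\<And>e. e \<in> E \<Longrightarrow> card e = 2"
    and U: "finite U" "x \<in> U" and tl: "tree_like E d n (d - 1) U x"
  shows "(\<integral>w. (tree_res E w n U x ^ p) $ k \<partial>PiM E (\<lambda>_. W)) =
    res_pow_aux (\<lambda>j. moment W (2 * j)) (real (d - 1)) n p $ k"
  using U tl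
proof (induction n arbitrary: U x p k)
  case 0
  interpret P: prob_space "PiM E (\<lambda>_. W)" by (rule prob_space_weights[OF W])
  show ?case by (simp add: P.prob_space)
next
  case (Suc n)
  have "(\<integral>w. (tree_res E w n (U - {x}) y ^ p) $ k \<partial>PiM E (\<lambda>_. W)) =
      res_pow_aux (\<lambda>j. moment W (2 * j)) (real (d - 1)) n p $ k" if y: "y \<in> nbrs E U x" for y p k
  proof (rule Suc.IH)
    show "finite (U - {x})" using Suc.prems by simp
    show "y \<in> U - {x}" using y E2[of "{x, x}"] by (auto simp: nbrs_def)
    show "tree_like E d n (d - 1) (U - {x}) y" using Suc.prems(3) y by simp
  qed
  from expectation_tree_res_step[OF W E Suc.prems(1,2) E2 Suc.prems(3) this]
  show ?case by simp
qed

lemma expectation_tree_res_root: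
  assumes W: "weight_distribution W" and E: "finite E" and E2: "\<And>e. e \<in> E \<Longrightarrow> card e = 2"
    and U: "finite U" "x \<in> U" and tl: "tree_like E d (Suc n) d U x" and k: "k \<le> Suc n"
  shows "(\<integral>w. tree_res E w (Suc n) U x $ k \<partial>PiM E (\<lambda>_. W)) = tree_moment (\<lambda>j. moment W (2 * j)) d k"
proof -
  let ?m = "\<lambda>j. moment W (2 * j)"
  have "(\<integral>w. (tree_res E w n (U - {x}) y ^ p) $ k \<partial>PiM E (\<lambda>_. W)) =
      res_pow_aux ?m (real (d - 1)) n p $ k" if y: "y \<in> nbrs E U x" for y p k
  proof (rule expectation_tree_res[OF W E E2])
    show "finite (U - {x})" using U by simp
    show "y \<in> U - {x}" using y E2[of "{x, x}"] by (auto simp: nbrs_def)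
    show "tree_like E d n (d - 1) (U - {x}) y" using tl y by simp
  qed
  from expectation_tree_res_step[OF W E U E2 tl this, of 1 k]
  have "(\<integral>w. tree_res E w (Suc n) U x $ k \<partial>PiM E (\<lambda>_. W)) = (\<Sum>q\<le>k.
     sum_pow (\<lambda>j. fps_const (?m j) * fps_X ^ j * res_pow_aux ?m (real (d - 1)) n j) (real d) q $ k)"
    by (simp del: tree_res.simps)
  also have "\<dots> = tree_moment ?m d k"
    unfolding tree_moment_def
  proof (intro sum.cong refl sum_pow_nth_cong)
    \<comment> \<open>The shift by \<open>Suc j \<ge> 1\<close> means that depth \<open>n\<close>
      below the root determines coefficients up to \<open>Suc n\<close>.\<close>
    fix i j assume "i \<le> k"
    then show "(fps_const (?m (Suc j)) * fps_X ^ Suc j * res_pow_aux ?m (real (d - 1)) n (Suc j)) $ i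
        = edge_pow ?m (real (d - 1)) (Suc j) $ i"
      unfolding const_X_power_mult_nth edge_pow_nth using k by (simp add: res_pow_aux_eq_res_pow)
  qed
  finally show ?thesis .
qed

section \<open>Moments of the averaged spectral distributions\<close>

lemma all_moments_walk_sum:
  assumes W: "weight_distribution W"
  shows "all_moments (PiM E (\<lambda>_. W)) (\<lambda>w. walk_sum E w U k x y)"
proof (induction k arbitrary: x)
  case (Suc k)
  show ?case
    unfolding walk_sum.simps
    by (intro all_moments_sum[OF prob_space_weights[OF W]] all_moments_mult Suc integral_weight_component[OF W])
       (auto simp: nbrs_def)
qed (simp add: all_moments_const[OF prob_space_weights[OF W]])

text \<open>Uniform over all graphs of degree at most \<open>d\<close>, so that exceptional vertices
  contribute a bounded amount. Separating an edge weight from the rest of the walk doubles the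
  exponent, hence the induction on \<open>k\<close> for all \<open>p\<close> at once.\<close>

lemma walk_sum_moment_bound:
  assumes W: "weight_distribution W" and p: "p \<ge> 1"
  shows "\<exists>B. \<forall>(E :: 'a set set) U x y. finite U \<longrightarrow> (\<forall>u\<in>U. card (nbrs E U u) \<le> d) \<longrightarrow> x \<in> U \<longrightarrow>
    (\<integral>w. walk_sum E w U k x y ^ (2 * p) \<partial>PiM E (\<lambda>_. W)) \<le> B"
  using p
proof (induction k arbitrary: p)
  case 0
  have "(\<integral>w. walk_sum E w U 0 x y ^ (2 * p) \<partial>PiM E (\<lambda>_. W)) \<le> 1" for E :: "'a set set" and U x y
  proof -
    interpret P: prob_space "PiM E (\<lambda>_. W)" by (rule prob_space_weights[OF W])
    show ?thesis using 0 by (cases "x = y"; cases p) (auto simp: P.prob_space)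
  qed
  then show ?case by blast
next
  case (Suc k)
  obtain B where B: "\<And>(E :: 'a set set) U x y. finite U \<Longrightarrow> (\<forall>u\<in>U. card (nbrs E U u) \<le> d) \<Longrightarrow> x \<in> U \<Longrightarrow>
    (\<integral>w. walk_sum E w U k x y ^ (2 * (2 * p)) \<partial>PiM E (\<lambda>_. W)) \<le> B"
  proof -
    have "2 * p \<ge> 1" using Suc.prems by simp
    from Suc.IH[OF this] obtain B where "\<forall>(E :: 'a set set) U x y. finite U \<longrightarrow> (\<forall>u\<in>U. card (nbrs E U u) \<le> d) \<longrightarrow> x \<in> U \<longrightarrow>
      (\<integral>w. walk_sum E w U k x y ^ (2 * (2 * p)) \<partial>PiM E (\<lambda>_. W)) \<le> B" ..
    then show thesis by (intro that[of B]) blast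
  qed
  define C where "C = max 0 (moment W (2 * (2 * p)) + B)"
  show ?case
  proof (intro exI allI impI)
    fix E :: "'a set set" and U x y
    assume U: "finite U" and deg: "\<forall>u\<in>U. card (nbrs E U u) \<le> d" and x: "x \<in> U"
    let ?P = "PiM E (\<lambda>_. W)" and ?N = "nbrs E U x"
    let ?s = "\<lambda>u w. walk_sum E w U k u y"
    have edge: "{x, u} \<in> E" "u \<in> U" if "u \<in> ?N" for u using that by (auto simp: nbrs_def)
    have i1: "integrable ?P (\<lambda>w. w {x, u} ^ (2 * (2 * p)))" if "u \<in> ?N" for u
      by (rule all_moments_integrable_power[OF integral_weight_component(1)[OF W edge(1)[OF that]]])
    have i2: "integrable ?P (\<lambda>w. ?s u w ^ (2 * (2 * p)))" for u
      by (rule all_moments_integrable_power[OF all_moments_walk_sum[OF W]])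
    have "(\<integral>w. walk_sum E w U (Suc k) x y ^ (2 * p) \<partial>?P) \<le>
      (\<integral>w. real d ^ (2 * p) * (\<Sum>u\<in>?N. w {x, u} ^ (2 * (2 * p)) + ?s u w ^ (2 * (2 * p))) \<partial>?P)"
    proof (rule integral_mono)
      show "integrable ?P (\<lambda>w. walk_sum E w U (Suc k) x y ^ (2 * p))"
        by (rule all_moments_integrable_power[OF all_moments_walk_sum[OF W]])
      show "integrable ?P (\<lambda>w. real d ^ (2 * p) * (\<Sum>u\<in>?N. w {x, u} ^ (2 * (2 * p)) + ?s u w ^ (2 * (2 * p))))"
        by (intro integrable_mult_right Bochner_Integration.integrable_sum Bochner_Integration.integrable_add i1 i2)
      fix w
      have ab: "(a * b) ^ (2 * p) \<le> a ^ (2 * (2 * p)) + b ^ (2 * (2 * p))" for a b :: real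
        using abs_mult_le_squares[of "a ^ (2 * p)" "b ^ (2 * p)"] abs_ge_self[of "a ^ (2 * p) * b ^ (2 * p)"]
        unfolding power_mult_distrib power_even_eq[of _ "2 * p"] by linarith
      have "walk_sum E w U (Suc k) x y ^ (2 * p) \<le> real (card ?N) ^ (2 * p) * (\<Sum>u\<in>?N. (w {x, u} * ?s u w) ^ (2 * p))"
        unfolding walk_sum.simps by (rule abs_sum_power_even_le[OF Suc.prems finite_nbrs[OF U]])
      also have "\<dots> \<le> real d ^ (2 * p) * (\<Sum>u\<in>?N. w {x, u} ^ (2 * (2 * p)) + ?s u w ^ (2 * (2 * p)))"
        using deg x by (intro mult_mono power_mono sum_mono ab sum_nonneg) auto
      finally show "walk_sum E w U (Suc k) x y ^ (2 * p) \<le>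
        real d ^ (2 * p) * (\<Sum>u\<in>?N. w {x, u} ^ (2 * (2 * p)) + ?s u w ^ (2 * (2 * p)))" .
    qed
    also have "\<dots> = real d ^ (2 * p) * (\<Sum>u\<in>?N. moment W (2 * (2 * p)) + (\<integral>w. ?s u w ^ (2 * (2 * p)) \<partial>?P))"
    proof -
      have "(\<integral>w. (\<Sum>u\<in>?N. w {x, u} ^ (2 * (2 * p)) + ?s u w ^ (2 * (2 * p))) \<partial>?P) =
        (\<Sum>u\<in>?N. moment W (2 * (2 * p)) + (\<integral>w. ?s u w ^ (2 * (2 * p)) \<partial>?P))"
      proof (subst Bochner_Integration.integral_sum)
        show "integrable ?P (\<lambda>w. w {x, u} ^ (2 * (2 * p)) + ?s u w ^ (2 * (2 * p)))" if "u \<in> ?N" for u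
          using i1[OF that] i2 by (rule Bochner_Integration.integrable_add)
        show "(\<Sum>u\<in>?N. \<integral>w. w {x, u} ^ (2 * (2 * p)) + ?s u w ^ (2 * (2 * p)) \<partial>?P) =
          (\<Sum>u\<in>?N. moment W (2 * (2 * p)) + (\<integral>w. ?s u w ^ (2 * (2 * p)) \<partial>?P))"
        proof (rule sum.cong[OF refl])
          fix u assume u: "u \<in> ?N"
          show "(\<integral>w. w {x, u} ^ (2 * (2 * p)) + ?s u w ^ (2 * (2 * p)) \<partial>?P) =
            moment W (2 * (2 * p)) + (\<integral>w. ?s u w ^ (2 * (2 * p)) \<partial>?P)"
            unfolding integral_weight_component(2)[OF W edge(1)[OF u], symmetric]
            by (rule Bochner_Integration.integral_add[OF i1[OF u] i2])
        qed
      qed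
      then show ?thesis by simp
    qed
    also have "\<dots> \<le> real d ^ (2 * p) * (\<Sum>u\<in>?N. C)"
    proof (intro mult_left_mono sum_mono)
      fix u assume "u \<in> ?N"
      then show "moment W (2 * (2 * p)) + (\<integral>w. ?s u w ^ (2 * (2 * p)) \<partial>?P) \<le> C"
        using B[OF U deg edge(2)] unfolding C_def by (simp add: le_max_iff_disj)
    qed auto
    also have "\<dots> \<le> real d ^ (2 * p) * (real d * C)"
      using deg x by (auto intro!: mult_left_mono mult_right_mono simp: C_def)
    finally show "(\<integral>w. walk_sum E w U (Suc k) x y ^ (2 * p) \<partial>?P) \<le> real d ^ (2 * p) * (real d * C)" .
  qed
qed

text \<open>The moment of the mixture is the expected normalised trace of a power, and the trace
  sums the weights of the closed walks.\<close>

lemma spectral_distribution_moment: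
  assumes W: "weight_distribution W" and G: "simple_graph G" and N: "nverts G > 0"
  shows "real_distribution (spectral_distribution G W)"
    and "integrable (spectral_distribution G W) (\<lambda>x. x ^ k)"
    and "moment (spectral_distribution G W) k =
      (\<Sum>v<nverts G. \<integral>w. walk_sum (edges G) w {..<nverts G} k v v \<partial>PiM (edges G) (\<lambda>_. W)) / nverts G"
proof -
  let ?P = "PiM (edges G) (\<lambda>_. W)" and ?N = "nverts G" and ?E = "edges G"
  define A where "A w = weighted_adjacency G w" for w
  define K where "K w = eigenvalue_distribution (A w)" for w
  interpret P: prob_space ?P by (rule prob_space_weights[OF W])
  have A: "A w \<in> carrier_mat ?N ?N" for w by (simp add: A_def weighted_adjacency_def)
  have sym: "A w $$ (i, j) = A w $$ (j, i)" if "i < ?N" "j < ?N" for w i j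
    using that by (simp add: A_def weighted_adjacency_def insert_commute)
  have tr: "(\<Sum>i<?N. (A w ^\<^sub>m k) $$ (i, i)) = (\<Sum>v<?N. walk_sum ?E w {..<?N} k v v)" for w k
    unfolding A_def by (intro sum.cong refl weighted_adjacency_power[OF G]) auto
  have am: "all_moments ?P (\<lambda>w. \<Sum>v<?N. walk_sum ?E w {..<?N} k v v)" for k
    by (intro all_moments_sum all_moments_walk_sum W P.prob_space_axioms)
  have Kmeas: "K \<in> ?P \<rightarrow>\<^sub>M subprob_algebra borel"
    unfolding K_def[abs_def]
    by (rule eigenvalue_distribution_measurable[OF P.not_empty A sym])
       (use all_moments_measurable[OF am] N in \<open>auto simp: tr\<close>)
  have spec: "spectral_distribution G W = ?P \<bind> K"
    by (simp add: spectral_distribution_def K_def[abs_def] A_def)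
  interpret Kw: real_distribution "K w" for w
    unfolding K_def by (rule real_distribution_eigenvalue_distribution)
  have "prob_space (?P \<bind> K)"
    by (rule P.prob_space_bind[OF _ Kmeas]) (simp add: Kw.prob_space_axioms)
  moreover have sets: "sets (?P \<bind> K) = sets borel"
    by (rule sets_bind[OF _ P.not_empty]) simp
  ultimately show "real_distribution (spectral_distribution G W)"
    unfolding spec real_distribution_def real_distribution_axioms_def by simp
  have "\<exists>rs. char_poly (A w) = (\<Prod>r\<leftarrow>rs. [:- r, 1:]) \<and> length rs = ?N" for w
    using symmetric_char_poly_splits[OF A sym] by metis
  then obtain rs where rs: "\<And>w. char_poly (A w) = (\<Prod>r\<leftarrow>rs w. [:- r, 1:])" "\<And>w. length (rs w) = ?N" by metis
  have ne: "rs w \<noteq> []" for w using rs(2)[of w] N by auto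
  have Kint: "integrable (K w) (\<lambda>x. x ^ k)" for w k
    unfolding K_def by (rule integral_eigenvalue_distribution(1)[OF rs(1) ne]) simp
  have Kval: "(\<integral>x. x ^ k \<partial>K w) = (\<Sum>v<?N. walk_sum ?E w {..<?N} k v v) / ?N" for w k
  proof -
    have "(\<integral>x. x ^ k \<partial>K w) = (\<Sum>r\<leftarrow>rs w. r ^ k) / ?N"
      unfolding K_def using integral_eigenvalue_distribution(2)[OF rs(1) ne, of "\<lambda>x. x ^ k"] rs(2) by simp
    then show ?thesis unfolding trace_power_eq_sum_roots[OF A rs(1), symmetric] tr .
  qed
  have Kval_int: "integrable ?P (\<lambda>w. \<integral>x. x ^ k \<partial>K w)" for k
    unfolding Kval using all_moments_integrable[OF am] by simp
  \<comment> \<open>Absolute moments are not polynomial in the weights, but they are dominated by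
    \<open>1 + x ^ (2 * k)\<close>, whose integral is.\<close>
  have fin: "integrable ?P (\<lambda>w. \<integral>x. \<bar>x ^ k\<bar> \<partial>K w)"
  proof (rule Bochner_Integration.integrable_bound)
    show "integrable ?P (\<lambda>w. 1 + (\<integral>x. x ^ (2 * k) \<partial>K w))" using Kval_int by simp
    show "(\<lambda>w. \<integral>x. \<bar>x ^ k\<bar> \<partial>K w) \<in> borel_measurable ?P"
      by (rule measurable_compose[OF Kmeas integral_measurable_subprob_algebra]) simp
    have "(\<integral>x. \<bar>x ^ k\<bar> \<partial>K w) \<le> (\<integral>x. 1 + x ^ (2 * k) \<partial>K w)" for w
    proof (rule integral_mono)
      show "integrable (K w) (\<lambda>x. \<bar>x ^ k\<bar>)" using Kint by (rule integrable_abs)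
      show "integrable (K w) (\<lambda>x. 1 + x ^ (2 * k))" using Kint by simp
      fix x :: real
      show "\<bar>x ^ k\<bar> \<le> 1 + x ^ (2 * k)" unfolding power_even_eq by (rule abs_le_one_plus_square)
    qed
    also have "(\<integral>x. 1 + x ^ (2 * k) \<partial>K w) = 1 + (\<integral>x. x ^ (2 * k) \<partial>K w)" for w
      using Kint Kw.prob_space[of w] by simp
    finally have "(\<integral>x. \<bar>x ^ k\<bar> \<partial>K w) \<le> 1 + (\<integral>x. x ^ (2 * k) \<partial>K w)" for w .
    then show "AE w in ?P. norm (\<integral>x. \<bar>x ^ k\<bar> \<partial>K w) \<le> norm (1 + (\<integral>x. x ^ (2 * k) \<partial>K w))"
      by (intro AE_I2) (simp add: integral_nonneg_AE abs_of_nonneg)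
  qed
  note bind = integral_bind_integrable[OF Kmeas _ Kint fin P.not_empty]
  show "integrable (spectral_distribution G W) (\<lambda>x. x ^ k)"
    unfolding spec by (rule bind(1)) simp
  have "moment (spectral_distribution G W) k = (\<integral>w. (\<Sum>v<?N. walk_sum ?E w {..<?N} k v v) / ?N \<partial>?P)"
    unfolding moment_def spec by (subst bind(2)) (simp_all add: Kval)
  also have "\<dots> = (\<Sum>v<?N. \<integral>w. walk_sum ?E w {..<?N} k v v \<partial>?P) / ?N"
    by (subst integral_divide_zero, subst Bochner_Integration.integral_sum)
       (auto intro!: all_moments_integrable all_moments_walk_sum W)
  finally show "moment (spectral_distribution G W) k = (\<Sum>v<?N. \<integral>w. walk_sum ?E w {..<?N} k v v \<partial>?P) / ?N" .
qed

text \<open>Vertices with a tree-like neighbourhood contribute exactly the limit value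
  \<open>T\<close>; the others contribute boundedly and form a vanishing proportion by the
  few-cycles hypothesis.\<close>

lemma spectral_moment_tendsto:
  assumes W: "weight_distribution W" and G: "few_cycles_sequence d G"
  shows "(\<lambda>i. moment (spectral_distribution (G i) W) (2 * k)) \<longlonglongrightarrow> tree_moment (\<lambda>j. moment W (2 * j)) d k" (is ?even)
    and "(\<lambda>i. moment (spectral_distribution (G i) W) (2 * k + 1)) \<longlonglongrightarrow> 0" (is ?odd)
proof -
  have reg: "regular_graph d (G i)" for i using G by (simp add: few_cycles_sequence_def)
  have N: "filterlim (\<lambda>i. nverts (G i)) at_top sequentially" using G by (simp add: few_cycles_sequence_def)
  \<comment> \<open>Depth \<open>k\<close> would do for walks of length \<open>2 * k\<close>; one
    more level covers length \<open>2 * k + 1\<close>.\<close>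
  define n where "n = Suc k"
  define bad where "bad i = {v \<in> {..<nverts (G i)}. \<not> tree_like (edges (G i)) d n d {..<nverts (G i)} v}" for i
  have bad0: "(\<lambda>i. real (card (bad i)) / real (nverts (G i))) \<longlonglongrightarrow> 0"
  proof (rule Lim_null_comparison)
    show "\<forall>\<^sub>F i in sequentially. norm (real (card (bad i)) / real (nverts (G i))) \<le>
       (\<Sum>l\<in>{3..2 * n + 1}. real (card (cycles (G i) l)) / real (nverts (G i)) * real (l * (d + 1) ^ n))"
    proof (intro always_eventually allI)
      fix i
      have "real (card (bad i)) \<le> real (\<Sum>l\<in>{3..2 * n + 1}. card (cycles (G i) l) * (l * (d + 1) ^ n))"
        unfolding bad_def by (intro of_nat_mono card_not_tree_like_le reg)
      then have "real (card (bad i)) / real (nverts (G i)) \<le>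
         (\<Sum>l\<in>{3..2 * n + 1}. real (card (cycles (G i) l)) * real (l * (d + 1) ^ n)) / real (nverts (G i))"
        by (intro divide_right_mono) (simp_all only: of_nat_sum of_nat_mult of_nat_0_le_iff)
      also have "\<dots> = (\<Sum>l\<in>{3..2 * n + 1}. real (card (cycles (G i) l)) / real (nverts (G i)) * real (l * (d + 1) ^ n))"
        by (simp only: sum_divide_distrib times_divide_eq_left)
      finally show "norm (real (card (bad i)) / real (nverts (G i))) \<le>
       (\<Sum>l\<in>{3..2 * n + 1}. real (card (cycles (G i) l)) / real (nverts (G i)) * real (l * (d + 1) ^ n))" by simp
    qed
    have "(\<lambda>i. real (card (cycles (G i) l)) / real (nverts (G i))) \<longlonglongrightarrow> 0" if "l \<ge> 3" for l
      using G that by (intro smalloD_tendsto) (simp add: few_cycles_sequence_def)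
    then have "(\<lambda>i. \<Sum>l\<in>{3..2 * n + 1}. real (card (cycles (G i) l)) / real (nverts (G i)) * real (l * (d + 1) ^ n))
       \<longlonglongrightarrow> (\<Sum>l\<in>{3..2 * n + 1}. 0 * real (l * (d + 1) ^ n))"
      by (intro tendsto_sum tendsto_mult tendsto_const) auto
    then show "(\<lambda>i. \<Sum>l\<in>{3..2 * n + 1}. real (card (cycles (G i) l)) / real (nverts (G i)) * real (l * (d + 1) ^ n)) \<longlonglongrightarrow> 0"
      by simp
  qed
  have main: "(\<lambda>i. moment (spectral_distribution (G i) W) l) \<longlonglongrightarrow> T"
    if good: "\<And>i v. v < nverts (G i) \<Longrightarrow> v \<notin> bad i \<Longrightarrow>
      (\<integral>w. walk_sum (edges (G i)) w {..<nverts (G i)} l v v \<partial>PiM (edges (G i)) (\<lambda>_. W)) = T" for l T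
  proof -
    from walk_sum_moment_bound[OF W order_refl] obtain B
      where "\<forall>(E :: nat set set) U x y. finite U \<longrightarrow> (\<forall>u\<in>U. card (nbrs E U u) \<le> d) \<longrightarrow> x \<in> U \<longrightarrow>
        (\<integral>w. walk_sum E w U l x y ^ (2 * 1) \<partial>PiM E (\<lambda>_. W)) \<le> B" ..
    note B = this[rule_format]
    define C where "C = 1 + B + \<bar>T\<bar>"
    define X where "X i v = (\<integral>w. walk_sum (edges (G i)) w {..<nverts (G i)} l v v \<partial>PiM (edges (G i)) (\<lambda>_. W))" for i v
    have Xb: "\<bar>X i v - T\<bar> \<le> C" if v: "v < nverts (G i)" for i v
    proof -
      let ?P = "PiM (edges (G i)) (\<lambda>_. W)" and ?f = "\<lambda>w. walk_sum (edges (G i)) w {..<nverts (G i)} l v v"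
      interpret P: prob_space ?P by (rule prob_space_weights[OF W])
      have am: "all_moments ?P ?f" by (rule all_moments_walk_sum[OF W])
      have "\<bar>X i v\<bar> \<le> (\<integral>w. \<bar>?f w\<bar> \<partial>?P)" unfolding X_def by (rule integral_abs_bound)
      also have "\<dots> \<le> (\<integral>w. 1 + ?f w ^ (2 * 1) \<partial>?P)"
      proof (rule integral_mono)
        show "integrable ?P (\<lambda>w. \<bar>?f w\<bar>)" by (rule integrable_abs[OF all_moments_integrable[OF am]])
        show "integrable ?P (\<lambda>w. 1 + ?f w ^ (2 * 1))" using all_moments_integrable_power[OF am, of "2 * 1"] by simp
        fix w
        show "\<bar>?f w\<bar> \<le> 1 + ?f w ^ (2 * 1)" unfolding mult_1_right by (rule abs_le_one_plus_square)
      qed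
      also have "\<dots> = 1 + (\<integral>w. ?f w ^ (2 * 1) \<partial>?P)"
        using all_moments_integrable_power[OF am, of "2 * 1"] by (simp add: P.prob_space)
      also have "\<dots> \<le> 1 + B"
        using B[of "{..<nverts (G i)}" "edges (G i)" v v] card_nbrs_regular[OF reg] v by (simp del: power_even_eq)
      finally show ?thesis unfolding C_def by linarith
    qed
    have "(\<lambda>i. moment (spectral_distribution (G i) W) l - T) \<longlonglongrightarrow> 0"
    proof (rule Lim_null_comparison)
      show "\<forall>\<^sub>F i in sequentially. norm (moment (spectral_distribution (G i) W) l - T) \<le> real (card (bad i)) / real (nverts (G i)) * C"
        using filterlim_at_top[THEN iffD1, OF N, rule_format, of 1]
      proof eventually_elim
        case (elim i')
        define i where "i = i'"
        have elim: "nverts (G i) > 0" using elim by (simp add: i_def)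
        have sg: "simple_graph (G i)" using reg[of i] by (simp add: regular_graph_def)
        have "moment (spectral_distribution (G i) W) l - T = (\<Sum>v<nverts (G i). X i v) / nverts (G i) - T"
          unfolding spectral_distribution_moment(3)[OF W sg elim] X_def ..
        also have "\<dots> = (\<Sum>v<nverts (G i). X i v - T) / nverts (G i)"
          using elim by (simp add: sum_subtractf field_simps)
        also have "(\<Sum>v<nverts (G i). X i v - T) = (\<Sum>v\<in>bad i. X i v - T)"
          by (rule sum.mono_neutral_right) (auto simp: bad_def X_def good)
        finally have eq: "moment (spectral_distribution (G i) W) l - T = (\<Sum>v\<in>bad i. X i v - T) / nverts (G i)" .
        have "\<bar>\<Sum>v\<in>bad i. X i v - T\<bar> \<le> (\<Sum>v\<in>bad i. C)"
          by (rule order_trans[OF sum_abs sum_mono]) (auto simp: bad_def intro!: Xb)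
        then have "\<bar>\<Sum>v\<in>bad i. X i v - T\<bar> / real (nverts (G i)) \<le> real (card (bad i)) * C / real (nverts (G i))"
          by (intro divide_right_mono) auto
        then show ?case unfolding eq i_def[symmetric] by simp
      qed
      show "(\<lambda>i. real (card (bad i)) / real (nverts (G i)) * C) \<longlonglongrightarrow> 0"
        using tendsto_mult[OF bad0 tendsto_const[of C]] by simp
    qed
    then show ?thesis by (simp add: LIM_zero_iff)
  qed
  have sg: "e \<in> edges (G i) \<Longrightarrow> card e = 2" "finite (edges (G i))" "{v, v} \<notin> edges (G i)" for e i v
  proof -
    have s: "edges (G i) \<subseteq> {e. e \<subseteq> {..<nverts (G i)} \<and> card e = 2}"
      using reg[of i] by (simp add: regular_graph_def simple_graph_def)
    show c: "e \<in> edges (G i) \<Longrightarrow> card e = 2" for e using s by auto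
    show "finite (edges (G i))" by (rule finite_subset[of _ "Pow {..<nverts (G i)}"]) (use s in auto)
    show "{v, v} \<notin> edges (G i)" using c[of "{v, v}"] by auto
  qed
  show ?even
  proof (rule main)
    fix i v assume v: "v < nverts (G i)" "v \<notin> bad i"
    then have tl: "tree_like (edges (G i)) d n d {..<nverts (G i)} v" by (simp add: bad_def)
    have "walk_sum (edges (G i)) w {..<nverts (G i)} (2 * k) v v = tree_res (edges (G i)) w n {..<nverts (G i)} v $ k" for w
      by (rule walk_sum_tree_like(1)[OF tl]) (use v sg in \<open>auto simp: n_def\<close>)
    then show "(\<integral>w. walk_sum (edges (G i)) w {..<nverts (G i)} (2 * k) v v \<partial>PiM (edges (G i)) (\<lambda>_. W)) = tree_moment (\<lambda>j. moment W (2 * j)) d k"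
      using expectation_tree_res_root[OF W sg(2) sg(1) _ _ tl[unfolded n_def], where k = k] v by (simp add: n_def del: tree_res.simps)
  qed
  show ?odd
  proof (rule main)
    fix i v assume v: "v < nverts (G i)" "v \<notin> bad i"
    then have tl: "tree_like (edges (G i)) d n d {..<nverts (G i)} v" by (simp add: bad_def)
    have "walk_sum (edges (G i)) w {..<nverts (G i)} (2 * k + 1) v v = 0" for w
      by (rule walk_sum_tree_like(2)[OF tl]) (use v sg in \<open>auto simp: n_def\<close>)
    then show "(\<integral>w. walk_sum (edges (G i)) w {..<nverts (G i)} (2 * k + 1) v v \<partial>PiM (edges (G i)) (\<lambda>_. W)) = 0"
      by (simp only: integral_zero)
  qed
qed

lemma spectral_moment_tendsto_all:
  assumes W: "weight_distribution W" and G: "few_cycles_sequence d G"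
  shows "(\<lambda>i. moment (spectral_distribution (G i) W) k) \<longlonglongrightarrow>
    (if even k then tree_moment (\<lambda>j. moment W (2 * j)) d (k div 2) else 0)"
proof (cases "even k")
  case True
  then obtain l where "k = 2 * l" by (elim evenE)
  then show ?thesis using spectral_moment_tendsto(1)[OF W G, of l] by simp
next
  case False
  then obtain l where "k = 2 * l + 1" by (elim oddE)
  then show ?thesis using spectral_moment_tendsto(2)[OF W G, of l] by simp
qed

lemma spectral_tail:
  assumes W: "weight_distribution W" and G: "few_cycles_sequence d G"
  obtains r where
    "\<forall>i. real_distribution (spectral_distribution (G (i + r)) W)"
    "\<forall>i k. integrable (spectral_distribution (G (i + r)) W) (\<lambda>x. x ^ k)"
    "\<forall>k. (\<lambda>i. moment (spectral_distribution (G (i + r)) W) k) \<longlonglongrightarrow>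
       (if even k then tree_moment (\<lambda>j. moment W (2 * j)) d (k div 2) else 0)"
proof -
  have "filterlim (\<lambda>i. nverts (G i)) at_top sequentially" using G by (simp add: few_cycles_sequence_def)
  then have "\<forall>\<^sub>F i in sequentially. 1 \<le> nverts (G i)" unfolding filterlim_at_top by blast
  then obtain r where r: "\<And>i. i \<ge> r \<Longrightarrow> 1 \<le> nverts (G i)" unfolding eventually_sequentially by blast
  have N: "nverts (G (i + r)) > 0" for i using r[of "i + r"] by simp
  have sg: "simple_graph (G i)" for i using G by (simp add: few_cycles_sequence_def regular_graph_def)
  show thesis
  proof (rule that[of r]; intro allI)
    show "real_distribution (spectral_distribution (G (i + r)) W)" for i
      by (rule spectral_distribution_moment(1)[OF W sg N])
    show "integrable (spectral_distribution (G (i + r)) W) (\<lambda>x. x ^ k)" for i k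
      by (rule spectral_distribution_moment(2)[OF W sg N])
    show "(\<lambda>i. moment (spectral_distribution (G (i + r)) W) k) \<longlonglongrightarrow>
       (if even k then tree_moment (\<lambda>j. moment W (2 * j)) d (k div 2) else 0)" for k
      by (rule LIMSEQ_ignore_initial_segment[OF spectral_moment_tendsto_all[OF W G]])
  qed
qed

lemma weak_conv_offset:
  assumes "weak_conv_m M M'"
  shows "weak_conv_m (\<lambda>i. M (i + r)) M'"
  using assms unfolding weak_conv_m_def weak_conv_def
  by (auto intro: LIMSEQ_ignore_initial_segment)

lemma weak_conv_offset_cancel:
  assumes "weak_conv_m (\<lambda>i. M (i + r)) M'"
  shows "weak_conv_m M M'"
  using assms unfolding weak_conv_m_def weak_conv_def
  by (auto dest: LIMSEQ_offset)

section \<open>Eigendistributions\<close>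

text \<open>\<open>T_maps\<close> quantifies over all sequences with few cycles, so a concrete one
  is needed to extract any information from it.\<close>

lemma T_maps_moment:
  assumes W: "weight_distribution W" and T: "T_maps d W \<nu>" and d: "d \<ge> 2"
  shows "moment \<nu> k = (if even k then tree_moment (\<lambda>j. moment W (2 * j)) d (k div 2) else 0)"
proof -
  obtain G where G: "few_cycles_sequence d G" using few_cycles_sequence_exists[OF d] by blast
  obtain r where "\<forall>i. real_distribution (spectral_distribution (G (i + r)) W)"
    "\<forall>i k. integrable (spectral_distribution (G (i + r)) W) (\<lambda>x. x ^ k)"
    "\<forall>k. (\<lambda>i. moment (spectral_distribution (G (i + r)) W) k) \<longlonglongrightarrow>
       (if even k then tree_moment (\<lambda>j. moment W (2 * j)) d (k div 2) else 0)"
    by (rule spectral_tail[OF W G])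
  note r = this[rule_format]
  have "weak_conv_m (\<lambda>i. spectral_distribution (G (i + r)) W) \<nu>"
    using T G unfolding T_maps_def by (intro weak_conv_offset) blast
  then show ?thesis
    using weak_limit_moments(2)[OF r(1) _ _ r(2) r(3)] T by (simp add: T_maps_def)
qed

lemma moment_rescale:
  assumes "weight_distribution W"
  shows "moment (rescale l W) k = moment W k / l ^ k"
    and "real_distribution (rescale l W)"
    and "integrable (rescale l W) (\<lambda>x. x ^ k)"
proof -
  interpret W: real_distribution W using assms by (simp add: weight_distribution_def)
  have meas: "(\<lambda>x. x / l) \<in> W \<rightarrow>\<^sub>M borel" by simp
  show "real_distribution (rescale l W)"
    unfolding rescale_def real_distribution_def real_distribution_axioms_def
    by (auto intro: W.prob_space_distr)
  have "moment (rescale l W) k = (\<integral>x. (x / l) ^ k \<partial>W)"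
    unfolding moment_def rescale_def by (rule integral_distr[OF meas]) simp
  then show "moment (rescale l W) k = moment W k / l ^ k"
    by (simp add: moment_def power_divide)
  have "integrable W (\<lambda>x. (x / l) ^ k)"
    using assms by (simp add: weight_distribution_def power_divide)
  then show "integrable (rescale l W) (\<lambda>x. x ^ k)"
    unfolding rescale_def by (subst integrable_distr_eq[OF meas]) auto
qed

text \<open>The equation for the second moment reads \<open>1 / l^2 = d\<close>, which turns the
  rescaling factor of the \<open>2 * k\<close>-th moment into \<open>d ^ k\<close>. Odd moments
  vanish because those of the image do.\<close>

lemma eigendistribution_moments:
  assumes eig: "eigendistribution d W" and m2: "moment W 2 = 1 / 4" and d: "d \<ge> 2"
  shows "moment W (2 * k + 1) = 0" and "eigen_moments d (\<lambda>j. moment W (2 * j))"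
proof -
  obtain l where W: "weight_distribution W" and l: "l > 0" "T_maps d W (rescale l W)"
    using eig by (auto simp: eigendistribution_def)
  let ?m = "\<lambda>j. moment W (2 * j)"
  have even: "?m k / l ^ (2 * k) = tree_moment ?m d k" for k
    using T_maps_moment[OF W l(2) d, of "2 * k"] moment_rescale(1)[OF W] by simp
  show "moment W (2 * k + 1) = 0"
    using T_maps_moment[OF W l(2) d, of "2 * k + 1"] moment_rescale(1)[OF W, of l "2 * k + 1"] l by simp
  have "tree_moment (?m(1 := 0)) d 1 = 0"
  proof -
    have "edge_pow (?m(1 := 0)) e (Suc 0) $ Suc 0 = 0" for e by (simp add: edge_pow_nth)
    moreover have "edge_pow (?m(1 := 0)) e (Suc 0) $ 0 = 0" for e by (simp add: edge_pow_nth)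
    ultimately show ?thesis
      by (simp add: tree_moment_def sum_pow_Suc_nth)
  qed
  then have "tree_moment ?m d 1 = real d * ?m 1"
    using tree_moment_affine[of 1 ?m d] by simp
  then have "1 / l\<^sup>2 = real d" using even[of 1] m2 by simp
  then have "(1 / l\<^sup>2) ^ k = real d ^ k" for k by (rule arg_cong)
  then have "1 / l ^ (2 * k) = real d ^ k" for k by (simp add: power_mult power_divide)
  moreover have "?m k / l ^ (2 * k) = 1 / l ^ (2 * k) * ?m k" for k by simp
  ultimately have "real d ^ k * ?m k = tree_moment ?m d k" for k using even[of k] by simp
  then show "eigen_moments d ?m" using m2 by (simp add: eigen_moments_def)
qed

lemma weight_distribution_even_moment_nonneg: "moment W (2 * k) \<ge> 0"
  unfolding moment_def by (intro integral_nonneg_AE AE_I2) (simp add: power_even_eq)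

text \<open>The scale \<open>c\<close> allows one statement for the eigendistribution
  (\<open>c = 1\<close>) and for its image under the map (\<open>c = d\<close>).\<close>

lemma eigen_determinacy:
  assumes W: "real_distribution W" "\<And>k. integrable W (\<lambda>x. x ^ k)"
    and V: "real_distribution V" "\<And>k. integrable V (\<lambda>x. x ^ k)"
    and eq: "\<And>k. moment W k = moment V k" and d: "d \<ge> 2" and c: "c \<ge> 0"
    and em: "\<And>k. moment W (2 * k) = c ^ k * m k" "eigen_moments d m" "\<And>k. m k \<ge> 0" "m 0 = 1"
  shows "W = V"
proof (rule moment_determinacy[OF W V eq])
  define C where "C = 12 * (real d)\<^sup>2 * c + 1"
  show "C > 0" using c by (simp add: C_def add_nonneg_pos)
  fix k
  have "m k \<le> (12 * (real d)\<^sup>2) ^ k * fact (2 * k)"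
  proof (cases "k = 0")
    case False
    have "(1::real) \<le> 12 * (real d)\<^sup>2"
    proof -
      have "(1::real) \<le> (real d)\<^sup>2" using d by (simp add: one_le_power)
      then show ?thesis by simp
    qed
    then have "(12 * (real d)\<^sup>2) ^ (k - 1) \<le> (12 * (real d)\<^sup>2) ^ k"
      by (intro power_increasing) auto
    moreover have "m k \<le> (12 * (real d)\<^sup>2) ^ (k - 1) * fact (2 * k)"
      using eigen_moments_le[OF em(2) d _ em(3), of k] False by simp
    ultimately show ?thesis
      by (meson fact_ge_zero mult_right_mono order_trans)
  qed (simp add: em)
  then have "moment W (2 * k) \<le> c ^ k * ((12 * (real d)\<^sup>2) ^ k * fact (2 * k))"
    unfolding em(1) using c by (intro mult_left_mono) auto
  also have "\<dots> = (12 * (real d)\<^sup>2 * c) ^ k * fact (2 * k)" by (simp add: power_mult_distrib)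
  also have "\<dots> \<le> 1 * C ^ k * fact (2 * k)"
    unfolding C_def using c by (intro mult_right_mono) (auto intro!: power_mono)
  finally show "moment W (2 * k) \<le> 1 * C ^ k * fact (2 * k)" .
qed

lemma eigendistribution_unique:
  assumes "eigendistribution d W" "moment W 2 = 1 / 4" "eigendistribution d V" "moment V 2 = 1 / 4" and d: "d \<ge> 2"
  shows "W = V"
proof -
  have W: "weight_distribution W" "weight_distribution V" using assms by (auto simp: eigendistribution_def)
  have m0: "moment M 0 = 1" if "weight_distribution M" for M
    using prob_space.prob_space[OF weight_distribution_prob_space[OF that]] by (simp add: moment_def)
  have even: "moment W (2 * k) = moment V (2 * k)" for k
    using eigen_moments_unique[OF eigendistribution_moments(2)[OF assms(1,2) d] eigendistribution_moments(2)[OF assms(3,4) d] d, of k]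
      m0 W by (cases "k = 0") auto
  have "moment W k = moment V k" for k
  proof (cases "even k")
    case True
    then show ?thesis using even by (elim evenE) simp
  next
    case False
    then show ?thesis
      using eigendistribution_moments(1)[OF assms(1,2) d] eigendistribution_moments(1)[OF assms(3,4) d]
      by (elim oddE) simp
  qed
  then show ?thesis
    by (intro eigen_determinacy[where d = d and c = 1 and m = "\<lambda>j. moment W (2 * j)"])
       (use W d m0 eigendistribution_moments(2)[OF assms(1,2) d] weight_distribution_even_moment_nonneg
        in \<open>auto simp: weight_distribution_def\<close>)
qed

section \<open>Construction of the eigendistribution by iteration\<close>

lemma contracting_recursion_convergent:
  fixes x b :: "nat \<Rightarrow> real"
  assumes rec: "\<And>n. x (Suc n) = q * x n + b n" and q: "0 \<le> q" "q < 1" and b: "convergent b"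
  shows "convergent x"
proof -
  obtain L where L: "b \<longlonglongrightarrow> L" using b by (auto simp: convergent_def)
  define c where "c = L / (1 - q)"
  define y where "y n = \<bar>x n - c\<bar>" for n
  define e where "e n = \<bar>b n - L\<bar>" for n
  have c: "c = q * c + L" using q by (simp add: c_def field_simps)
  have yrec: "y (Suc n) \<le> q * y n + e n" for n
  proof -
    have "x (Suc n) - c = q * (x n - c) + (b n - L)"
      using c by (simp add: rec algebra_simps)
    then show ?thesis using q abs_triangle_ineq[of "q * (x n - c)" "b n - L"]
      by (simp add: y_def e_def abs_mult)
  qed
  have e0: "e \<longlonglongrightarrow> 0"
    using tendsto_rabs[OF tendsto_diff[OF L tendsto_const[of L]]] by (simp add: e_def[abs_def])
  have "y \<longlonglongrightarrow> 0"
  proof (rule LIMSEQ_I)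
    fix r :: real assume r: "r > 0"
    \<comment> \<open>Solves \<open>q * (r / 2) + \<delta> = r / 2\<close>, so the error bound
      \<open>r / 2\<close> reproduces itself along the recursion.\<close>
    define \<delta> where "\<delta> = r * (1 - q) / 2"
    have \<delta>: "\<delta> > 0" using r q by (simp add: \<delta>_def)
    obtain N where N: "\<And>n. n \<ge> N \<Longrightarrow> e n < \<delta>"
      using LIMSEQ_D[OF e0 \<delta>] by (auto simp: e_def)
    have bd: "y (N + k) \<le> q ^ k * y N + r / 2" for k
    proof (induction k)
      case 0
      then show ?case using r by simp
    next
      case (Suc k)
      have "y (N + Suc k) \<le> q * y (N + k) + \<delta>"
        using yrec[of "N + k"] N[of "N + k"] by simp
      also have "\<dots> \<le> q * (q ^ k * y N + r / 2) + \<delta>"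
        using Suc q by (intro add_right_mono mult_left_mono) auto
      also have "\<dots> = q ^ Suc k * y N + r / 2" by (simp add: \<delta>_def algebra_simps add_divide_distrib diff_divide_distrib)
      finally show ?case .
    qed
    have "(\<lambda>k. q ^ k * y N) \<longlonglongrightarrow> 0 * y N"
      using q by (intro tendsto_mult LIMSEQ_power_zero tendsto_const) auto
    then obtain K where K: "\<And>k. k \<ge> K \<Longrightarrow> \<bar>q ^ k * y N\<bar> < r / 2"
      using LIMSEQ_D[of "\<lambda>k. q ^ k * y N" 0 "r / 2"] r by auto
    show "\<exists>no. \<forall>n\<ge>no. norm (y n - 0) < r"
    proof (intro exI allI impI)
      fix n assume "n \<ge> N + K"
      then obtain k where k: "n = N + k" "k \<ge> K" by (metis add_leD1 le_Suc_ex nat_add_left_cancel_le)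
      have "y n \<ge> 0" by (simp add: y_def)
      then show "norm (y n - 0) < r" using bd[of k] K[OF k(2)] k(1) by simp
    qed
  qed
  then have "(\<lambda>n. x n - c) \<longlonglongrightarrow> 0" unfolding y_def by (simp add: tendsto_rabs_zero_iff)
  then show ?thesis unfolding convergent_def LIM_zero_iff by blast
qed

text \<open>Iterating on moment sequences avoids having to know that the map is defined as a weak
  limit at every iterate: some measure with the given moments suffices. Symmetry refers to the
  vanishing of odd moments only.\<close>

definition symmetric_moments :: "(nat \<Rightarrow> real) \<Rightarrow> bool" where
  "symmetric_moments m \<longleftrightarrow> (\<exists>W. weight_distribution W \<and> (\<forall>k. moment W k = (if even k then m (k div 2) else 0)))"

lemma symmetric_momentsI:
  fixes M :: "nat \<Rightarrow> real measure"
  assumes "\<And>n. real_distribution (M n)" "\<And>n k. integrable (M n) (\<lambda>x. x ^ k)"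
    "\<And>k. (\<lambda>n. moment (M n) k) \<longlonglongrightarrow> (if even k then m (k div 2) else 0)"
  shows "symmetric_moments m"
proof -
  obtain W where "real_distribution W" "\<And>k. integrable W (\<lambda>x. x ^ k)"
    "\<And>k. moment W k = (if even k then m (k div 2) else 0)"
    using limit_of_moments_is_moments[OF assms] by metis
  then show ?thesis unfolding symmetric_moments_def weight_distribution_def by blast
qed

text \<open>The moments are realised as limits of those of spectral distributions of actual finite
  graphs, rescaled by \<open>sqrt d\<close>.\<close>

lemma symmetric_moments_tree_moment:
  assumes m: "symmetric_moments m" and d: "d \<ge> 2"
  shows "symmetric_moments (\<lambda>k. tree_moment m d k / real d ^ k)"
proof -
  obtain W where W: "weight_distribution W" "\<And>k. moment W k = (if even k then m (k div 2) else 0)"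
    using m by (auto simp: symmetric_moments_def)
  have m': "(\<lambda>j. moment W (2 * j)) = m" by (simp add: W(2))
  obtain G where G: "few_cycles_sequence d G" using few_cycles_sequence_exists[OF d] by blast
  obtain r where "\<forall>i. real_distribution (spectral_distribution (G (i + r)) W)"
    "\<forall>i k. integrable (spectral_distribution (G (i + r)) W) (\<lambda>x. x ^ k)"
    "\<forall>k. (\<lambda>i. moment (spectral_distribution (G (i + r)) W) k) \<longlonglongrightarrow> (if even k then tree_moment m d (k div 2) else 0)"
    by (rule spectral_tail[OF W(1) G, unfolded m'])
  note r = this[rule_format]
  have wd: "weight_distribution (spectral_distribution (G (i + r)) W)" for i
    using r by (simp add: weight_distribution_def)
  show ?thesis
  proof (rule symmetric_momentsI)
    show "real_distribution (rescale (sqrt (real d)) (spectral_distribution (G (i + r)) W))" for i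
      by (rule moment_rescale(2)[OF wd])
    show "integrable (rescale (sqrt (real d)) (spectral_distribution (G (i + r)) W)) (\<lambda>x. x ^ k)" for i k
      by (rule moment_rescale(3)[OF wd])
    fix k
    have "(\<lambda>i. moment (spectral_distribution (G (i + r)) W) k / sqrt (real d) ^ k) \<longlonglongrightarrow>
      (if even k then tree_moment m d (k div 2) else 0) / sqrt (real d) ^ k"
      by (intro tendsto_divide r(3) tendsto_const) (use d in auto)
    moreover have "(if even k then tree_moment m d (k div 2) else 0) / sqrt (real d) ^ k
      = (if even k then tree_moment m d (k div 2) / real d ^ (k div 2) else 0)"
      by (auto elim!: evenE simp: power_mult)
    ultimately show "(\<lambda>i. moment (rescale (sqrt (real d)) (spectral_distribution (G (i + r)) W)) k) \<longlonglongrightarrow>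
      (if even k then tree_moment m d (k div 2) / real d ^ (k div 2) else 0)"
      by (simp add: moment_rescale(1)[OF wd])
  qed
qed

lemma symmetric_moments_limit:
  assumes "\<And>n. symmetric_moments (ms n)" "\<And>k. (\<lambda>n. ms n k) \<longlonglongrightarrow> m k"
  shows "symmetric_moments m"
proof -
  obtain W where W: "\<And>n. weight_distribution (W n)"
    "\<And>n k. moment (W n) k = (if even k then ms n (k div 2) else 0)"
    using assms(1) unfolding symmetric_moments_def by metis
  show ?thesis
  proof (rule symmetric_momentsI)
    show "real_distribution (W n)" "integrable (W n) (\<lambda>x. x ^ k)" for n k
      using W(1)[of n] by (auto simp: weight_distribution_def)
    show "(\<lambda>n. moment (W n) k) \<longlonglongrightarrow> (if even k then m (k div 2) else 0)" for k
      unfolding W(2) using assms(2) by auto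
  qed
qed

lemma symmetric_moments_two_point: "symmetric_moments (\<lambda>k. (1 / 4) ^ k)"
proof -
  define p where "p = pmf_of_set {1 / 2, - 1 / 2 :: real}"
  define W where "W = distr (measure_pmf p) borel (\<lambda>x. x)"
  have int: "integrable (measure_pmf p) (\<lambda>x. x ^ k)" for k
    by (rule integrable_measure_pmf_finite) (simp add: p_def)
  have "real_distribution W"
    unfolding W_def real_distribution_def real_distribution_axioms_def
    by (auto intro!: measure_pmf.prob_space_distr)
  moreover have "integrable W (\<lambda>x. x ^ k)" for k
    unfolding W_def using int by (subst integrable_distr_eq) auto
  moreover have "moment W k = (if even k then (1 / 4) ^ (k div 2) else 0)" for k
  proof -
    have "moment W k = (\<integral>x. x ^ k \<partial>measure_pmf p)"
      unfolding moment_def W_def by (subst integral_distr) auto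
    also have "\<dots> = ((1 / 2) ^ k + (- 1 / 2) ^ k) / 2"
      unfolding p_def by (subst integral_pmf_of_set) auto
    also have "\<dots> = (if even k then (1 / 4) ^ (k div 2) else 0)"
    proof (cases "even k")
      case True
      then obtain l where "k = 2 * l" by (elim evenE)
      then show ?thesis by (simp add: power_mult power_divide)
    next
      case False
      then show ?thesis by (simp add: power_divide)
    qed
    finally show ?thesis .
  qed
  ultimately show ?thesis unfolding symmetric_moments_def weight_distribution_def by blast
qed

text \<open>
  The eigenmoments are the limit of iterating \<open>W \<mapsto> rescale (sqrt d) (T\<^sub>d W)\<close>: the second moment is
  preserved, and the \<open>2k\<close>-th moment obeys an affine recursion with ratio \<open>d / d ^ k\<close> once the lower moments converge.
\<close>

lemma eigen_moments_exist:
  assumes d: "d \<ge> 2"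
  obtains m where "eigen_moments d m" "symmetric_moments m"
proof -
  define ms where "ms = rec_nat (\<lambda>k. (1 / 4) ^ k) (\<lambda>_ m k. tree_moment m d k / real d ^ k)"
  have ms0: "ms 0 = (\<lambda>k. (1 / 4) ^ k)" and msS: "\<And>n. ms (Suc n) = (\<lambda>k. tree_moment (ms n) d k / real d ^ k)"
    by (auto simp: ms_def)
  have sym: "symmetric_moments (ms n)" for n
    by (induction n) (auto simp: ms0 msS symmetric_moments_two_point symmetric_moments_tree_moment[OF _ d])
  have tm0: "tree_moment m d 0 = 1" for m by (simp add: tree_moment_def)
  have rec: "ms (Suc n) k = (real d / real d ^ k) * ms n k + tree_moment ((ms n)(k := 0)) d k / real d ^ k" if "k \<ge> 1" for n k
    using tree_moment_affine[OF that, of "ms n" d] by (simp add: msS add_divide_distrib)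
  have tm1: "tree_moment (m(Suc 0 := 0)) d (Suc 0) = 0" for m
    by (simp add: tree_moment_def sum_pow_Suc_nth edge_pow_nth)
  have one: "ms n 1 = 1 / 4" for n
  proof (induction n)
    case (Suc n)
    then show ?case using rec[of 1 n] tm1[of "ms n"] d by simp
  qed (simp add: ms0)
  have conv: "convergent (\<lambda>n. ms n k)" for k
  proof (induction k rule: less_induct)
    case (less k)
    consider "k = 0" | "k = 1" | "k \<ge> 2" by linarith
    then show ?case
    proof cases
      case 1
      have "ms n 0 = 1" for n by (cases n) (auto simp: ms0 msS tm0)
      then show ?thesis using 1 by (simp add: convergent_const)
    next
      case 2
      then show ?thesis unfolding 2 one by (simp add: convergent_const)
    next
      case 3
      define m where "m j = (if j < k then lim (\<lambda>n. ms n j) else 0)" for j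
      have "(\<lambda>n. tree_moment ((ms n)(k := 0)) d k) \<longlonglongrightarrow> tree_moment m d k"
      proof (rule tree_moment_tendsto)
        fix j assume j: "1 \<le> j" "j \<le> k"
        show "(\<lambda>n. ((ms n)(k := 0)) j) \<longlonglongrightarrow> m j"
          using less.IH[of j] j by (cases "j = k") (auto simp: m_def convergent_LIMSEQ_iff)
      qed
      then have b: "convergent (\<lambda>n. tree_moment ((ms n)(k := 0)) d k / real d ^ k)"
        using d by (auto intro!: convergentI tendsto_divide)
      show ?thesis
      proof (rule contracting_recursion_convergent[OF rec _ _ b])
        show "k \<ge> 1" "0 \<le> real d / real d ^ k" using 3 by auto
        show "real d / real d ^ k < 1" using power_minus_self_pos[OF d 3] d by (simp add: divide_less_eq)
      qed
    qed
  qed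
  define m where "m k = lim (\<lambda>n. ms n k)" for k
  have lim: "(\<lambda>n. ms n k) \<longlonglongrightarrow> m k" for k
    using conv[of k] by (simp add: m_def convergent_LIMSEQ_iff)
  have "m k = tree_moment m d k / real d ^ k" for k
  proof (rule LIMSEQ_unique)
    show "(\<lambda>n. ms (Suc n) k) \<longlonglongrightarrow> m k" using lim[of k] by (rule LIMSEQ_Suc)
    show "(\<lambda>n. ms (Suc n) k) \<longlonglongrightarrow> tree_moment m d k / real d ^ k"
      unfolding msS by (intro tendsto_divide tree_moment_tendsto lim tendsto_const) (use d in auto)
  qed
  then have "real d ^ k * m k = tree_moment m d k" for k using d by (simp add: nonzero_eq_divide_eq mult.commute)
  moreover have "m 1 = 1 / 4" using lim[of 1] unfolding one LIMSEQ_const_iff by simp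
  ultimately have "eigen_moments d m" by (simp add: eigen_moments_def)
  then show thesis using symmetric_moments_limit[OF sym lim] that by blast
qed

text \<open>The limit moments are realised by some \<open>W\<close>, and the fixed point equation
  says that its rescaling by \<open>1 / sqrt d\<close> has the limiting spectral moments. As those
  moments are determinate, convergence of moments upgrades to weak convergence along every
  sequence.\<close>

lemma eigendistribution_exists:
  assumes d: "d \<ge> 2"
  obtains W where "eigendistribution d W" "moment W 2 = 1 / 4"
proof -
  obtain m where em: "eigen_moments d m" and "symmetric_moments m" using eigen_moments_exist[OF d] .
  then obtain W where W: "weight_distribution W" "\<And>k. moment W k = (if even k then m (k div 2) else 0)"
    by (auto simp: symmetric_moments_def)
  have m': "(\<lambda>j. moment W (2 * j)) = m" by (simp add: W(2))
  have m0: "m 0 = 1"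
    using prob_space.prob_space[OF weight_distribution_prob_space[OF W(1)]] W(2)[of 0] by (simp add: moment_def)
  have mnn: "m k \<ge> 0" for k using weight_distribution_even_moment_nonneg[of W k] by (simp add: W(2))
  define l where "l = 1 / sqrt (real d)"
  have l: "l > 0" using d by (simp add: l_def)
  let ?\<nu> = "rescale l W"
  have \<nu>: "moment ?\<nu> k = (if even k then tree_moment m d (k div 2) else 0)" for k
  proof (cases "even k")
    case True
    then obtain j where j: "k = 2 * j" by (elim evenE)
    have "moment ?\<nu> k = real d ^ j * m j"
      using moment_rescale(1)[OF W(1), of l k] by (simp add: j W(2) l_def power_mult power_divide)
    also have "\<dots> = tree_moment m d j"
      using em m0 by (cases "j = 0") (auto simp: eigen_moments_def tree_moment_def)
    finally show ?thesis by (simp add: j)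
  qed (simp add: moment_rescale(1)[OF W(1)] W(2))
  have "T_maps d W ?\<nu>"
    unfolding T_maps_def
  proof (intro conjI allI impI)
    show real: "real_distribution ?\<nu>" by (rule moment_rescale(2)[OF W(1)])
    fix G assume G: "few_cycles_sequence d G"
    obtain r where "\<forall>i. real_distribution (spectral_distribution (G (i + r)) W)"
      "\<forall>i k. integrable (spectral_distribution (G (i + r)) W) (\<lambda>x. x ^ k)"
      "\<forall>k. (\<lambda>i. moment (spectral_distribution (G (i + r)) W) k) \<longlonglongrightarrow>
        (if even k then tree_moment m d (k div 2) else 0)"
      by (rule spectral_tail[OF W(1) G, unfolded m'])
    note r = this[rule_format]
    have r3: "(\<lambda>i. moment (spectral_distribution (G (i + r)) W) k) \<longlonglongrightarrow> moment ?\<nu> k" for k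
      using r(3)[of k] by (simp only: \<nu>)
    have "weak_conv_m (\<lambda>i. spectral_distribution (G (i + r)) W) ?\<nu>"
    proof (rule weak_conv_of_convergent_moments[OF r(1,2) real r3])
      fix V assume V: "real_distribution V" "\<And>k. integrable V (\<lambda>x. x ^ k)" "\<And>k. moment V k = moment ?\<nu> k"
      have "moment ?\<nu> (2 * k) = real d ^ k * m k" for k
        using \<nu>[of "2 * k"] em m0 by (cases "k = 0") (auto simp: eigen_moments_def tree_moment_def)
      then have "?\<nu> = V"
        by (intro eigen_determinacy[where d = d and c = "real d" and m = m] real moment_rescale(3)[OF W(1)] V d em mnn m0)
           (simp_all add: V(3))
      then show "V = ?\<nu>" ..
    qed
    then show "weak_conv_m (\<lambda>i. spectral_distribution (G i) W) ?\<nu>" by (rule weak_conv_offset_cancel)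
  qed
  then have "eigendistribution d W" unfolding eigendistribution_def using W(1) l by blast
  moreover have "moment W 2 = 1 / 4" using em by (simp add: W(2) eigen_moments_def)
  ultimately show thesis by (rule that)
qed

lemma W_eigen:
  assumes "d \<ge> 2"
  shows "\<exists>!W. eigendistribution d W \<and> moment W 2 = 1 / 4"
    and "eigendistribution d (W_eigen d)" "moment (W_eigen d) 2 = 1 / 4"
proof -
  show ex1: "\<exists>!W. eigendistribution d W \<and> moment W 2 = 1 / 4"
    using eigendistribution_exists[OF assms] eigendistribution_unique[OF _ _ _ _ assms] by metis
  show "eigendistribution d (W_eigen d)" "moment (W_eigen d) 2 = 1 / 4"
    using theI'[OF ex1] unfolding W_eigen_def by auto
qed

theorem theorem1p2:
  shows "(\<forall>d\<ge>2. \<exists>!W. eigendistribution d W \<and> moment W 2 = 1 / 4)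
    \<and> (\<forall>d\<ge>2. \<forall>k. moment (W_eigen d) (2 * k + 1) = 0)
    \<and> (\<forall>k. (\<lambda>d. moment (W_eigen d) (2 * k) - semicircle_moment (2 * k)) \<in> O(\<lambda>d::nat. 1 / (real d)\<^sup>2))
    \<and> (\<forall>d\<ge>2. moment (W_eigen d) 2 = 1 / 4 \<and> semicircle_moment 2 = 1 / 4
          \<and> moment (W_eigen d) 4 = 1 / 8 \<and> semicircle_moment 4 = 1 / 8
          \<and> moment (W_eigen d) 6 = 5 / 64 \<and> semicircle_moment 6 = 5 / 64
          \<and> moment (W_eigen d) 8 = 7 / 128 + 1 / (128 * ((real d)\<^sup>2 + real d + 1))
          \<and> semicircle_moment 8 = 7 / 128 \<and> moment (W_eigen d) 8 \<noteq> semicircle_moment 8)"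
proof (intro conjI allI impI)
  fix d :: nat assume d: "d \<ge> 2"
  note eig = eigendistribution_moments[OF W_eigen(2,3)[OF d] d]
  show "\<exists>!W. eigendistribution d W \<and> moment W 2 = 1 / 4" by (rule W_eigen(1)[OF d])
  show "moment (W_eigen d) (2 * k + 1) = 0" for k by (rule eig(1))
  show "moment (W_eigen d) 2 = 1 / 4" by (rule W_eigen(3)[OF d])
  have v: "moment (W_eigen d) 4 = 1 / 8" "moment (W_eigen d) 6 = 5 / 64"
    "moment (W_eigen d) 8 = 7 / 128 + 1 / (128 * ((real d)\<^sup>2 + real d + 1))"
    using eigen_moments_values[OF eig(2) d] by simp_all
  then show "moment (W_eigen d) 4 = 1 / 8" "moment (W_eigen d) 6 = 5 / 64"
    "moment (W_eigen d) 8 = 7 / 128 + 1 / (128 * ((real d)\<^sup>2 + real d + 1))" by auto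
  have "(real d)\<^sup>2 + real d + 1 > 0" by (simp add: add_nonneg_pos)
  then have "1 / (128 * ((real d)\<^sup>2 + real d + 1)) > 0" by simp
  then show "moment (W_eigen d) 8 \<noteq> semicircle_moment 8" unfolding v semicircle_moment_values by simp
next
  fix k
  show "(\<lambda>d. moment (W_eigen d) (2 * k) - semicircle_moment (2 * k)) \<in> O(\<lambda>d::nat. 1 / (real d)\<^sup>2)"
  proof (cases "k = 0")
    case True
    \<comment> \<open>Existence and uniqueness are available from \<open>d \<ge> 2\<close> on, so
      the zeroth moments agree eventually.\<close>
    have "\<forall>\<^sub>F d in sequentially. moment (W_eigen d) (2 * k) - semicircle_moment (2 * k) = 0"
      using eventually_ge_at_top[of 2]
    proof eventually_elim
      case (elim d)
      have "weight_distribution (W_eigen d)" using W_eigen(2)[OF elim] by (simp add: eigendistribution_def)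
      from prob_space.prob_space[OF weight_distribution_prob_space[OF this]]
      show ?case using True by (simp add: moment_def semicircle_moment_0)
    qed
    from landau_o.big.in_cong[OF this, of "\<lambda>d. 1 / (real d)\<^sup>2"] show ?thesis by simp
  next
    case False
    have "(\<lambda>d. moment (W_eigen d) (2 * k) - Abs_fps (\<lambda>k. semicircle_moment (2 * k)) $ k) \<in> O(\<lambda>d. 1 / (real d)\<^sup>2)"
      by (rule eigen_moments_asymptotics[OF semicircle_generating_function[OF refl], where m = "\<lambda>d j. moment (W_eigen d) (2 * j)"])
         (use eigendistribution_moments(2)[OF W_eigen(2,3)] False in auto)
    then show ?thesis by simp
  qed
qed (simp_all add: semicircle_moment_values)

end
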